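(* Let $1<p<\infty$, let $\Omega\subset\mathbb{R}^n$ be a $W^{1,p}$-extension domain of finite measure and let $0<s<\infty$. Let $r$ satisfy $$ \begin{cases} s\leq r \leq \frac{np}{n-p} & \text{if } p< n,\\ s\leq r<\infty & \text{if } p=n>1,\\ s\leq r \leq \infty & \text{if } p>n \text{ or } p=n=1, \end{cases} $$ and let $\theta\in[0,1]$ satisfy $$ \theta \left( \frac{1}{p} - \frac{1}{n} \right) + (1-\theta)\,\frac{1}{s} = \frac{1}{r} $$ (with $1/r=0$ if $r=\infty$). Then there is a constant $C$, independent of $u$, such that for any $u\in W^{1,p}(\Omega)\cap L^s(\Omega)$ $$ \| u - u_\Omega \|_{L^r(\Omega)} \leq C\, \| \nabla u \|_{L^{p}(\Omega)}^\theta\, \|u - u_\Omega \|_{L^s(\Omega)}^{1-\theta}. $$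
   Context: A domain is a (nonempty) connected open set $\Omega\subset\mathbb{R}^n$. $W^{1,p}(\Omega)$ is the space of all functions in $L^p(\Omega)$ whose first order distributional derivatives belong to $L^p(\Omega)$, with its usual norm $\|u\|_{W^{1,p}(\Omega)}=\left(\int_\Omega (|\nabla u|^p+|u|^p)\,dx\right)^{1/p}$. A $W^{1,p}(\Omega)$-extension operator is a map $E:W^{1,p}(\Omega)\to W^{1,p}(\mathbb{R}^n)$ (not assumed linear) with $E(u)|_\Omega = u$ for every $u\in W^{1,p}(\Omega)$. It is bounded if there is a constant $C\ge 1$ such that $\|E(u)\|_{W^{1,p}(\mathbb{R}^n)}\leq C\|u\|_{W^{1,p}(\Omega)}$ for all $u\in W^{1,p}(\Omega)$. A domain $\Omega$ is a $W^{1,p}$-extension domain if it admits a bounded $W^{1,p}(\Omega)$-extension operator. For $0<s<\infty$ (including $s<1$), $\|u\|_{L^s(\Omega)}=\left(\int_\Omega|u|^s\,dx\right)^{1/s}$, and $L^s(\Omega)$ is the set of measurable functions for which this is finite. $u_\Omega=\frac{1}{|\Omega|}\int_\Omega u\,dx$ denotes the mean value of $u$ over $\Omega$. *)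

theory Defs
  imports "HOL-Analysis.Analysis" "HOL-Probability.Essential_Supremum"
begin

text \<open>
  The ambient space is a Euclidean space of type \<open>'a\<close>, of dimension \<open>DIM('a) \<ge> 1\<close>.
  Functions are total on \<open>'a\<close>; only their values on the set in question matter, and
  functions are identified when they agree almost everywhere on it.
\<close>

section \<open>Lebesgue spaces\<close>

text \<open>
  The exponent ranges over \<open>0 < r \<le> \<infinity>\<close>. The quantity \<open>Lp_norm\<close> is meaningful only together
  with membership in \<open>Lp_space\<close>, since the Bochner integral of a non-integrable function is 0.
\<close>

definition Lp_space :: "'a::euclidean_space set \<Rightarrow> ereal \<Rightarrow> ('a \<Rightarrow> 'b::euclidean_space) set" where
  "Lp_space \<Omega> r = {f. f \<in> borel_measurable (lebesgue_on \<Omega>) \<and>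
     (if r = \<infinity> then esssup (lebesgue_on \<Omega>) (\<lambda>x. ereal (norm (f x))) < \<infinity>
      else integrable (lebesgue_on \<Omega>) (\<lambda>x. norm (f x) powr real_of_ereal r))}"

definition Lp_norm :: "'a::euclidean_space set \<Rightarrow> ereal \<Rightarrow> ('a \<Rightarrow> 'b::euclidean_space) \<Rightarrow> real" where
  "Lp_norm \<Omega> r f =
     (if r = \<infinity> then real_of_ereal (esssup (lebesgue_on \<Omega>) (\<lambda>x. ereal (norm (f x))))
      else (\<integral>x. norm (f x) powr real_of_ereal r \<partial>lebesgue_on \<Omega>) powr (1 / real_of_ereal r))"

definition mean_value :: "'a::euclidean_space set \<Rightarrow> ('a \<Rightarrow> real) \<Rightarrow> real" where
  "mean_value \<Omega> u = (1 / measure lebesgue \<Omega>) * (\<integral>x. u x \<partial>lebesgue_on \<Omega>)"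

section \<open>Distributional gradients\<close>

text \<open>\<open>C\<^sup>k\<close> functions, through iterated partial derivatives along the standard basis.\<close>

primrec Ck :: "nat \<Rightarrow> ('a::euclidean_space \<Rightarrow> real) \<Rightarrow> bool" where
  "Ck 0 f \<longleftrightarrow> continuous_on UNIV f"
| "Ck (Suc k) f \<longleftrightarrow> (\<forall>x. f differentiable (at x)) \<and>
     (\<forall>b\<in>Basis. Ck k (\<lambda>x. frechet_derivative f (at x) b))"

definition test_function :: "'a::euclidean_space set \<Rightarrow> ('a \<Rightarrow> real) \<Rightarrow> bool" where
  "test_function \<Omega> \<phi> \<longleftrightarrow> (\<forall>k. Ck k \<phi>) \<and>
     compact (closure {x. \<phi> x \<noteq> 0}) \<and> closure {x. \<phi> x \<noteq> 0} \<subseteq> \<Omega>"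

definition locally_integrable ::
    "'a::euclidean_space set \<Rightarrow> ('a \<Rightarrow> 'b::euclidean_space) \<Rightarrow> bool" where
  "locally_integrable \<Omega> f \<longleftrightarrow> (\<forall>K. compact K \<and> K \<subseteq> \<Omega> \<longrightarrow> set_integrable lebesgue K f)"

text \<open>The component \<open>g \<bullet> b\<close> is the distributional partial derivative of \<open>u\<close> in direction \<open>b\<close>.\<close>

definition has_weak_gradient ::
    "'a::euclidean_space set \<Rightarrow> ('a \<Rightarrow> real) \<Rightarrow> ('a \<Rightarrow> 'a) \<Rightarrow> bool" where
  "has_weak_gradient \<Omega> u g \<longleftrightarrow> locally_integrable \<Omega> u \<and> locally_integrable \<Omega> g \<and>
     (\<forall>\<phi>. test_function \<Omega> \<phi> \<longrightarrow> (\<forall>b\<in>Basis.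
        (\<integral>x. u x * frechet_derivative \<phi> (at x) b \<partial>lebesgue_on \<Omega>)
          = - (\<integral>x. (g x \<bullet> b) * \<phi> x \<partial>lebesgue_on \<Omega>)))"

text \<open>On an open set, weak gradients are unique up to null sets, so the choice is immaterial.\<close>

definition weak_gradient :: "'a::euclidean_space set \<Rightarrow> ('a \<Rightarrow> real) \<Rightarrow> 'a \<Rightarrow> 'a" where
  "weak_gradient \<Omega> u = (SOME g. has_weak_gradient \<Omega> u g)"

section \<open>Sobolev spaces and extension domains\<close>

definition W1p :: "'a::euclidean_space set \<Rightarrow> real \<Rightarrow> ('a \<Rightarrow> real) set" where
  "W1p \<Omega> p = {u \<in> Lp_space \<Omega> (ereal p). \<exists>g. has_weak_gradient \<Omega> u g \<and> g \<in> Lp_space \<Omega> (ereal p)}"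

definition W1p_norm :: "'a::euclidean_space set \<Rightarrow> real \<Rightarrow> ('a \<Rightarrow> real) \<Rightarrow> real" where
  "W1p_norm \<Omega> p u =
     (\<integral>x. norm (weak_gradient \<Omega> u x) powr p + \<bar>u x\<bar> powr p \<partial>lebesgue_on \<Omega>) powr (1 / p)"

definition is_domain :: "'a::euclidean_space set \<Rightarrow> bool" where
  "is_domain \<Omega> \<longleftrightarrow> open \<Omega> \<and> connected \<Omega> \<and> \<Omega> \<noteq> {}"

text \<open>
  The second condition says that the operator is well defined on classes of functions
  that agree almost everywhere. Linearity is not required.
\<close>

definition W1p_extension_operator ::
    "'a::euclidean_space set \<Rightarrow> real \<Rightarrow> (('a \<Rightarrow> real) \<Rightarrow> ('a \<Rightarrow> real)) \<Rightarrow> bool" where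
  "W1p_extension_operator \<Omega> p E \<longleftrightarrow>
     (\<forall>u\<in>W1p \<Omega> p. E u \<in> W1p UNIV p) \<and>
     (\<forall>u\<in>W1p \<Omega> p. \<forall>v\<in>W1p \<Omega> p.
        (AE x in lebesgue_on \<Omega>. u x = v x) \<longrightarrow> (AE x in lebesgue. E u x = E v x)) \<and>
     (\<forall>u\<in>W1p \<Omega> p. AE x in lebesgue_on \<Omega>. E u x = u x)"

definition bounded_W1p_extension_operator ::
    "'a::euclidean_space set \<Rightarrow> real \<Rightarrow> (('a \<Rightarrow> real) \<Rightarrow> ('a \<Rightarrow> real)) \<Rightarrow> bool" where
  "bounded_W1p_extension_operator \<Omega> p E \<longleftrightarrow> W1p_extension_operator \<Omega> p E \<and>
     (\<exists>C\<ge>1. \<forall>u\<in>W1p \<Omega> p. W1p_norm UNIV p (E u) \<le> C * W1p_norm \<Omega> p u)"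

definition W1p_extension_domain :: "'a::euclidean_space set \<Rightarrow> real \<Rightarrow> bool" where
  "W1p_extension_domain \<Omega> p \<longleftrightarrow> is_domain \<Omega> \<and> (\<exists>E. bounded_W1p_extension_operator \<Omega> p E)"

section \<open>Powers with exponent zero\<close>

text \<open>Real powers of nonnegative numbers with \<open>0\<^sup>0 = 1\<close>, whereas \<open>0 powr 0 = 0\<close> in the library.\<close>

definition rpow :: "real \<Rightarrow> real \<Rightarrow> real" where
  "rpow x t = (if t = 0 then 1 else x powr t)"

end

theory Submission
  imports Defs
begin

text \<open>
  Applying the extension operator and a Poincare inequality to \<open>v = u - u\<^sub>\<Omega>\<close>, we may bound
  the full Sobolev norm of \<open>v\<close>, and of its extension \<open>w\<close>, by \<open>D = \<parallel>\<nabla>u\<parallel>\<^sub>p\<close>. The Poincare inequality needs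
  no compact embedding: higher integrability makes the mass of \<open>v\<close> near the boundary small, and
  the rest of \<open>\<Omega>\<close> is exhausted by finite unions of overlapping balls.

  If \<open>p < n\<close>, the Sobolev embedding bounds \<open>\<parallel>v\<parallel>\<^sub>q\<close> for \<open>q = np/(n-p)\<close>, and the claim is interpolation
  between \<open>L\<^sup>s\<close> and \<open>L\<^sup>q\<close>. If \<open>p \<ge> n\<close>, let \<open>\<rho>\<close> be the scale at which \<open>\<rho>\<^sup>\<alpha> D = \<rho> powr (-n/s) S\<close>, where
  \<open>\<alpha> = 1 - n/p\<close> and \<open>S = \<parallel>v\<parallel>\<^sub>s\<close>. An extension domain has the measure density property
  \<open>\<bar>\<Omega> \<inter> ball x \<rho>\<bar> \<ge> c \<rho>\<^sup>n\<close>, so the averages of \<open>w\<close> over balls of radius \<open>\<rho>\<close> centred in \<open>\<Omega>\<close> are controlled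
  by this common value, while \<open>w\<close> minus these averages is controlled by \<open>D\<close>.
\<close>

text \<open>An interpolation inequality on the whole space cannot simply be applied to the
  extension: the operator controls only the full W^{1,p} norm, and the L^s norm of \<open>w\<close>
  off \<Omega> is unrelated to that of \<open>v\<close>. For p < n one interpolates on \<Omega>
  itself, with the Sobolev exponent as endpoint. For p = n there is no such endpoint, and for p > n
  interpolation with the sup bound leaves too large a power of \<open>D\<close>. So a scale is
  chosen for each function, and L^s information reaches a ball average of \<open>w\<close> only
  through the part of the ball inside \<Omega>; this is what the measure density is for. It is
  proved by testing the extension property on radial cutoffs. When the scale is large,
  \<open>S\<close> is bounded below by a multiple of \<open>D\<close>, and the embeddings at unit
  radius suffice.

  On the whole space everything is first shown for continuous functions with an upper gradient,
  because these can be truncated segment by segment. Mollification carries the results over to weak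
  gradients.\<close>

section \<open>Powers of extended nonnegative reals\<close>

text \<open>As for \<open>powr\<close>, \<open>epow 0 p = 0\<close> for every \<open>p\<close>.\<close>

definition epow :: "ennreal \<Rightarrow> real \<Rightarrow> ennreal" where
  "epow x p = (if x = top then top else ennreal (enn2real x powr p))"

lemma epow_top [simp]: "epow top p = top"
  by (simp add: epow_def)

lemma epow_zero [simp]: "epow 0 p = 0"
  by (simp add: epow_def)

lemma epow_one [simp]: "epow x 1 = x"
  by (cases x) (auto simp: epow_def)

lemma epow_ennreal [simp]: "0 \<le> a \<Longrightarrow> epow (ennreal a) p = ennreal (a powr p)"
  by (simp add: epow_def)

lemma epow_eq_top_iff [simp]: "epow x p = top \<longleftrightarrow> x = top"
  by (simp add: epow_def)

lemma epow_less_top_iff [simp]: "epow x p < top \<longleftrightarrow> x < top"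
  by (metis epow_eq_top_iff less_top)

lemma epow_eq_0_iff [simp]: "epow x p = 0 \<longleftrightarrow> x = 0"
  by (cases x) auto

lemma epow_mono: "0 \<le> p \<Longrightarrow> x \<le> y \<Longrightarrow> epow x p \<le> epow y p"
  by (cases x; cases y) (auto intro!: ennreal_leI powr_mono2 simp: top_unique)

lemma epow_mult: "epow (x * y) p = epow x p * epow y p"
proof (cases x; cases y)
  fix a b assume "0 \<le> a" "x = ennreal a" "0 \<le> b" "y = ennreal b"
  then show ?thesis by (simp add: ennreal_mult[symmetric] powr_mult)
qed (auto simp: ennreal_mult_top ennreal_top_mult)

lemma epow_epow: "epow (epow x p) q = epow x (p * q)"
  by (cases x) (auto simp: powr_powr)

lemma epow_add: "epow x (p + q) = epow x p * epow x q"
  by (cases x) (auto simp: powr_add ennreal_mult)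

text \<open>The sum is at most twice the larger summand. This works for every p >= 0, in particular
  below 1, where Minkowski's inequality fails.\<close>

lemma epow_plus_le:
  assumes "0 \<le> p" shows "epow (x + y) p \<le> ennreal (2 powr p) * (epow x p + epow y p)"
proof -
  have "epow (x + y) p \<le> epow (2 * max x y) p"
    by (intro epow_mono assms) (metis add_mono max.cobounded1 max.cobounded2 mult_2)
  also have "\<dots> = ennreal (2 powr p) * epow (max x y) p"
    using epow_ennreal[of 2 p] by (simp add: epow_mult)
  also have "epow (max x y) p \<le> epow x p + epow y p"
    by (simp add: max_def)
  finally show ?thesis by (simp add: mult_left_mono)
qed

lemma epow_measurable [measurable (raw)]:
  assumes [measurable]: "f \<in> borel_measurable M"
  shows "(\<lambda>x. epow (f x) p) \<in> borel_measurable M"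
  unfolding epow_def by measurable

text \<open>Convexity: rearranged, b^p lies above its tangent at a. With all terms nonnegative the
  inequality can be integrated in \<open>ennreal\<close>.\<close>

lemma powr_tangent:
  fixes a b p :: real
  assumes "0 \<le> a" "0 \<le> b" "1 \<le> p"
  shows "p * a powr (p - 1) * b \<le> b powr p + (p - 1) * a powr p"
proof (cases "p = 1")
  case True
  then show ?thesis using assms by (cases "a = 0") auto
next
  case False
  with assms have p: "1 < p" by auto
  define q where "q = p / (p - 1)"
  have q: "1 < q" "1/p + 1/q = 1" using p by (auto simp: q_def field_simps)
  have "b * a powr (p - 1) \<le> b powr p / p + (a powr (p - 1)) powr q / q"
    using Youngs_inequality[of p q b "a powr (p - 1)"] p q assms by auto
  also have "(a powr (p - 1)) powr q = a powr p"
    using p by (simp add: powr_powr q_def)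
  finally have "p * (b * a powr (p - 1)) \<le> p * (b powr p / p + a powr p / q)"
    using p by (intro mult_left_mono) auto
  also have "\<dots> = b powr p + (p - 1) * a powr p"
    using p by (simp add: q_def field_simps)
  finally show ?thesis by (simp add: mult_ac)
qed

text \<open>Jensen for a finite, unnormalised weight, whence the power of the total mass.
  Integrating the tangent inequality at every level and then choosing the best level works for
  arbitrary \<open>ennreal\<close> integrands.\<close>

lemma nn_integral_Jensen_powr:
  assumes [measurable]: "f \<in> borel_measurable M" "k \<in> borel_measurable M"
    and p: "1 \<le> p" and fin: "(\<integral>\<^sup>+x. k x \<partial>M) < top"
  shows "epow (\<integral>\<^sup>+x. f x * k x \<partial>M) p \<le> epow (\<integral>\<^sup>+x. k x \<partial>M) (p - 1) * (\<integral>\<^sup>+x. epow (f x) p * k x \<partial>M)"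
proof -
  define K where "K = (\<integral>\<^sup>+x. k x \<partial>M)"
  define I where "I = (\<integral>\<^sup>+x. f x * k x \<partial>M)"
  define J where "J = (\<integral>\<^sup>+x. epow (f x) p * k x \<partial>M)"
  have tan: "ennreal (p * a powr (p - 1)) * I \<le> J + ennreal ((p - 1) * a powr p) * K" if a: "0 \<le> a" for a
  proof -
    have "ennreal (p * a powr (p - 1)) * f x \<le> epow (f x) p + ennreal ((p - 1) * a powr p)" for x
    proof (cases "f x")
      case (real b)
      then show ?thesis using powr_tangent[OF a, of b p] p a
        by (simp add: ennreal_mult[symmetric] ennreal_plus[symmetric] del: ennreal_plus)
    qed auto
    then have "(\<integral>\<^sup>+x. ennreal (p * a powr (p - 1)) * f x * k x \<partial>M)
        \<le> (\<integral>\<^sup>+x. epow (f x) p * k x + ennreal ((p - 1) * a powr p) * k x \<partial>M)"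
      by (intro nn_integral_mono) (metis distrib_right mult_right_mono zero_le)
    then show ?thesis
      by (simp add: nn_integral_add nn_integral_cmult I_def J_def K_def mult.assoc)
  qed
  consider "K = 0" | "K \<noteq> 0" "J = top" | "K \<noteq> 0" "J \<noteq> top" by blast
  then have "epow I p \<le> epow K (p - 1) * J"
  proof cases
    case 1
    then have "AE x in M. k x = 0" by (simp add: K_def nn_integral_0_iff_AE)
    then have "I = 0" by (subst I_def) (auto simp: nn_integral_0_iff_AE)
    then show ?thesis by simp
  next
    case 2
    then show ?thesis by (simp add: ennreal_mult_top)
  next
    case 3
    obtain j where j: "0 \<le> j" "J = ennreal j" using 3 by (cases J) auto
    obtain c where c: "0 < c" "K = ennreal c" using 3 fin by (cases K) (auto simp: K_def[symmetric] less_le)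
    \<comment> \<open>Finiteness of \<open>I\<close> comes first, from the tangent at 1, because the
      optimal level below is a quotient of real numbers.\<close>
    have "I \<noteq> top" using tan[of 1] p j c
      by (auto simp: ennreal_mult_top ennreal_mult[symmetric] ennreal_plus[symmetric] top_unique simp del: ennreal_plus)
    then obtain i where i: "0 \<le> i" "I = ennreal i" by (cases I) auto
    \<comment> \<open>The tangent is taken at the weighted mean \<open>i/c\<close>, where the
      inequality is sharpest.\<close>
    have "p * (i/c) powr (p - 1) * i \<le> j + (p - 1) * (i/c) powr p * c"
      using tan[of "i/c"] p j c i
      by (simp add: ennreal_mult[symmetric] ennreal_plus[symmetric] del: ennreal_plus)
    also have "p * (i/c) powr (p - 1) * i = p * ((i/c) powr p * c)"
      using i c p by (cases "i = 0") (auto simp: powr_diff)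
    finally have "(i/c) powr p * c \<le> j" by (simp add: algebra_simps)
    then have "i powr p \<le> c powr (p - 1) * j"
      using i c by (simp add: powr_divide powr_diff field_simps)
    then show ?thesis using i j c
      by (simp add: ennreal_mult[symmetric])
  qed
  then show ?thesis by (simp add: I_def J_def K_def)
qed

section \<open>Ball averages and upper gradients\<close>

lemma nn_integral_lborel_affine:
  fixes f :: "'a::euclidean_space \<Rightarrow> ennreal"
  assumes [measurable]: "f \<in> borel_measurable borel" and c: "c \<noteq> 0"
  shows "(\<integral>\<^sup>+x. f x \<partial>lborel) = ennreal (\<bar>c\<bar> ^ DIM('a)) * (\<integral>\<^sup>+x. f (t + c *\<^sub>R x) \<partial>lborel)"
  by (subst lborel_affine[OF c, of t])
     (simp add: nn_integral_density nn_integral_distr nn_integral_cmult)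

lemma nn_integral_lborel_translate:
  fixes f :: "'a::euclidean_space \<Rightarrow> ennreal"
  assumes "f \<in> borel_measurable borel"
  shows "(\<integral>\<^sup>+x. f (t + x) \<partial>lborel) = (\<integral>\<^sup>+x. f x \<partial>lborel)"
  using nn_integral_lborel_affine[of f 1 t] assms by simp

definition ball_volume :: "'a::euclidean_space itself \<Rightarrow> real \<Rightarrow> real" where
  "ball_volume _ s = measure lborel (ball (0::'a) s)"

lemma ball_volume_eq: "0 \<le> s \<Longrightarrow> ball_volume TYPE('a::euclidean_space) s = s ^ DIM('a) * ball_volume TYPE('a) 1"
  using content_ball_conv_unit_ball[of s "0::'a"] by (simp add: ball_volume_def measure_completion)

lemma ball_volume_pos: "0 < s \<Longrightarrow> 0 < ball_volume TYPE('a::euclidean_space) s"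
  using content_ball_pos[of s "0::'a"] by (simp add: ball_volume_def)

lemma ball_volume_powr:
  "0 < s \<Longrightarrow> ball_volume TYPE('a::euclidean_space) s = s powr DIM('a) * ball_volume TYPE('a) 1"
  by (subst ball_volume_eq) (auto simp: powr_realpow)

lemma emeasure_ball_volume: "emeasure lborel (ball (x::'a::euclidean_space) s) = ennreal (ball_volume TYPE('a) s)"
proof (cases "0 \<le> s")
  case True
  have "measure lborel (ball x s) = measure lborel (ball (0::'a) s)"
    using content_ball_conv_unit_ball[OF True, of x] content_ball_conv_unit_ball[OF True, of "0::'a"] by simp
  then show ?thesis
    using emeasure_lborel_ball_finite[of x s] by (simp add: emeasure_eq_ennreal_measure ball_volume_def)
qed (simp add: ball_volume_def ball_empty)

text \<open>Integration runs over a ball about 0, so that centre and radius enter only through the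
  integrand and an indicator; this gives joint measurability and the exchanges of integrals
  below.\<close>

definition ball_mean :: "('a::euclidean_space \<Rightarrow> ennreal) \<Rightarrow> real \<Rightarrow> 'a \<Rightarrow> ennreal" where
  "ball_mean f s x = ennreal (1 / ball_volume TYPE('a) s) * (\<integral>\<^sup>+z\<in>ball 0 s. f (x + z) \<partial>lborel)"

text \<open>Measurability jointly in radius and point is what allows the integrals over radius and
  position to be exchanged.\<close>

lemma ball_indicator_measurable [measurable]:
  "(\<lambda>(s, z::'a::euclidean_space). indicator (ball 0 s) z :: ennreal) \<in> borel_measurable (borel \<Otimes>\<^sub>M borel)"
proof -
  have "(\<lambda>(s, z::'a). indicator (ball 0 s) z :: ennreal) = indicator {p \<in> space (borel \<Otimes>\<^sub>M borel). norm (snd p) < fst p}"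
    by (auto simp: indicator_def space_pair_measure)
  then show ?thesis by simp
qed

lemma ball_indicator_measurable' [measurable (raw)]:
  assumes "f \<in> borel_measurable M" "g \<in> M \<rightarrow>\<^sub>M borel"
  shows "(\<lambda>x. indicator (ball 0 (f x)) (g x :: 'a::euclidean_space) :: ennreal) \<in> borel_measurable M"
  using measurable_compose[OF measurable_Pair[OF assms] ball_indicator_measurable] by simp

lemma ball_volume_measurable [measurable]: "ball_volume TYPE('a::euclidean_space) \<in> borel_measurable borel"
proof -
  have *: "ball_volume TYPE('a) = (\<lambda>s. if 0 \<le> s then s ^ DIM('a) * ball_volume TYPE('a) 1 else 0)"
    by (rule ext) (metis ball_volume_eq ball_empty ball_volume_def linorder_not_less measure_empty less_eq_real_def)
  show ?thesis by (subst *) measurable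
qed

lemma ball_mean_measurable [measurable (raw)]:
  fixes h :: "'b \<Rightarrow> 'a::euclidean_space"
  assumes [measurable]: "f \<in> borel_measurable borel" "g \<in> borel_measurable M" "h \<in> M \<rightarrow>\<^sub>M borel"
  shows "(\<lambda>x. ball_mean f (g x) (h x)) \<in> borel_measurable M"
  unfolding ball_mean_def by measurable

lemma ball_mean_Jensen:
  fixes f :: "'a::euclidean_space \<Rightarrow> ennreal"
  assumes [measurable]: "f \<in> borel_measurable borel" and "1 \<le> p" "0 < s"
  shows "epow (ball_mean f s x) p \<le> ball_mean (\<lambda>y. epow (f y) p) s x"
proof -
  let ?k = "\<lambda>z::'a. ennreal (1 / ball_volume TYPE('a) s) * indicator (ball 0 s) z"
  have v: "0 < ball_volume TYPE('a) s" using ball_volume_pos assms by blast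
  have 1: "(\<integral>\<^sup>+z. ?k z \<partial>lborel) = 1"
    using v by (simp add: nn_integral_cmult emeasure_ball_volume ennreal_mult[symmetric])
  have 2: "ball_mean g s x = (\<integral>\<^sup>+z. g (x + z) * ?k z \<partial>lborel)" if [measurable]: "g \<in> borel_measurable borel" for g
    unfolding ball_mean_def by (subst nn_integral_cmult[symmetric]) (auto simp: mult_ac)
  have "epow (\<integral>\<^sup>+z. f (x + z) * ?k z \<partial>lborel) p
      \<le> epow (\<integral>\<^sup>+z. ?k z \<partial>lborel) (p - 1) * (\<integral>\<^sup>+z. epow (f (x + z)) p * ?k z \<partial>lborel)"
    by (rule nn_integral_Jensen_powr) (use assms 1 in auto)
  moreover have "epow 1 (p - 1) = 1" using epow_ennreal[of 1 "p-1"] by simp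
  ultimately show ?thesis by (simp add: 1 2)
qed

lemma ball_mean_le_integral:
  fixes f :: "'a::euclidean_space \<Rightarrow> ennreal"
  assumes [measurable]: "f \<in> borel_measurable borel"
  shows "ball_mean f s x \<le> ennreal (1 / ball_volume TYPE('a) s) * (\<integral>\<^sup>+z. f z \<partial>lborel)"
proof -
  have "(\<integral>\<^sup>+z\<in>ball 0 s. f (x + z) \<partial>lborel) \<le> (\<integral>\<^sup>+z. f (x + z) \<partial>lborel)"
    by (intro nn_integral_mono) (auto simp: indicator_def)
  then show ?thesis
    unfolding ball_mean_def by (simp add: nn_integral_lborel_translate mult_left_mono)
qed

lemma nn_integral_ball_mean:
  fixes f :: "'a::euclidean_space \<Rightarrow> ennreal"
  assumes [measurable]: "f \<in> borel_measurable borel" and s: "0 < s"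
  shows "(\<integral>\<^sup>+x. ball_mean f s x \<partial>lborel) = (\<integral>\<^sup>+x. f x \<partial>lborel)"
proof -
  have v: "0 < ball_volume TYPE('a) s" using ball_volume_pos s by blast
  have "(\<integral>\<^sup>+x. (\<integral>\<^sup>+z\<in>ball 0 s. f (x + z) \<partial>lborel) \<partial>lborel) = (\<integral>\<^sup>+z. (\<integral>\<^sup>+x. f (x + z) * indicator (ball 0 s) z \<partial>lborel) \<partial>lborel)"
    by (rule lborel_pair.Fubini') measurable
  also have "\<dots> = (\<integral>\<^sup>+z. (\<integral>\<^sup>+x. f x \<partial>lborel) * indicator (ball 0 s) (z::'a) \<partial>lborel)"
  proof (rule nn_integral_cong)
    fix z :: 'a
    show "(\<integral>\<^sup>+x. f (x + z) * indicator (ball 0 s) z \<partial>lborel) = (\<integral>\<^sup>+x. f x \<partial>lborel) * indicator (ball 0 s) z"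
      using nn_integral_lborel_translate[of f z] by (simp add: nn_integral_multc add.commute)
  qed
  also have "\<dots> = (\<integral>\<^sup>+x. f x \<partial>lborel) * ennreal (ball_volume TYPE('a) s)"
    by (simp add: nn_integral_cmult emeasure_ball_volume)
  finally show ?thesis
    using v by (simp add: ball_mean_def nn_integral_cmult)
       (simp add: mult.left_commute ennreal_mult[symmetric])
qed

text \<open>Jensen, after which the ball is enlarged to the whole space. The scaling s^(-n/p) found
  here decides which exponents occur in the later estimates.\<close>

lemma ball_mean_bound:
  fixes f :: "'a::euclidean_space \<Rightarrow> ennreal"
  assumes [measurable]: "f \<in> borel_measurable borel" and p: "1 \<le> p" and s: "0 < s"
  shows "ball_mean f s x \<le> ennreal (ball_volume TYPE('a) 1 powr (-1/p) * s powr (- DIM('a) / p)) * epow (\<integral>\<^sup>+x. epow (f x) p \<partial>lborel) (1/p)"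
proof -
  have v: "0 < ball_volume TYPE('a) s" "0 < ball_volume TYPE('a) 1" using ball_volume_pos[where 'a='a] s by auto
  have "epow (ball_mean f s x) p \<le> ennreal (1 / ball_volume TYPE('a) s) * (\<integral>\<^sup>+x. epow (f x) p \<partial>lborel)"
    by (rule order_trans[OF ball_mean_Jensen[OF assms] ball_mean_le_integral]) simp
  then have "epow (epow (ball_mean f s x) p) (1/p) \<le> epow (ennreal (1 / ball_volume TYPE('a) s) * (\<integral>\<^sup>+x. epow (f x) p \<partial>lborel)) (1/p)"
    using p by (intro epow_mono) auto
  also have "\<dots> = epow (ennreal (1 / ball_volume TYPE('a) s)) (1/p) * epow (\<integral>\<^sup>+x. epow (f x) p \<partial>lborel) (1/p)"
    by (rule epow_mult)
  also have "epow (ennreal (1 / ball_volume TYPE('a) s)) (1/p) = ennreal (ball_volume TYPE('a) 1 powr (-1/p) * s powr (- DIM('a) / p))"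
    using s v by (simp add: ball_volume_powr[OF s] powr_divide powr_mult powr_powr powr_minus divide_simps)
  finally show ?thesis using p by (simp add: epow_epow)
qed

section \<open>The potential formed from ball means\<close>

lemma nn_integral_powr_from_0_le:
  assumes "a > (-1::real)" "0 < c"
  shows "(\<integral>\<^sup>+s\<in>{0<..<c}. ennreal (s powr a) \<partial>lborel) \<le> ennreal (c powr (a + 1) / (a + 1))"
proof -
  have "(\<integral>\<^sup>+s. ennreal (s powr a) * indicator {0..c} s \<partial>lborel) = ennreal (c powr (a + 1) / (a + 1))"
    by (rule nn_integral_has_integral_lebesgue'[OF _ has_integral_powr_from_0]) (use assms in auto)
  moreover have "(\<integral>\<^sup>+s\<in>{0<..<c}. ennreal (s powr a) \<partial>lborel) \<le> (\<integral>\<^sup>+s. ennreal (s powr a) * indicator {0..c} s \<partial>lborel)"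
    by (intro nn_integral_mono) (auto simp: indicator_def)
  ultimately show ?thesis by simp
qed

lemma nn_integral_powr_to_inf_le:
  assumes "a < (-1::real)" "0 < c"
  shows "(\<integral>\<^sup>+s\<in>{c..}. ennreal (s powr a) \<partial>lborel) \<le> ennreal (c powr (a + 1) / - (a + 1))"
proof -
  have "(\<integral>\<^sup>+s. ennreal (s powr a) * indicator {c..} s \<partial>lborel) = ennreal (-(c powr (a + 1)) / (a + 1))"
    by (rule nn_integral_has_integral_lebesgue'[OF _ has_integral_powr_to_inf]) (use assms in auto)
  moreover have "-(c powr (a + 1)) / (a + 1) = c powr (a + 1) / - (a + 1)"
    using assms by (simp add: field_simps)
  ultimately show ?thesis by simp
qed

text \<open>Jensen's inequality for the weight \<open>s powr (-\<gamma>)\<close> on \<open>{0<..<\<delta>}\<close> makes the \<open>s\<close>-integral converge.\<close>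

lemma nn_integral_ball_mean_Lq:
  fixes p q \<gamma> :: real
  assumes p: "1 \<le> p" and pq: "p \<le> q" and \<gamma>: "0 \<le> \<gamma>" "\<gamma> < 1"
    and \<beta>: "\<gamma> * (q - 1) - DIM('a) * (q - p) / p > -1"
  shows "\<exists>C\<ge>0. \<forall>f\<in>borel_measurable (borel :: 'a::euclidean_space measure). \<forall>\<delta>>0.
    (\<integral>\<^sup>+x. epow (\<integral>\<^sup>+s\<in>{0<..<\<delta>}. ball_mean f s x \<partial>lborel) q \<partial>lborel)
      \<le> ennreal (C * \<delta> powr (q - DIM('a) * (q - p) / p)) * epow (\<integral>\<^sup>+x. epow (f x) p \<partial>lborel) (q / p)"
proof -
  \<comment> \<open>The exponent of s that remains at the end; being above -1, it is integrable near
    0.\<close>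
  define \<beta>' where "\<beta>' = \<gamma> * (q - 1) - DIM('a) * (q - p) / p"
  define V where "V = ball_volume TYPE('a) 1 powr (-1/p)"
  define C where "C = (1 / (1 - \<gamma>)) powr (q - 1) * (V powr (q - p) * (1 / (\<beta>' + 1)))"
  have b': "\<beta>' > -1" using \<beta> by (simp add: \<beta>'_def)
  have q: "1 \<le> q" using p pq by simp
  have "0 \<le> C" using b' by (simp add: C_def V_def)
  moreover have "(\<integral>\<^sup>+x. epow (\<integral>\<^sup>+s\<in>{0<..<\<delta>}. ball_mean f s x \<partial>lborel) q \<partial>lborel)
      \<le> ennreal (C * \<delta> powr (q - DIM('a) * (q - p) / p)) * epow (\<integral>\<^sup>+x. epow (f x) p \<partial>lborel) (q / p)"
    if [measurable]: "f \<in> borel_measurable (borel :: 'a measure)" and d: "0 < \<delta>" for f \<delta>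
  proof -
    define N where "N = (\<integral>\<^sup>+x. epow (f x) p \<partial>lborel)"
    let ?k = "\<lambda>s. ennreal (s powr (- \<gamma>)) * indicator {0<..<\<delta>} s"
    define K where "K = (\<integral>\<^sup>+s. ?k s \<partial>lborel)"
    have K: "K \<le> ennreal (\<delta> powr (1 - \<gamma>) / (1 - \<gamma>))"
      using nn_integral_powr_from_0_le[of "-\<gamma>" \<delta>] \<gamma> d by (simp add: K_def)
    then have Kfin: "K < top" by (metis ennreal_less_top le_less_trans)
    \<comment> \<open>Each ball mean is written as s^\<gamma> times the mean, against the weight
      s^(-\<gamma>), which is integrable near 0 because \<gamma> < 1.\<close>
    have A: "epow (\<integral>\<^sup>+s\<in>{0<..<\<delta>}. ball_mean f s x \<partial>lborel) q
       \<le> epow K (q - 1) * (\<integral>\<^sup>+s. ennreal (s powr (\<gamma> * (q - 1))) * epow (ball_mean f s x) q * indicator {0<..<\<delta>} s \<partial>lborel)"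
      for x
    proof -
      have "(\<integral>\<^sup>+s\<in>{0<..<\<delta>}. ball_mean f s x \<partial>lborel) = (\<integral>\<^sup>+s. (ennreal (s powr \<gamma>) * ball_mean f s x) * ?k s \<partial>lborel)"
      proof (rule nn_integral_cong)
        fix s :: real
        have "ennreal (s powr \<gamma>) * ennreal (s powr (-\<gamma>)) = 1" if "0 < s"
          using that by (simp add: ennreal_mult[symmetric] powr_minus)
        then show "ball_mean f s x * indicator {0<..<\<delta>} s = (ennreal (s powr \<gamma>) * ball_mean f s x) * ?k s"
          by (auto simp: indicator_def) (metis mult.assoc mult.commute mult.right_neutral)
      qed
      also have "epow \<dots> q \<le> epow K (q - 1) * (\<integral>\<^sup>+s. epow (ennreal (s powr \<gamma>) * ball_mean f s x) q * ?k s \<partial>lborel)"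
        unfolding K_def by (rule nn_integral_Jensen_powr) (use q Kfin in \<open>auto simp: K_def\<close>)
      also have "(\<integral>\<^sup>+s. epow (ennreal (s powr \<gamma>) * ball_mean f s x) q * ?k s \<partial>lborel)
         = (\<integral>\<^sup>+s. ennreal (s powr (\<gamma> * (q - 1))) * epow (ball_mean f s x) q * indicator {0<..<\<delta>} s \<partial>lborel)"
      proof (rule nn_integral_cong)
        fix s :: real
        have "ennreal (s powr (\<gamma> * q)) * ennreal (s powr (-\<gamma>)) = ennreal (s powr (\<gamma> * (q - 1)))" if "0 < s"
          using that by (simp add: ennreal_mult[symmetric] powr_add[symmetric] algebra_simps)
        then show "epow (ennreal (s powr \<gamma>) * ball_mean f s x) q * ?k s
          = ennreal (s powr (\<gamma> * (q - 1))) * epow (ball_mean f s x) q * indicator {0<..<\<delta>} s"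
          by (auto simp: indicator_def epow_mult powr_powr) (metis mult.assoc mult.commute)
      qed
      finally show ?thesis .
    qed
    \<comment> \<open>Of the q powers, q - p are bounded uniformly in x by the p-norm, and only the
      remaining p are integrated over x.\<close>
    have B: "epow (ball_mean f s x) q \<le> ennreal (V powr (q - p) * s powr (- DIM('a) * (q - p) / p)) * epow N ((q - p) / p)
        * ball_mean (\<lambda>y. epow (f y) p) s x" if s: "0 < s" for s x
    proof -
      have "epow (ball_mean f s x) q = epow (ball_mean f s x) (q - p) * epow (ball_mean f s x) p"
        by (simp add: epow_add[symmetric])
      also have "\<dots> \<le> epow (ennreal (V * s powr (- DIM('a) / p)) * epow N (1/p)) (q - p) * ball_mean (\<lambda>y. epow (f y) p) s x"
        unfolding V_def N_def
        by (intro mult_mono epow_mono ball_mean_bound ball_mean_Jensen) (use p pq s in auto)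
      also have "epow (ennreal (V * s powr (- DIM('a) / p)) * epow N (1/p)) (q - p)
         = ennreal (V powr (q - p) * s powr (- DIM('a) * (q - p) / p)) * epow N ((q - p) / p)"
        by (simp add: epow_mult epow_epow V_def powr_mult powr_powr)
      finally show ?thesis .
    qed
    have "(\<integral>\<^sup>+x. epow (\<integral>\<^sup>+s\<in>{0<..<\<delta>}. ball_mean f s x \<partial>lborel) q \<partial>lborel)
      \<le> (\<integral>\<^sup>+x. epow K (q - 1) * (\<integral>\<^sup>+s. ennreal (s powr (\<gamma> * (q - 1))) * epow (ball_mean f s x) q * indicator {0<..<\<delta>} s \<partial>lborel) \<partial>lborel)"
      by (intro nn_integral_mono A)
    also have "\<dots> = epow K (q - 1) * (\<integral>\<^sup>+x. (\<integral>\<^sup>+s. ennreal (s powr (\<gamma> * (q - 1))) * epow (ball_mean f s x) q * indicator {0<..<\<delta>} s \<partial>lborel) \<partial>lborel)"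
      by (rule nn_integral_cmult) measurable
    also have "(\<integral>\<^sup>+x. (\<integral>\<^sup>+s. ennreal (s powr (\<gamma> * (q - 1))) * epow (ball_mean f s x) q * indicator {0<..<\<delta>} s \<partial>lborel) \<partial>lborel)
      = (\<integral>\<^sup>+s. (\<integral>\<^sup>+x. ennreal (s powr (\<gamma> * (q - 1))) * epow (ball_mean f s x) q * indicator {0<..<\<delta>} s \<partial>lborel) \<partial>lborel)"
      by (rule lborel_pair.Fubini') measurable
    also have "\<dots> \<le> (\<integral>\<^sup>+s. ennreal (V powr (q - p)) * epow N (q / p) * (ennreal (s powr \<beta>') * indicator {0<..<\<delta>} s) \<partial>lborel)"
    proof (rule nn_integral_mono)
      fix s :: real
      show "(\<integral>\<^sup>+x. ennreal (s powr (\<gamma> * (q - 1))) * epow (ball_mean f s x) q * indicator {0<..<\<delta>} s \<partial>lborel)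
        \<le> ennreal (V powr (q - p)) * epow N (q / p) * (ennreal (s powr \<beta>') * indicator {0<..<\<delta>} s)"
      proof (cases "s \<in> {0<..<\<delta>}")
        case True
        then have s: "0 < s" by simp
        have "(\<integral>\<^sup>+x. epow (ball_mean f s x) q \<partial>lborel)
          \<le> (\<integral>\<^sup>+x. ennreal (V powr (q - p) * s powr (- DIM('a) * (q - p) / p)) * epow N ((q - p) / p) * ball_mean (\<lambda>y. epow (f y) p) s x \<partial>lborel)"
          by (intro nn_integral_mono B s)
        also have "\<dots> = ennreal (V powr (q - p) * s powr (- DIM('a) * (q - p) / p)) * epow N ((q - p) / p) * N"
          using s by (simp add: nn_integral_cmult nn_integral_ball_mean N_def)
        also have "\<dots> = ennreal (V powr (q - p) * s powr (- DIM('a) * (q - p) / p)) * epow N (q / p)"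
          using epow_add[of N "(q-p)/p" 1] p by (simp add: mult.assoc diff_divide_distrib)
        finally have *: "(\<integral>\<^sup>+x. epow (ball_mean f s x) q \<partial>lborel) \<le> ennreal (V powr (q - p) * s powr (- DIM('a) * (q - p) / p)) * epow N (q / p)" .
        have "(\<integral>\<^sup>+x. ennreal (s powr (\<gamma> * (q - 1))) * epow (ball_mean f s x) q * indicator {0<..<\<delta>} s \<partial>lborel)
           = ennreal (s powr (\<gamma> * (q - 1))) * (\<integral>\<^sup>+x. epow (ball_mean f s x) q \<partial>lborel)"
          using True by (simp add: nn_integral_cmult)
        also have "\<dots> \<le> ennreal (s powr (\<gamma> * (q - 1))) * (ennreal (V powr (q - p) * s powr (- DIM('a) * (q - p) / p)) * epow N (q / p))"
          by (intro mult_left_mono *) auto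
        also have "\<dots> = ennreal (V powr (q - p) * (s powr (\<gamma> * (q - 1)) * s powr (- DIM('a) * (q - p) / p))) * epow N (q / p)"
          by (simp add: ennreal_mult mult_ac)
        also have "s powr (\<gamma> * (q - 1)) * s powr (- DIM('a) * (q - p) / p) = s powr \<beta>'"
          by (simp add: \<beta>'_def powr_add[symmetric])
        finally show ?thesis using True by (simp add: ennreal_mult mult_ac)
      qed simp
    qed
    also have "\<dots> = ennreal (V powr (q - p)) * epow N (q / p) * (\<integral>\<^sup>+s. ennreal (s powr \<beta>') * indicator {0<..<\<delta>} s \<partial>lborel)"
      by (simp add: nn_integral_cmult)
    also have "\<dots> \<le> ennreal (V powr (q - p)) * epow N (q / p) * ennreal (\<delta> powr (\<beta>' + 1) / (\<beta>' + 1))"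
      by (intro mult_left_mono nn_integral_powr_from_0_le b' d) auto
    finally have "(\<integral>\<^sup>+x. epow (\<integral>\<^sup>+s\<in>{0<..<\<delta>}. ball_mean f s x \<partial>lborel) q \<partial>lborel)
       \<le> epow K (q - 1) * (ennreal (V powr (q - p)) * epow N (q / p) * ennreal (\<delta> powr (\<beta>' + 1) / (\<beta>' + 1)))"
      by (simp add: mult_left_mono)
    also have "\<dots> \<le> epow (ennreal (\<delta> powr (1 - \<gamma>) / (1 - \<gamma>))) (q - 1) * (ennreal (V powr (q - p)) * epow N (q / p) * ennreal (\<delta> powr (\<beta>' + 1) / (\<beta>' + 1)))"
      using q by (intro mult_right_mono epow_mono K) auto
    also have "\<dots> = ennreal ((\<delta> powr (1 - \<gamma>) / (1 - \<gamma>)) powr (q - 1) * (V powr (q - p) * (\<delta> powr (\<beta>' + 1) / (\<beta>' + 1)))) * epow N (q / p)"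
    proof -
      define X Y Z where "X = (\<delta> powr (1 - \<gamma>) / (1 - \<gamma>)) powr (q - 1)" "Y = V powr (q - p)" "Z = \<delta> powr (\<beta>' + 1) / (\<beta>' + 1)"
      moreover have "0 \<le> X" "0 \<le> Y" "0 \<le> Z" using b' by (auto simp: X_Y_Z_def)
      ultimately show ?thesis using \<gamma> by (simp add: ennreal_mult mult_ac flip: X_Y_Z_def)
    qed
    also have "(\<delta> powr (1 - \<gamma>) / (1 - \<gamma>)) powr (q - 1) * (V powr (q - p) * (\<delta> powr (\<beta>' + 1) / (\<beta>' + 1)))
       = C * (\<delta> powr ((1 - \<gamma>) * (q - 1)) * \<delta> powr (\<beta>' + 1))"
      using \<gamma> by (simp add: C_def powr_divide powr_powr)
    \<comment> \<open>The auxiliary \<gamma> drops out of the total exponent.\<close>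
    also have "\<delta> powr ((1 - \<gamma>) * (q - 1)) * \<delta> powr (\<beta>' + 1) = \<delta> powr (q - DIM('a) * (q - p) / p)"
      by (simp add: powr_add[symmetric] \<beta>'_def algebra_simps)
    finally show ?thesis by (simp add: N_def)
  qed
  ultimately show ?thesis by blast
qed

section \<open>Signed averages, upper gradients and their local estimates\<close>

definition ball_avg :: "('a::euclidean_space \<Rightarrow> real) \<Rightarrow> real \<Rightarrow> 'a \<Rightarrow> real" where
  "ball_avg w R x = (LINT z:ball 0 R|lborel. w (x + z)) / ball_volume TYPE('a) R"

lemma ball_avg_diff_le:
  fixes w :: "'a::euclidean_space \<Rightarrow> real"
  assumes R: "0 < R" and int: "set_integrable lborel (ball 0 R) (\<lambda>z. w (x + z))"
  shows "ennreal \<bar>c - ball_avg w R x\<bar>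
    \<le> ennreal (1 / ball_volume TYPE('a) R) * (\<integral>\<^sup>+z\<in>ball 0 R. ennreal \<bar>c - w (x + z)\<bar> \<partial>lborel)"
proof -
  let ?B = "ball (0::'a) R" and ?v = "ball_volume TYPE('a) R"
  have v: "0 < ?v" using ball_volume_pos R by blast
  have c: "set_integrable lborel ?B (\<lambda>z. c)"
    unfolding set_integrable_def
    by (intro integrable_scaleR_left integrable_real_indicator) (auto simp: emeasure_ball_volume)
  have "(LINT z:?B|lborel. c) = c * ?v"
    by (simp add: set_lebesgue_integral_def ball_volume_def mult.commute)
  then have "(LINT z:?B|lborel. c - w (x + z)) = c * ?v - (LINT z:?B|lborel. w (x + z))"
    using c int by simp
  then have eq: "c - ball_avg w R x = (1 / ?v) * (LINT z:?B|lborel. c - w (x + z))"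
    using v by (simp add: ball_avg_def field_simps)
  have "set_integrable lborel ?B (\<lambda>z. c - w (x + z))"
    by (rule set_integral_diff(1)[OF c int])
  then have "ennreal (norm (LINT z:?B|lborel. c - w (x + z)))
      \<le> (\<integral>\<^sup>+z. ennreal (norm (indicator ?B z *\<^sub>R (c - w (x + z)))) \<partial>lborel)"
    unfolding set_integrable_def set_lebesgue_integral_def by (rule integral_norm_bound_ennreal)
  also have "\<dots> = (\<integral>\<^sup>+z\<in>?B. ennreal \<bar>c - w (x + z)\<bar> \<partial>lborel)"
    by (intro nn_integral_cong) (auto simp: indicator_def)
  finally show ?thesis
    using v ennreal_mult'[of "1 / ?v" "\<bar>LINT z:?B|lborel. c - w (x + z)\<bar>"]
    by (simp add: eq abs_mult mult_left_mono)
qed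

lemma ball_avg_le_ball_mean:
  fixes w :: "'a::euclidean_space \<Rightarrow> real"
  assumes "0 < R" "set_integrable lborel (ball 0 R) (\<lambda>z. w (x + z))"
  shows "ennreal \<bar>ball_avg w R x\<bar> \<le> ball_mean (\<lambda>y. ennreal \<bar>w y\<bar>) R x"
  using ball_avg_diff_le[OF assms, of 0] by (simp add: ball_mean_def)

lemma continuous_set_integrable_ball:
  fixes w :: "'a::euclidean_space \<Rightarrow> real"
  assumes "continuous_on UNIV w"
  shows "set_integrable lborel (ball 0 R) (\<lambda>z. w (x + z))"
proof -
  have "set_integrable lborel (cball 0 R) (\<lambda>z. w (x + z))"
    unfolding set_integrable_def
    by (rule borel_integrable_compact) (auto intro!: continuous_intros continuous_on_compose2[OF assms])
  then show ?thesis
    by (rule set_integrable_subset) auto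
qed

text \<open>Only straight segments inside \<open>U\<close> are tested, which is all that ball
  averages require. The pointwise form makes truncation a one-dimensional matter, and the
  restriction to \<open>U\<close> admits functions whose gradient is known on a subdomain
  only.\<close>

definition upper_gradient :: "'a::euclidean_space set \<Rightarrow> ('a \<Rightarrow> real) \<Rightarrow> ('a \<Rightarrow> ennreal) \<Rightarrow> bool" where
  "upper_gradient U w f \<longleftrightarrow> continuous_on UNIV w \<and> f \<in> borel_measurable borel \<and>
     (\<forall>x z. closed_segment x (x + z) \<subseteq> U \<longrightarrow>
        ennreal \<bar>w (x + z) - w x\<bar> \<le> ennreal (norm z) * (\<integral>\<^sup>+t\<in>{0..1}. f (x + t *\<^sub>R z) \<partial>lborel))"

lemma upper_gradientD:
  assumes "upper_gradient U w f"
  shows "continuous_on UNIV w" "w \<in> borel_measurable borel" "f \<in> borel_measurable borel"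
    "closed_segment x (x + z) \<subseteq> U \<Longrightarrow>
       ennreal \<bar>w (x + z) - w x\<bar> \<le> ennreal (norm z) * (\<integral>\<^sup>+t\<in>{0..1}. f (x + t *\<^sub>R z) \<partial>lborel)"
  using assms by (auto simp: upper_gradient_def intro: borel_measurable_continuous_onI)

text \<open>The points of the ball are joined to x by segments. Dilation by t turns the values of f
  on them into ball means of radius R t, so no singular kernel appears; the right side plays the
  part of a truncated Riesz potential of order 1.\<close>

lemma upper_gradient_diff_ball_avg:
  fixes w :: "'a::euclidean_space \<Rightarrow> real"
  assumes ug: "upper_gradient UNIV w f" and R: "0 < R"
  shows "ennreal \<bar>w x - ball_avg w R x\<bar> \<le> (\<integral>\<^sup>+s\<in>{0<..<R}. ball_mean f s x \<partial>lborel)"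
proof -
  let ?B = "ball (0::'a) R" and ?v = "ball_volume TYPE('a) R"
  note [measurable] = upper_gradientD(2,3)[OF ug]
  have v: "0 < ?v" using ball_volume_pos R by blast
  have "ennreal \<bar>w x - ball_avg w R x\<bar> \<le> ennreal (1 / ?v) * (\<integral>\<^sup>+z\<in>?B. ennreal \<bar>w x - w (x + z)\<bar> \<partial>lborel)"
    by (intro ball_avg_diff_le R continuous_set_integrable_ball upper_gradientD(1)[OF ug])
  also have "(\<integral>\<^sup>+z\<in>?B. ennreal \<bar>w x - w (x + z)\<bar> \<partial>lborel)
      \<le> (\<integral>\<^sup>+z. (\<integral>\<^sup>+t. ennreal R * f (x + t *\<^sub>R z) * indicator ?B z * indicator {0..1} t \<partial>lborel) \<partial>lborel)"
  proof (rule nn_integral_mono)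
    fix z :: 'a
    show "ennreal \<bar>w x - w (x + z)\<bar> * indicator ?B z
      \<le> (\<integral>\<^sup>+t. ennreal R * f (x + t *\<^sub>R z) * indicator ?B z * indicator {0..1} t \<partial>lborel)"
    proof (cases "z \<in> ?B")
      case True
      have "ennreal \<bar>w x - w (x + z)\<bar> \<le> ennreal (norm z) * (\<integral>\<^sup>+t\<in>{0..1}. f (x + t *\<^sub>R z) \<partial>lborel)"
        using upper_gradientD(4)[OF ug, of x z] by (simp add: abs_minus_commute)
      also have "\<dots> \<le> ennreal R * (\<integral>\<^sup>+t\<in>{0..1}. f (x + t *\<^sub>R z) \<partial>lborel)"
        using True by (intro mult_right_mono ennreal_leI) auto
      finally show ?thesis using True by (simp add: nn_integral_cmult mult.assoc)
    qed simp
  qed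
  also have "\<dots> = (\<integral>\<^sup>+t. (\<integral>\<^sup>+z. ennreal R * f (x + t *\<^sub>R z) * indicator ?B z * indicator {0..1} t \<partial>lborel) \<partial>lborel)"
    by (rule lborel_pair.Fubini') measurable
  \<comment> \<open>Substituting y = t z for fixed t. The null values t = 0, where the dilation
    degenerates, and t = 1, where R t leaves the open interval, are discarded.\<close>
  also have "\<dots> = (\<integral>\<^sup>+t. ennreal ?v * (ennreal R * ball_mean f (0 + R * t) x * indicator {0<..<R} (0 + R * t)) \<partial>lborel)"
  proof (rule nn_integral_cong_AE)
    have "AE t in lborel. t \<noteq> (0::real)" "AE t in lborel. t \<noteq> (1::real)" by (rule AE_lborel_singleton)+
    then show "AE t in lborel. (\<integral>\<^sup>+z. ennreal R * f (x + t *\<^sub>R z) * indicator ?B z * indicator {0..1} t \<partial>lborel)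
       = ennreal ?v * (ennreal R * ball_mean f (0 + R * t) x * indicator {0<..<R} (0 + R * t))"
    proof eventually_elim
      fix t :: real assume t01: "t \<noteq> 0" "t \<noteq> 1"
      show "(\<integral>\<^sup>+z. ennreal R * f (x + t *\<^sub>R z) * indicator ?B z * indicator {0..1} t \<partial>lborel)
       = ennreal ?v * (ennreal R * ball_mean f (0 + R * t) x * indicator {0<..<R} (0 + R * t))"
      proof (cases "t \<in> {0<..<1}")
        case True
        then have t: "0 < t" "t < 1" by auto
        have "(\<integral>\<^sup>+y\<in>ball 0 (R * t). f (x + y) \<partial>lborel)
            = ennreal (t ^ DIM('a)) * (\<integral>\<^sup>+z. f (x + t *\<^sub>R z) * indicator (ball 0 (R * t)) (t *\<^sub>R z) \<partial>lborel)"
          using nn_integral_lborel_affine[of "\<lambda>y. f (x + y) * indicator (ball 0 (R * t)) y" t 0] t by simp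
        also have "(\<lambda>z. indicator (ball 0 (R * t)) (t *\<^sub>R z) :: ennreal) = indicator ?B"
          using t by (auto simp: indicator_def fun_eq_iff)
        then have "(\<lambda>z. f (x + t *\<^sub>R z) * indicator (ball 0 (R * t)) (t *\<^sub>R z)) = (\<lambda>z. f (x + t *\<^sub>R z) * indicator ?B z)"
          by (metis (mono_tags))
        finally have 1: "(\<integral>\<^sup>+y\<in>ball 0 (R * t). f (x + y) \<partial>lborel)
            = ennreal (t ^ DIM('a)) * (\<integral>\<^sup>+z\<in>?B. f (x + t *\<^sub>R z) \<partial>lborel)" .
        have 2: "?v * (1 / ball_volume TYPE('a) (R * t)) * t ^ DIM('a) = 1"
          using ball_volume_eq[of R, where 'a='a] ball_volume_eq[of "R * t", where 'a='a] R t ball_volume_pos[of 1, where 'a='a]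
          by (simp add: power_mult_distrib)
        have "ennreal ?v * ball_mean f (R * t) x
           = ennreal (?v * (1 / ball_volume TYPE('a) (R * t)) * t ^ DIM('a)) * (\<integral>\<^sup>+z\<in>?B. f (x + t *\<^sub>R z) \<partial>lborel)"
        proof -
          define a b c where "a = ?v" "b = 1 / ball_volume TYPE('a) (R * t)" "c = t ^ DIM('a)"
          moreover have "0 \<le> a" "0 \<le> b" "0 \<le> c"
            using v ball_volume_pos[of "R*t", where 'a='a] R t by (auto simp: a_b_c_def)
          ultimately show ?thesis
            unfolding ball_mean_def 1 by (simp add: ennreal_mult mult.assoc flip: a_b_c_def)
        qed
        then have 3: "ennreal ?v * ball_mean f (R * t) x = (\<integral>\<^sup>+z\<in>?B. f (x + t *\<^sub>R z) \<partial>lborel)"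
          unfolding 2 by simp
        have "(\<integral>\<^sup>+z. ennreal R * f (x + t *\<^sub>R z) * indicator ?B z * indicator {0..1} t \<partial>lborel)
           = ennreal R * (\<integral>\<^sup>+z\<in>?B. f (x + t *\<^sub>R z) \<partial>lborel)"
          using t by (simp add: nn_integral_cmult mult.assoc)
        moreover have "ennreal ?v * (ennreal R * ball_mean f (0 + R * t) x * indicator {0<..<R} (0 + R * t))
           = ennreal R * (ennreal ?v * ball_mean f (R * t) x)"
          using t R by (simp add: mult_ac)
        ultimately show ?thesis by (simp only: 3)
      next
        case False
        with t01 R have "t \<notin> {0..1}" "R * t \<notin> {0<..<R}"
          by (auto simp: zero_less_mult_iff mult_less_cancel_left1)
        then show ?thesis by simp
      qed
    qed
  qed
  also have "\<dots> = ennreal ?v * (\<integral>\<^sup>+t. ennreal R * (ball_mean f (0 + R * t) x * indicator {0<..<R} (0 + R * t)) \<partial>lborel)"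
    by (subst nn_integral_cmult[symmetric]) (auto simp: mult.assoc)
  also have "(\<integral>\<^sup>+t. ennreal R * (ball_mean f (0 + R * t) x * indicator {0<..<R} (0 + R * t)) \<partial>lborel)
     = (\<integral>\<^sup>+s\<in>{0<..<R}. ball_mean f s x \<partial>lborel)"
    using nn_integral_real_affine[of "\<lambda>s. ball_mean f s x * indicator {0<..<R} s" R 0] R
    by (simp add: nn_integral_cmult)
  finally have "ennreal \<bar>w x - ball_avg w R x\<bar>
      \<le> ennreal (1 / ?v) * (ennreal ?v * (\<integral>\<^sup>+s\<in>{0<..<R}. ball_mean f s x \<partial>lborel))"
    by (simp add: mult_left_mono)
  also have "\<dots> = (\<integral>\<^sup>+s\<in>{0<..<R}. ball_mean f s x \<partial>lborel)"
    using v by (simp add: mult.assoc[symmetric] ennreal_mult[symmetric])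
  finally show ?thesis .
qed

text \<open>The ball is slid along the segment from y to x: the change is at most the length of the
  segment times the ball means of f at the centres passed on the way.\<close>

lemma upper_gradient_ball_avg_diff:
  fixes w :: "'a::euclidean_space \<Rightarrow> real"
  assumes ug: "upper_gradient UNIV w f" and R: "0 < R" and p: "1 \<le> p"
  shows "ennreal \<bar>ball_avg w R x - ball_avg w R y\<bar>
    \<le> ennreal (norm (x - y) * (ball_volume TYPE('a) 1 powr (-1/p) * R powr (- DIM('a) / p))) * epow (\<integral>\<^sup>+x. epow (f x) p \<partial>lborel) (1/p)"
proof -
  let ?B = "ball (0::'a) R" and ?v = "ball_volume TYPE('a) R"
  define c where "c = ball_volume TYPE('a) 1 powr (-1/p) * R powr (- DIM('a) / p)"
  define N where "N = epow (\<integral>\<^sup>+x. epow (f x) p \<partial>lborel) (1/p)"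
  note [measurable] = upper_gradientD(2,3)[OF ug]
  have v: "0 < ?v" using ball_volume_pos R by blast
  have int: "set_integrable lborel ?B (\<lambda>z. w (x + z))" for x
    by (intro continuous_set_integrable_ball upper_gradientD(1)[OF ug])
  have "ball_avg w R x - ball_avg w R y = (1 / ?v) * (LINT z:?B|lborel. w (x + z) - w (y + z))"
    using int by (simp add: ball_avg_def diff_divide_distrib)
  then have "ennreal \<bar>ball_avg w R x - ball_avg w R y\<bar> = ennreal (1 / ?v) * ennreal (norm (LINT z:?B|lborel. w (x + z) - w (y + z)))"
    using v ennreal_mult'[of "1 / ?v" "\<bar>LINT z:?B|lborel. w (x + z) - w (y + z)\<bar>"] by (simp add: abs_mult)
  also have "\<dots> \<le> ennreal (1 / ?v) * (\<integral>\<^sup>+z. ennreal (norm (indicator ?B z *\<^sub>R (w (x + z) - w (y + z)))) \<partial>lborel)"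
    using set_integral_diff(1)[OF int int]
    unfolding set_integrable_def set_lebesgue_integral_def
    by (intro mult_left_mono integral_norm_bound_ennreal) auto
  also have "(\<integral>\<^sup>+z. ennreal (norm (indicator ?B z *\<^sub>R (w (x + z) - w (y + z)))) \<partial>lborel)
     \<le> (\<integral>\<^sup>+z. (\<integral>\<^sup>+t. ennreal (norm (x - y)) * (f (y + t *\<^sub>R (x - y) + z) * indicator ?B z * indicator {0..1} t) \<partial>lborel) \<partial>lborel)"
  proof (rule nn_integral_mono)
    fix z :: 'a
    have "ennreal \<bar>w (x + z) - w (y + z)\<bar> \<le> ennreal (norm (x - y)) * (\<integral>\<^sup>+t\<in>{0..1}. f (y + t *\<^sub>R (x - y) + z) \<partial>lborel)"
      using upper_gradientD(4)[OF ug, of "y + z" "x - y"] by (simp add: algebra_simps)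
    then show "ennreal (norm (indicator ?B z *\<^sub>R (w (x + z) - w (y + z))))
      \<le> (\<integral>\<^sup>+t. ennreal (norm (x - y)) * (f (y + t *\<^sub>R (x - y) + z) * indicator ?B z * indicator {0..1} t) \<partial>lborel)"
      by (auto simp: indicator_def nn_integral_cmult)
  qed
  also have "\<dots> = (\<integral>\<^sup>+t. (\<integral>\<^sup>+z. ennreal (norm (x - y)) * (f (y + t *\<^sub>R (x - y) + z) * indicator ?B z * indicator {0..1} t) \<partial>lborel) \<partial>lborel)"
    by (rule lborel_pair.Fubini') measurable
  also have "\<dots> = (\<integral>\<^sup>+t. ennreal (norm (x - y)) * ((\<integral>\<^sup>+z\<in>?B. f (y + t *\<^sub>R (x - y) + z) \<partial>lborel) * indicator {0..1} t) \<partial>lborel)"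
    by (intro nn_integral_cong) (auto simp: nn_integral_cmult nn_integral_multc)
  also have "\<dots> \<le> (\<integral>\<^sup>+t. ennreal (norm (x - y)) * ((ennreal ?v * (ennreal c * N)) * indicator {0..1::real} t) \<partial>lborel)"
  proof (intro nn_integral_mono mult_left_mono mult_right_mono)
    fix t :: real
    have "(\<integral>\<^sup>+z\<in>?B. f (y + t *\<^sub>R (x - y) + z) \<partial>lborel) = ennreal ?v * ball_mean f R (y + t *\<^sub>R (x - y))"
      using v by (simp add: ball_mean_def mult.assoc[symmetric] ennreal_mult[symmetric])
    also have "\<dots> \<le> ennreal ?v * (ennreal c * N)"
      unfolding c_def N_def by (intro mult_left_mono ball_mean_bound R p) auto
    finally show "(\<integral>\<^sup>+z\<in>?B. f (y + t *\<^sub>R (x - y) + z) \<partial>lborel) \<le> ennreal ?v * (ennreal c * N)" .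
  qed auto
  also have "\<dots> = ennreal (norm (x - y)) * (ennreal ?v * (ennreal c * N))"
    by (simp add: nn_integral_cmult)
  finally have "ennreal \<bar>ball_avg w R x - ball_avg w R y\<bar> \<le> ennreal (1 / ?v) * (ennreal (norm (x - y)) * (ennreal ?v * (ennreal c * N)))"
    by (simp add: mult_left_mono)
  also have "\<dots> = (ennreal (1 / ?v) * ennreal ?v) * (ennreal (norm (x - y)) * ennreal c * N)"
    by (simp only: mult_ac)
  also have "ennreal (1 / ?v) * ennreal ?v = 1" using v by (simp add: ennreal_mult[symmetric])
  also have "1 * (ennreal (norm (x - y)) * ennreal c * N) = ennreal (norm (x - y) * c) * N"
    by (simp add: ennreal_mult c_def)
  finally show ?thesis unfolding c_def N_def .
qed

text \<open>The double integral dispenses with mean values. For fixed z and t the map from x to x +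
  t z preserves Lebesgue measure, so no Jacobian in t has to be controlled; convexity keeps the
  intermediate points in the ball.\<close>

lemma upper_gradient_poincare_ball:
  fixes w :: "'a::euclidean_space \<Rightarrow> real"
  assumes ug: "upper_gradient (ball x0 R) w f" and R: "0 < R" and p: "1 \<le> p"
  shows "(\<integral>\<^sup>+x\<in>ball x0 R. (\<integral>\<^sup>+y\<in>ball x0 R. epow (ennreal \<bar>w y - w x\<bar>) p \<partial>lborel) \<partial>lborel)
    \<le> ennreal ((2 * R) powr p * ball_volume TYPE('a) (2 * R)) * (\<integral>\<^sup>+x\<in>ball x0 R. epow (f x) p \<partial>lborel)"
proof -
  let ?B = "ball x0 R" and ?D = "ball (0::'a) (2 * R)"
  note [measurable] = upper_gradientD(2,3)[OF ug]
  define F where "F = (\<lambda>y. epow (f y) p * indicator ?B y)"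
  have [measurable]: "?B \<in> sets borel" by simp
  have [measurable]: "F \<in> borel_measurable borel" unfolding F_def by measurable
  have "(\<integral>\<^sup>+x\<in>?B. (\<integral>\<^sup>+y\<in>?B. epow (ennreal \<bar>w y - w x\<bar>) p \<partial>lborel) \<partial>lborel)
     \<le> (\<integral>\<^sup>+x. (\<integral>\<^sup>+z. (\<integral>\<^sup>+t. ennreal ((2 * R) powr p) * F (x + t *\<^sub>R z) * indicator ?D z * indicator {0..1} t \<partial>lborel) \<partial>lborel) \<partial>lborel)"
  proof (rule nn_integral_mono)
    fix x :: 'a
    show "(\<integral>\<^sup>+y\<in>?B. epow (ennreal \<bar>w y - w x\<bar>) p \<partial>lborel) * indicator ?B x
       \<le> (\<integral>\<^sup>+z. (\<integral>\<^sup>+t. ennreal ((2 * R) powr p) * F (x + t *\<^sub>R z) * indicator ?D z * indicator {0..1} t \<partial>lborel) \<partial>lborel)"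
    proof (cases "x \<in> ?B")
      case x: True
      have "(\<integral>\<^sup>+y\<in>?B. epow (ennreal \<bar>w y - w x\<bar>) p \<partial>lborel) = (\<integral>\<^sup>+z. epow (ennreal \<bar>w (x + z) - w x\<bar>) p * indicator ?B (x + z) \<partial>lborel)"
        by (subst nn_integral_lborel_translate[of _ x, symmetric]) auto
      also have "\<dots> \<le> (\<integral>\<^sup>+z. (\<integral>\<^sup>+t. ennreal ((2 * R) powr p) * F (x + t *\<^sub>R z) * indicator ?D z * indicator {0..1} t \<partial>lborel) \<partial>lborel)"
      proof (rule nn_integral_mono)
        fix z :: 'a
        show "epow (ennreal \<bar>w (x + z) - w x\<bar>) p * indicator ?B (x + z)
           \<le> (\<integral>\<^sup>+t. ennreal ((2 * R) powr p) * F (x + t *\<^sub>R z) * indicator ?D z * indicator {0..1} t \<partial>lborel)"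
        proof (cases "x + z \<in> ?B")
          case True
          have seg: "closed_segment x (x + z) \<subseteq> ?B"
            using x True by (intro closed_segment_subset convex_ball)
          have "norm z \<le> norm (x + z - x0) + norm (x - x0)"
            using norm_triangle_ineq4[of "x + z - x0" "x - x0"] by simp
          then have z: "norm z < 2 * R"
            using x True by (simp add: dist_norm norm_minus_commute)
          have inB: "x + t *\<^sub>R z \<in> ?B" if "t \<in> {0..1}" for t
            using seg that by (auto simp: closed_segment_def subset_iff algebra_simps)
          have "epow (ennreal \<bar>w (x + z) - w x\<bar>) p \<le> epow (ennreal (2 * R) * (\<integral>\<^sup>+t\<in>{0..1}. f (x + t *\<^sub>R z) \<partial>lborel)) p"
            using p z by (intro epow_mono order_trans[OF upper_gradientD(4)[OF ug seg]] mult_right_mono ennreal_leI) auto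
          also have "\<dots> = ennreal ((2 * R) powr p) * epow (\<integral>\<^sup>+t\<in>{0..1}. f (x + t *\<^sub>R z) \<partial>lborel) p"
            using R by (simp add: epow_mult)
          also have "epow (\<integral>\<^sup>+t\<in>{0..1}. f (x + t *\<^sub>R z) \<partial>lborel) p
              \<le> epow (\<integral>\<^sup>+t. indicator {0..1::real} t \<partial>lborel) (p - 1) * (\<integral>\<^sup>+t. epow (f (x + t *\<^sub>R z)) p * indicator {0..1} t \<partial>lborel)"
            by (rule nn_integral_Jensen_powr) (use p in auto)
          also have "\<dots> = (\<integral>\<^sup>+t. epow (f (x + t *\<^sub>R z)) p * indicator {0..1} t \<partial>lborel)"
            using epow_ennreal[of 1 "p - 1"] by simp
          also have "\<dots> = (\<integral>\<^sup>+t. F (x + t *\<^sub>R z) * indicator {0..1} t \<partial>lborel)"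
            using inB by (intro nn_integral_cong) (auto simp: F_def indicator_def)
          finally have "epow (ennreal \<bar>w (x + z) - w x\<bar>) p \<le> ennreal ((2 * R) powr p) * (\<integral>\<^sup>+t. F (x + t *\<^sub>R z) * indicator {0..1} t \<partial>lborel)"
            by (simp add: mult_left_mono)
          then show ?thesis using True z by (simp add: nn_integral_cmult mult.assoc)
        qed simp
      qed
      finally show ?thesis using x by simp
    qed simp
  qed
  also have "\<dots> = (\<integral>\<^sup>+z. (\<integral>\<^sup>+x. (\<integral>\<^sup>+t. ennreal ((2 * R) powr p) * F (x + t *\<^sub>R z) * indicator ?D z * indicator {0..1} t \<partial>lborel) \<partial>lborel) \<partial>lborel)"
    by (rule lborel_pair.Fubini') measurable
  also have "\<dots> = (\<integral>\<^sup>+z. (\<integral>\<^sup>+t. (\<integral>\<^sup>+x. ennreal ((2 * R) powr p) * F (x + t *\<^sub>R z) * indicator ?D z * indicator {0..1} t \<partial>lborel) \<partial>lborel) \<partial>lborel)"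
    by (intro nn_integral_cong lborel_pair.Fubini') measurable
  also have "\<dots> = (\<integral>\<^sup>+z. (\<integral>\<^sup>+t. ennreal ((2 * R) powr p) * (\<integral>\<^sup>+x. F x \<partial>lborel) * (indicator ?D z * indicator {0..1::real} t) \<partial>lborel) \<partial>lborel)"
  proof (intro nn_integral_cong)
    fix z :: 'a and t :: real
    have "(\<integral>\<^sup>+x. F (x + t *\<^sub>R z) \<partial>lborel) = (\<integral>\<^sup>+x. F x \<partial>lborel)"
      using nn_integral_lborel_translate[of F "t *\<^sub>R z"] by (simp add: add.commute)
    then show "(\<integral>\<^sup>+x. ennreal ((2 * R) powr p) * F (x + t *\<^sub>R z) * indicator ?D z * indicator {0..1} t \<partial>lborel)
       = ennreal ((2 * R) powr p) * (\<integral>\<^sup>+x. F x \<partial>lborel) * (indicator ?D z * indicator {0..1} t)"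
      by (simp add: nn_integral_cmult nn_integral_multc mult.assoc)
  qed
  also have "\<dots> = ennreal ((2 * R) powr p) * (\<integral>\<^sup>+x. F x \<partial>lborel) * ennreal (ball_volume TYPE('a) (2 * R))"
    by (simp add: nn_integral_cmult nn_integral_multc emeasure_ball_volume mult.assoc[symmetric])
  finally show ?thesis
    using ball_volume_pos[of "2 * R", where 'a='a] R by (simp add: F_def ennreal_mult mult_ac)
qed

section \<open>Truncation between two levels\<close>

lemma clamp_upper_gradient_aux:
  fixes h :: "real \<Rightarrow> real" and F :: "real \<Rightarrow> ennreal"
  assumes cont: "continuous_on {0..1} h" and [measurable]: "F \<in> borel_measurable borel"
    and FTC: "\<And>a b. 0 \<le> a \<Longrightarrow> a \<le> b \<Longrightarrow> b \<le> 1 \<Longrightarrow> ennreal \<bar>h b - h a\<bar> \<le> (\<integral>\<^sup>+t\<in>{a..b}. F t \<partial>lborel)"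
    and le: "h 0 \<le> h 1"
  shows "ennreal \<bar>max \<alpha> (min \<beta> (h 1)) - max \<alpha> (min \<beta> (h 0))\<bar>
    \<le> (\<integral>\<^sup>+t\<in>{0..1}. F t * (if \<alpha> < h t \<and> h t < \<beta> then 1 else 0) \<partial>lborel)"
proof -
  define c0 c1 where "c0 = max \<alpha> (min \<beta> (h 0))" and "c1 = max \<alpha> (min \<beta> (h 1))"
  have c01: "c0 \<le> c1" using le by (auto simp: c0_def c1_def)
  show ?thesis
  proof (cases "c0 = c1")
    case True
    then show ?thesis by (simp add: c0_def c1_def)
  next
    case False
    with c01 have lt: "c0 < c1" by simp
    have h0: "h 0 \<le> c0" and h1: "c1 \<le> h 1" and bd: "\<alpha> \<le> c0" "c1 \<le> \<beta>"
      using lt le by (auto simp: c0_def c1_def max_def min_def split: if_splits)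
    \<comment> \<open>\<open>a\<close> is the last time at which h is at or below the lower clamped
      end value, and \<open>b\<close> the first later time at which h reaches the upper one.
      Strictly between them h stays inside the band.\<close>
    define S where "S = {t \<in> {0..1}. h t \<le> c0}"
    have "closed S" unfolding S_def
      by (intro continuous_on_closed_Collect_le cont continuous_on_const closed_atLeastAtMost)
    then have S: "compact S" "S \<noteq> {}"
      using h0 by (auto simp: S_def compact_eq_bounded_closed intro: bounded_subset[of "{0..1}"] intro!: exI[of _ 0])
    then obtain a where a: "a \<in> S" "\<And>t. t \<in> S \<Longrightarrow> t \<le> a"
      by (metis compact_attains_sup)
    define T where "T = {t \<in> {a..1}. c1 \<le> h t}"
    have conta: "continuous_on {a..1} h" using a(1) by (intro continuous_on_subset[OF cont]) (auto simp: S_def)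
    have "closed T" unfolding T_def
      by (intro continuous_on_closed_Collect_le conta continuous_on_const closed_atLeastAtMost)
    moreover have "1 \<in> T" using a(1) h1 by (auto simp: T_def S_def)
    ultimately have T: "compact T" "T \<noteq> {}"
      by (auto simp: T_def compact_eq_bounded_closed intro: bounded_subset[of "{a..1}"])
    then obtain b where b: "b \<in> T" "\<And>t. t \<in> T \<Longrightarrow> b \<le> t"
      by (metis compact_attains_inf)
    have ab: "0 \<le> a" "a \<le> b" "b \<le> 1" "h a \<le> c0" "c1 \<le> h b"
      using a(1) b(1) by (auto simp: S_def T_def)
    have mid: "\<alpha> < h t \<and> h t < \<beta>" if "a < t" "t < b" for t
      using a(2)[of t] b(2)[of t] that ab bd by (force simp: S_def T_def)
    have "ennreal \<bar>c1 - c0\<bar> \<le> ennreal \<bar>h b - h a\<bar>" using ab lt by (intro ennreal_leI) auto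
    also have "\<dots> \<le> (\<integral>\<^sup>+t\<in>{a..b}. F t \<partial>lborel)" by (intro FTC ab)
    also have "\<dots> \<le> (\<integral>\<^sup>+t\<in>{0..1}. F t * (if \<alpha> < h t \<and> h t < \<beta> then 1 else 0) \<partial>lborel)"
    proof (rule nn_integral_mono_AE)
      have "AE t in lborel. t \<noteq> a" "AE t in lborel. t \<noteq> b" by (rule AE_lborel_singleton)+
      then show "AE t in lborel. F t * indicator {a..b} t \<le> F t * (if \<alpha> < h t \<and> h t < \<beta> then 1 else 0) * indicator {0..1} t"
        by eventually_elim (use mid ab in \<open>auto simp: indicator_def\<close>)
    qed
    finally show ?thesis by (simp add: c0_def c1_def)
  qed
qed

lemma clamp_upper_gradient_line:
  fixes h :: "real \<Rightarrow> real" and F :: "real \<Rightarrow> ennreal"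
  assumes cont: "continuous_on {0..1} h" and F: "F \<in> borel_measurable borel" and \<alpha>\<beta>: "\<alpha> \<le> \<beta>"
    and FTC: "\<And>a b. 0 \<le> a \<Longrightarrow> a \<le> b \<Longrightarrow> b \<le> 1 \<Longrightarrow> ennreal \<bar>h b - h a\<bar> \<le> (\<integral>\<^sup>+t\<in>{a..b}. F t \<partial>lborel)"
  shows "ennreal \<bar>max \<alpha> (min \<beta> (h 1)) - max \<alpha> (min \<beta> (h 0))\<bar>
    \<le> (\<integral>\<^sup>+t\<in>{0..1}. F t * (if \<alpha> < h t \<and> h t < \<beta> then 1 else 0) \<partial>lborel)"
proof (cases "h 0 \<le> h 1")
  case True
  then show ?thesis by (intro clamp_upper_gradient_aux assms)
next
  case False
  \<comment> \<open>A descent is an ascent of - h between the reflected levels.\<close>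
  have *: "ennreal \<bar>max (-\<beta>) (min (-\<alpha>) (- h 1)) - max (-\<beta>) (min (-\<alpha>) (- h 0))\<bar>
    \<le> (\<integral>\<^sup>+t\<in>{0..1}. F t * (if -\<beta> < - h t \<and> - h t < -\<alpha> then 1 else 0) \<partial>lborel)"
    by (rule clamp_upper_gradient_aux[of "\<lambda>t. - h t"])
       (use False FTC in \<open>auto intro!: continuous_intros cont F simp: abs_minus_commute\<close>)
  have "max (-\<beta>) (min (-\<alpha>) (- x)) = - max \<alpha> (min \<beta> x)" for x
    using \<alpha>\<beta> by (auto simp: max_def min_def)
  with * show ?thesis by (simp add: abs_minus_commute conj_commute)
qed

text \<open>The open band is what makes the new upper gradients of adjacent layers live on disjoint
  sets. Subtracting \<alpha> makes the truncation vanish where w is at most \<alpha>, which is how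
  it inherits p-integrability.\<close>

lemma upper_gradient_clamp:
  fixes w :: "'a::euclidean_space \<Rightarrow> real"
  assumes ug: "upper_gradient UNIV w f" and \<alpha>\<beta>: "\<alpha> \<le> \<beta>"
  shows "upper_gradient UNIV (\<lambda>x. max \<alpha> (min \<beta> (w x)) - \<alpha>) (\<lambda>x. f x * (if \<alpha> < w x \<and> w x < \<beta> then 1 else 0))"
  unfolding upper_gradient_def
proof (intro conjI allI impI)
  note [measurable] = upper_gradientD(2,3)[OF ug]
  show "continuous_on UNIV (\<lambda>x. max \<alpha> (min \<beta> (w x)) - \<alpha>)"
    by (intro continuous_intros upper_gradientD(1)[OF ug])
  show "(\<lambda>x. f x * (if \<alpha> < w x \<and> w x < \<beta> then 1 else 0)) \<in> borel_measurable borel" by measurable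
  fix x z :: 'a
  have "ennreal \<bar>max \<alpha> (min \<beta> (w (x + 1 *\<^sub>R z))) - max \<alpha> (min \<beta> (w (x + 0 *\<^sub>R z)))\<bar>
     \<le> (\<integral>\<^sup>+t\<in>{0..1}. ennreal (norm z) * f (x + t *\<^sub>R z) * (if \<alpha> < w (x + t *\<^sub>R z) \<and> w (x + t *\<^sub>R z) < \<beta> then 1 else 0) \<partial>lborel)"
  proof (rule clamp_upper_gradient_line[of "\<lambda>t. w (x + t *\<^sub>R z)"])
    show "continuous_on {0..1} (\<lambda>t. w (x + t *\<^sub>R z))"
      by (intro continuous_on_compose2[OF upper_gradientD(1)[OF ug]] continuous_intros) auto
    show "(\<lambda>t. ennreal (norm z) * f (x + t *\<^sub>R z)) \<in> borel_measurable borel" by measurable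
    show "\<alpha> \<le> \<beta>" by fact
    fix a b :: real assume ab: "0 \<le> a" "a \<le> b" "b \<le> 1"
    show "ennreal \<bar>w (x + b *\<^sub>R z) - w (x + a *\<^sub>R z)\<bar> \<le> (\<integral>\<^sup>+t\<in>{a..b}. ennreal (norm z) * f (x + t *\<^sub>R z) \<partial>lborel)"
    proof (cases "a = b")
      case False
      with ab have lt: "0 < b - a" by simp
      \<comment> \<open>Subsegments are reparametrised affinely to the unit interval, the form in
        which an upper gradient is given.\<close>
      have *: "indicator {a..b} (a + (b - a) * t) = (indicator {0..1} t :: ennreal)" for t
        using lt mult_le_cancel_left_pos[OF lt, of t 1] mult_right_mono[of a b t]
        by (auto simp: indicator_def zero_le_mult_iff algebra_simps)
      have "ennreal \<bar>w (x + b *\<^sub>R z) - w (x + a *\<^sub>R z)\<bar> \<le> ennreal (norm ((b - a) *\<^sub>R z)) * (\<integral>\<^sup>+t\<in>{0..1}. f (x + a *\<^sub>R z + t *\<^sub>R (b - a) *\<^sub>R z) \<partial>lborel)"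
        using upper_gradientD(4)[OF ug, of "x + a *\<^sub>R z" "(b - a) *\<^sub>R z"] by (simp add: algebra_simps)
      also have "(\<lambda>t. f (x + a *\<^sub>R z + t *\<^sub>R (b - a) *\<^sub>R z)) = (\<lambda>t. f (x + (a + (b - a) * t) *\<^sub>R z))"
        by (simp add: algebra_simps)
      also have "ennreal (norm ((b - a) *\<^sub>R z)) * (\<integral>\<^sup>+t\<in>{0..1}. f (x + (a + (b - a) * t) *\<^sub>R z) \<partial>lborel)
         = ennreal (norm z) * (\<integral>\<^sup>+t\<in>{a..b}. f (x + t *\<^sub>R z) \<partial>lborel)"
        using nn_integral_real_affine[of "\<lambda>t. f (x + t *\<^sub>R z) * indicator {a..b} t" "b - a" a] lt
        by (simp add: * *[unfolded mult.commute[of "b - a"]] ennreal_mult mult_ac)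
      finally show ?thesis by (simp add: nn_integral_cmult mult.assoc)
    qed simp
  qed
  then show "ennreal \<bar>max \<alpha> (min \<beta> (w (x + z))) - \<alpha> - (max \<alpha> (min \<beta> (w x)) - \<alpha>)\<bar>
    \<le> ennreal (norm z) * (\<integral>\<^sup>+t\<in>{0..1}. f (x + t *\<^sub>R z) * (if \<alpha> < w (x + t *\<^sub>R z) \<and> w (x + t *\<^sub>R z) < \<beta> then 1 else 0) \<partial>lborel)"
    by (subst nn_integral_cmult[symmetric]) (auto simp: mult.assoc)
qed

lemma upper_gradient_abs:
  assumes ug: "upper_gradient U w f"
  shows "upper_gradient U (\<lambda>x. \<bar>w x\<bar>) f"
  unfolding upper_gradient_def
proof (intro conjI allI impI)
  show "continuous_on UNIV (\<lambda>x. \<bar>w x\<bar>)" by (intro continuous_intros upper_gradientD(1)[OF ug])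
  show "f \<in> borel_measurable borel" using upper_gradientD(3)[OF ug] .
  fix x z :: 'a assume "closed_segment x (x + z) \<subseteq> U"
  have "ennreal \<bar>\<bar>w (x + z)\<bar> - \<bar>w x\<bar>\<bar> \<le> ennreal \<bar>w (x + z) - w x\<bar>"
    by (intro ennreal_leI) auto
  also have "\<dots> \<le> ennreal (norm z) * (\<integral>\<^sup>+t\<in>{0..1}. f (x + t *\<^sub>R z) \<partial>lborel)"
    by (rule upper_gradientD(4)[OF ug]) fact
  finally show "ennreal \<bar>\<bar>w (x + z)\<bar> - \<bar>w x\<bar>\<bar> \<le> ennreal (norm z) * (\<integral>\<^sup>+t\<in>{0..1}. f (x + t *\<^sub>R z) \<partial>lborel)" .
qed

text \<open>The far part of the potential is summable because \<open>p < n\<close>; letting the radius tend to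
  infinity removes the mean value.\<close>

lemma upper_gradient_pointwise:
  fixes w :: "'a::euclidean_space \<Rightarrow> real" and p :: real
  assumes ug: "upper_gradient UNIV w f" and p: "1 \<le> p" "p < DIM('a)"
    and w: "(\<integral>\<^sup>+x. epow (ennreal \<bar>w x\<bar>) p \<partial>lborel) < top" and \<delta>: "0 < \<delta>"
  shows "ennreal \<bar>w x\<bar> \<le> (\<integral>\<^sup>+s\<in>{0<..<\<delta>}. ball_mean f s x \<partial>lborel)
    + ennreal (ball_volume TYPE('a) 1 powr (-1/p) / (DIM('a) / p - 1) * \<delta> powr (1 - DIM('a) / p)) * epow (\<integral>\<^sup>+x. epow (f x) p \<partial>lborel) (1/p)"
    (is "_ \<le> ?near + ?far")
proof -
  note [measurable] = upper_gradientD(2,3)[OF ug]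
  define V where "V = ball_volume TYPE('a) 1 powr (-1/p)"
  define N where "N = epow (\<integral>\<^sup>+x. epow (f x) p \<partial>lborel) (1/p)"
  define W where "W = epow (\<integral>\<^sup>+x. epow (ennreal \<bar>w x\<bar>) p \<partial>lborel) (1/p)"
  \<comment> \<open>\<open>n\<close> is the dimension divided by p; it exceeds 1, which makes the
    far part converge at infinity.\<close>
  define n where "n = real DIM('a) / p"
  have n: "1 < n" using p by (simp add: n_def)
  have V: "0 \<le> V" by (simp add: V_def)
  have far: "(\<integral>\<^sup>+s\<in>{\<delta>..}. ball_mean f s x \<partial>lborel) \<le> ennreal (V / (n - 1) * \<delta> powr (1 - n)) * N"
  proof -
    have "(\<integral>\<^sup>+s\<in>{\<delta>..}. ball_mean f s x \<partial>lborel) \<le> (\<integral>\<^sup>+s\<in>{\<delta>..}. ennreal V * N * ennreal (s powr (-n)) \<partial>lborel)"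
    proof (intro nn_integral_mono)
      fix s :: real
      show "ball_mean f s x * indicator {\<delta>..} s \<le> ennreal V * N * ennreal (s powr (-n)) * indicator {\<delta>..} s"
      proof (cases "\<delta> \<le> s")
        case True
        then have "ball_mean f s x \<le> ennreal (V * s powr (-n)) * N"
          unfolding V_def N_def n_def using ball_mean_bound[of f p s x] p \<delta> by simp
        then show ?thesis using True V by (simp add: ennreal_mult mult_ac)
      qed simp
    qed
    also have "\<dots> = ennreal V * N * (\<integral>\<^sup>+s\<in>{\<delta>..}. ennreal (s powr (-n)) \<partial>lborel)"
      by (subst nn_integral_cmult[symmetric]) (auto simp: mult.assoc)
    also have "\<dots> \<le> ennreal V * N * ennreal (\<delta> powr (-n + 1) / - (-n + 1))"
      using n \<delta> by (intro mult_left_mono nn_integral_powr_to_inf_le) auto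
    also have "\<dots> = ennreal (V * (\<delta> powr (-n + 1) / - (-n + 1))) * N"
      using V n by (subst ennreal_mult) (auto simp: mult_ac)
    also have "V * (\<delta> powr (-n + 1) / - (-n + 1)) = V / (n - 1) * \<delta> powr (1 - n)"
      by simp
    finally show ?thesis .
  qed
  \<comment> \<open>R is auxiliary: splitting the radii at \<delta> and comparing with the average
    at radius R leaves an error of order R^(-n) times the p-norm of w.\<close>
  have main: "ennreal \<bar>w x\<bar> \<le> (?near + ?far) + ennreal (V * R powr (-n)) * W" if R: "\<delta> < R" for R
  proof -
    have "ennreal \<bar>w x\<bar> \<le> ennreal \<bar>w x - ball_avg w R x\<bar> + ennreal \<bar>ball_avg w R x\<bar>"
      by (simp add: ennreal_plus[symmetric] ennreal_leI del: ennreal_plus)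
    also have "ennreal \<bar>w x - ball_avg w R x\<bar> \<le> (\<integral>\<^sup>+s\<in>{0<..<R}. ball_mean f s x \<partial>lborel)"
      using R \<delta> by (intro upper_gradient_diff_ball_avg ug) auto
    also have "\<dots> \<le> (\<integral>\<^sup>+s. ball_mean f s x * indicator {0<..<\<delta>} s + ball_mean f s x * indicator {\<delta>..} s \<partial>lborel)"
      by (intro nn_integral_mono) (auto simp: indicator_def)
    also have "\<dots> = ?near + (\<integral>\<^sup>+s\<in>{\<delta>..}. ball_mean f s x \<partial>lborel)"
      by (rule nn_integral_add) auto
    also have "ennreal \<bar>ball_avg w R x\<bar> \<le> ball_mean (\<lambda>y. ennreal \<bar>w y\<bar>) R x"
      using R \<delta> by (intro ball_avg_le_ball_mean continuous_set_integrable_ball upper_gradientD(1)[OF ug]) auto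
    also have "\<dots> \<le> ennreal (V * R powr (-n)) * W"
      unfolding V_def W_def n_def using ball_mean_bound[of "\<lambda>y. ennreal \<bar>w y\<bar>" p R x] p R \<delta> by simp
    also have "(\<integral>\<^sup>+s\<in>{\<delta>..}. ball_mean f s x \<partial>lborel) \<le> ?far"
      using far by (simp add: V_def N_def n_def)
    finally show ?thesis by (simp add: add_mono)
  qed
  have "((\<lambda>R. R powr (-n)) \<longlongrightarrow> 0) at_top"
    using n by (intro tendsto_neg_powr filterlim_ident) auto
  then have "((\<lambda>R. V * R powr (-n)) \<longlongrightarrow> 0) at_top" by (rule tendsto_mult_right_zero)
  then have "((\<lambda>R. ennreal (V * R powr (-n))) \<longlongrightarrow> 0) at_top"
    using tendsto_ennrealI by fastforce
  then have "((\<lambda>R. ennreal (V * R powr (-n)) * W) \<longlongrightarrow> 0 * W) at_top"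
    using w by (intro tendsto_mult_ennreal tendsto_const) (auto simp: W_def)
  then have "((\<lambda>R. (?near + ?far) + ennreal (V * R powr (-n)) * W) \<longlongrightarrow> (?near + ?far) + 0) at_top"
    by (intro tendsto_add tendsto_const) simp
  then have "ennreal \<bar>w x\<bar> \<le> (?near + ?far) + 0"
    by (rule tendsto_lowerbound)
       (use main in \<open>auto intro: eventually_mono[OF eventually_gt_at_top[of \<delta>]]\<close>)
  then show ?thesis by simp
qed

section \<open>The Sobolev inequality for upper gradients\<close>

text \<open>Splitting the potential at a radius for which the far part is half the level leaves the
  near part to Chebyshev's inequality in L^p. Since p (1 + e) = n p / (n - p), with n the dimension,
  this is the weak form of the Sobolev inequality.\<close>

lemma weak_type_upper_gradient:
  fixes p :: real
  assumes p: "1 \<le> p" "p < DIM('a::euclidean_space)"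
  defines "e \<equiv> p / (DIM('a) - p)"
  shows "\<exists>C>0. \<forall>(w :: 'a \<Rightarrow> real) f. upper_gradient UNIV w f \<longrightarrow> (\<integral>\<^sup>+x. epow (ennreal \<bar>w x\<bar>) p \<partial>lborel) < top \<longrightarrow>
    (\<forall>\<kappa>>0. emeasure lborel {x. \<kappa> < \<bar>w x\<bar>} \<le> ennreal (C * \<kappa> powr (- (p * (1 + e)))) * epow (\<integral>\<^sup>+x. epow (f x) p \<partial>lborel) (1 + e))"
proof -
  have e: "0 < e" using p by (simp add: e_def)
  define c where "c = ball_volume TYPE('a) 1 powr (-1/p) / (DIM('a) / p - 1)"
  have c: "0 < c" using p ball_volume_pos[of 1, where 'a='a] by (simp add: c_def)
  obtain C0 where C0: "0 \<le> C0" "\<And>f \<delta>. f \<in> borel_measurable (borel :: 'a measure) \<Longrightarrow> 0 < \<delta> \<Longrightarrow>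
    (\<integral>\<^sup>+x. epow (\<integral>\<^sup>+s\<in>{0<..<\<delta>}. ball_mean f s x \<partial>lborel) p \<partial>lborel)
      \<le> ennreal (C0 * \<delta> powr p) * (\<integral>\<^sup>+x. epow (f x) p \<partial>lborel)"
    using nn_integral_ball_mean_Lq[of p p 0, where 'a='a] p by auto
  \<comment> \<open>The summand 1 secures positivity, since \<open>C0\<close> may be 0.\<close>
  define C where "C = 2 powr p * C0 * (2 * c) powr (p * e) + 1"
  have "0 < C" using C0 by (simp add: C_def add_nonneg_pos)
  moreover have "emeasure lborel {x. \<kappa> < \<bar>w x\<bar>} \<le> ennreal (C * \<kappa> powr (- (p * (1 + e)))) * epow (\<integral>\<^sup>+x. epow (f x) p \<partial>lborel) (1 + e)"
    if ug: "upper_gradient UNIV w f" and w: "(\<integral>\<^sup>+x. epow (ennreal \<bar>w x\<bar>) p \<partial>lborel) < top" and l: "0 < \<kappa>" for w :: "'a \<Rightarrow> real" and f \<kappa>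
  proof -
    note [measurable] = upper_gradientD(2,3)[OF ug]
    define N where "N = (\<integral>\<^sup>+x. epow (f x) p \<partial>lborel)"
    have pw: "ennreal \<bar>w x\<bar> \<le> (\<integral>\<^sup>+s\<in>{0<..<\<delta>}. ball_mean f s x \<partial>lborel) + ennreal (c * \<delta> powr (1 - DIM('a) / p)) * epow N (1/p)"
      if "0 < \<delta>" for x \<delta>
      unfolding c_def N_def by (rule upper_gradient_pointwise[OF ug p w that])
    consider "N = 0" | "N = top" | m where "N = ennreal m" "0 < m"
      by (cases N) (auto simp: less_le)
    then show ?thesis
    proof cases
      case 1
      have "\<bar>w x\<bar> = 0" for x
      proof -
        have "ball_mean f s x = 0" if "0 < s" for s
          using ball_mean_bound[of f p s x] 1 that p by (simp add: N_def)
        then have "(\<integral>\<^sup>+s\<in>{0<..<1}. ball_mean f s x \<partial>lborel) = (\<integral>\<^sup>+s\<in>{0<..<1::real}. 0 \<partial>lborel)"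
          by (intro nn_integral_cong) (auto simp: indicator_def)
        then show ?thesis using pw[of 1 x] 1 by simp
      qed
      then have "{x. \<kappa> < \<bar>w x\<bar>} = {}" using l by (auto simp: not_less)
      then show ?thesis by simp
    next
      case 2
      then show ?thesis using \<open>0 < C\<close> l by (simp add: N_def[symmetric] ennreal_mult_top)
    next
      case 3
      define M where "M = m powr (1/p)"
      have M: "0 < M" using 3 by (simp add: M_def)
      \<comment> \<open>Solves c \<delta>^(1 - n/p) M = \<kappa>/2, n being the dimension; the
        exponent e is the reciprocal of n/p - 1.\<close>
      define \<delta> where "\<delta> = (\<kappa> / (2 * c * M)) powr (- e)"
      have d: "0 < \<delta>" using l c M by (simp add: \<delta>_def)
      have ep: "e * (DIM('a) / p - 1) = 1" using p by (simp add: e_def field_simps)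
      have "\<delta> powr (1 - DIM('a) / p) = (\<kappa> / (2 * c * M)) powr (e * (DIM('a) / p - 1))"
        by (simp add: \<delta>_def powr_powr algebra_simps)
      also have "\<dots> = \<kappa> / (2 * c * M)"
        using l c M by (simp add: ep)
      finally have far: "c * \<delta> powr (1 - DIM('a) / p) * M = \<kappa> / 2"
        using c M by simp
      define h where "h x = (\<integral>\<^sup>+s\<in>{0<..<\<delta>}. ball_mean f s x \<partial>lborel)" for x
      have [measurable]: "h \<in> borel_measurable borel" unfolding h_def by measurable
      have sub: "{x. \<kappa> < \<bar>w x\<bar>} \<subseteq> {x \<in> UNIV. 1 \<le> ennreal ((2 / \<kappa>) powr p) * epow (h x) p}"
      proof (rule subsetI)
        fix x assume "x \<in> {x. \<kappa> < \<bar>w x\<bar>}"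
        then have wx: "\<kappa> < \<bar>w x\<bar>" by simp
        have "ennreal (c * \<delta> powr (1 - DIM('a) / p)) * epow N (1/p) = ennreal (c * \<delta> powr (1 - DIM('a) / p)) * ennreal M"
          using 3 by (simp add: M_def)
        also have "\<dots> = ennreal (\<kappa> / 2)"
          using c M by (simp add: ennreal_mult[symmetric] far)
        finally have "ennreal \<bar>w x\<bar> \<le> h x + ennreal (\<kappa> / 2)"
          using pw[OF d, of x] by (simp add: h_def)
        then have "ennreal (\<kappa> / 2) \<le> h x"
          using wx l by (cases "h x") (auto simp: ennreal_plus[symmetric] simp del: ennreal_plus)
        then have "epow (ennreal (\<kappa> / 2)) p \<le> epow (h x) p"
          using p by (intro epow_mono) auto
        then have "ennreal ((2 / \<kappa>) powr p) * epow (ennreal (\<kappa> / 2)) p \<le> ennreal ((2 / \<kappa>) powr p) * epow (h x) p"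
          by (intro mult_left_mono) auto
        moreover have "ennreal ((2 / \<kappa>) powr p) * epow (ennreal (\<kappa> / 2)) p = 1"
          using l by (simp add: ennreal_mult[symmetric] powr_mult[symmetric])
        ultimately show "x \<in> {x \<in> UNIV. 1 \<le> ennreal ((2 / \<kappa>) powr p) * epow (h x) p}" by simp
      qed
      have "emeasure lborel {x. \<kappa> < \<bar>w x\<bar>} \<le> emeasure lborel {x \<in> UNIV. 1 \<le> ennreal ((2 / \<kappa>) powr p) * epow (h x) p}"
        by (intro emeasure_mono sub) measurable
      also have "\<dots> \<le> ennreal ((2 / \<kappa>) powr p) * (\<integral>\<^sup>+x. epow (h x) p * indicator UNIV x \<partial>lborel)"
        by (rule nn_integral_Markov_inequality) auto
      also have "\<dots> \<le> ennreal ((2 / \<kappa>) powr p) * (ennreal (C0 * \<delta> powr p) * ennreal m)"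
        using C0(2)[OF _ d, of f] by (intro mult_left_mono) (auto simp: h_def 3[unfolded N_def])
      also have "\<dots> = ennreal ((2 / \<kappa>) powr p * (C0 * \<delta> powr p) * m)"
        using C0(1) 3 by (simp add: ennreal_mult mult_ac)
      also have "(2 / \<kappa>) powr p * (C0 * \<delta> powr p) * m = 2 powr p * C0 * (2 * c) powr (p * e) * \<kappa> powr (- (p * (1 + e))) * m powr (1 + e)"
      proof -
        have "\<delta> powr p = \<kappa> powr (- (p * e)) * (2 * c) powr (p * e) * M powr (p * e)"
          using l c M by (simp add: \<delta>_def powr_powr powr_divide powr_mult powr_minus divide_simps mult_ac)
        moreover have "M powr (p * e) = m powr e"
          using p by (simp add: M_def powr_powr)
        moreover have "\<kappa> powr (- (p * (1 + e))) = \<kappa> powr (-p) * \<kappa> powr (- (p * e))"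
          by (simp add: powr_add[symmetric] algebra_simps)
        moreover have "m powr (1 + e) = m * m powr e" using 3 by (simp add: powr_add)
        moreover have "(2 / \<kappa>) powr p = 2 powr p * \<kappa> powr (-p)"
          using l by (simp add: powr_divide powr_minus divide_simps)
        ultimately show ?thesis by (simp only: mult_ac)
      qed
      also have "\<dots> \<le> C * \<kappa> powr (- (p * (1 + e))) * m powr (1 + e)"
        unfolding C_def by (intro mult_right_mono) auto
      finally have "emeasure lborel {x. \<kappa> < \<bar>w x\<bar>} \<le> ennreal (C * \<kappa> powr (- (p * (1 + e))) * m powr (1 + e))"
        by (simp add: ennreal_leI)
      then show ?thesis using 3 \<open>0 < C\<close> by (simp add: N_def[symmetric] ennreal_mult)
    qed
  qed
  ultimately show ?thesis by blast
qed

text \<open>Maz'ya's truncation argument: the weak type bound for the truncations of \<open>w\<close> to dyadic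
  layers sums to the strong bound, because their upper gradients live on disjoint sets.\<close>

lemma sobolev_upper_gradient:
  fixes p :: real
  assumes p: "1 \<le> p" "p < DIM('a::euclidean_space)"
  defines "e \<equiv> p / (DIM('a) - p)"
  shows "\<exists>C>0. \<forall>(w :: 'a \<Rightarrow> real) f. upper_gradient UNIV w f \<longrightarrow> (\<integral>\<^sup>+x. epow (ennreal \<bar>w x\<bar>) p \<partial>lborel) < top \<longrightarrow>
    (\<integral>\<^sup>+x. epow (ennreal \<bar>w x\<bar>) (p * (1 + e)) \<partial>lborel) \<le> ennreal C * epow (\<integral>\<^sup>+x. epow (f x) p \<partial>lborel) (1 + e)"
proof -
  define r where "r = p * (1 + e)"
  have e: "0 < e" using p by (simp add: e_def)
  then have r: "0 < r" using p by (simp add: r_def)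
  from weak_type_upper_gradient[OF p]
  obtain C where C: "0 < C" "\<And>(w :: 'a \<Rightarrow> real) f \<kappa>. upper_gradient UNIV w f \<Longrightarrow> (\<integral>\<^sup>+x. epow (ennreal \<bar>w x\<bar>) p \<partial>lborel) < top \<Longrightarrow>
    0 < \<kappa> \<Longrightarrow> emeasure lborel {x. \<kappa> < \<bar>w x\<bar>} \<le> ennreal (C * \<kappa> powr (- r)) * epow (\<integral>\<^sup>+x. epow (f x) p \<partial>lborel) (1 + e)"
    unfolding e_def r_def by blast
  have "(\<integral>\<^sup>+x. epow (ennreal \<bar>w x\<bar>) r \<partial>lborel) \<le> ennreal (8 powr r * C) * epow (\<integral>\<^sup>+x. epow (f x) p \<partial>lborel) (1 + e)"
    if ug: "upper_gradient UNIV w f" and w: "(\<integral>\<^sup>+x. epow (ennreal \<bar>w x\<bar>) p \<partial>lborel) < top" for w :: "'a \<Rightarrow> real" and f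
  proof -
    note [measurable] = upper_gradientD(2,3)[OF ug]
    define N where "N = (\<integral>\<^sup>+x. epow (f x) p \<partial>lborel)"
    \<comment> \<open>All integer powers of 2, enumerated by \<open>nat\<close> so that sums over
      layers become series.\<close>
    define a where "a i = 2 powr real_of_int (int_decode i)" for i :: nat
    have a: "0 < a i" for i by (simp add: a_def)
    define B where "B i = {x. a i < \<bar>w x\<bar> \<and> \<bar>w x\<bar> < 2 * a i}" for i
    have [measurable]: "B i \<in> sets borel" for i unfolding B_def by measurable
    define Ni where "Ni i = (\<integral>\<^sup>+x. epow (f x) p * indicator (B i) x \<partial>lborel)" for i
    have disj: "disjoint_family B"
      unfolding disjoint_family_on_def
    proof (intro ballI impI)
      fix i j :: nat assume "i \<noteq> j"
      then have "int_decode i < int_decode j \<or> int_decode j < int_decode i"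
        by (metis int_decode_inverse linorder_neqE_linordered_idom)
      moreover have "2 * a i \<le> a j" if "int_decode i < int_decode j" for i j
      proof -
        have "2 * a i = 2 powr (1 + real_of_int (int_decode i))" by (simp add: a_def powr_add)
        also have "\<dots> \<le> a j" unfolding a_def using that by (intro powr_mono) auto
        finally show ?thesis .
      qed
      ultimately have "2 * a i \<le> a j \<or> 2 * a j \<le> a i" by blast
      then show "B i \<inter> B j = {}" by (auto simp: B_def)
    qed
    \<comment> \<open>The energies of the layers are values, on disjoint sets, of the single measure
      with density f^p.\<close>
    have sumN: "(\<Sum>i. Ni i) \<le> N"
    proof -
      let ?D = "density lborel (\<lambda>x. epow (f x) p)"
      have "(\<Sum>i. Ni i) = (\<Sum>i. emeasure ?D (B i))"
        by (simp add: Ni_def emeasure_density)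
      also have "\<dots> = emeasure ?D (\<Union>i. B i)"
        using disj by (intro suminf_emeasure) auto
      also have "\<dots> \<le> emeasure ?D (space ?D)" by (rule emeasure_space)
      also have "\<dots> = N" by (simp add: emeasure_density N_def)
      finally show ?thesis .
    qed
    \<comment> \<open>The truncation \<open>v\<close> equals \<open>a i\<close> above the layer,
      hence exceeds \<open>a i / 2\<close> there, and its weak type bound at that level controls the
      whole superlevel set of w.\<close>
    have level: "emeasure lborel {x. 2 * a i < \<bar>w x\<bar>} \<le> ennreal (C * (a i / 2) powr (- r)) * epow (Ni i) (1 + e)" for i
    proof -
      define v where "v x = max (a i) (min (2 * a i) \<bar>w x\<bar>) - a i" for x
      define g where "g x = f x * (if a i < \<bar>w x\<bar> \<and> \<bar>w x\<bar> < 2 * a i then 1 else 0)" for x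
      have "upper_gradient UNIV v g"
        unfolding v_def g_def using a[of i] by (intro upper_gradient_clamp upper_gradient_abs ug) auto
      moreover have vw: "\<bar>v x\<bar> \<le> \<bar>w x\<bar>" for x
        using a[of i] by (auto simp: v_def max_def min_def)
      have "(\<integral>\<^sup>+x. epow (ennreal \<bar>v x\<bar>) p \<partial>lborel) \<le> (\<integral>\<^sup>+x. epow (ennreal \<bar>w x\<bar>) p \<partial>lborel)"
        using p by (intro nn_integral_mono epow_mono ennreal_leI vw) auto
      then have "(\<integral>\<^sup>+x. epow (ennreal \<bar>v x\<bar>) p \<partial>lborel) < top"
        using w by (rule le_less_trans)
      moreover have "0 < a i / 2" using a[of i] by simp
      ultimately have "emeasure lborel {x. a i / 2 < \<bar>v x\<bar>} \<le> ennreal (C * (a i / 2) powr (- r)) * epow (\<integral>\<^sup>+x. epow (g x) p \<partial>lborel) (1 + e)"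
        by (rule C(2))
      moreover have "(\<integral>\<^sup>+x. epow (g x) p \<partial>lborel) = Ni i"
        unfolding Ni_def by (intro nn_integral_cong) (auto simp: g_def B_def indicator_def)
      moreover have "emeasure lborel {x. 2 * a i < \<bar>w x\<bar>} \<le> emeasure lborel {x. a i / 2 < \<bar>v x\<bar>}"
      proof (rule emeasure_mono)
        have [measurable]: "v \<in> borel_measurable borel" unfolding v_def by measurable
        have "{x. a i / 2 < \<bar>v x\<bar>} \<in> sets borel" by measurable
        then show "{x. a i / 2 < \<bar>v x\<bar>} \<in> sets lborel" by simp
      qed (use a[of i] in \<open>auto simp: v_def\<close>)
      ultimately show ?thesis by simp
    qed
    have "(\<integral>\<^sup>+x. epow (ennreal \<bar>w x\<bar>) r \<partial>lborel)
       \<le> (\<integral>\<^sup>+x. (\<Sum>i. ennreal ((4 * a i) powr r) * indicator {x. 2 * a i < \<bar>w x\<bar>} x) * indicator UNIV x \<partial>lborel)"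
    proof (rule nn_integral_mono)
      fix x
      show "epow (ennreal \<bar>w x\<bar>) r \<le> (\<Sum>i. ennreal ((4 * a i) powr r) * indicator {x. 2 * a i < \<bar>w x\<bar>} x) * indicator UNIV x"
      proof (cases "w x = 0")
        case False
        \<comment> \<open>Selects the layer with 2 a < |w x| <= 4 a; the ceiling makes the lower
          inequality strict.\<close>
        define k where "k = \<lceil>log 2 \<bar>w x\<bar>\<rceil> - 2"
        define i where "i = int_encode k"
        have k: "real_of_int k + 1 < log 2 \<bar>w x\<bar>" "log 2 \<bar>w x\<bar> \<le> real_of_int k + 2"
          by (auto simp: k_def) linarith+
        have "2 powr (real_of_int k + 1) < \<bar>w x\<bar>" "\<bar>w x\<bar> \<le> 2 powr (real_of_int k + 2)"
          using k False by (auto simp: less_log_iff log_le_iff)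
        then have wx: "2 * a i < \<bar>w x\<bar>" "\<bar>w x\<bar> \<le> 4 * a i"
          by (auto simp: a_def i_def powr_add)
        have "epow (ennreal \<bar>w x\<bar>) r \<le> ennreal ((4 * a i) powr r) * indicator {x. 2 * a i < \<bar>w x\<bar>} x"
          using wx r by (auto intro!: ennreal_leI powr_mono2)
        also have "\<dots> \<le> (\<Sum>i. ennreal ((4 * a i) powr r) * indicator {x. 2 * a i < \<bar>w x\<bar>} x)"
          (is "?F i \<le> suminf ?F")
        proof -
          have "sum F {i} \<le> suminf F" for F :: "nat \<Rightarrow> ennreal" by (rule sum_le_suminf) auto
          from this[of ?F] show ?thesis by (simp only: sum.insert sum.empty finite.emptyI empty_iff not_False_eq_True add_0_right)
        qed
        finally show ?thesis by simp
      qed simp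
    qed
    also have "\<dots> = (\<Sum>i. ennreal ((4 * a i) powr r) * emeasure lborel {x. 2 * a i < \<bar>w x\<bar>})"
      by (simp add: nn_integral_suminf nn_integral_cmult)
    also have "\<dots> \<le> (\<Sum>i. ennreal (8 powr r * C) * epow N e * Ni i)"
    proof (rule suminf_le)
      fix i
      \<comment> \<open>The surplus exponent e > 0 is spent on bounding one factor by the total
        energy; the other factor is summable over the layers.\<close>
      have "epow (Ni i) (1 + e) = Ni i * epow (Ni i) e" by (simp add: epow_add)
      also have "\<dots> \<le> Ni i * epow N e"
        unfolding Ni_def N_def using e
        by (intro mult_left_mono epow_mono nn_integral_mono) (auto simp: indicator_def)
      finally have 1: "epow (Ni i) (1 + e) \<le> Ni i * epow N e" .
      \<comment> \<open>The layer height cancels, which is why summation over the layers costs only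
        a constant.\<close>
      have "(4 * a i) powr r * (C * (a i / 2) powr (- r)) = 8 powr r * C"
      proof -
        have "(4 * a i) powr r = 8 powr r * (a i / 2) powr r"
          using a[of i] by (simp add: powr_mult[symmetric])
        then show ?thesis using a[of i] by (simp add: powr_minus)
      qed
      then have 2: "ennreal ((4 * a i) powr r) * ennreal (C * (a i / 2) powr (- r)) = ennreal (8 powr r * C)"
        using C by (simp add: ennreal_mult[symmetric])
      have "ennreal ((4 * a i) powr r) * emeasure lborel {x. 2 * a i < \<bar>w x\<bar>}
        \<le> ennreal ((4 * a i) powr r) * (ennreal (C * (a i / 2) powr (- r)) * (Ni i * epow N e))"
        by (intro mult_left_mono order_trans[OF level] 1) auto
      also have "\<dots> = ennreal (8 powr r * C) * epow N e * Ni i"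
        unfolding 2[symmetric] by (simp only: mult_ac)
      finally show "ennreal ((4 * a i) powr r) * emeasure lborel {x. 2 * a i < \<bar>w x\<bar>} \<le> ennreal (8 powr r * C) * epow N e * Ni i" .
    qed auto
    also have "\<dots> = ennreal (8 powr r * C) * epow N e * (\<Sum>i. Ni i)" by simp
    also have "\<dots> \<le> ennreal (8 powr r * C) * epow N e * N" by (intro mult_left_mono sumN) auto
    also have "\<dots> = ennreal (8 powr r * C) * epow N (1 + e)"
      by (simp add: epow_add mult_ac)
    finally show ?thesis by (simp add: N_def)
  qed
  moreover have "0 < 8 powr r * C" using C by simp
  ultimately show ?thesis unfolding r_def by blast
qed

section \<open>Mollification\<close>

text \<open>\<open>flat m t = t powr (-m) * exp (-1/t)\<close>, extended by 0; the span of the products of these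
  functions of \<open>e\<^sup>2 - dist\<^sup>2\<close> with coordinate polynomials is closed under partial derivatives.\<close>

definition flat :: "nat \<Rightarrow> real \<Rightarrow> real" where
  "flat m t = (if t \<le> 0 then 0 else exp (- inverse t) * inverse t ^ m)"

lemma flat_tendsto_0: "(flat m \<longlongrightarrow> 0) (at 0)"
proof -
  have "((\<lambda>x::real. x ^ m / exp x) \<longlongrightarrow> 0) at_top" by (rule tendsto_power_div_exp_0)
  then have "((\<lambda>t::real. inverse t ^ m / exp (inverse t)) \<longlongrightarrow> 0) (at_right 0)"
    by (rule filterlim_compose[OF _ filterlim_inverse_at_top_right])
  then have r: "(flat m \<longlongrightarrow> 0) (at_right 0)"
    by (rule Lim_transform_eventually)
       (auto simp: eventually_at_filter flat_def exp_minus divide_simps)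
  have "(flat m \<longlongrightarrow> 0) (at_left 0)"
    by (rule tendsto_eventually) (auto simp: eventually_at_filter flat_def)
  with r show ?thesis by (simp add: filterlim_at_split)
qed

text \<open>Differentiation raises m and stays in the family; at 0 the difference quotient of
  \<open>flat m\<close> is \<open>flat (m + 1)\<close> itself, which tends to 0.\<close>

lemma flat_has_derivative: "(flat m has_real_derivative (flat (m + 2) t - m * flat (m + 1) t)) (at t)"
proof -
  consider "t < 0" | "t = 0" | "0 < t" by linarith
  then show ?thesis
  proof cases
    case 1
    have "((\<lambda>_. 0) has_real_derivative (flat (m + 2) t - m * flat (m + 1) t)) (at t)"
      using 1 by (auto simp: flat_def)
    then show ?thesis
      by (rule has_field_derivative_transform_within_open[of _ _ _ "{..<0}"]) (use 1 in \<open>auto simp: flat_def\<close>)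
  next
    case 2
    have "((\<lambda>h. flat (m + 1) h) \<longlongrightarrow> 0) (at 0)" by (rule flat_tendsto_0)
    moreover have "flat (m + 1) h = (flat m (0 + h) - flat m 0) / h" for h
      by (auto simp: flat_def divide_simps)
    ultimately show ?thesis using 2 by (simp add: DERIV_def) (simp add: flat_def)
  next
    case 3
    have "((\<lambda>t. exp (- inverse t) * inverse t ^ m) has_real_derivative (flat (m + 2) t - m * flat (m + 1) t)) (at t)"
    proof (cases m)
      case (Suc k)
      then show ?thesis using 3
        by (auto intro!: derivative_eq_intros simp: flat_def power2_eq_square field_simps power_Suc)
          (metis One_nat_def gr0I mult.commute power_minus_mult)+
    qed (use 3 in \<open>auto intro!: derivative_eq_intros simp: flat_def power2_eq_square field_simps\<close>)
    then show ?thesis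
      by (rule has_field_derivative_transform_within_open[of _ _ _ "{0<..}"]) (use 3 in \<open>auto simp: flat_def\<close>)
  qed
qed

text \<open>Closure under the operations that differentiation can produce is built into the
  predicate, so that a single rule induction gives derivatives of all orders.\<close>

inductive smooth_bump :: "'a::euclidean_space \<Rightarrow> real \<Rightarrow> ('a \<Rightarrow> real) \<Rightarrow> bool" for x0 e where
  flat: "smooth_bump x0 e (\<lambda>y. flat m (e\<^sup>2 - (y - x0) \<bullet> (y - x0)))"
| add: "smooth_bump x0 e f \<Longrightarrow> smooth_bump x0 e g \<Longrightarrow> smooth_bump x0 e (\<lambda>y. f y + g y)"
| scale: "smooth_bump x0 e f \<Longrightarrow> smooth_bump x0 e (\<lambda>y. c * f y)"
| coord: "smooth_bump x0 e f \<Longrightarrow> smooth_bump x0 e (\<lambda>y. ((y - x0) \<bullet> b) * f y)"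

lemma smooth_bump_has_derivative:
  assumes "smooth_bump x0 e f"
  shows "\<exists>D. (\<forall>b. smooth_bump x0 e (D b)) \<and> (\<forall>y. (f has_derivative (\<lambda>h. D h y)) (at y))"
  using assms
proof induction
  case (flat m)
  define D where "D h y = (flat (m + 2) (e\<^sup>2 - (y - x0) \<bullet> (y - x0)) + (- real m) * flat (m + 1) (e\<^sup>2 - (y - x0) \<bullet> (y - x0)))" for h y :: 'a
  let ?E = "\<lambda>h y. ((y - x0) \<bullet> h) * ((-2) * D h y)"
  have "smooth_bump x0 e (?E b)" for b
    unfolding D_def by (intro smooth_bump.intros)
  moreover have "((\<lambda>y. flat m (e\<^sup>2 - (y - x0) \<bullet> (y - x0))) has_derivative (\<lambda>h. ?E h y)) (at y)" for y
  proof -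
    have "((\<lambda>y. e\<^sup>2 - (y - x0) \<bullet> (y - x0)) has_derivative (\<lambda>h. - (2 * ((y - x0) \<bullet> h)))) (at y)"
      by (auto intro!: derivative_eq_intros simp: inner_commute)
    from DERIV_compose_FDERIV[OF flat_has_derivative this]
    show ?thesis by (simp add: D_def algebra_simps)
  qed
  ultimately show ?case by (intro exI[of _ ?E]) blast
next
  case (add f g)
  then obtain D E where D: "\<forall>b. smooth_bump x0 e (D b)" "\<forall>y. (f has_derivative (\<lambda>h. D h y)) (at y)"
    and E: "\<forall>b. smooth_bump x0 e (E b)" "\<forall>y. (g has_derivative (\<lambda>h. E h y)) (at y)" by blast
  show ?case
    by (intro exI[of _ "\<lambda>b y. D b y + E b y"] conjI allI)
       (use D E in \<open>auto intro: smooth_bump.add has_derivative_add\<close>)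
next
  case (scale f c)
  then obtain D where D: "\<forall>b. smooth_bump x0 e (D b)" "\<forall>y. (f has_derivative (\<lambda>h. D h y)) (at y)" by blast
  show ?case
    by (intro exI[of _ "\<lambda>b y. c * D b y"] conjI allI)
       (use D in \<open>auto intro: smooth_bump.scale has_derivative_mult_right\<close>)
next
  case (coord f b)
  then obtain D where D: "\<forall>b. smooth_bump x0 e (D b)" "\<forall>y. (f has_derivative (\<lambda>h. D h y)) (at y)" by blast
  have "((\<lambda>y. ((y - x0) \<bullet> b) * f y) has_derivative (\<lambda>h. ((y - x0) \<bullet> b) * D h y + (h \<bullet> b) * f y)) (at y)" for y
    using D(2)[rule_format, of y] by (auto intro!: derivative_eq_intros)
  moreover have "smooth_bump x0 e (\<lambda>y. ((y - x0) \<bullet> b) * D h y + (h \<bullet> b) * f y)" for h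
    using D(1) coord.hyps by (intro smooth_bump.add smooth_bump.coord smooth_bump.scale) auto
  ultimately show ?case
    by (intro exI[of _ "\<lambda>h y. ((y - x0) \<bullet> b) * D h y + (h \<bullet> b) * f y"]) blast
qed

lemma smooth_bump_zero: "smooth_bump x0 e f \<Longrightarrow> e \<le> dist x0 y \<Longrightarrow> 0 \<le> e \<Longrightarrow> f y = 0"
proof (induction rule: smooth_bump.induct)
  case (flat m)
  then have "e\<^sup>2 \<le> (norm (y - x0))\<^sup>2" by (intro power_mono) (auto simp: dist_norm norm_minus_commute)
  then show ?case by (simp add: flat_def dot_square_norm)
qed auto

lemma smooth_bump_frechet:
  assumes "smooth_bump x0 e f"
  shows "f differentiable (at y)" "smooth_bump x0 e (\<lambda>y. frechet_derivative f (at y) b)"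
proof -
  obtain D where D: "\<forall>b. smooth_bump x0 e (D b)" "\<forall>y. (f has_derivative (\<lambda>h. D h y)) (at y)"
    using smooth_bump_has_derivative[OF assms] by blast
  then show "f differentiable (at y)" by (auto simp: differentiable_def)
  have "frechet_derivative f (at y) = (\<lambda>h. D h y)" for y
    using D(2) by (metis frechet_derivative_at)
  then show "smooth_bump x0 e (\<lambda>y. frechet_derivative f (at y) b)" using D(1) by simp
qed

lemma smooth_bump_continuous: "smooth_bump x0 e f \<Longrightarrow> continuous_on S f"
  by (intro continuous_at_imp_continuous_on ballI differentiable_imp_continuous_within smooth_bump_frechet(1))

lemma smooth_bump_Ck: "smooth_bump x0 e f \<Longrightarrow> Ck k f"
  by (induction k arbitrary: f) (auto simp: smooth_bump_continuous smooth_bump_frechet)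

lemma smooth_bump_support:
  assumes "smooth_bump x0 e f" "0 \<le> e"
  shows "closure {y. f y \<noteq> 0} \<subseteq> cball x0 e" "compact (closure {y. f y \<noteq> 0})"
proof -
  have sub: "{y. f y \<noteq> 0} \<subseteq> cball x0 e"
    using smooth_bump_zero[OF assms(1) _ assms(2)] by (force simp: not_le)
  show "closure {y. f y \<noteq> 0} \<subseteq> cball x0 e"
    by (rule closure_minimal[OF sub]) simp
  show "compact (closure {y. f y \<noteq> 0})"
    using bounded_subset[OF bounded_cball sub] by (simp add: compact_closure)
qed

lemma smooth_bump_test_function:
  assumes "smooth_bump x0 e f" "0 \<le> e" "cball x0 e \<subseteq> \<Omega>"
  shows "test_function \<Omega> f"
  using smooth_bump_support[OF assms(1,2)] assms(3) smooth_bump_Ck[OF assms(1)]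
  by (auto simp: test_function_def)

lemma smooth_bump_integrable:
  fixes f :: "'a::euclidean_space \<Rightarrow> real"
  assumes "smooth_bump x0 e f" "0 \<le> e"
  shows "integrable lborel f"
proof -
  have "integrable lborel (\<lambda>y. indicator (cball x0 e) y *\<^sub>R f y)"
    by (rule borel_integrable_compact) (auto intro: smooth_bump_continuous[OF assms(1)])
  moreover have "(\<lambda>y. indicator (cball x0 e) y *\<^sub>R f y) = f"
    using smooth_bump_zero[OF assms(1) _ assms(2)] by (auto simp: indicator_def fun_eq_iff not_le)
  ultimately show ?thesis by simp
qed

section \<open>The mollifier\<close>

definition bump :: "real \<Rightarrow> 'a::euclidean_space \<Rightarrow> real" where
  "bump e z = flat 0 (e\<^sup>2 - z \<bullet> z)"

lemma bump_eq: "bump e (y - x) = flat 0 (e\<^sup>2 - (y - x) \<bullet> (y - x))"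
  by (simp add: bump_def)

lemma smooth_bump_bump: "smooth_bump x e (\<lambda>y. bump e (y - x))"
  unfolding bump_eq by (rule smooth_bump.flat)

lemma bump_nonneg [simp]: "0 \<le> bump e z"
  by (simp add: bump_def flat_def)

lemma bump_minus: "bump e (- z) = bump e z"
  by (simp add: bump_def)

lemma bump_pos: "norm z < e \<Longrightarrow> 0 < bump e z"
  using power_strict_mono[of "norm z" e 2] by (simp add: bump_def flat_def dot_square_norm)

lemma integral_bump_pos:
  assumes "0 < e" shows "0 < (LINT z|lborel. bump e (z::'a::euclidean_space))"
proof -
  have int: "integrable lborel (bump e :: 'a \<Rightarrow> real)"
    using smooth_bump_integrable[OF smooth_bump_bump[of 0 e]] assms by simp
  have "(LINT z|lborel. bump e (z::'a)) \<noteq> 0"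
  proof
    assume "(LINT z|lborel. bump e (z::'a)) = 0"
    then have "AE z in lborel. bump e (z::'a) = 0"
      using integral_nonneg_eq_0_iff_AE[OF int] by simp
    then have "AE z in lborel. (z::'a) \<notin> ball 0 e"
      by eventually_elim (use bump_pos in force)
    then have "emeasure lborel (ball (0::'a) e) = 0"
      by (subst AE_iff_measurable[symmetric, of _ _ "\<lambda>z. z \<notin> ball 0 e"]) auto
    then show False using ball_volume_pos[OF assms, where 'a='a] by (simp add: emeasure_ball_volume)
  qed
  then show ?thesis by (simp add: less_le)
qed

definition moll :: "real \<Rightarrow> 'a::euclidean_space \<Rightarrow> real" where
  "moll e z = (1 / (LINT z|lborel. bump e (z::'a))) * bump e z"

lemma smooth_bump_moll: "smooth_bump x e (\<lambda>y. moll e (y - x))"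
  unfolding moll_def by (intro smooth_bump.scale smooth_bump_bump)

lemma moll_minus: "moll e (x - y) = moll e (y - x)"
  using bump_minus[of e "x - y"] by (simp add: moll_def)

lemma moll_nonneg [simp]: "0 < e \<Longrightarrow> 0 \<le> moll e z"
  by (simp add: moll_def less_imp_le[OF integral_bump_pos])

lemma moll_zero: "e \<le> norm z \<Longrightarrow> 0 \<le> e \<Longrightarrow> moll e z = 0"
  using smooth_bump_zero[OF smooth_bump_moll[of 0 e], of z] by simp

lemma continuous_moll: "continuous_on S (moll e)"
  using smooth_bump_continuous[OF smooth_bump_moll[of 0 e]] by simp

lemma moll_measurable [measurable]: "moll e \<in> borel_measurable borel"
  by (intro borel_measurable_continuous_onI continuous_moll)

lemma integrable_moll: "0 < e \<Longrightarrow> integrable lborel (moll e)"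
  using smooth_bump_integrable[OF smooth_bump_moll[of 0 e]] by simp

lemma integral_moll: "0 < e \<Longrightarrow> (LINT z|lborel. moll e z) = 1"
  using integral_bump_pos[of e, where 'a='a] by (simp add: moll_def[where 'a='a])

lemma nn_integral_moll: "0 < e \<Longrightarrow> (\<integral>\<^sup>+z. ennreal (moll e z) \<partial>lborel) = 1"
  by (subst nn_integral_eq_integral) (auto simp: integral_moll integrable_moll)

lemma nn_integral_moll_shift: "0 < e \<Longrightarrow> (\<integral>\<^sup>+y. ennreal (moll e (x - y)) \<partial>lborel) = 1"
  using nn_integral_lborel_translate[of "\<lambda>y. ennreal (moll e y)" "-x"] nn_integral_moll[of e]
  by (simp add: moll_minus[of e x])

section \<open>Mollification of locally integrable functions\<close>

definition loc_int :: "('a::euclidean_space \<Rightarrow> 'b::euclidean_space) \<Rightarrow> bool" where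
  "loc_int u \<longleftrightarrow> u \<in> borel_measurable borel \<and> (\<forall>x r. integrable lborel (\<lambda>y. indicator (cball x r) y *\<^sub>R u y))"

lemma loc_int_measurable [measurable_dest]: "loc_int u \<Longrightarrow> u \<in> borel_measurable borel"
  by (simp add: loc_int_def)

lemma loc_int_mult:
  fixes u :: "'a::euclidean_space \<Rightarrow> real"
  assumes u: "loc_int u" and [measurable]: "\<phi> \<in> borel_measurable borel"
    and K: "\<And>y. \<bar>\<phi> y\<bar> \<le> K" and supp: "\<And>y. y \<notin> cball x r \<Longrightarrow> \<phi> y = 0"
  shows "integrable lborel (\<lambda>y. u y * \<phi> y)"
proof (rule Bochner_Integration.integrable_bound)
  note [measurable] = loc_int_measurable[OF u]
  show "integrable lborel (\<lambda>y. K * (indicator (cball x r) y *\<^sub>R u y))"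
    using u by (intro integrable_mult_right) (auto simp: loc_int_def)
  show "(\<lambda>y. u y * \<phi> y) \<in> borel_measurable lborel" by simp
  have "0 \<le> K" using K[of 0] by linarith
  then show "AE y in lborel. norm (u y * \<phi> y) \<le> norm (K * (indicator (cball x r) y *\<^sub>R u y))"
    using K supp by (intro AE_I2) (auto simp: indicator_def abs_mult mult.commute intro: mult_right_mono)
qed

lemma smooth_bump_bounded:
  fixes f :: "'a::euclidean_space \<Rightarrow> real"
  assumes "smooth_bump x0 e f" "0 \<le> e"
  obtains K where "0 \<le> K" "\<And>y. \<bar>f y\<bar> \<le> K"
proof -
  have "compact (f ` cball x0 e)"
    by (intro compact_continuous_image smooth_bump_continuous[OF assms(1)]) simp
  then obtain K where "\<forall>z\<in>f ` cball x0 e. norm z \<le> K"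
    using compact_imp_bounded bounded_iff by metis
  then have K: "\<And>y. y \<in> cball x0 e \<Longrightarrow> \<bar>f y\<bar> \<le> K" by auto
  have "\<bar>f y\<bar> \<le> max K 0" for y
    using K[of y] smooth_bump_zero[OF assms(1) _ assms(2), of y] by (cases "y \<in> cball x0 e") auto
  then show ?thesis by (intro that[of "max K 0"]) auto
qed

lemma smooth_bump_measurable: "smooth_bump x0 e f \<Longrightarrow> f \<in> borel_measurable borel"
  by (intro borel_measurable_continuous_onI smooth_bump_continuous)

lemma loc_int_mult_moll:
  fixes u :: "'a::euclidean_space \<Rightarrow> real"
  assumes u: "loc_int u" and e: "0 < e"
  shows "integrable lborel (\<lambda>y. u y * moll e (x - y))"
proof -
  obtain K where K: "\<And>y. \<bar>moll e (y - x)\<bar> \<le> K"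
    using smooth_bump_bounded[OF smooth_bump_moll[of x e]] e by (metis less_imp_le)
  show ?thesis
    using loc_int_mult[OF u smooth_bump_measurable[OF smooth_bump_moll[of x e]] K, of x e] e
      smooth_bump_zero[OF smooth_bump_moll[of x e]]
    by (simp add: moll_minus[of e x])
qed

definition mollify :: "real \<Rightarrow> ('a::euclidean_space \<Rightarrow> real) \<Rightarrow> 'a \<Rightarrow> real" where
  "mollify e u x = (LINT y|lborel. u y * moll e (x - y))"

lemma continuous_mollify:
  fixes u :: "'a::euclidean_space \<Rightarrow> real"
  assumes u: "loc_int u" and e: "0 < e"
  shows "continuous_on UNIV (mollify e u)"
proof (rule continuous_at_imp_continuous_on, rule ballI)
  fix x :: 'a
  note [measurable] = loc_int_measurable[OF u]
  obtain K where K: "0 \<le> K" "\<And>y::'a. \<bar>moll e (y - 0)\<bar> \<le> K"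
    using smooth_bump_bounded[OF smooth_bump_moll[of 0 e]] e by (metis less_imp_le)
  show "isCont (mollify e u) x"
    unfolding continuous_at_sequentially comp_def
  proof (intro allI impI)
    fix X assume X: "X \<longlonglongrightarrow> x"
    then have "(\<lambda>k. X k - x) \<longlonglongrightarrow> 0" by (simp add: LIM_zero)
    then have "Bseq (\<lambda>k. X k - x)" by (intro convergent_imp_Bseq convergentI)
    \<comment> \<open>A convergent sequence is bounded, so all the translated kernels live in one
      ball, which supplies the dominating function.\<close>
    then obtain M where M: "\<And>k. norm (X k - x) \<le> M" by (auto simp: Bseq_def)
    show "(\<lambda>k. mollify e u (X k)) \<longlonglongrightarrow> mollify e u x"
      unfolding mollify_def
    proof (rule integral_dominated_convergence[where w = "\<lambda>y. K * norm (indicator (cball x (M + e)) y *\<^sub>R u y)"])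
      show "integrable lborel (\<lambda>y. K * norm (indicator (cball x (M + e)) y *\<^sub>R u y))"
        using u by (intro integrable_mult_right integrable_norm) (auto simp: loc_int_def)
      show "AE y in lborel. (\<lambda>k. u y * moll e (X k - y)) \<longlonglongrightarrow> u y * moll e (x - y)"
        by (intro AE_I2 tendsto_mult tendsto_const continuous_on_tendsto_compose[OF continuous_moll[of UNIV]] tendsto_diff X) auto
      fix k
      show "AE y in lborel. norm (u y * moll e (X k - y)) \<le> K * norm (indicator (cball x (M + e)) y *\<^sub>R u y)"
      proof (rule AE_I2)
        fix y
        show "norm (u y * moll e (X k - y)) \<le> K * norm (indicator (cball x (M + e)) y *\<^sub>R u y)"
        proof (cases "y \<in> cball x (M + e)")
          case True
          then show ?thesis using mult_left_mono[OF K(2)[of "X k - y"], of "\<bar>u y\<bar>"] by (simp add: abs_mult mult.commute)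
        next
          case False
          have "norm (x - y) \<le> norm (X k - y) + norm (X k - x)"
            using norm_triangle_ineq4[of "X k - y" "X k - x"] by simp
          with False M[of k] have "e \<le> norm (X k - y)" by (auto simp: dist_norm)
          then show ?thesis using e K by (simp add: moll_zero)
        qed
      qed
    qed measurable
  qed
qed

lemma smooth_bump_FTC:
  fixes f :: "'a::euclidean_space \<Rightarrow> real"
  assumes f: "smooth_bump x0 e f"
  shows "f (v + z) - f v = (LINT t:{0..1}|lborel. frechet_derivative f (at (v + t *\<^sub>R z)) z)"
proof -
  have "((\<lambda>t. f (v + t *\<^sub>R z)) has_real_derivative frechet_derivative f (at (v + t *\<^sub>R z)) z) (at t within {0..1})" for t :: real
  proof -
    have "(f has_derivative frechet_derivative f (at (v + t *\<^sub>R z))) (at (v + t *\<^sub>R z))"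
      using smooth_bump_frechet(1)[OF f] frechet_derivative_works by blast
    moreover have "((\<lambda>t. v + t *\<^sub>R z) has_derivative (\<lambda>h. h *\<^sub>R z)) (at t within {0..1})"
      by (auto intro!: derivative_eq_intros)
    ultimately have "((\<lambda>t. f (v + t *\<^sub>R z)) has_derivative (\<lambda>h. frechet_derivative f (at (v + t *\<^sub>R z)) (h *\<^sub>R z))) (at t within {0..1})"
      using has_derivative_compose by blast
    moreover have "frechet_derivative f (at (v + t *\<^sub>R z)) (h *\<^sub>R z) = h * frechet_derivative f (at (v + t *\<^sub>R z)) z" for h
      using linear_frechet_derivative[OF smooth_bump_frechet(1)[OF f]] by (simp add: linear_cmul)
    ultimately show ?thesis by (simp add: has_field_derivative_def mult.commute[of _ "frechet_derivative f (at (v + t *\<^sub>R z)) z"])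
  qed
  then have "(LBINT t. indicator {0..1} t *\<^sub>R frechet_derivative f (at (v + t *\<^sub>R z)) z) = f (v + 1 *\<^sub>R z) - f (v + 0 *\<^sub>R z)"
    by (intro integral_FTC_Icc[of 0 1 "\<lambda>t. f (v + t *\<^sub>R z)"])
       (auto simp: has_real_derivative_iff_has_vector_derivative intro!: continuous_intros continuous_on_compose2[OF smooth_bump_continuous[OF smooth_bump_frechet(2)[OF f], of UNIV]])
  then show ?thesis by (simp add: set_lebesgue_integral_def)
qed

text \<open>The fundamental theorem of calculus is applied to the kernel for each y and the
  integrals are exchanged, which avoids differentiating the convolution itself.\<close>

lemma mollify_diff:
  fixes u :: "'a::euclidean_space \<Rightarrow> real"
  assumes u: "loc_int u" and e: "0 < e"
  shows "mollify e u (x + z) - mollify e u x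
    = (LINT t:{0..1}|lborel. (LINT y|lborel. u y * frechet_derivative (moll e) (at (x + t *\<^sub>R z - y)) z))"
proof -
  note [measurable] = loc_int_measurable[OF u]
  have m: "smooth_bump 0 e (moll e)" using smooth_bump_moll[of 0 e] by simp
  define G where "G v = frechet_derivative (moll e) (at v) z" for v :: 'a
  have G: "smooth_bump 0 e G" unfolding G_def by (rule smooth_bump_frechet(2)[OF m])
  note [measurable] = smooth_bump_measurable[OF G]
  obtain K where K: "0 \<le> K" "\<And>y. \<bar>G y\<bar> \<le> K"
    using smooth_bump_bounded[OF G] e by (metis less_imp_le)
  define F where "F = (\<lambda>(y, t). indicator {0..1::real} t * (u y * G (x + t *\<^sub>R z - y)))"
  have [measurable]: "F \<in> borel_measurable (lborel \<Otimes>\<^sub>M lborel)" unfolding F_def by measurable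
  \<comment> \<open>Shifting by t z moves the support by at most the length of z, so this majorant
    serves all t in the unit interval.\<close>
  define U where "U y = K * norm (indicator (cball x (e + norm z)) y *\<^sub>R u y)" for y
  have Uint: "integrable lborel U"
    unfolding U_def using u by (intro integrable_mult_right integrable_norm) (auto simp: loc_int_def)
  have FU: "norm (F (y, t)) \<le> indicator {0..1} t * U y" for y t
  proof (cases "t \<in> {0..1}")
    case True
    then have tz: "norm (t *\<^sub>R z) \<le> norm z" by (simp add: mult_left_le_one_le)
    show ?thesis
    proof (cases "y \<in> cball x (e + norm z)")
      case True
      then show ?thesis using K(2)[of "x + t *\<^sub>R z - y"] K(1)
        by (auto simp: F_def U_def abs_mult indicator_def intro: mult_right_mono mult_left_mono)
           (metis abs_ge_zero mult.commute mult_right_mono)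
    next
      case False
      have "norm (x - y) \<le> norm (x + t *\<^sub>R z - y) + norm (t *\<^sub>R z)"
        using norm_triangle_ineq4[of "x + t *\<^sub>R z - y" "t *\<^sub>R z"] by simp
      with False tz have "e \<le> norm (x + t *\<^sub>R z - y)" by (auto simp: dist_norm)
      then show ?thesis
        using smooth_bump_zero[OF G, of "x + t *\<^sub>R z - y"] e K(1)
        by (auto simp: F_def U_def indicator_def)
    qed
  qed (simp add: F_def)
  have Fint: "integrable (lborel \<Otimes>\<^sub>M lborel) F"
  proof (rule lborel_pair.Fubini_integrable)
    have "integrable lborel (\<lambda>t. F (y, t))" for y
    proof (rule Bochner_Integration.integrable_bound)
      show "integrable lborel (\<lambda>t::real. indicator {0..1} t * U y)" by simp
      show "AE t in lborel. norm (F (y, t)) \<le> norm (indicator {0..1} t * U y)"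
        using FU[of y] by (intro AE_I2) (metis abs_ge_self order_trans real_norm_def)
    qed (simp add: F_def)
    then show "AE y in lborel. integrable lborel (\<lambda>t. F (y, t))" by simp
    show "integrable lborel (\<lambda>y. LINT t|lborel. norm (F (y, t)))"
    proof (rule Bochner_Integration.integrable_bound[OF Uint])
      show "(\<lambda>y. LINT t|lborel. norm (F (y, t))) \<in> borel_measurable lborel" by measurable
      show "AE y in lborel. norm (LINT t|lborel. norm (F (y, t))) \<le> norm (U y)"
      proof (rule AE_I2)
        fix y
        have "(LINT t|lborel. norm (F (y, t))) \<le> (LINT t|lborel. indicator {0..1::real} t * U y)"
          using \<open>integrable lborel (\<lambda>t. F (y, t))\<close> FU by (intro integral_mono) auto
        then show "norm (LINT t|lborel. norm (F (y, t))) \<le> norm (U y)" by simp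
      qed
    qed
  qed measurable
  have "mollify e u (x + z) - mollify e u x = (LINT y|lborel. u y * (moll e (x + z - y) - moll e (x - y)))"
    unfolding mollify_def using loc_int_mult_moll[OF u e]
    by (subst Bochner_Integration.integral_diff[symmetric]) (auto simp: algebra_simps)
  also have "\<dots> = (LINT y|lborel. (LINT t|lborel. F (y, t)))"
  proof (rule Bochner_Integration.integral_cong)
    fix y
    have "moll e (x + z - y) - moll e (x - y) = (LINT t:{0..1}|lborel. G (x - y + t *\<^sub>R z))"
      using smooth_bump_FTC[OF m, of "x - y" z] by (simp add: G_def algebra_simps)
    then show "u y * (moll e (x + z - y) - moll e (x - y)) = (LINT t|lborel. F (y, t))"
      by (simp add: F_def set_lebesgue_integral_def algebra_simps integral_mult_right_zero[symmetric] del: integral_mult_right_zero)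
  qed simp
  also have "\<dots> = (LINT t|lborel. (LINT y|lborel. F (y, t)))"
    using lborel_pair.Fubini_integral[of "\<lambda>y t. F (y, t)"] Fint by simp
  also have "\<dots> = (LINT t:{0..1}|lborel. (LINT y|lborel. u y * G (x + t *\<^sub>R z - y)))"
    by (simp add: F_def set_lebesgue_integral_def)
  finally show ?thesis by (simp add: G_def)
qed

section \<open>From weak gradients to upper gradients\<close>

definition weak_grad_eq :: "'a::euclidean_space set \<Rightarrow> ('a \<Rightarrow> real) \<Rightarrow> ('a \<Rightarrow> 'a) \<Rightarrow> bool" where
  "weak_grad_eq \<Omega> u g \<longleftrightarrow> (\<forall>\<phi>. test_function \<Omega> \<phi> \<longrightarrow> (\<forall>b\<in>Basis.
     (LINT y|lborel. u y * frechet_derivative \<phi> (at y) b) = - (LINT y|lborel. (g y \<bullet> b) * \<phi> y)))"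

lemma loc_int_inner:
  fixes g :: "'a::euclidean_space \<Rightarrow> 'a"
  assumes "loc_int g" shows "loc_int (\<lambda>y. g y \<bullet> b)"
proof -
  note [measurable] = loc_int_measurable[OF assms]
  have "integrable lborel (\<lambda>y. (indicator (cball x r) y *\<^sub>R g y) \<bullet> b)" for x r
    using assms by (intro integrable_inner_left) (auto simp: loc_int_def)
  then show ?thesis by (simp add: loc_int_def)
qed

text \<open>Segments point in all directions, whereas the weak equation is stated for the coordinate
  ones; linearity of the derivative and of the inner product bridges the gap.\<close>

lemma weak_grad_eq_direction:
  fixes u :: "'a::euclidean_space \<Rightarrow> real"
  assumes u: "loc_int u" and g: "loc_int g" and eq: "weak_grad_eq \<Omega> u g"
    and f: "smooth_bump x e f" and e: "0 \<le> e" and sub: "cball x e \<subseteq> \<Omega>"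
  shows "(LINT y|lborel. u y * frechet_derivative f (at y) z) = - (LINT y|lborel. (g y \<bullet> z) * f y)"
proof -
  have int: "integrable lborel (\<lambda>y. v y * h y)" if v: "loc_int v" and h: "smooth_bump x e h" for v h :: "'a \<Rightarrow> real"
  proof -
    obtain K where K: "\<And>y. \<bar>h y\<bar> \<le> K" using smooth_bump_bounded[OF h e] by metis
    show ?thesis
      by (rule loc_int_mult[OF v smooth_bump_measurable[OF h] K, of x e])
         (use smooth_bump_zero[OF h _ e] in auto)
  qed
  have lin: "frechet_derivative f (at y) z = (\<Sum>b\<in>Basis. (z \<bullet> b) * frechet_derivative f (at y) b)" for y
  proof -
    have l: "linear (frechet_derivative f (at y))"
      by (rule linear_frechet_derivative[OF smooth_bump_frechet(1)[OF f]])
    have "frechet_derivative f (at y) z = frechet_derivative f (at y) (\<Sum>b\<in>Basis. (z \<bullet> b) *\<^sub>R b)"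
      by (simp add: euclidean_representation)
    also have "\<dots> = (\<Sum>b\<in>Basis. (z \<bullet> b) * frechet_derivative f (at y) b)"
      by (simp add: linear_sum[OF l] linear_cmul[OF l])
    finally show ?thesis .
  qed
  have "(LINT y|lborel. u y * frechet_derivative f (at y) z)
      = (LINT y|lborel. (\<Sum>b\<in>Basis. (z \<bullet> b) * (u y * frechet_derivative f (at y) b)))"
    by (simp add: lin sum_distrib_left mult_ac)
  also have "\<dots> = (\<Sum>b\<in>Basis. (z \<bullet> b) * (LINT y|lborel. u y * frechet_derivative f (at y) b))"
    using int[OF u smooth_bump_frechet(2)[OF f]] by (subst Bochner_Integration.integral_sum) auto
  also have "\<dots> = (\<Sum>b\<in>Basis. (z \<bullet> b) * - (LINT y|lborel. (g y \<bullet> b) * f y))"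
    using eq smooth_bump_test_function[OF f e sub] by (simp add: weak_grad_eq_def)
  also have "\<dots> = - (LINT y|lborel. (\<Sum>b\<in>Basis. (z \<bullet> b) * ((g y \<bullet> b) * f y)))"
    using int[OF loc_int_inner[OF g] f] by (subst Bochner_Integration.integral_sum) (auto simp: sum_negf)
  also have "(\<lambda>y. \<Sum>b\<in>Basis. (z \<bullet> b) * ((g y \<bullet> b) * f y)) = (\<lambda>y. (g y \<bullet> z) * f y)"
    by (simp add: fun_eq_iff euclidean_inner[of "g _" z] sum_distrib_right sum_distrib_left mult_ac)
  finally show ?thesis .
qed

text \<open>Averaging the norm of g, rather than g itself, dominates the derivatives of the
  mollification in all directions at once.\<close>

definition mollify_norm :: "real \<Rightarrow> ('a::euclidean_space \<Rightarrow> 'b::euclidean_space) \<Rightarrow> 'a \<Rightarrow> ennreal" where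
  "mollify_norm e g x = (\<integral>\<^sup>+y. ennreal (norm (g y)) * ennreal (moll e (x - y)) \<partial>lborel)"

text \<open>The derivative falls on the kernel, an admissible test function as long as its support
  lies in \<Omega>. The weak equation moves it onto g, and Cauchy-Schwarz leaves the mollified norm
  of g.\<close>

lemma upper_gradient_mollify:
  fixes u :: "'a::euclidean_space \<Rightarrow> real"
  assumes u: "loc_int u" and g: "loc_int g" and eq: "weak_grad_eq \<Omega> u g"
    and e: "0 < e" and U: "\<And>x. x \<in> U \<Longrightarrow> cball x e \<subseteq> \<Omega>"
  shows "upper_gradient U (mollify e u) (mollify_norm e g)"
  unfolding upper_gradient_def
proof (intro conjI allI impI)
  note [measurable] = loc_int_measurable[OF u] loc_int_measurable[OF g]
  show "continuous_on UNIV (mollify e u)" by (rule continuous_mollify[OF u e])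
  show [measurable]: "mollify_norm e g \<in> borel_measurable borel" unfolding mollify_norm_def by measurable
  fix x z :: 'a assume seg: "closed_segment x (x + z) \<subseteq> U"
  define H where "H t = (LINT y|lborel. u y * frechet_derivative (moll e) (at (x + t *\<^sub>R z - y)) z)" for t
  have H: "ennreal \<bar>H t\<bar> \<le> ennreal (norm z) * mollify_norm e g (x + t *\<^sub>R z)" if t: "t \<in> {0..1}" for t
  proof -
    let ?x = "x + t *\<^sub>R z"
    have "?x \<in> closed_segment x (x + z)"
      using t unfolding closed_segment_def by (auto simp: algebra_simps intro!: exI[of _ t])
    then have sub: "cball ?x e \<subseteq> \<Omega>" using seg U by blast
    let ?f = "\<lambda>y. moll e (y - ?x)"
    have f: "smooth_bump ?x e ?f" by (rule smooth_bump_moll)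
    have m: "smooth_bump 0 e (moll e)" using smooth_bump_moll[of 0 e] by simp
    \<comment> \<open>Reflecting the argument of the kernel produces the sign that cancels the one
      in the weak equation.\<close>
    have fr: "frechet_derivative ?f (at y) z = - frechet_derivative (moll e) (at (?x - y)) z" for y
    proof -
      have "(moll e has_derivative frechet_derivative (moll e) (at (?x - y))) (at (?x - y))"
        using smooth_bump_frechet(1)[OF m] frechet_derivative_works by blast
      moreover have "((\<lambda>y. ?x - y) has_derivative (\<lambda>h. - h)) (at y)"
        by (auto intro!: derivative_eq_intros)
      ultimately have "((\<lambda>y. moll e (?x - y)) has_derivative (\<lambda>h. frechet_derivative (moll e) (at (?x - y)) (- h))) (at y)"
        using has_derivative_compose by blast
      then have "(?f has_derivative (\<lambda>h. frechet_derivative (moll e) (at (?x - y)) (- h))) (at y)"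
        by (simp add: moll_minus[of e ?x])
      then have "frechet_derivative ?f (at y) = (\<lambda>h. frechet_derivative (moll e) (at (?x - y)) (- h))"
        using frechet_derivative_at by metis
      then show ?thesis
        using linear_neg[OF linear_frechet_derivative[OF smooth_bump_frechet(1)[OF m]]] by simp
    qed
    have "H t = - (LINT y|lborel. u y * frechet_derivative ?f (at y) z)"
      by (simp add: H_def fr)
    also have "\<dots> = (LINT y|lborel. (g y \<bullet> z) * moll e (?x - y))"
      using weak_grad_eq_direction[OF u g eq f _ sub, of z] e by (simp add: moll_minus[of e ?x])
    finally have "ennreal \<bar>H t\<bar> = ennreal (norm (LINT y|lborel. (g y \<bullet> z) * moll e (?x - y)))" by simp
    also have "\<dots> \<le> (\<integral>\<^sup>+y. ennreal (norm ((g y \<bullet> z) * moll e (?x - y))) \<partial>lborel)"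
      by (intro integral_norm_bound_ennreal loc_int_mult_moll loc_int_inner g e)
    also have "\<dots> \<le> (\<integral>\<^sup>+y. ennreal (norm z) * (ennreal (norm (g y)) * ennreal (moll e (?x - y))) \<partial>lborel)"
    proof (rule nn_integral_mono)
      fix y
      have "norm ((g y \<bullet> z) * moll e (?x - y)) \<le> norm z * (norm (g y) * moll e (?x - y))"
        using mult_right_mono[OF Cauchy_Schwarz_ineq2[of "g y" z] moll_nonneg[OF e, of "?x - y"]] e
        by (simp add: abs_mult mult_ac)
      then show "ennreal (norm ((g y \<bullet> z) * moll e (?x - y))) \<le> ennreal (norm z) * (ennreal (norm (g y)) * ennreal (moll e (?x - y)))"
        using e by (simp add: ennreal_mult[symmetric] ennreal_leI)
    qed
    also have "\<dots> = ennreal (norm z) * mollify_norm e g ?x"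
      by (simp add: mollify_norm_def nn_integral_cmult)
    finally show ?thesis .
  qed
  have "ennreal \<bar>mollify e u (x + z) - mollify e u x\<bar> = ennreal (norm (LINT t|lborel. indicator {0..1} t *\<^sub>R H t))"
    by (simp add: mollify_diff[OF u e] H_def set_lebesgue_integral_def)
  also have "\<dots> \<le> (\<integral>\<^sup>+t. ennreal (norm (indicator {0..1} t *\<^sub>R H t)) \<partial>lborel)"
  \<comment> \<open>For a non-integrable integrand the Bochner integral is 0, and the bound is
    trivial.\<close>
  proof (cases "integrable lborel (\<lambda>t. indicator {0..1} t *\<^sub>R H t)")
    case True
    then show ?thesis by (rule integral_norm_bound_ennreal)
  qed (simp add: not_integrable_integral_eq)
  also have "\<dots> \<le> (\<integral>\<^sup>+t. ennreal (norm z) * (mollify_norm e g (x + t *\<^sub>R z) * indicator {0..1} t) \<partial>lborel)"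
    using H by (intro nn_integral_mono) (auto simp: indicator_def)
  also have "\<dots> = ennreal (norm z) * (\<integral>\<^sup>+t\<in>{0..1}. mollify_norm e g (x + t *\<^sub>R z) \<partial>lborel)"
    by (simp add: nn_integral_cmult)
  finally show "ennreal \<bar>mollify e u (x + z) - mollify e u x\<bar> \<le> ennreal (norm z) * (\<integral>\<^sup>+t\<in>{0..1}. mollify_norm e g (x + t *\<^sub>R z) \<partial>lborel)" .
qed

text \<open>The kernel has total mass 1, so that Jensen and Tonelli apply without loss of a
  constant.\<close>

lemma nn_integral_mollify_norm_le:
  fixes g :: "'a::euclidean_space \<Rightarrow> 'b::euclidean_space"
  assumes [measurable]: "g \<in> borel_measurable borel" and e: "0 < e" and p: "1 \<le> p"
  shows "(\<integral>\<^sup>+x. epow (mollify_norm e g x) p \<partial>lborel) \<le> (\<integral>\<^sup>+x. epow (ennreal (norm (g x))) p \<partial>lborel)"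
proof -
  have "epow (mollify_norm e g x) p \<le> (\<integral>\<^sup>+y. epow (ennreal (norm (g y))) p * ennreal (moll e (x - y)) \<partial>lborel)" for x
  proof -
    have "epow (mollify_norm e g x) p \<le> epow (\<integral>\<^sup>+y. ennreal (moll e (x - y)) \<partial>lborel) (p - 1) * (\<integral>\<^sup>+y. epow (ennreal (norm (g y))) p * ennreal (moll e (x - y)) \<partial>lborel)"
      unfolding mollify_norm_def by (rule nn_integral_Jensen_powr) (use p e in \<open>auto simp: nn_integral_moll_shift\<close>)
    then show ?thesis using epow_ennreal[of 1 "p - 1"] e by (simp add: nn_integral_moll_shift)
  qed
  then have "(\<integral>\<^sup>+x. epow (mollify_norm e g x) p \<partial>lborel)
     \<le> (\<integral>\<^sup>+x. (\<integral>\<^sup>+y. epow (ennreal (norm (g y))) p * ennreal (moll e (x - y)) \<partial>lborel) \<partial>lborel)"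
    by (intro nn_integral_mono)
  also have "\<dots> = (\<integral>\<^sup>+y. (\<integral>\<^sup>+x. epow (ennreal (norm (g y))) p * ennreal (moll e (x - y)) \<partial>lborel) \<partial>lborel)"
    by (rule lborel_pair.Fubini') measurable
  also have "\<dots> = (\<integral>\<^sup>+y. epow (ennreal (norm (g y))) p \<partial>lborel)"
    using e by (intro nn_integral_cong) (simp add: nn_integral_cmult moll_minus[of e _ ] nn_integral_moll_shift)
  finally show ?thesis .
qed

section \<open>Translations in L^1 and convergence of mollifications\<close>

definition L1_shift :: "('a::euclidean_space \<Rightarrow> real) \<Rightarrow> 'a \<Rightarrow> ennreal" where
  "L1_shift f z = (\<integral>\<^sup>+x. ennreal \<bar>f (x + z) - f x\<bar> \<partial>lborel)"

definition L1_shift_cont :: "('a::euclidean_space \<Rightarrow> real) \<Rightarrow> bool" where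
  "L1_shift_cont f \<longleftrightarrow> (\<forall>\<eta>>0. \<exists>d>0. \<forall>z. norm z < d \<longrightarrow> L1_shift f z \<le> ennreal \<eta>)"

lemma L1_shift_cont_approx:
  fixes f :: "'a::euclidean_space \<Rightarrow> real"
  assumes [measurable]: "f \<in> borel_measurable borel"
    and approx: "\<And>\<eta>. 0 < \<eta> \<Longrightarrow> \<exists>g\<in>borel_measurable borel. L1_shift_cont g \<and> (\<integral>\<^sup>+x. ennreal \<bar>f x - g x\<bar> \<partial>lborel) \<le> ennreal \<eta>"
  shows "L1_shift_cont f"
  unfolding L1_shift_cont_def
proof (intro allI impI)
  fix \<eta> :: real assume \<eta>: "0 < \<eta>"
  then have "0 < \<eta> / 3" by simp
  from approx[OF this] obtain g where [measurable]: "g \<in> borel_measurable borel"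
    and g: "L1_shift_cont g" "(\<integral>\<^sup>+x. ennreal \<bar>f x - g x\<bar> \<partial>lborel) \<le> ennreal (\<eta>/3)" by blast
  from g(1) \<open>0 < \<eta> / 3\<close> obtain d where d: "0 < d" "\<And>z. norm z < d \<Longrightarrow> L1_shift g z \<le> ennreal (\<eta>/3)"
    unfolding L1_shift_cont_def by blast
  have "L1_shift f z \<le> ennreal \<eta>" if "norm z < d" for z
  proof -
    let ?h = "\<lambda>x. ennreal \<bar>f x - g x\<bar>"
    have "L1_shift f z \<le> (\<integral>\<^sup>+x. ?h (z + x) + ennreal \<bar>g (x + z) - g x\<bar> + ?h x \<partial>lborel)"
      unfolding L1_shift_def
      by (intro nn_integral_mono) (auto simp: ennreal_plus[symmetric] add.commute simp del: ennreal_plus intro!: ennreal_leI)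
    also have "\<dots> = (\<integral>\<^sup>+x. ?h (z + x) \<partial>lborel) + L1_shift g z + (\<integral>\<^sup>+x. ?h x \<partial>lborel)"
      by (simp add: nn_integral_add L1_shift_def)
    also have "(\<integral>\<^sup>+x. ?h (z + x) \<partial>lborel) = (\<integral>\<^sup>+x. ?h x \<partial>lborel)"
      by (rule nn_integral_lborel_translate) simp
    also have "(\<integral>\<^sup>+x. ?h x \<partial>lborel) + L1_shift g z + (\<integral>\<^sup>+x. ?h x \<partial>lborel) \<le> ennreal (\<eta>/3) + ennreal (\<eta>/3) + ennreal (\<eta>/3)"
      by (intro add_mono g(2) d(2) that)
    also have "\<dots> = ennreal \<eta>" using \<eta> by (simp add: ennreal_plus[symmetric] del: ennreal_plus)
    finally show ?thesis .
  qed
  then show "\<exists>d>0. \<forall>z. norm z < d \<longrightarrow> L1_shift f z \<le> ennreal \<eta>" using d(1) by blast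
qed

text \<open>For an open set the two one-sided differences have the same integral, and the one carried by
  the set itself tends to 0 by dominated convergence.\<close>

lemma L1_shift_cont_open:
  fixes U :: "'a::euclidean_space set"
  assumes U: "open U" and fin: "emeasure lborel U < top"
  shows "L1_shift_cont (indicator U)"
proof -
  have [measurable]: "U \<in> sets borel" using U by simp
  \<comment> \<open>The measure of the part of \<open>U\<close> that translation by z carries out of
    \<open>U\<close>.\<close>
  define D where "D z = (\<integral>\<^sup>+x. indicator U x * indicator (- U) (x + z) \<partial>lborel)" for z :: 'a
  have split: "L1_shift (indicator U) z = D z + D (- z)" for z
  proof -
    have "L1_shift (indicator U) z = (\<integral>\<^sup>+x. indicator U x * indicator (- U) (x + z) + indicator U (z + x) * indicator (- U) (z + x + - z) \<partial>lborel)"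
      unfolding L1_shift_def by (intro nn_integral_cong) (auto simp: indicator_def add.commute)
    also have "\<dots> = D z + (\<integral>\<^sup>+x. indicator U (z + x) * indicator (- U) (z + x + - z) \<partial>lborel)"
      unfolding D_def by (rule nn_integral_add) auto
    also have "(\<integral>\<^sup>+x. indicator U (z + x) * indicator (- U) (z + x + - z) \<partial>lborel) = D (- z)"
      unfolding D_def by (rule nn_integral_lborel_translate) auto
    finally show ?thesis .
  qed
  have D: "\<exists>d>0. \<forall>z. norm z < d \<longrightarrow> D z \<le> ennreal \<eta>" if \<eta>: "0 < \<eta>" for \<eta>
  proof (rule ccontr)
    assume "\<not> ?thesis"
    then have "\<forall>k::nat. \<exists>z. norm z < 1 / Suc k \<and> ennreal \<eta> < D z"
      by (metis divide_pos_pos not_le of_nat_0_less_iff zero_less_Suc zero_less_one)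
    then obtain Z where Z: "\<And>k. norm (Z k) < 1 / Suc k" "\<And>k. ennreal \<eta> < D (Z k)" by metis
    have "Z \<longlonglongrightarrow> 0"
    proof (rule metric_LIMSEQ_I)
      fix r :: real assume "0 < r"
      then obtain n where "1 / Suc n < r" using nat_approx_posE by blast
      then have "dist (Z m) 0 < r" if "n \<le> m" for m
        using Z(1)[of m] that frac_le[of 1 1 "real (Suc n)" "real (Suc m)"] by (simp add: dist_norm)
      then show "\<exists>no. \<forall>n\<ge>no. dist (Z n) 0 < r" by blast
    qed
    have "(\<lambda>k. D (Z k)) \<longlonglongrightarrow> integral\<^sup>N lborel (\<lambda>x::'a. 0)"
      unfolding D_def
    proof (rule nn_integral_dominated_convergence[where w = "indicator U"])
      show "AE x in lborel. (\<lambda>k. indicator U x * indicator (- U) (x + Z k) :: ennreal) \<longlonglongrightarrow> 0"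
      proof (rule AE_I2)
        fix x
        show "(\<lambda>k. indicator U x * indicator (- U) (x + Z k) :: ennreal) \<longlonglongrightarrow> 0"
        proof (cases "x \<in> U")
          case True
          have "(\<lambda>k. x + Z k) \<longlonglongrightarrow> x + 0" by (intro tendsto_add tendsto_const \<open>Z \<longlonglongrightarrow> 0\<close>)
          then have "\<forall>\<^sub>F k in sequentially. x + Z k \<in> U" using U True topological_tendstoD by force
          then have "\<forall>\<^sub>F k in sequentially. indicator U x * indicator (- U) (x + Z k) = (0::ennreal)"
            by (rule eventually_mono) auto
          then show ?thesis by (rule tendsto_eventually)
        qed simp
      qed
      show "AE x in lborel. indicator U x * indicator (- U) (x + Z k) \<le> (indicator U x :: ennreal)" for k
        by (auto simp: indicator_def)
    qed (use fin in auto)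
    then have "(\<lambda>k. D (Z k)) \<longlonglongrightarrow> 0" by simp
    then have "\<forall>\<^sub>F k in sequentially. D (Z k) < ennreal \<eta>" using \<eta> by (intro order_tendstoD) auto
    then obtain k where "D (Z k) < ennreal \<eta>" by (auto simp: eventually_sequentially)
    with Z(2)[of k] show False by simp
  qed
  show ?thesis
    unfolding L1_shift_cont_def
  proof (intro allI impI)
    fix \<eta> :: real assume \<eta>: "0 < \<eta>"
    obtain d where d: "0 < d" "\<And>z. norm z < d \<Longrightarrow> D z \<le> ennreal (\<eta>/2)" using D[of "\<eta>/2"] \<eta> by auto
    have "L1_shift (indicator U) z \<le> ennreal \<eta>" if "norm z < d" for z
    proof -
      have "L1_shift (indicator U) z \<le> ennreal (\<eta>/2) + ennreal (\<eta>/2)"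
        unfolding split using that by (intro add_mono d(2)) auto
      then show ?thesis using \<eta> by (simp add: ennreal_plus[symmetric] del: ennreal_plus)
    qed
    then show "\<exists>d>0. \<forall>z. norm z < d \<longrightarrow> L1_shift (indicator U) z \<le> ennreal \<eta>" using d(1) by blast
  qed
qed

lemma L1_shift_cont_scale:
  assumes [measurable]: "f \<in> borel_measurable borel" and f: "L1_shift_cont f"
  shows "L1_shift_cont (\<lambda>x. f x * c)"
  unfolding L1_shift_cont_def
proof (intro allI impI)
  fix \<eta> :: real assume \<eta>: "0 < \<eta>"
  then have "0 < \<eta> / (\<bar>c\<bar> + 1)" by simp
  then obtain d where d: "0 < d" "\<And>z. norm z < d \<Longrightarrow> L1_shift f z \<le> ennreal (\<eta> / (\<bar>c\<bar> + 1))"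
    using f unfolding L1_shift_cont_def by blast
  have "L1_shift (\<lambda>x. f x * c) z \<le> ennreal \<eta>" if "norm z < d" for z
  proof -
    have "L1_shift (\<lambda>x. f x * c) z = (\<integral>\<^sup>+x. ennreal \<bar>c\<bar> * ennreal \<bar>f (x + z) - f x\<bar> \<partial>lborel)"
      unfolding L1_shift_def by (intro nn_integral_cong) (simp add: ennreal_mult[symmetric] abs_mult[symmetric] algebra_simps)
    also have "\<dots> = ennreal \<bar>c\<bar> * L1_shift f z"
      by (simp add: L1_shift_def nn_integral_cmult)
    also have "\<dots> \<le> ennreal \<bar>c\<bar> * ennreal (\<eta> / (\<bar>c\<bar> + 1))"
      by (intro mult_left_mono d that) auto
    also have "\<dots> = ennreal (\<bar>c\<bar> * (\<eta> / (\<bar>c\<bar> + 1)))" using \<eta> by (subst ennreal_mult) auto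
    also have "\<dots> \<le> ennreal \<eta>" using \<eta> by (intro ennreal_leI) (simp add: divide_simps algebra_simps)
    finally show ?thesis .
  qed
  then show "\<exists>d>0. \<forall>z. norm z < d \<longrightarrow> L1_shift (\<lambda>x. f x * c) z \<le> ennreal \<eta>" using d(1) by blast
qed

lemma L1_shift_cont_add:
  assumes [measurable]: "f \<in> borel_measurable borel" "g \<in> borel_measurable borel"
    and f: "L1_shift_cont f" and g: "L1_shift_cont g"
  shows "L1_shift_cont (\<lambda>x. f x + g x)"
  unfolding L1_shift_cont_def
proof (intro allI impI)
  fix \<eta> :: real assume \<eta>: "0 < \<eta>"
  then have h: "0 < \<eta> / 2" by simp
  obtain d where d: "0 < d" "\<And>z. norm z < d \<Longrightarrow> L1_shift f z \<le> ennreal (\<eta> / 2)"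
    using f h unfolding L1_shift_cont_def by blast
  obtain d' where d': "0 < d'" "\<And>z. norm z < d' \<Longrightarrow> L1_shift g z \<le> ennreal (\<eta> / 2)"
    using g h unfolding L1_shift_cont_def by blast
  have "L1_shift (\<lambda>x. f x + g x) z \<le> ennreal \<eta>" if "norm z < min d d'" for z
  proof -
    have "L1_shift (\<lambda>x. f x + g x) z \<le> (\<integral>\<^sup>+x. ennreal \<bar>f (x + z) - f x\<bar> + ennreal \<bar>g (x + z) - g x\<bar> \<partial>lborel)"
      unfolding L1_shift_def by (intro nn_integral_mono) (auto simp: ennreal_plus[symmetric] simp del: ennreal_plus intro!: ennreal_leI)
    also have "\<dots> = L1_shift f z + L1_shift g z" by (simp add: L1_shift_def nn_integral_add)
    also have "\<dots> \<le> ennreal (\<eta>/2) + ennreal (\<eta>/2)" using that by (intro add_mono d(2) d'(2)) auto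
    also have "\<dots> = ennreal \<eta>" using \<eta> by (simp add: ennreal_plus[symmetric] del: ennreal_plus)
    finally show ?thesis .
  qed
  then show "\<exists>d>0. \<forall>z. norm z < d \<longrightarrow> L1_shift (\<lambda>x. f x + g x) z \<le> ennreal \<eta>"
    using d(1) d'(1) by (intro exI[of _ "min d d'"]) auto
qed

text \<open>Indicators of Borel sets are reached from open sets by outer regularity; sums and
  dominated limits follow because the class is closed under L^1 approximation.\<close>

lemma L1_shift_cont_integrable:
  fixes f :: "'a::euclidean_space \<Rightarrow> real"
  assumes "integrable lborel f"
  shows "L1_shift_cont f"
  using assms
proof (induction rule: integrable_induct)
  case (base A c)
  then have [measurable]: "A \<in> sets borel" by simp
  have "L1_shift_cont (indicator A :: 'a \<Rightarrow> real)"
  proof (rule L1_shift_cont_approx)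
    fix \<eta> :: real assume \<eta>: "0 < \<eta>"
    obtain U where U: "open U" "A \<subseteq> U" "emeasure lborel (U - A) < ennreal \<eta>"
      using outer_regular_lborel[OF \<open>A \<in> sets borel\<close> \<eta>] by blast
    then have [measurable]: "U \<in> sets borel" by simp
    have "emeasure lborel U \<le> emeasure lborel A + emeasure lborel (U - A)"
      using U(2) by (subst plus_emeasure) (auto simp: Un_absorb1)
    also have "\<dots> < top" using base order.strict_trans[OF U(3) ennreal_less_top] by auto
    finally have fin: "emeasure lborel U < top" .
    have "(\<integral>\<^sup>+x. ennreal \<bar>indicator A x - indicator U x\<bar> \<partial>lborel) = (\<integral>\<^sup>+x. indicator (U - A) x \<partial>lborel)"
      using U(2) by (intro nn_integral_cong) (auto simp: indicator_def)
    also have "\<dots> = emeasure lborel (U - A)" by simp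
    also have "\<dots> \<le> ennreal \<eta>" using U(3) by simp
    finally show "\<exists>g\<in>borel_measurable borel. L1_shift_cont g \<and> (\<integral>\<^sup>+x. ennreal \<bar>indicator A x - g x\<bar> \<partial>lborel) \<le> ennreal \<eta>"
      using L1_shift_cont_open[OF U(1) fin] by (intro bexI[of _ "indicator U"]) auto
  qed simp
  then show ?case using L1_shift_cont_scale[of "indicator A" c] by simp
next
  case (add f g)
  then show ?case by (intro L1_shift_cont_add) auto
next
  case (lim f s)
  then have [measurable]: "f \<in> borel_measurable borel" "\<And>i. s i \<in> borel_measurable borel" by auto
  have int: "(\<lambda>i. \<integral>\<^sup>+x. ennreal \<bar>f x - s i x\<bar> \<partial>lborel) \<longlonglongrightarrow> integral\<^sup>N lborel (\<lambda>x::'a. 0)"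
  proof (rule nn_integral_dominated_convergence[where w = "\<lambda>x. ennreal (3 * norm (f x))"])
    show "AE x in lborel. (\<lambda>i. ennreal \<bar>f x - s i x\<bar>) \<longlonglongrightarrow> 0"
    proof (rule AE_I2)
      fix x
      have "(\<lambda>i. \<bar>f x - s i x\<bar>) \<longlonglongrightarrow> \<bar>f x - f x\<bar>" using lim by (intro tendsto_intros) auto
      then show "(\<lambda>i. ennreal \<bar>f x - s i x\<bar>) \<longlonglongrightarrow> 0" using tendsto_ennrealI by fastforce
    qed
    show "AE x in lborel. ennreal \<bar>f x - s i x\<bar> \<le> ennreal (3 * norm (f x))" for i
    proof (rule AE_I2, rule ennreal_leI)
      fix x
      have "norm (s i x) \<le> 2 * norm (f x)" using lim by auto
      then show "\<bar>f x - s i x\<bar> \<le> 3 * norm (f x)" by (auto simp: abs_le_iff)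
    qed
    have "integrable lborel (\<lambda>x. 3 * norm (f x))" using lim by auto
    then show "(\<integral>\<^sup>+x. ennreal (3 * norm (f x)) \<partial>lborel) < \<infinity>"
      by (subst nn_integral_eq_integral) auto
  qed auto
  show ?case
  proof (rule L1_shift_cont_approx)
    fix \<eta> :: real assume "0 < \<eta>"
    then have "\<forall>\<^sub>F i in sequentially. (\<integral>\<^sup>+x. ennreal \<bar>f x - s i x\<bar> \<partial>lborel) < ennreal \<eta>"
      using int by (intro order_tendstoD(2)) auto
    then obtain i where "(\<integral>\<^sup>+x. ennreal \<bar>f x - s i x\<bar> \<partial>lborel) < ennreal \<eta>"
      by (auto simp: eventually_sequentially)
    then show "\<exists>g\<in>borel_measurable borel. L1_shift_cont g \<and> (\<integral>\<^sup>+x. ennreal \<bar>f x - g x\<bar> \<partial>lborel) \<le> ennreal \<eta>"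
      using lim by (intro bexI[of _ "s i"]) auto
  qed simp
qed

text \<open>On the ball, a mollification of radius below 1 sees only the truncation of u to radius R
  + 1, which is integrable. The error is then an average of L^1 translation differences.\<close>

lemma mollify_L1_loc:
  fixes u :: "'a::euclidean_space \<Rightarrow> real"
  assumes u: "loc_int u" and \<eta>: "0 < \<eta>"
  shows "\<exists>d>0. \<forall>e. 0 < e \<and> e < d \<longrightarrow> (\<integral>\<^sup>+x\<in>ball 0 R. ennreal \<bar>mollify e u x - u x\<bar> \<partial>lborel) \<le> ennreal \<eta>"
proof -
  note [measurable] = loc_int_measurable[OF u]
  define f where "f = (\<lambda>y. indicator (cball 0 (R + 1)) y *\<^sub>R u y)"
  have f: "integrable lborel f" unfolding f_def using u by (auto simp: loc_int_def)
  note [measurable] = borel_measurable_integrable[OF f, simplified]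
  have lf: "loc_int f"
    using integrable_mult_indicator[OF _ f] by (simp add: loc_int_def)
  obtain d where d: "0 < d" "\<And>z. norm z < d \<Longrightarrow> L1_shift f z \<le> ennreal \<eta>"
    using L1_shift_cont_integrable[OF f] \<eta> unfolding L1_shift_cont_def by blast
  have "(\<integral>\<^sup>+x\<in>ball 0 R. ennreal \<bar>mollify e u x - u x\<bar> \<partial>lborel) \<le> ennreal \<eta>" if e: "0 < e" "e < min d 1" for e
  proof -
    have "(\<integral>\<^sup>+x\<in>ball 0 R. ennreal \<bar>mollify e u x - u x\<bar> \<partial>lborel)
       \<le> (\<integral>\<^sup>+x. (\<integral>\<^sup>+v. ennreal \<bar>f (x + v) - f x\<bar> * ennreal (moll e v) \<partial>lborel) \<partial>lborel)"
    proof (rule nn_integral_mono)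
      fix x :: 'a
      show "ennreal \<bar>mollify e u x - u x\<bar> * indicator (ball 0 R) x \<le> (\<integral>\<^sup>+v. ennreal \<bar>f (x + v) - f x\<bar> * ennreal (moll e v) \<partial>lborel)"
      proof (cases "x \<in> ball 0 R")
        case True
        have 1: "u y * moll e (x - y) = f y * moll e (x - y)" for y
        proof (cases "norm (x - y) < e")
          case near: True
          have "norm y \<le> norm x + norm (x - y)" using norm_triangle_ineq4[of x "x - y"] by simp
          then show ?thesis using True e near by (simp add: f_def)
        next
          case False
          then show ?thesis using e by (simp add: moll_zero)
        qed
        have 2: "(LINT y|lborel. moll e (x - y)) = 1"
          using e nn_integral_moll_shift[of e x] integral_eq_nn_integral[of "\<lambda>y. moll e (x - y)" lborel]
          by simp
        have 3: "f x = u x" using True by (simp add: f_def)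
        have "mollify e u x - u x = (LINT y|lborel. f y * moll e (x - y)) - f x * (LINT y|lborel. moll e (x - y))"
          unfolding mollify_def 1 2 3 by simp
        also have "\<dots> = (LINT y|lborel. (f y - f x) * moll e (x - y))"
        proof -
          have "integrable lborel (\<lambda>y. moll e (x - y))"
            using smooth_bump_integrable[OF smooth_bump_moll[of x e]] e by (simp add: moll_minus[of e x])
          then show ?thesis
            using loc_int_mult_moll[OF lf e(1), of x] by (simp add: left_diff_distrib)
        qed
        finally have "ennreal \<bar>mollify e u x - u x\<bar> = ennreal (norm (LINT y|lborel. (f y - f x) * moll e (x - y)))" by simp
        also have "\<dots> \<le> (\<integral>\<^sup>+y. ennreal (norm ((f y - f x) * moll e (x - y))) \<partial>lborel)"
        proof (rule integral_norm_bound_ennreal)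
          have "integrable lborel (\<lambda>y. moll e (x - y))"
            using smooth_bump_integrable[OF smooth_bump_moll[of x e]] e by (simp add: moll_minus[of e x])
          then show "integrable lborel (\<lambda>y. (f y - f x) * moll e (x - y))"
            using loc_int_mult_moll[OF lf e(1), of x] by (simp add: left_diff_distrib)
        qed
        also have "\<dots> = (\<integral>\<^sup>+y. ennreal \<bar>f y - f x\<bar> * ennreal (moll e (y - x)) \<partial>lborel)"
          using e by (intro nn_integral_cong) (simp add: abs_mult ennreal_mult moll_minus[of e x])
        also have "\<dots> = (\<integral>\<^sup>+v. ennreal \<bar>f (x + v) - f x\<bar> * ennreal (moll e v) \<partial>lborel)"
          by (subst nn_integral_lborel_translate[of _ x, symmetric]) auto
        finally show ?thesis using True by simp
      qed simp
    qed
    also have "\<dots> = (\<integral>\<^sup>+v. (\<integral>\<^sup>+x. ennreal \<bar>f (x + v) - f x\<bar> * ennreal (moll e v) \<partial>lborel) \<partial>lborel)"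
      by (rule lborel_pair.Fubini') measurable
    also have "\<dots> = (\<integral>\<^sup>+v. L1_shift f v * ennreal (moll e v) \<partial>lborel)"
      by (intro nn_integral_cong) (simp add: L1_shift_def nn_integral_multc)
    also have "\<dots> \<le> (\<integral>\<^sup>+v. ennreal \<eta> * ennreal (moll e (v::'a)) \<partial>lborel)"
    proof (rule nn_integral_mono)
      fix v :: 'a
      show "L1_shift f v * ennreal (moll e v) \<le> ennreal \<eta> * ennreal (moll e v)"
        using d(2)[of v] e moll_zero[of e v] by (cases "norm v < e") (auto intro: mult_right_mono)
    qed
    also have "\<dots> = ennreal \<eta>" using e by (simp add: nn_integral_cmult nn_integral_moll)
    finally show ?thesis .
  qed
  then show ?thesis using d(1) by (intro exI[of _ "min d 1"]) auto
qed

section \<open>Inequalities for weak gradients on the whole space\<close>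

lemma ball_avg_measurable [measurable (raw)]:
  fixes w :: "'a::euclidean_space \<Rightarrow> real"
  assumes [measurable]: "w \<in> borel_measurable borel"
  shows "ball_avg w R \<in> borel_measurable borel"
proof -
  have [measurable]: "ball (0::'a) R \<in> sets borel" by simp
  have "(\<lambda>x. LINT z|lborel. indicator (ball 0 R) z *\<^sub>R w (x + z)) \<in> borel_measurable borel"
    by measurable
  then show ?thesis
    unfolding ball_avg_def[abs_def] set_lebesgue_integral_def by (intro borel_measurable_divide borel_measurable_const)
qed

text \<open>One sequence of radii serves all purposes: errors below 2^(-k) on balls of radius k are
  summable, which gives convergence almost everywhere and convergence of the averages on every fixed
  ball. The bound \<open>e0\<close> keeps the kernels inside a domain.\<close>

lemma mollify_sequence:
  fixes u :: "'a::euclidean_space \<Rightarrow> real"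
  assumes u: "loc_int u" and e0: "0 < e0"
  obtains E :: "nat \<Rightarrow> real" where "\<And>k. 0 < E k" "\<And>k. E k < e0"
    "AE x in lborel. (\<lambda>k. mollify (E k) u x) \<longlonglongrightarrow> u x"
    "\<And>x R. (\<lambda>k. ball_avg (mollify (E k) u) R x) \<longlonglongrightarrow> ball_avg u R x"
proof -
  note [measurable] = loc_int_measurable[OF u]
  have "\<forall>k::nat. \<exists>e. 0 < e \<and> e < e0 \<and> (\<integral>\<^sup>+x\<in>ball 0 (real k). ennreal \<bar>mollify e u x - u x\<bar> \<partial>lborel) \<le> ennreal ((1/2)^k)"
  proof
    fix k :: nat
    obtain d where "d > 0" and d: "\<And>e. 0 < e \<Longrightarrow> e < d \<Longrightarrow> (\<integral>\<^sup>+x\<in>ball 0 (real k). ennreal \<bar>mollify e u x - u x\<bar> \<partial>lborel) \<le> ennreal ((1/2)^k)"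
      using mollify_L1_loc[OF u, of "(1/2)^k" "real k"] by auto
    then show "\<exists>e. 0 < e \<and> e < e0 \<and> (\<integral>\<^sup>+x\<in>ball 0 (real k). ennreal \<bar>mollify e u x - u x\<bar> \<partial>lborel) \<le> ennreal ((1/2)^k)"
      using e0 by (intro exI[of _ "min d e0 / 2"] conjI d) auto
  qed
  then obtain E where E: "\<And>k. 0 < E k" "\<And>k. E k < e0"
    "\<And>k. (\<integral>\<^sup>+x\<in>ball 0 (real k). ennreal \<bar>mollify (E k) u x - u x\<bar> \<partial>lborel) \<le> ennreal ((1/2)^k)"
    by metis
  have [measurable]: "mollify (E k) u \<in> borel_measurable borel" for k
    by (intro borel_measurable_continuous_onI continuous_mollify u E)
  define D where "D k x = ennreal \<bar>mollify (E k) u x - u x\<bar> * indicator (ball 0 (real k)) x" for k x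
  have [measurable]: "D k \<in> borel_measurable borel" for k unfolding D_def by measurable
  have "(\<integral>\<^sup>+x. (\<Sum>k. D k x) \<partial>lborel) = (\<Sum>k. \<integral>\<^sup>+x. D k x \<partial>lborel)"
    by (rule nn_integral_suminf) simp
  also have "\<dots> \<le> (\<Sum>k. ennreal ((1/2)^k))"
    by (intro suminf_le) (auto simp: D_def E(3))
  also have "\<dots> = ennreal (\<Sum>k. (1/2)^k)"
    by (rule suminf_ennreal2) (auto intro: summable_geometric)
  finally have "(\<integral>\<^sup>+x. (\<Sum>k. D k x) \<partial>lborel) \<noteq> \<infinity>" by (auto simp: top_unique)
  then have "AE x in lborel. (\<Sum>k. D k x) \<noteq> \<infinity>"
    by (intro nn_integral_noteq_infinite) auto
  then have ae: "AE x in lborel. (\<lambda>k. mollify (E k) u x) \<longlonglongrightarrow> u x"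
  proof eventually_elim
    fix x assume fin: "(\<Sum>k. D k x) \<noteq> \<infinity>"
    define a where "a k = \<bar>mollify (E k) u x - u x\<bar> * indicator (ball 0 (real k)) x" for k
    have "D k x = ennreal (a k)" for k by (auto simp: D_def a_def indicator_def)
    then have "summable a"
      using fin by (intro summable_suminf_not_top) (auto simp: a_def)
    then have "a \<longlonglongrightarrow> 0" by (rule summable_LIMSEQ_zero)
    \<comment> \<open>Every fixed x eventually lies in the growing balls, so the indicator
      disappears.\<close>
    moreover have "\<forall>\<^sub>F k in sequentially. a k = \<bar>mollify (E k) u x - u x\<bar>"
    proof -
      obtain k0 :: nat where "norm x < real k0" using reals_Archimedean2 by blast
      then show ?thesis unfolding eventually_sequentially by (intro exI[of _ k0]) (auto simp: a_def)
    qed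
    ultimately have "(\<lambda>k. \<bar>mollify (E k) u x - u x\<bar>) \<longlonglongrightarrow> 0"
      by (rule Lim_transform_eventually)
    then show "(\<lambda>k. mollify (E k) u x) \<longlonglongrightarrow> u x"
      by (simp add: tendsto_rabs_zero_iff LIM_zero_iff)
  qed
  have avg: "(\<lambda>k. ball_avg (mollify (E k) u) R x) \<longlonglongrightarrow> ball_avg u R x" for x :: 'a and R
  proof -
    obtain k0 :: nat where k0: "norm x + R < real k0" using reals_Archimedean2 by blast
    have su: "set_integrable lborel (ball x R) u"
    proof -
      have "set_integrable lborel (cball x R) u" using u by (simp add: loc_int_def set_integrable_def)
      then show ?thesis by (rule set_integrable_subset) auto
    qed
    have sm: "set_integrable lborel (ball x R) (mollify (E k) u)" for k
    proof -
      have "set_integrable lborel (cball x R) (mollify (E k) u)"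
        unfolding set_integrable_def
        by (rule borel_integrable_compact) (auto intro: continuous_on_subset[OF continuous_mollify[OF u E(1)]])
      then show ?thesis by (rule set_integrable_subset) auto
    qed
    have shift: "ball_avg w R x = (LINT y:ball x R|lborel. w y) / ball_volume TYPE('a) R"
      if [measurable]: "w \<in> borel_measurable borel" for w :: "'a \<Rightarrow> real"
    proof -
      have [measurable]: "ball x R \<in> sets borel" by simp
      have "(LINT y|distr lborel borel ((+) x). indicator (ball x R) y *\<^sub>R w y) = (LINT z|lborel. indicator (ball x R) (x + z) *\<^sub>R w (x + z))"
        by (rule integral_distr) auto
      also have "(\<lambda>z. indicator (ball x R) (x + z) *\<^sub>R w (x + z)) = (\<lambda>z. indicator (ball 0 R) z *\<^sub>R w (x + z))"
        by (auto simp: indicator_def dist_norm fun_eq_iff)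
      finally show ?thesis
        by (simp add: ball_avg_def set_lebesgue_integral_def lborel_distr_plus)
    qed
    have "norm (ball_avg (mollify (E k) u) R x - ball_avg u R x) \<le> (1/2)^k / ball_volume TYPE('a) R"
      if k: "k0 \<le> k" for k
    proof -
      have "ennreal (norm (LINT y:ball x R|lborel. mollify (E k) u y - u y)) \<le> (\<integral>\<^sup>+y. ennreal (norm (indicator (ball x R) y *\<^sub>R (mollify (E k) u y - u y))) \<partial>lborel)"
        using set_integral_diff(1)[OF sm su] unfolding set_integrable_def set_lebesgue_integral_def
        by (rule integral_norm_bound_ennreal)
      also have "\<dots> \<le> (\<integral>\<^sup>+y\<in>ball 0 (real k). ennreal \<bar>mollify (E k) u y - u y\<bar> \<partial>lborel)"
      proof (rule nn_integral_mono)
        fix y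
        have "y \<in> ball 0 (real k)" if "y \<in> ball x R"
          using norm_triangle_ineq4[of x "x - y"] that k0 k by (simp add: dist_norm)
        then show "ennreal (norm (indicator (ball x R) y *\<^sub>R (mollify (E k) u y - u y))) \<le> ennreal \<bar>mollify (E k) u y - u y\<bar> * indicator (ball 0 (real k)) y"
          by (auto simp: indicator_def)
      qed
      also have "\<dots> \<le> ennreal ((1/2)^k)" by (rule E(3))
      finally have "norm (LINT y:ball x R|lborel. mollify (E k) u y - u y) \<le> (1/2)^k"
        by (simp add: ennreal_le_iff)
      then show ?thesis
        using sm su by (simp add: shift diff_divide_distrib[symmetric] divide_right_mono ball_volume_def)
    qed
    then have "\<forall>\<^sub>F k in sequentially. norm (ball_avg (mollify (E k) u) R x - ball_avg u R x) \<le> (1/2)^k / ball_volume TYPE('a) R"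
      by (auto simp: eventually_sequentially)
    moreover have "(\<lambda>k. (1/2)^k / ball_volume TYPE('a) R) \<longlonglongrightarrow> 0"
      using tendsto_divide_zero[OF LIMSEQ_power_zero[of "1/2::real"]] by simp
    ultimately have "(\<lambda>k. ball_avg (mollify (E k) u) R x - ball_avg u R x) \<longlonglongrightarrow> 0"
      by (rule Lim_null_comparison)
    then show ?thesis by (simp add: LIM_zero_iff)
  qed
  show ?thesis using that[OF E(1,2) ae avg] .
qed

lemma nn_integral_Fatou_bound:
  fixes h :: "nat \<Rightarrow> 'a \<Rightarrow> ennreal"
  assumes [measurable]: "\<And>k. h k \<in> borel_measurable M"
    and lim: "AE x in M. (\<lambda>k. h k x) \<longlonglongrightarrow> l x" and le: "\<And>k. (\<integral>\<^sup>+x. h k x \<partial>M) \<le> B"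
  shows "(\<integral>\<^sup>+x. l x \<partial>M) \<le> B"
proof -
  have "(\<integral>\<^sup>+x. l x \<partial>M) = (\<integral>\<^sup>+x. liminf (\<lambda>k. h k x) \<partial>M)"
    using lim by (intro nn_integral_cong_AE) (auto elim!: eventually_mono simp: lim_imp_Liminf)
  also have "\<dots> \<le> liminf (\<lambda>k. \<integral>\<^sup>+x. h k x \<partial>M)" by (rule nn_integral_liminf) simp
  also have "\<dots> \<le> B"
    by (rule Liminf_le) (use le in auto)
  finally show ?thesis .
qed

lemma tendsto_epow_abs:
  "0 < q \<Longrightarrow> a \<longlonglongrightarrow> b \<Longrightarrow> (\<lambda>k. epow (ennreal \<bar>a k\<bar>) q) \<longlonglongrightarrow> epow (ennreal \<bar>b\<bar>) q"
  by (simp, intro tendsto_ennrealI tendsto_powr2 tendsto_rabs tendsto_const) auto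

lemma mollify_le_mollify_norm:
  fixes u :: "'a::euclidean_space \<Rightarrow> real"
  assumes "loc_int u" "0 < e"
  shows "ennreal \<bar>mollify e u x\<bar> \<le> mollify_norm e u x"
proof -
  have "ennreal (norm (LINT y|lborel. u y * moll e (x - y))) \<le> (\<integral>\<^sup>+y. ennreal (norm (u y * moll e (x - y))) \<partial>lborel)"
    by (rule integral_norm_bound_ennreal[OF loc_int_mult_moll[OF assms]])
  then show ?thesis
    using assms by (simp add: mollify_def mollify_norm_def abs_mult ennreal_mult)
qed

lemma sobolev_weak:
  fixes p :: real
  assumes p: "1 \<le> p" "p < DIM('a::euclidean_space)"
  defines "e \<equiv> p / (DIM('a) - p)"
  shows "\<exists>C>0. \<forall>(u :: 'a \<Rightarrow> real) g. loc_int u \<longrightarrow> loc_int g \<longrightarrow> weak_grad_eq UNIV u g \<longrightarrow>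
    (\<integral>\<^sup>+x. epow (ennreal \<bar>u x\<bar>) p \<partial>lborel) < top \<longrightarrow>
    (\<integral>\<^sup>+x. epow (ennreal \<bar>u x\<bar>) (p * (1 + e)) \<partial>lborel) \<le> ennreal C * epow (\<integral>\<^sup>+x. epow (ennreal (norm (g x))) p \<partial>lborel) (1 + e)"
proof -
  obtain C where C: "0 < C" "\<And>(w :: 'a \<Rightarrow> real) f. upper_gradient UNIV w f \<Longrightarrow> (\<integral>\<^sup>+x. epow (ennreal \<bar>w x\<bar>) p \<partial>lborel) < top \<Longrightarrow>
    (\<integral>\<^sup>+x. epow (ennreal \<bar>w x\<bar>) (p * (1 + e)) \<partial>lborel) \<le> ennreal C * epow (\<integral>\<^sup>+x. epow (f x) p \<partial>lborel) (1 + e)"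
    using sobolev_upper_gradient[OF p] unfolding e_def by blast
  have e: "0 < e" using p by (simp add: e_def)
  show ?thesis
  proof (intro exI[of _ C] conjI allI impI)
    show "0 < C" by fact
    fix u :: "'a \<Rightarrow> real" and g
    assume u: "loc_int u" and g: "loc_int g" and eq: "weak_grad_eq UNIV u g" and fin: "(\<integral>\<^sup>+x. epow (ennreal \<bar>u x\<bar>) p \<partial>lborel) < top"
    note [measurable] = loc_int_measurable[OF u] loc_int_measurable[OF g]
    obtain E :: "nat \<Rightarrow> real" where E: "\<And>k. 0 < E k" "AE x in lborel. (\<lambda>k. mollify (E k) u x) \<longlonglongrightarrow> u x"
      by (rule mollify_sequence[OF u zero_less_one]) blast
    have ug: "upper_gradient UNIV (mollify (E k) u) (mollify_norm (E k) g)" for k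
      by (rule upper_gradient_mollify[OF u g eq E(1)]) auto
    note [measurable] = upper_gradientD(2)[OF ug]
    show "(\<integral>\<^sup>+x. epow (ennreal \<bar>u x\<bar>) (p * (1 + e)) \<partial>lborel) \<le> ennreal C * epow (\<integral>\<^sup>+x. epow (ennreal (norm (g x))) p \<partial>lborel) (1 + e)"
    proof (rule nn_integral_Fatou_bound)
      show "AE x in lborel. (\<lambda>k. epow (ennreal \<bar>mollify (E k) u x\<bar>) (p * (1 + e))) \<longlonglongrightarrow> epow (ennreal \<bar>u x\<bar>) (p * (1 + e))"
        using E(2) by eventually_elim (use p e in \<open>auto intro!: tendsto_epow_abs simp del: epow_ennreal\<close>)
      fix k
      have "(\<integral>\<^sup>+x. epow (ennreal \<bar>mollify (E k) u x\<bar>) p \<partial>lborel) \<le> (\<integral>\<^sup>+x. epow (mollify_norm (E k) u x) p \<partial>lborel)"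
        using p by (intro nn_integral_mono epow_mono mollify_le_mollify_norm u E) auto
      also have "\<dots> \<le> (\<integral>\<^sup>+x. epow (ennreal (norm (u x))) p \<partial>lborel)"
        by (rule nn_integral_mollify_norm_le) (use E p in auto)
      finally have "(\<integral>\<^sup>+x. epow (ennreal \<bar>mollify (E k) u x\<bar>) p \<partial>lborel) < top"
        unfolding real_norm_def using fin by (rule le_less_trans)
      then have "(\<integral>\<^sup>+x. epow (ennreal \<bar>mollify (E k) u x\<bar>) (p * (1 + e)) \<partial>lborel)
        \<le> ennreal C * epow (\<integral>\<^sup>+x. epow (mollify_norm (E k) g x) p \<partial>lborel) (1 + e)"
        by (rule C(2)[OF ug])
      also have "\<dots> \<le> ennreal C * epow (\<integral>\<^sup>+x. epow (ennreal (norm (g x))) p \<partial>lborel) (1 + e)"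
        using e p E by (intro mult_left_mono epow_mono nn_integral_mollify_norm_le) auto
      finally show "(\<integral>\<^sup>+x. epow (ennreal \<bar>mollify (E k) u x\<bar>) (p * (1 + e)) \<partial>lborel) \<le> ennreal C * epow (\<integral>\<^sup>+x. epow (ennreal (norm (g x))) p \<partial>lborel) (1 + e)" .
    qed simp
  qed
qed

lemma ball_avg_diff_weak:
  fixes u :: "'a::euclidean_space \<Rightarrow> real"
  assumes u: "loc_int u" and g: "loc_int g" and eq: "weak_grad_eq UNIV u g" and R: "0 < R" and p: "1 \<le> p"
  shows "ennreal \<bar>ball_avg u R x - ball_avg u R y\<bar>
    \<le> ennreal (norm (x - y) * (ball_volume TYPE('a) 1 powr (-1/p) * R powr (- DIM('a) / p))) * epow (\<integral>\<^sup>+x. epow (ennreal (norm (g x))) p \<partial>lborel) (1/p)"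
    (is "_ \<le> ?c * epow ?N (1/p)")
proof -
  note [measurable] = loc_int_measurable[OF g]
  obtain E :: "nat \<Rightarrow> real" where E: "\<And>k. 0 < E k" "\<And>x R. (\<lambda>k. ball_avg (mollify (E k) u) R x) \<longlonglongrightarrow> ball_avg u R x"
    by (rule mollify_sequence[OF u zero_less_one]) blast
  have "ennreal \<bar>ball_avg (mollify (E k) u) R x - ball_avg (mollify (E k) u) R y\<bar> \<le> ?c * epow ?N (1/p)" for k
  proof -
    have "upper_gradient UNIV (mollify (E k) u) (mollify_norm (E k) g)"
      by (rule upper_gradient_mollify[OF u g eq E(1)]) auto
    then have "ennreal \<bar>ball_avg (mollify (E k) u) R x - ball_avg (mollify (E k) u) R y\<bar> \<le> ?c * epow (\<integral>\<^sup>+x. epow (mollify_norm (E k) g x) p \<partial>lborel) (1/p)"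
      by (rule upper_gradient_ball_avg_diff[OF _ R p])
    also have "\<dots> \<le> ?c * epow ?N (1/p)"
      using p E by (intro mult_left_mono epow_mono nn_integral_mollify_norm_le) auto
    finally show ?thesis .
  qed
  moreover have "(\<lambda>k. ennreal \<bar>ball_avg (mollify (E k) u) R x - ball_avg (mollify (E k) u) R y\<bar>) \<longlonglongrightarrow> ennreal \<bar>ball_avg u R x - ball_avg u R y\<bar>"
    by (intro tendsto_ennrealI tendsto_rabs tendsto_diff E)
  ultimately show ?thesis using LIMSEQ_le_const2 by blast
qed

lemma diff_ball_avg_Lq_weak:
  fixes p q :: real
  assumes p: "1 \<le> p" "DIM('a::euclidean_space) \<le> p" and pq: "p \<le> q"
  shows "\<exists>C>0. \<forall>(u :: 'a \<Rightarrow> real) g. loc_int u \<longrightarrow> loc_int g \<longrightarrow> weak_grad_eq UNIV u g \<longrightarrow> (\<forall>R>0.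
    (\<integral>\<^sup>+x. epow (ennreal \<bar>u x - ball_avg u R x\<bar>) q \<partial>lborel)
      \<le> ennreal (C * R powr (q - DIM('a) * (q - p) / p)) * epow (\<integral>\<^sup>+x. epow (ennreal (norm (g x))) p \<partial>lborel) (q / p))"
proof -
  \<comment> \<open>Any value close enough to 1 would do. As p >= n, the term n (q - p)/p is at most
    q - p, so the exponent is at least p - 1 - (q - 1)/(2 q), which is above -1.\<close>
  define \<gamma> where "\<gamma> = 1 - 1 / (2 * q)"
  have g01: "0 \<le> \<gamma>" "\<gamma> < 1" using p pq by (auto simp: \<gamma>_def)
  have \<beta>: "-1 < \<gamma> * (q - 1) - DIM('a) * (q - p) / p"
  proof -
    have "DIM('a) * (q - p) / p \<le> q - p"
      using p pq mult_right_mono[of "real DIM('a)" p "q - p"] by (simp add: divide_simps mult.commute)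
    moreover have "\<gamma> * (q - 1) = q - 1 - (q - 1) / (2 * q)" by (simp add: \<gamma>_def algebra_simps diff_divide_distrib)
    moreover have "(q - 1) / (2 * q) < 1" using p pq by (simp add: divide_simps)
    ultimately show ?thesis using p pq by linarith
  qed
  obtain C where C: "0 \<le> C" "\<forall>f\<in>borel_measurable (borel :: 'a measure). \<forall>\<delta>>0.
    (\<integral>\<^sup>+x. epow (\<integral>\<^sup>+s\<in>{0<..<\<delta>}. ball_mean f s x \<partial>lborel) q \<partial>lborel)
      \<le> ennreal (C * \<delta> powr (q - DIM('a) * (q - p) / p)) * epow (\<integral>\<^sup>+x. epow (f x) p \<partial>lborel) (q / p)"
    using nn_integral_ball_mean_Lq[OF p(1) pq g01 \<beta>] by blast
  show ?thesis
  proof (intro exI[of _ "C + 1"] conjI allI impI)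
    show "0 < C + 1" using C by simp
    fix u :: "'a \<Rightarrow> real" and g R
    assume u: "loc_int u" and g: "loc_int g" and eq: "weak_grad_eq UNIV u g" and R: "(0::real) < R"
    note [measurable] = loc_int_measurable[OF u] loc_int_measurable[OF g]
    obtain E :: "nat \<Rightarrow> real" where E: "\<And>k. 0 < E k" "AE x in lborel. (\<lambda>k. mollify (E k) u x) \<longlonglongrightarrow> u x"
      "\<And>x R. (\<lambda>k. ball_avg (mollify (E k) u) R x) \<longlonglongrightarrow> ball_avg u R x"
      by (rule mollify_sequence[OF u zero_less_one]) blast
    have ug: "upper_gradient UNIV (mollify (E k) u) (mollify_norm (E k) g)" for k
      by (rule upper_gradient_mollify[OF u g eq E(1)]) auto
    note [measurable] = upper_gradientD(2,3)[OF ug]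
    show "(\<integral>\<^sup>+x. epow (ennreal \<bar>u x - ball_avg u R x\<bar>) q \<partial>lborel)
      \<le> ennreal ((C + 1) * R powr (q - DIM('a) * (q - p) / p)) * epow (\<integral>\<^sup>+x. epow (ennreal (norm (g x))) p \<partial>lborel) (q / p)"
    proof (rule nn_integral_Fatou_bound)
      show "(\<lambda>x. epow (ennreal \<bar>mollify (E k) u x - ball_avg (mollify (E k) u) R x\<bar>) q) \<in> borel_measurable lborel" for k
        by measurable
      show "AE x in lborel. (\<lambda>k. epow (ennreal \<bar>mollify (E k) u x - ball_avg (mollify (E k) u) R x\<bar>) q) \<longlonglongrightarrow> epow (ennreal \<bar>u x - ball_avg u R x\<bar>) q"
        using E(2) by eventually_elim (use p pq E(3) in \<open>auto intro!: tendsto_epow_abs tendsto_diff simp del: epow_ennreal\<close>)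
      fix k
      have "(\<integral>\<^sup>+x. epow (ennreal \<bar>mollify (E k) u x - ball_avg (mollify (E k) u) R x\<bar>) q \<partial>lborel)
        \<le> (\<integral>\<^sup>+x. epow (\<integral>\<^sup>+s\<in>{0<..<R}. ball_mean (mollify_norm (E k) g) s x \<partial>lborel) q \<partial>lborel)"
        using p pq R by (intro nn_integral_mono epow_mono upper_gradient_diff_ball_avg ug) auto
      also have "\<dots> \<le> ennreal (C * R powr (q - DIM('a) * (q - p) / p)) * epow (\<integral>\<^sup>+x. epow (mollify_norm (E k) g x) p \<partial>lborel) (q / p)"
        by (rule C(2)[rule_format, OF _ R]) measurable
      also have "\<dots> \<le> ennreal ((C + 1) * R powr (q - DIM('a) * (q - p) / p)) * epow (\<integral>\<^sup>+x. epow (ennreal (norm (g x))) p \<partial>lborel) (q / p)"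
        using p pq E C(1) by (intro mult_mono ennreal_leI mult_right_mono epow_mono nn_integral_mollify_norm_le) auto
      finally show "(\<integral>\<^sup>+x. epow (ennreal \<bar>mollify (E k) u x - ball_avg (mollify (E k) u) R x\<bar>) q \<partial>lborel) \<le> ennreal ((C + 1) * R powr (q - DIM('a) * (q - p) / p)) * epow (\<integral>\<^sup>+x. epow (ennreal (norm (g x))) p \<partial>lborel) (q / p)" .
    qed
  qed
qed

text \<open>Since p > n, the bound s^(-n/p) on the ball means is integrable at 0, so the potential
  is bounded pointwise: this is Morrey's estimate.\<close>

lemma diff_ball_avg_sup_weak:
  fixes u :: "'a::euclidean_space \<Rightarrow> real" and p :: real
  assumes u: "loc_int u" and g: "loc_int g" and eq: "weak_grad_eq UNIV u g" and R: "0 < R" and p: "1 \<le> p" "DIM('a) < p"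
  shows "AE x in lborel. ennreal \<bar>u x - ball_avg u R x\<bar>
    \<le> ennreal (ball_volume TYPE('a) 1 powr (-1/p) / (1 - DIM('a) / p) * R powr (1 - DIM('a) / p)) * epow (\<integral>\<^sup>+x. epow (ennreal (norm (g x))) p \<partial>lborel) (1/p)"
    (is "AE x in _. _ \<le> ?c * epow ?N (1/p)")
proof -
  note [measurable] = loc_int_measurable[OF g]
  define V where "V = ball_volume TYPE('a) 1 powr (-1/p)"
  define n where "n = DIM('a) / p"
  have n: "n < 1" using p by (simp add: n_def)
  have V: "0 \<le> V" by (simp add: V_def)
  obtain E :: "nat \<Rightarrow> real" where E: "\<And>k. 0 < E k" "AE x in lborel. (\<lambda>k. mollify (E k) u x) \<longlonglongrightarrow> u x"
    "\<And>x R. (\<lambda>k. ball_avg (mollify (E k) u) R x) \<longlonglongrightarrow> ball_avg u R x"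
    by (rule mollify_sequence[OF u zero_less_one]) blast
  have le: "ennreal \<bar>mollify (E k) u x - ball_avg (mollify (E k) u) R x\<bar> \<le> ?c * epow ?N (1/p)" for k x
  proof -
    have ug: "upper_gradient UNIV (mollify (E k) u) (mollify_norm (E k) g)"
      by (rule upper_gradient_mollify[OF u g eq E(1)]) auto
    note [measurable] = upper_gradientD(2,3)[OF ug]
    have "ennreal \<bar>mollify (E k) u x - ball_avg (mollify (E k) u) R x\<bar> \<le> (\<integral>\<^sup>+s\<in>{0<..<R}. ball_mean (mollify_norm (E k) g) s x \<partial>lborel)"
      by (rule upper_gradient_diff_ball_avg[OF ug R])
    also have "\<dots> \<le> (\<integral>\<^sup>+s. ennreal V * epow ?N (1/p) * (ennreal (s powr (-n)) * indicator {0<..<R} s) \<partial>lborel)"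
    proof (rule nn_integral_mono)
      fix s
      show "ball_mean (mollify_norm (E k) g) s x * indicator {0<..<R} s \<le> ennreal V * epow ?N (1/p) * (ennreal (s powr (-n)) * indicator {0<..<R} s)"
      proof (cases "s \<in> {0<..<R}")
        case True
        then have "ball_mean (mollify_norm (E k) g) s x \<le> ennreal (V * s powr (-n)) * epow (\<integral>\<^sup>+x. epow (mollify_norm (E k) g x) p \<partial>lborel) (1/p)"
          unfolding V_def n_def using ball_mean_bound[of "mollify_norm (E k) g" p s x] p by simp
        also have "\<dots> \<le> ennreal (V * s powr (-n)) * epow ?N (1/p)"
          using p E by (intro mult_left_mono epow_mono nn_integral_mollify_norm_le) auto
        finally show ?thesis using True V by (simp add: ennreal_mult mult_ac)
      qed simp
    qed
    also have "\<dots> = ennreal V * epow ?N (1/p) * (\<integral>\<^sup>+s\<in>{0<..<R}. ennreal (s powr (-n)) \<partial>lborel)"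
      by (simp add: nn_integral_cmult)
    also have "\<dots> \<le> ennreal V * epow ?N (1/p) * ennreal (R powr (-n + 1) / (-n + 1))"
      using n R by (intro mult_left_mono nn_integral_powr_from_0_le) auto
    also have "\<dots> = ennreal (V * (R powr (-n + 1) / (-n + 1))) * epow ?N (1/p)"
      using V n by (subst ennreal_mult) (auto simp: mult_ac)
    also have "V * (R powr (-n + 1) / (-n + 1)) = V / (1 - n) * R powr (1 - n)" by simp
    finally show ?thesis by (simp add: V_def n_def)
  qed
  show ?thesis
    using E(2)
  proof eventually_elim
    fix x assume "(\<lambda>k. mollify (E k) u x) \<longlonglongrightarrow> u x"
    then have "(\<lambda>k. ennreal \<bar>mollify (E k) u x - ball_avg (mollify (E k) u) R x\<bar>) \<longlonglongrightarrow> ennreal \<bar>u x - ball_avg u R x\<bar>"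
      by (intro tendsto_ennrealI tendsto_rabs tendsto_diff E)
    then show "ennreal \<bar>u x - ball_avg u R x\<bar> \<le> ?c * epow ?N (1/p)"
      using le LIMSEQ_le_const2 by blast
  qed
qed

text \<open>Fatou is applied twice, in y for almost every fixed x and then in x. The margin
  \<open>e0\<close> keeps all mollification kernels inside \<Omega>.\<close>

lemma poincare_ball_weak:
  fixes u :: "'a::euclidean_space \<Rightarrow> real"
  assumes u: "loc_int u" and g: "loc_int g" and eq: "weak_grad_eq \<Omega> u g" and R: "0 < R" and p: "1 \<le> p"
    and e0: "0 < e0" and sub: "\<And>x. x \<in> ball x0 R \<Longrightarrow> cball x e0 \<subseteq> \<Omega>"
  shows "(\<integral>\<^sup>+x\<in>ball x0 R. (\<integral>\<^sup>+y\<in>ball x0 R. epow (ennreal \<bar>u y - u x\<bar>) p \<partial>lborel) \<partial>lborel)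
    \<le> ennreal ((2 * R) powr p * ball_volume TYPE('a) (2 * R)) * (\<integral>\<^sup>+x. epow (ennreal (norm (g x))) p \<partial>lborel)"
    (is "_ \<le> ?c * ?N")
proof -
  let ?B = "ball x0 R"
  have [measurable]: "?B \<in> sets borel" by simp
  note [measurable] = loc_int_measurable[OF u] loc_int_measurable[OF g]
  obtain E :: "nat \<Rightarrow> real" where E: "\<And>k. 0 < E k" "\<And>k. E k < e0" "AE x in lborel. (\<lambda>k. mollify (E k) u x) \<longlonglongrightarrow> u x"
    by (rule mollify_sequence[OF u e0]) blast
  have ug: "upper_gradient ?B (mollify (E k) u) (mollify_norm (E k) g)" for k
  proof (rule upper_gradient_mollify[OF u g eq E(1)])
    fix x assume "x \<in> ?B"
    then show "cball x (E k) \<subseteq> \<Omega>" using sub[of x] E(2)[of k] subset_cball[of "E k" e0 x] by auto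
  qed
  note [measurable] = upper_gradientD(2)[OF ug]
  define H where "H k x = (\<integral>\<^sup>+y. epow (ennreal \<bar>mollify (E k) u y - mollify (E k) u x\<bar>) p * indicator ?B y \<partial>lborel)" for k x
  have [measurable]: "H k \<in> borel_measurable borel" for k unfolding H_def by measurable
  have "AE x in lborel. (\<integral>\<^sup>+y. epow (ennreal \<bar>u y - u x\<bar>) p * indicator ?B y \<partial>lborel) \<le> liminf (\<lambda>k. H k x)"
    using E(3)
  proof eventually_elim
    fix x assume x: "(\<lambda>k. mollify (E k) u x) \<longlonglongrightarrow> u x"
    have "(\<integral>\<^sup>+y. epow (ennreal \<bar>u y - u x\<bar>) p * indicator ?B y \<partial>lborel)
       = (\<integral>\<^sup>+y. liminf (\<lambda>k. epow (ennreal \<bar>mollify (E k) u y - mollify (E k) u x\<bar>) p * indicator ?B y) \<partial>lborel)"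
    proof (rule nn_integral_cong_AE)
      show "AE y in lborel. epow (ennreal \<bar>u y - u x\<bar>) p * indicator ?B y = liminf (\<lambda>k. epow (ennreal \<bar>mollify (E k) u y - mollify (E k) u x\<bar>) p * indicator ?B y)"
        using E(3)
      proof eventually_elim
        fix y assume y: "(\<lambda>k. mollify (E k) u y) \<longlonglongrightarrow> u y"
        have "(\<lambda>k. epow (ennreal \<bar>mollify (E k) u y - mollify (E k) u x\<bar>) p) \<longlonglongrightarrow> epow (ennreal \<bar>u y - u x\<bar>) p"
          using p by (intro tendsto_epow_abs tendsto_diff x y) auto
        then have "(\<lambda>k. epow (ennreal \<bar>mollify (E k) u y - mollify (E k) u x\<bar>) p * indicator ?B y) \<longlonglongrightarrow> epow (ennreal \<bar>u y - u x\<bar>) p * indicator ?B y"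
          by (auto simp: indicator_def)
        then show "epow (ennreal \<bar>u y - u x\<bar>) p * indicator ?B y = liminf (\<lambda>k. epow (ennreal \<bar>mollify (E k) u y - mollify (E k) u x\<bar>) p * indicator ?B y)"
          by (rule lim_imp_Liminf[OF trivial_limit_sequentially, symmetric])
      qed
    qed
    also have "\<dots> \<le> liminf (\<lambda>k. H k x)" unfolding H_def by (rule nn_integral_liminf) measurable
    finally show "(\<integral>\<^sup>+y. epow (ennreal \<bar>u y - u x\<bar>) p * indicator ?B y \<partial>lborel) \<le> liminf (\<lambda>k. H k x)" .
  qed
  then have "(\<integral>\<^sup>+x\<in>?B. (\<integral>\<^sup>+y\<in>?B. epow (ennreal \<bar>u y - u x\<bar>) p \<partial>lborel) \<partial>lborel) \<le> (\<integral>\<^sup>+x. liminf (\<lambda>k. H k x * indicator ?B x) \<partial>lborel)"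
    by (intro nn_integral_mono_AE) (auto elim!: eventually_mono simp: indicator_def)
  also have "\<dots> \<le> liminf (\<lambda>k. \<integral>\<^sup>+x. H k x * indicator ?B x \<partial>lborel)" by (rule nn_integral_liminf) measurable
  also have "\<dots> \<le> ?c * ?N"
  proof -
    have "(\<integral>\<^sup>+x. H k x * indicator ?B x \<partial>lborel) \<le> ?c * ?N" for k
    proof -
      have "(\<integral>\<^sup>+x. H k x * indicator ?B x \<partial>lborel) \<le> ?c * (\<integral>\<^sup>+x\<in>?B. epow (mollify_norm (E k) g x) p \<partial>lborel)"
        unfolding H_def by (rule upper_gradient_poincare_ball[OF ug R p])
      also have "\<dots> \<le> ?c * (\<integral>\<^sup>+x. epow (mollify_norm (E k) g x) p \<partial>lborel)"
        by (intro mult_left_mono nn_integral_mono) (auto simp: indicator_def)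
      also have "\<dots> \<le> ?c * ?N" using p E by (intro mult_left_mono nn_integral_mollify_norm_le) auto
      finally show ?thesis .
    qed
    then show ?thesis by (intro Liminf_le) auto
  qed
  finally show ?thesis .
qed

section \<open>Borel representatives\<close>

text \<open>Functions in \<open>Lp_space\<close> are measurable only for the completed measure,
  while the translations and exchanges of integrals above are stated for Borel functions and
  \<open>lborel\<close>.\<close>

definition borel_rep :: "'a::euclidean_space set \<Rightarrow> ('a \<Rightarrow> 'b::euclidean_space) \<Rightarrow> ('a \<Rightarrow> 'b) \<Rightarrow> bool" where
  "borel_rep \<Omega> f f' \<longleftrightarrow> f' \<in> borel_measurable borel \<and> (\<forall>x. x \<notin> \<Omega> \<longrightarrow> f' x = 0) \<and> (AE x in lborel. x \<in> \<Omega> \<longrightarrow> f x = f' x)"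

lemma borel_rep_self: "f \<in> borel_measurable borel \<Longrightarrow> (\<And>x. x \<notin> \<Omega> \<Longrightarrow> f x = 0) \<Longrightarrow> borel_rep \<Omega> f f"
  by (simp add: borel_rep_def)

lemma borel_rep_exists:
  fixes f :: "'a::euclidean_space \<Rightarrow> 'b::euclidean_space"
  assumes \<Omega>: "\<Omega> \<in> sets borel" and f: "f \<in> borel_measurable (lebesgue_on \<Omega>)"
  shows "\<exists>f'. borel_rep \<Omega> f f'"
proof -
  note [measurable] = \<Omega>
  have m: "(\<lambda>x. if x \<in> \<Omega> then f x else 0) \<in> borel_measurable lebesgue"
    using f \<Omega> by (subst borel_measurable_if) auto
  have "\<forall>b\<in>Basis. \<exists>h\<in>borel_measurable lborel. AE x in lborel. (if x \<in> \<Omega> then f x else 0) \<bullet> b = h x"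
    using m by (intro ballI completion_ex_borel_measurable_real) auto
  then obtain h where h: "\<And>b. b \<in> Basis \<Longrightarrow> h b \<in> borel_measurable lborel"
    "\<And>b. b \<in> Basis \<Longrightarrow> AE x in lborel. (if x \<in> \<Omega> then f x else 0) \<bullet> b = h b x" by metis
  define f' where "f' x = indicator \<Omega> x *\<^sub>R (\<Sum>b\<in>Basis. h b x *\<^sub>R b)" for x
  have "f' \<in> borel_measurable borel"
    unfolding f'_def using h(1) by (intro borel_measurable_scaleR borel_measurable_sum) auto
  moreover have "AE x in lborel. \<forall>b\<in>Basis. (if x \<in> \<Omega> then f x else 0) \<bullet> b = h b x"
    using h(2) by (simp add: AE_finite_all)
  then have "AE x in lborel. x \<in> \<Omega> \<longrightarrow> f x = f' x"
  proof eventually_elim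
    fix x assume *: "\<forall>b\<in>Basis. (if x \<in> \<Omega> then f x else 0) \<bullet> b = h b x"
    show "x \<in> \<Omega> \<longrightarrow> f x = f' x"
      using * euclidean_representation[of "f x"] by (auto simp: f'_def)
  qed
  ultimately show ?thesis by (auto simp: borel_rep_def f'_def)
qed

lemma lebesgue_measurable_AE:
  fixes f g :: "'a::euclidean_space \<Rightarrow> 'b::euclidean_space"
  assumes g: "g \<in> borel_measurable lebesgue" and ae: "AE x in lebesgue. f x = g x"
  shows "f \<in> borel_measurable lebesgue"
proof (rule measurableI)
  fix A :: "'b set" assume A: "A \<in> sets borel"
  have 1: "g -` A \<inter> space lebesgue \<in> sets lebesgue" by (rule measurable_sets[OF g A])
  have 2: "AE x in lebesgue. x \<in> g -` A \<inter> space lebesgue \<longleftrightarrow> x \<in> f -` A \<inter> space lebesgue"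
    using ae by eventually_elim auto
  show "f -` A \<inter> space lebesgue \<in> sets lebesgue"
    by (rule completion.in_sets_AE[OF 2 1]) auto
qed auto

lemma borel_rep_measurable:
  fixes f :: "'a::euclidean_space \<Rightarrow> 'b::euclidean_space"
  assumes \<Omega>: "\<Omega> \<in> sets borel" and rep: "borel_rep \<Omega> f f'"
  shows "f \<in> borel_measurable (lebesgue_on \<Omega>)"
proof -
  have "f' \<in> borel_measurable lebesgue" using rep by (auto simp: borel_rep_def intro: measurable_completion)
  moreover have "AE x in lborel. (if x \<in> \<Omega> then f x else 0) = f' x"
    using rep by (auto simp: borel_rep_def elim!: eventually_mono)
  then have "AE x in lebesgue. (if x \<in> \<Omega> then f x else 0) = f' x" by (rule AE_completion)
  ultimately have "(\<lambda>x. if x \<in> \<Omega> then f x else 0) \<in> borel_measurable lebesgue" by (rule lebesgue_measurable_AE)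
  then show ?thesis by (rule borel_measurable_if_D)
qed

lemma borel_rep_nn_integral:
  assumes \<Omega>: "\<Omega> \<in> sets borel" and rep: "borel_rep \<Omega> f f'"
  shows "(\<integral>\<^sup>+x. h (f x) \<partial>lebesgue_on \<Omega>) = (\<integral>\<^sup>+x. h (f' x) * indicator \<Omega> x \<partial>lborel)"
proof -
  have "(\<integral>\<^sup>+x. h (f x) \<partial>lebesgue_on \<Omega>) = (\<integral>\<^sup>+x. h (f x) * indicator \<Omega> x \<partial>lborel)"
    using \<Omega> by (simp add: nn_integral_restrict_space nn_integral_completion)
  also have "\<dots> = (\<integral>\<^sup>+x. h (f' x) * indicator \<Omega> x \<partial>lborel)"
    using rep by (intro nn_integral_cong_AE) (auto simp: borel_rep_def indicator_def elim!: eventually_mono)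
  finally show ?thesis .
qed

lemma borel_rep_integral:
  fixes F :: "'b::euclidean_space \<Rightarrow> 'a::euclidean_space \<Rightarrow> real"
  assumes \<Omega>: "\<Omega> \<in> sets borel" and rep: "borel_rep \<Omega> f f'"
    and m: "(\<lambda>x. indicator \<Omega> x *\<^sub>R F (f' x) x) \<in> borel_measurable borel"
  shows "(LINT x|lebesgue_on \<Omega>. F (f x) x) = (LINT x|lborel. indicator \<Omega> x *\<^sub>R F (f' x) x)"
    and "integrable (lebesgue_on \<Omega>) (\<lambda>x. F (f x) x) \<longleftrightarrow> integrable lborel (\<lambda>x. indicator \<Omega> x *\<^sub>R F (f' x) x)"
proof -
  have m': "(\<lambda>x. indicator \<Omega> x *\<^sub>R F (f' x) x) \<in> borel_measurable lebesgue"
    using m by (auto intro: measurable_completion)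
  have ae: "AE x in lebesgue. indicator \<Omega> x *\<^sub>R F (f x) x = indicator \<Omega> x *\<^sub>R F (f' x) x"
    using rep by (intro AE_completion) (auto simp: borel_rep_def indicator_def elim!: eventually_mono)
  have m'': "(\<lambda>x. indicator \<Omega> x *\<^sub>R F (f x) x) \<in> borel_measurable lebesgue"
    by (rule lebesgue_measurable_AE[OF m' ae])
  have "(LINT x|lebesgue_on \<Omega>. F (f x) x) = (LINT x|lebesgue. indicator \<Omega> x *\<^sub>R F (f x) x)"
    using \<Omega> by (subst integral_restrict_space) auto
  also have "\<dots> = (LINT x|lebesgue. indicator \<Omega> x *\<^sub>R F (f' x) x)" by (rule integral_cong_AE[OF m'' m' ae])
  also have "\<dots> = (LINT x|lborel. indicator \<Omega> x *\<^sub>R F (f' x) x)" using m by (subst integral_completion) auto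
  finally show "(LINT x|lebesgue_on \<Omega>. F (f x) x) = (LINT x|lborel. indicator \<Omega> x *\<^sub>R F (f' x) x)" .
  have "integrable (lebesgue_on \<Omega>) (\<lambda>x. F (f x) x) \<longleftrightarrow> integrable lebesgue (\<lambda>x. indicator \<Omega> x *\<^sub>R F (f x) x)"
    using \<Omega> by (subst integrable_restrict_space) auto
  also have "\<dots> \<longleftrightarrow> integrable lebesgue (\<lambda>x. indicator \<Omega> x *\<^sub>R F (f' x) x)" by (rule integrable_cong_AE[OF m'' m' ae])
  also have "\<dots> \<longleftrightarrow> integrable lborel (\<lambda>x. indicator \<Omega> x *\<^sub>R F (f' x) x)" using m by (subst integrable_completion) auto
  finally show "integrable (lebesgue_on \<Omega>) (\<lambda>x. F (f x) x) \<longleftrightarrow> integrable lborel (\<lambda>x. indicator \<Omega> x *\<^sub>R F (f' x) x)" .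
qed

lemma borel_rep_powr:
  fixes f :: "'a::euclidean_space \<Rightarrow> 'b::euclidean_space"
  assumes \<Omega>: "\<Omega> \<in> sets borel" and rep: "borel_rep \<Omega> f f'" and p: "0 < p"
  shows "(\<integral>\<^sup>+x. ennreal (norm (f x) powr p) \<partial>lebesgue_on \<Omega>) = (\<integral>\<^sup>+x. epow (ennreal (norm (f' x))) p \<partial>lborel)"
proof -
  have "(\<integral>\<^sup>+x. ennreal (norm (f x) powr p) \<partial>lebesgue_on \<Omega>) = (\<integral>\<^sup>+x. ennreal (norm (f' x) powr p) * indicator \<Omega> x \<partial>lborel)"
    by (rule borel_rep_nn_integral[OF \<Omega> rep, of "\<lambda>y. ennreal (norm y powr p)"])
  also have "\<dots> = (\<integral>\<^sup>+x. epow (ennreal (norm (f' x))) p \<partial>lborel)"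
    using rep p by (intro nn_integral_cong) (auto simp: borel_rep_def indicator_def)
  finally show ?thesis .
qed

lemma borel_rep_Lp:
  fixes f :: "'a::euclidean_space \<Rightarrow> 'b::euclidean_space"
  assumes \<Omega>: "\<Omega> \<in> sets borel" and rep: "borel_rep \<Omega> f f'" and p: "0 < p"
  shows "f \<in> Lp_space \<Omega> (ereal p) \<longleftrightarrow> (\<integral>\<^sup>+x. epow (ennreal (norm (f' x))) p \<partial>lborel) < top"
    and "Lp_norm \<Omega> (ereal p) f = enn2real (\<integral>\<^sup>+x. epow (ennreal (norm (f' x))) p \<partial>lborel) powr (1/p)"
proof -
  note [measurable] = borel_rep_measurable[OF \<Omega> rep]
  have "f \<in> Lp_space \<Omega> (ereal p) \<longleftrightarrow> (\<integral>\<^sup>+x. ennreal (norm (f x) powr p) \<partial>lebesgue_on \<Omega>) < top"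
    by (simp add: Lp_space_def integrable_iff_bounded)
  then show "f \<in> Lp_space \<Omega> (ereal p) \<longleftrightarrow> (\<integral>\<^sup>+x. epow (ennreal (norm (f' x))) p \<partial>lborel) < top"
    unfolding borel_rep_powr[OF \<Omega> rep p] .
  have "(LINT x|lebesgue_on \<Omega>. norm (f x) powr p) = enn2real (\<integral>\<^sup>+x. ennreal (norm (f x) powr p) \<partial>lebesgue_on \<Omega>)"
    by (rule integral_eq_nn_integral) auto
  then show "Lp_norm \<Omega> (ereal p) f = enn2real (\<integral>\<^sup>+x. epow (ennreal (norm (f' x))) p \<partial>lborel) powr (1/p)"
    unfolding borel_rep_powr[OF \<Omega> rep p] by (simp add: Lp_norm_def)
qed

text \<open>On a ball the first power is controlled by t <= 1 + t^p.\<close>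

lemma Lp_loc_int:
  fixes f :: "'a::euclidean_space \<Rightarrow> 'b::euclidean_space"
  assumes [measurable]: "f \<in> borel_measurable borel" and p: "1 \<le> p"
    and fin: "(\<integral>\<^sup>+x. epow (ennreal (norm (f x))) p \<partial>lborel) < top"
  shows "loc_int f"
  unfolding loc_int_def
proof (intro conjI allI)
  fix x :: 'a and r :: real
  have [measurable]: "cball x r \<in> sets borel" by simp
  show "integrable lborel (\<lambda>y. indicator (cball x r) y *\<^sub>R f y)"
    unfolding integrable_iff_bounded
  proof
    have "(\<integral>\<^sup>+y. ennreal (norm (indicator (cball x r) y *\<^sub>R f y)) \<partial>lborel) \<le> (\<integral>\<^sup>+y. indicator (cball x r) y + epow (ennreal (norm (f y))) p \<partial>lborel)"
    proof (rule nn_integral_mono)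
      fix y
      have "norm (f y) \<le> 1 + norm (f y) powr p"
      proof (cases "norm (f y) \<le> 1")
        case False
        then have "norm (f y) powr 1 \<le> norm (f y) powr p" using p by (intro powr_mono) auto
        with False show ?thesis by simp
      qed (simp add: add_increasing2)
      then have "ennreal (norm (f y)) \<le> 1 + epow (ennreal (norm (f y))) p"
        by (simp add: ennreal_1[symmetric] ennreal_plus[symmetric] ennreal_leI del: ennreal_1 ennreal_plus)
      then show "ennreal (norm (indicator (cball x r) y *\<^sub>R f y)) \<le> indicator (cball x r) y + epow (ennreal (norm (f y))) p"
        by (auto simp: indicator_def)
    qed
    also have "\<dots> = emeasure lborel (cball x r) + (\<integral>\<^sup>+x. epow (ennreal (norm (f x))) p \<partial>lborel)"
      by (simp add: nn_integral_add)
    also have "\<dots> < \<infinity>" using fin emeasure_lborel_cball_finite[of x r] by auto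
    finally show "(\<integral>\<^sup>+y. ennreal (norm (indicator (cball x r) y *\<^sub>R f y)) \<partial>lborel) < \<infinity>" .
  qed measurable
qed simp

section \<open>Test functions and uniqueness of weak gradients\<close>

lemma test_function_facts:
  assumes "test_function \<Omega> \<phi>"
  shows "continuous_on UNIV \<phi>" "\<phi> \<in> borel_measurable borel"
    "b \<in> Basis \<Longrightarrow> continuous_on UNIV (\<lambda>y. frechet_derivative \<phi> (at y) b)"
    "b \<in> Basis \<Longrightarrow> (\<lambda>y. frechet_derivative \<phi> (at y) b) \<in> borel_measurable borel"
    "\<phi> differentiable (at y)" "\<phi> y \<noteq> 0 \<Longrightarrow> y \<in> \<Omega>" "y \<notin> \<Omega> \<Longrightarrow> frechet_derivative \<phi> (at y) b = 0"
    "compact (closure {x. \<phi> x \<noteq> 0})"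
proof -
  have C: "Ck k \<phi>" for k using assms by (simp add: test_function_def)
  show 1: "continuous_on UNIV \<phi>" using C[of 0] by simp
  then show "\<phi> \<in> borel_measurable borel" by (rule borel_measurable_continuous_onI)
  have C1: "Ck (Suc 0) \<phi>" by (rule C)
  show 2: "continuous_on UNIV (\<lambda>y. frechet_derivative \<phi> (at y) b)" if "b \<in> Basis" for b using C1 that by simp
  then show "(\<lambda>y. frechet_derivative \<phi> (at y) b) \<in> borel_measurable borel" if "b \<in> Basis" for b
    using that by (intro borel_measurable_continuous_onI) auto
  show "\<phi> differentiable (at y)" using C1 by simp
  have sub: "closure {x. \<phi> x \<noteq> 0} \<subseteq> \<Omega>" using assms by (simp add: test_function_def)
  show "y \<in> \<Omega>" if "\<phi> y \<noteq> 0" using that sub closure_subset[of "{x. \<phi> x \<noteq> 0}"] by blast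
  show "compact (closure {x. \<phi> x \<noteq> 0})" using assms by (simp add: test_function_def)
  show "frechet_derivative \<phi> (at y) b = 0" if "y \<notin> \<Omega>"
  proof -
    have y: "y \<in> - closure {x. \<phi> x \<noteq> 0}" using that sub by auto
    have "((\<lambda>_. 0) has_derivative (\<lambda>_. 0)) (at y)" by (rule has_derivative_const)
    then have "(\<phi> has_derivative (\<lambda>_. 0)) (at y)"
      by (rule has_derivative_transform_within_open[OF _ _ y]) (use closure_subset[of "{x. \<phi> x \<noteq> 0}"] in auto)
    then show ?thesis using frechet_derivative_at by metis
  qed
qed

lemma weak_gradient_rep_eq:
  fixes \<Omega> :: "'a::euclidean_space set"
  assumes \<Omega>: "open \<Omega>" and u: "borel_rep \<Omega> u u'" and g: "borel_rep \<Omega> g g'"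
  shows "(\<forall>\<phi>. test_function \<Omega> \<phi> \<longrightarrow> (\<forall>b\<in>Basis.
        (\<integral>x. u x * frechet_derivative \<phi> (at x) b \<partial>lebesgue_on \<Omega>)
          = - (\<integral>x. (g x \<bullet> b) * \<phi> x \<partial>lebesgue_on \<Omega>))) \<longleftrightarrow> weak_grad_eq \<Omega> u' g'"
proof -
  have O: "\<Omega> \<in> sets borel" using \<Omega> by simp
  have z: "\<And>x. x \<notin> \<Omega> \<Longrightarrow> u' x = 0" "\<And>x. x \<notin> \<Omega> \<Longrightarrow> g' x = 0"
    and [measurable]: "u' \<in> borel_measurable borel" "g' \<in> borel_measurable borel"
    using u g by (auto simp: borel_rep_def)
  have "(\<integral>x. u x * frechet_derivative \<phi> (at x) b \<partial>lebesgue_on \<Omega>) = (LINT y|lborel. u' y * frechet_derivative \<phi> (at y) b)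
    \<and> (\<integral>x. (g x \<bullet> b) * \<phi> x \<partial>lebesgue_on \<Omega>) = (LINT y|lborel. (g' y \<bullet> b) * \<phi> y)"
    if "test_function \<Omega> \<phi>" "b \<in> Basis" for \<phi> b
  proof
    note [measurable] = test_function_facts(2)[OF that(1)] test_function_facts(4)[OF that]
    have i: "(\<lambda>x. indicator \<Omega> x *\<^sub>R (u' x * frechet_derivative \<phi> (at x) b)) = (\<lambda>x. u' x * frechet_derivative \<phi> (at x) b)"
      "(\<lambda>x. indicator \<Omega> x *\<^sub>R ((g' x \<bullet> b) * \<phi> x)) = (\<lambda>x. (g' x \<bullet> b) * \<phi> x)"
      using z by (auto simp: indicator_def fun_eq_iff)
    show "(\<integral>x. u x * frechet_derivative \<phi> (at x) b \<partial>lebesgue_on \<Omega>) = (LINT y|lborel. u' y * frechet_derivative \<phi> (at y) b)"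
      using borel_rep_integral(1)[OF O u, of "\<lambda>v x. v * frechet_derivative \<phi> (at x) b"] by (simp add: i(1)[simplified])
    show "(\<integral>x. (g x \<bullet> b) * \<phi> x \<partial>lebesgue_on \<Omega>) = (LINT y|lborel. (g' y \<bullet> b) * \<phi> y)"
      using borel_rep_integral(1)[OF O g, of "\<lambda>v x. (v \<bullet> b) * \<phi> x"] by (simp add: i(2)[simplified])
  qed
  then show ?thesis unfolding weak_grad_eq_def by auto
qed

lemma loc_int_locally_integrable:
  fixes f :: "'a::euclidean_space \<Rightarrow> 'b::euclidean_space"
  assumes \<Omega>: "open \<Omega>" and rep: "borel_rep \<Omega> f f'" and loc: "loc_int f'"
  shows "locally_integrable \<Omega> f"
  unfolding locally_integrable_def
proof (intro allI impI)
  fix K :: "'a set" assume K: "compact K \<and> K \<subseteq> \<Omega>"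
  then have [measurable]: "K \<in> sets borel" by (simp add: compact_imp_closed)
  note [measurable] = loc_int_measurable[OF loc]
  obtain r where "K \<subseteq> ball 0 r" using K compact_imp_bounded bounded_subset_ballD by metis
  then have r: "K \<subseteq> cball 0 r" using ball_subset_cball by blast
  have c: "integrable lborel (\<lambda>y. indicator (cball 0 r) y *\<^sub>R f' y)"
    using loc unfolding loc_int_def by blast
  have "integrable lborel (\<lambda>y. indicator K y *\<^sub>R (indicator (cball 0 r) y *\<^sub>R f' y))"
    by (rule integrable_mult_indicator[OF _ c]) simp
  also have "(\<lambda>y. indicator K y *\<^sub>R (indicator (cball 0 r) y *\<^sub>R f' y)) = (\<lambda>y. indicator K y *\<^sub>R f' y)"
    using r by (auto simp: indicator_def fun_eq_iff)
  finally have i: "integrable lebesgue (\<lambda>y. indicator K y *\<^sub>R f' y)" by (subst integrable_completion) auto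
  have ae: "AE y in lebesgue. indicator K y *\<^sub>R f y = indicator K y *\<^sub>R f' y"
    using rep K by (intro AE_completion) (auto simp: borel_rep_def indicator_def elim!: eventually_mono)
  have m: "(\<lambda>y. indicator K y *\<^sub>R f y) \<in> borel_measurable lebesgue"
    by (rule lebesgue_measurable_AE[OF borel_measurable_integrable[OF i] ae])
  show "set_integrable lebesgue K f"
    unfolding set_integrable_def using integrable_cong_AE[OF m borel_measurable_integrable[OF i] ae] i by simp
qed

text \<open>Small kernels centred in the ball have their support in the doubled ball and are test
  functions, so the difference of the two gradients has zero mollifications there; these converge to
  it almost everywhere.\<close>

lemma weak_gradient_unique_ball:
  fixes \<Omega> :: "'a::euclidean_space set"
  assumes \<Omega>: "open \<Omega>" and g1: "has_weak_gradient \<Omega> u g1" and g2: "has_weak_gradient \<Omega> u g2"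
    and r: "0 < r" and sub: "cball x0 (2 * r) \<subseteq> \<Omega>" and b: "b \<in> Basis"
  shows "AE x in lborel. x \<in> ball x0 r \<longrightarrow> g1 x \<bullet> b = g2 x \<bullet> b"
proof -
  let ?B = "cball x0 (2 * r)"
  have [measurable]: "?B \<in> sets borel" "\<Omega> \<in> sets borel" using \<Omega> by auto
  define h where "h x = indicator ?B x *\<^sub>R (g1 x \<bullet> b - g2 x \<bullet> b)" for x
  have int: "integrable lebesgue (\<lambda>x. indicator ?B x *\<^sub>R (g x \<bullet> b))" if "has_weak_gradient \<Omega> u g" for g
  proof -
    have "integrable lebesgue (\<lambda>x. indicator ?B x *\<^sub>R g x)"
      using that sub by (auto simp: has_weak_gradient_def locally_integrable_def set_integrable_def)
    then have "integrable lebesgue (\<lambda>x. (indicator ?B x *\<^sub>R g x) \<bullet> b)" by (rule integrable_inner_left)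
    then show ?thesis by simp
  qed
  have hint: "integrable lebesgue h"
    using Bochner_Integration.integrable_diff[OF int[OF g1] int[OF g2]] unfolding h_def by (simp add: right_diff_distrib)
  obtain h' where [measurable]: "h' \<in> borel_measurable lborel" and h': "AE x in lborel. h x = h' x"
    using completion_ex_borel_measurable_real[OF borel_measurable_integrable[OF hint]] by blast
  have h'int: "integrable lborel h'"
  proof -
    have mh: "h' \<in> borel_measurable lebesgue" by (rule measurable_completion) simp
    have "integrable lebesgue h'"
      using integrable_cong_AE[OF borel_measurable_integrable[OF hint] mh AE_completion[OF h']] hint by blast
    then show ?thesis by (subst (asm) integrable_completion) auto
  qed
  have lh: "loc_int h'"
    using integrable_mult_indicator[OF _ h'int] by (simp add: loc_int_def)
  have zero: "mollify e h' x = 0" if x: "x \<in> ball x0 r" and e: "0 < e" "e < r" for x e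
  proof -
    have cb: "cball x e \<subseteq> ?B"
    proof
      fix y assume "y \<in> cball x e"
      then show "y \<in> ?B" using dist_triangle[of x0 y x] x e by auto
    qed
    then have sb: "cball x e \<subseteq> \<Omega>" using sub by blast
    let ?\<phi> = "\<lambda>y. moll e (y - x)"
    have bump: "smooth_bump x e ?\<phi>" by (rule smooth_bump_moll)
    have tf: "test_function \<Omega> ?\<phi>" using smooth_bump_test_function[OF bump _ sb] e by simp
    have \<phi>0: "?\<phi> y = 0" if "y \<notin> ?B" for y
    proof -
      have "y \<notin> cball x e" using that cb by auto
      then show ?thesis using smooth_bump_zero[OF bump, of y] e by simp
    qed
    obtain K where K: "\<And>y. \<bar>?\<phi> y\<bar> \<le> K" using smooth_bump_bounded[OF bump] e by (metis less_imp_le)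
    have mb: "?\<phi> \<in> borel_measurable lebesgue" using smooth_bump_measurable[OF bump] by (auto intro: measurable_completion)
    have i\<phi>: "integrable lebesgue (\<lambda>y. indicator ?B y *\<^sub>R (g y \<bullet> b) * ?\<phi> y)" if "has_weak_gradient \<Omega> u g" for g
    proof (rule Bochner_Integration.integrable_bound)
      show "integrable lebesgue (\<lambda>y. K * (indicator ?B y *\<^sub>R (g y \<bullet> b)))" by (intro integrable_mult_right int that)
      show "(\<lambda>y. indicator ?B y *\<^sub>R (g y \<bullet> b) * ?\<phi> y) \<in> borel_measurable lebesgue"
        by (intro borel_measurable_times mb borel_measurable_integrable[OF int[OF that]])
      have "0 \<le> K" using K[of 0] by linarith
      then show "AE y in lebesgue. norm (indicator ?B y *\<^sub>R (g y \<bullet> b) * ?\<phi> y) \<le> norm (K * (indicator ?B y *\<^sub>R (g y \<bullet> b)))"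
        using K by (intro AE_I2) (simp add: abs_mult mult.commute mult_right_mono mult_left_mono)
    qed
    have eq: "(LINT y|lebesgue. indicator ?B y *\<^sub>R (g y \<bullet> b) * ?\<phi> y) = - (\<integral>x. u x * frechet_derivative ?\<phi> (at x) b \<partial>lebesgue_on \<Omega>)"
      if "has_weak_gradient \<Omega> u g" for g
    proof -
      have "(LINT y|lebesgue. indicator ?B y *\<^sub>R (g y \<bullet> b) * ?\<phi> y) = (LINT y|lebesgue. indicator \<Omega> y *\<^sub>R ((g y \<bullet> b) * ?\<phi> y))"
        using \<phi>0 sub by (intro Bochner_Integration.integral_cong) (auto simp: indicator_def)
      also have "\<dots> = (\<integral>x. (g x \<bullet> b) * ?\<phi> x \<partial>lebesgue_on \<Omega>)" by (subst integral_restrict_space) auto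
      also have "\<dots> = - (\<integral>x. u x * frechet_derivative ?\<phi> (at x) b \<partial>lebesgue_on \<Omega>)"
        using that tf b by (simp add: has_weak_gradient_def)
      finally show ?thesis .
    qed
    have "mollify e h' x = (LINT y|lebesgue. h' y * ?\<phi> y)"
      unfolding mollify_def using smooth_bump_measurable[OF bump] by (subst integral_completion) (auto simp: moll_minus[of e x])
    also have "\<dots> = (LINT y|lebesgue. indicator ?B y *\<^sub>R (g1 y \<bullet> b) * ?\<phi> y - indicator ?B y *\<^sub>R (g2 y \<bullet> b) * ?\<phi> y)"
    proof (rule integral_cong_AE)
      show "(\<lambda>y. h' y * ?\<phi> y) \<in> borel_measurable lebesgue"
        by (intro borel_measurable_times mb measurable_completion) simp
      show "(\<lambda>y. indicator ?B y *\<^sub>R (g1 y \<bullet> b) * ?\<phi> y - indicator ?B y *\<^sub>R (g2 y \<bullet> b) * ?\<phi> y) \<in> borel_measurable lebesgue"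
        by (intro borel_measurable_diff borel_measurable_integrable[OF i\<phi>] g1 g2)
      show "AE y in lebesgue. h' y * ?\<phi> y = indicator ?B y *\<^sub>R (g1 y \<bullet> b) * ?\<phi> y - indicator ?B y *\<^sub>R (g2 y \<bullet> b) * ?\<phi> y"
        using AE_completion[OF h']
      proof eventually_elim
        fix y assume "h y = h' y"
        then have "h' y = indicator ?B y *\<^sub>R (g1 y \<bullet> b - g2 y \<bullet> b)" by (simp add: h_def)
        then show "h' y * ?\<phi> y = indicator ?B y *\<^sub>R (g1 y \<bullet> b) * ?\<phi> y - indicator ?B y *\<^sub>R (g2 y \<bullet> b) * ?\<phi> y"
          by (simp only:) (simp add: algebra_simps)
      qed
    qed
    also have "\<dots> = (LINT y|lebesgue. indicator ?B y *\<^sub>R (g1 y \<bullet> b) * ?\<phi> y) - (LINT y|lebesgue. indicator ?B y *\<^sub>R (g2 y \<bullet> b) * ?\<phi> y)"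
      by (rule Bochner_Integration.integral_diff[OF i\<phi>[OF g1] i\<phi>[OF g2]])
    also have "\<dots> = 0" unfolding eq[OF g1] eq[OF g2] by simp
    finally show ?thesis .
  qed
  obtain E :: "nat \<Rightarrow> real" where E: "\<And>k. 0 < E k" "\<And>k. E k < r" "AE x in lborel. (\<lambda>k. mollify (E k) h' x) \<longlonglongrightarrow> h' x"
    by (rule mollify_sequence[OF lh r]) blast
  show ?thesis
    using E(3) h'
  proof eventually_elim
    fix x assume lim: "(\<lambda>k. mollify (E k) h' x) \<longlonglongrightarrow> h' x" and hx: "h x = h' x"
    show "x \<in> ball x0 r \<longrightarrow> g1 x \<bullet> b = g2 x \<bullet> b"
    proof
      assume x: "x \<in> ball x0 r"
      have eq: "(\<lambda>k. mollify (E k) h' x) = (\<lambda>k. 0)" using zero[OF x] E(1,2) by (intro ext) blast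
      have "h' x = 0" using lim unfolding eq by (simp add: LIMSEQ_const_iff)
      moreover have "x \<in> ?B" using x r by auto
      ultimately show "g1 x \<bullet> b = g2 x \<bullet> b" using hx by (simp add: h_def)
    qed
  qed
qed

text \<open>Countably many balls with room around them cover \<Omega> by Lindelof, so the
  exceptional sets unite to a null set.\<close>

lemma weak_gradient_unique:
  fixes \<Omega> :: "'a::euclidean_space set"
  assumes \<Omega>: "open \<Omega>" and g1: "has_weak_gradient \<Omega> u g1" and g2: "has_weak_gradient \<Omega> u g2"
  shows "AE x in lborel. x \<in> \<Omega> \<longrightarrow> g1 x = g2 x"
proof -
  define \<B> where "\<B> = {ball x r | x r. 0 < r \<and> cball x (2 * r) \<subseteq> \<Omega>}"
  have "\<Union>\<B> = \<Omega>"
  proof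
    show "\<Union>\<B> \<subseteq> \<Omega>"
    proof (rule Union_least)
      fix B assume "B \<in> \<B>"
      then obtain x r where "B = ball x r" "0 < r" "cball x (2 * r) \<subseteq> \<Omega>" by (auto simp: \<B>_def)
      moreover from this have "ball x r \<subseteq> cball x (2 * r)" by auto
      ultimately show "B \<subseteq> \<Omega>" by blast
    qed
    show "\<Omega> \<subseteq> \<Union>\<B>"
    proof
      fix x assume "x \<in> \<Omega>"
      then obtain e where "0 < e" "cball x e \<subseteq> \<Omega>" using \<Omega> open_contains_cball by blast
      then have "ball x (e/2) \<in> \<B>" "x \<in> ball x (e/2)" by (auto simp: \<B>_def intro!: exI[of _ x] exI[of _ "e/2"])
      then show "x \<in> \<Union>\<B>" by blast
    qed
  qed
  moreover obtain \<C> where \<C>: "\<C> \<subseteq> \<B>" "countable \<C>" "\<Union>\<C> = \<Union>\<B>"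
    by (rule Lindelof[of \<B>]) (auto simp: \<B>_def)
  have "AE x in lborel. \<forall>B\<in>\<C>. x \<in> B \<longrightarrow> g1 x = g2 x"
  proof (subst AE_ball_countable[OF \<C>(2)], rule ballI)
    fix B assume "B \<in> \<C>"
    then obtain x0 r where B: "B = ball x0 r" "0 < r" "cball x0 (2 * r) \<subseteq> \<Omega>" using \<C>(1) by (auto simp: \<B>_def)
    have "AE x in lborel. \<forall>b\<in>Basis. x \<in> ball x0 r \<longrightarrow> g1 x \<bullet> b = g2 x \<bullet> b"
      by (rule AE_finite_allI[OF finite_Basis]) (rule weak_gradient_unique_ball[OF \<Omega> g1 g2 B(2,3)])
    then show "AE x in lborel. x \<in> B \<longrightarrow> g1 x = g2 x"
      by eventually_elim (auto simp: B(1) intro: euclidean_eqI)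
  qed
  then show ?thesis
    by eventually_elim (use \<open>\<Union>\<B> = \<Omega>\<close> \<C>(3) in blast)
qed

section \<open>Sobolev functions and embeddings\<close>

text \<open>Functions on \<open>\<Omega>\<close> are replaced by Borel representatives that vanish off \<open>\<Omega>\<close>, so that all
  integrals are taken over \<open>lborel\<close>.\<close>

definition sob :: "'a::euclidean_space set \<Rightarrow> real \<Rightarrow> ('a \<Rightarrow> real) \<Rightarrow> ('a \<Rightarrow> 'a) \<Rightarrow> bool" where
  "sob \<Omega> p u g \<longleftrightarrow> u \<in> borel_measurable borel \<and> g \<in> borel_measurable borel \<and>
     (\<forall>x. x \<notin> \<Omega> \<longrightarrow> u x = 0 \<and> g x = 0) \<and>
     (\<integral>\<^sup>+x. epow (ennreal \<bar>u x\<bar>) p \<partial>lborel) < top \<and> (\<integral>\<^sup>+x. epow (ennreal (norm (g x))) p \<partial>lborel) < top \<and>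
     weak_grad_eq \<Omega> u g"

lemma sobD:
  assumes "sob \<Omega> p u g"
  shows "u \<in> borel_measurable borel" "g \<in> borel_measurable borel" "x \<notin> \<Omega> \<Longrightarrow> u x = 0" "x \<notin> \<Omega> \<Longrightarrow> g x = 0"
    "(\<integral>\<^sup>+x. epow (ennreal \<bar>u x\<bar>) p \<partial>lborel) < top" "(\<integral>\<^sup>+x. epow (ennreal (norm (g x))) p \<partial>lborel) < top"
    "weak_grad_eq \<Omega> u g"
  using assms by (auto simp: sob_def simp del: epow_ennreal)

lemma sob_loc_int:
  assumes "sob \<Omega> p u g" "1 \<le> p"
  shows "loc_int u" "loc_int g"
  using assms sobD[OF assms(1)] by (auto intro!: Lp_loc_int[of _ p] simp: real_norm_def simp del: epow_ennreal)

lemma W1p_sob: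
  fixes \<Omega> :: "'a::euclidean_space set"
  assumes \<Omega>: "open \<Omega>" and p: "1 \<le> p" and u: "u \<in> W1p \<Omega> p"
  shows "\<exists>u' g'. borel_rep \<Omega> u u' \<and> borel_rep \<Omega> (weak_gradient \<Omega> u) g' \<and> sob \<Omega> p u' g'"
proof -
  have O: "\<Omega> \<in> sets borel" using \<Omega> by simp
  obtain g where g: "has_weak_gradient \<Omega> u g" "g \<in> Lp_space \<Omega> (ereal p)" and uL: "u \<in> Lp_space \<Omega> (ereal p)"
    using u by (auto simp: W1p_def)
  have w: "has_weak_gradient \<Omega> u (weak_gradient \<Omega> u)"
    unfolding weak_gradient_def by (rule someI[of _ g]) (rule g(1))
  obtain u' where u': "borel_rep \<Omega> u u'"
    using borel_rep_exists[OF O] uL by (auto simp: Lp_space_def)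
  obtain g' where g': "borel_rep \<Omega> g g'"
    using borel_rep_exists[OF O] g(2) by (auto simp: Lp_space_def)
  have ae: "AE x in lborel. x \<in> \<Omega> \<longrightarrow> weak_gradient \<Omega> u x = g x"
    by (rule weak_gradient_unique[OF \<Omega> w g(1)])
  moreover have "AE x in lborel. x \<in> \<Omega> \<longrightarrow> g x = g' x" using g' by (simp add: borel_rep_def)
  ultimately have "AE x in lborel. x \<in> \<Omega> \<longrightarrow> weak_gradient \<Omega> u x = g' x" by eventually_elim auto
  then have wg': "borel_rep \<Omega> (weak_gradient \<Omega> u) g'" using g' by (simp add: borel_rep_def)
  have "weak_grad_eq \<Omega> u' g'"
    using weak_gradient_rep_eq[OF \<Omega> u' g'] g(1) by (simp add: has_weak_gradient_def)
  moreover have "(\<integral>\<^sup>+x. epow (ennreal (norm (u' x))) p \<partial>lborel) < top"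
    using borel_rep_Lp(1)[OF O u', of p] uL p by (simp del: epow_ennreal)
  moreover have "(\<integral>\<^sup>+x. epow (ennreal (norm (g' x))) p \<partial>lborel) < top"
    using borel_rep_Lp(1)[OF O g', of p] g(2) p by (simp del: epow_ennreal)
  ultimately have "sob \<Omega> p u' g'"
    using u' g' by (auto simp: sob_def borel_rep_def real_norm_def simp del: epow_ennreal)
  with u' wg' show ?thesis by blast
qed

lemma sob_W1p:
  fixes \<Omega> :: "'a::euclidean_space set"
  assumes \<Omega>: "open \<Omega>" and p: "1 \<le> p" and s: "sob \<Omega> p u' g'" and u: "borel_rep \<Omega> u u'"
  shows "u \<in> W1p \<Omega> p" "borel_rep \<Omega> (weak_gradient \<Omega> u) g'"
proof -
  have O: "\<Omega> \<in> sets borel" using \<Omega> by simp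
  have g': "borel_rep \<Omega> g' g'" using sobD[OF s] by (intro borel_rep_self) auto
  note l = sob_loc_int[OF s p]
  have h: "has_weak_gradient \<Omega> u g'"
    using weak_gradient_rep_eq[OF \<Omega> u g'] sobD(7)[OF s]
      loc_int_locally_integrable[OF \<Omega> u l(1)] loc_int_locally_integrable[OF \<Omega> g' l(2)]
    by (simp add: has_weak_gradient_def)
  have "u \<in> Lp_space \<Omega> (ereal p)" "g' \<in> Lp_space \<Omega> (ereal p)"
    using borel_rep_Lp(1)[OF O u, of p] borel_rep_Lp(1)[OF O g', of p] p sobD(5,6)[OF s] by (auto simp: real_norm_def simp del: epow_ennreal)
  with h show "u \<in> W1p \<Omega> p" by (auto simp: W1p_def)
  have w: "has_weak_gradient \<Omega> u (weak_gradient \<Omega> u)"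
    unfolding weak_gradient_def by (rule someI[of _ g']) (rule h)
  show "borel_rep \<Omega> (weak_gradient \<Omega> u) g'"
    using weak_gradient_unique[OF \<Omega> w h] g' by (simp add: borel_rep_def)
qed

lemma W1p_norm_rep:
  fixes \<Omega> :: "'a::euclidean_space set"
  assumes \<Omega>: "open \<Omega>" and p: "1 \<le> p" and s: "sob \<Omega> p u' g'" and u: "borel_rep \<Omega> u u'" and g: "borel_rep \<Omega> (weak_gradient \<Omega> u) g'"
  shows "W1p_norm \<Omega> p u = enn2real ((\<integral>\<^sup>+x. epow (ennreal (norm (g' x))) p \<partial>lborel) + (\<integral>\<^sup>+x. epow (ennreal \<bar>u' x\<bar>) p \<partial>lborel)) powr (1/p)"
proof -
  have O: "\<Omega> \<in> sets borel" using \<Omega> by simp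
  note [measurable] = borel_rep_measurable[OF O u] borel_rep_measurable[OF O g]
  have "(LINT x|lebesgue_on \<Omega>. norm (weak_gradient \<Omega> u x) powr p + \<bar>u x\<bar> powr p)
     = enn2real (\<integral>\<^sup>+x. ennreal (norm (weak_gradient \<Omega> u x) powr p + \<bar>u x\<bar> powr p) \<partial>lebesgue_on \<Omega>)"
    by (rule integral_eq_nn_integral) auto
  also have "(\<integral>\<^sup>+x. ennreal (norm (weak_gradient \<Omega> u x) powr p + \<bar>u x\<bar> powr p) \<partial>lebesgue_on \<Omega>)
     = (\<integral>\<^sup>+x. ennreal (norm (weak_gradient \<Omega> u x) powr p) \<partial>lebesgue_on \<Omega>) + (\<integral>\<^sup>+x. ennreal (norm (u x) powr p) \<partial>lebesgue_on \<Omega>)"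
    by (subst nn_integral_add[symmetric]) auto
  also have "\<dots> = (\<integral>\<^sup>+x. epow (ennreal (norm (g' x))) p \<partial>lborel) + (\<integral>\<^sup>+x. epow (ennreal (norm (u' x))) p \<partial>lborel)"
    using p borel_rep_powr[OF O g, of p] borel_rep_powr[OF O u, of p] by simp
  finally show ?thesis by (simp add: W1p_norm_def)
qed

text \<open>All that is kept of the extension operator is one extension for each function. Norms are
  raised to the p-th power, which turns C into C^p.\<close>

lemma W1p_extension_sob:
  fixes \<Omega> :: "'a::euclidean_space set"
  assumes p: "1 \<le> p" and ext: "W1p_extension_domain \<Omega> p"
  shows "\<exists>C\<ge>1. \<forall>u g. sob \<Omega> p u g \<longrightarrow> (\<exists>w h. sob UNIV p w h \<and> (AE x in lborel. x \<in> \<Omega> \<longrightarrow> w x = u x) \<and>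
    (\<integral>\<^sup>+x. epow (ennreal (norm (h x))) p \<partial>lborel) + (\<integral>\<^sup>+x. epow (ennreal \<bar>w x\<bar>) p \<partial>lborel)
      \<le> ennreal C * ((\<integral>\<^sup>+x. epow (ennreal (norm (g x))) p \<partial>lborel) + (\<integral>\<^sup>+x. epow (ennreal \<bar>u x\<bar>) p \<partial>lborel)))"
proof -
  obtain E C where \<Omega>: "open \<Omega>" and E: "W1p_extension_operator \<Omega> p E" and C: "1 \<le> C"
    "\<And>u. u \<in> W1p \<Omega> p \<Longrightarrow> W1p_norm UNIV p (E u) \<le> C * W1p_norm \<Omega> p u"
    using ext by (auto simp: W1p_extension_domain_def bounded_W1p_extension_operator_def is_domain_def)
  have O: "\<Omega> \<in> sets borel" using \<Omega> by simp
  show ?thesis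
  proof (intro exI[of _ "C powr p"] conjI allI impI)
    show "1 \<le> C powr p" using C p by (simp add: ge_one_powr_ge_zero)
    fix u g assume s: "sob \<Omega> p u g"
    have rep: "borel_rep \<Omega> u u" using sobD[OF s] by (intro borel_rep_self) auto
    note uW = sob_W1p[OF \<Omega> p s rep]
    have EW: "E u \<in> W1p UNIV p" using E uW(1) by (simp add: W1p_extension_operator_def)
    obtain w h where w: "borel_rep UNIV (E u) w" "borel_rep UNIV (weak_gradient UNIV (E u)) h" "sob UNIV p w h"
      using W1p_sob[OF open_UNIV p EW] by blast
    have "AE x in lebesgue_on \<Omega>. E u x = u x" using E uW(1) by (simp add: W1p_extension_operator_def)
    then have "AE x in lebesgue. x \<in> \<Omega> \<longrightarrow> E u x = u x" using O by (simp add: AE_restrict_space_iff)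
    then have "AE x in lborel. x \<in> \<Omega> \<longrightarrow> E u x = u x" by (simp add: AE_completion_iff)
    moreover have "AE x in lborel. E u x = w x" using w(1) by (simp add: borel_rep_def)
    ultimately have ae: "AE x in lborel. x \<in> \<Omega> \<longrightarrow> w x = u x" by eventually_elim auto
    define A where "A = (\<integral>\<^sup>+x. epow (ennreal (norm (h x))) p \<partial>lborel) + (\<integral>\<^sup>+x. epow (ennreal \<bar>w x\<bar>) p \<partial>lborel)"
    define B where "B = (\<integral>\<^sup>+x. epow (ennreal (norm (g x))) p \<partial>lborel) + (\<integral>\<^sup>+x. epow (ennreal \<bar>u x\<bar>) p \<partial>lborel)"
    have fin: "A < top" "B < top" using sobD(5,6)[OF s] sobD(5,6)[OF w(3)] by (auto simp: A_def B_def simp del: epow_ennreal)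
    have "enn2real A powr (1/p) \<le> C * enn2real B powr (1/p)"
      using C(2)[OF uW(1)] W1p_norm_rep[OF open_UNIV p w(3,1,2)] W1p_norm_rep[OF \<Omega> p s rep uW(2)]
      by (simp add: A_def B_def)
    then have "(enn2real A powr (1/p)) powr p \<le> (C * enn2real B powr (1/p)) powr p"
      using p by (intro powr_mono2) auto
    then have "enn2real A \<le> C powr p * enn2real B"
      using p C by (simp add: powr_powr powr_mult)
    then have "A \<le> ennreal (C powr p) * B"
      using fin by (cases A; cases B) (auto simp: ennreal_mult[symmetric] ennreal_leI)
    with w(3) ae show "\<exists>w h. sob UNIV p w h \<and> (AE x in lborel. x \<in> \<Omega> \<longrightarrow> w x = u x) \<and>
    (\<integral>\<^sup>+x. epow (ennreal (norm (h x))) p \<partial>lborel) + (\<integral>\<^sup>+x. epow (ennreal \<bar>w x\<bar>) p \<partial>lborel)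
      \<le> ennreal (C powr p) * ((\<integral>\<^sup>+x. epow (ennreal (norm (g x))) p \<partial>lborel) + (\<integral>\<^sup>+x. epow (ennreal \<bar>u x\<bar>) p \<partial>lborel))"
      unfolding A_def B_def by blast
  qed
qed

text \<open>Translation invariance makes the integral of F(b + y) - F(y) vanish. By the fundamental
  theorem along b and Fubini, this integral equals that of the derivative.\<close>

lemma integral_frechet_derivative_zero:
  fixes F :: "'a::euclidean_space \<Rightarrow> real"
  assumes d: "\<And>y. (F has_derivative D y) (at y)" and c: "continuous_on UNIV (\<lambda>y. D y b)"
    and supp: "\<And>y. R \<le> norm y \<Longrightarrow> F y = 0"
  shows "(LINT y|lborel. D y b) = 0"
proof -
  let ?G = "\<lambda>y. D y b"
  have Dz: "?G y = 0" if "R < norm y" for y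
  proof -
    have y: "y \<in> - cball 0 R" using that by simp
    have "((\<lambda>_. 0) has_derivative (\<lambda>_. 0)) (at y)" by (rule has_derivative_const)
    then have "(F has_derivative (\<lambda>_. 0)) (at y)"
      by (rule has_derivative_transform_within_open[OF _ _ y]) (auto simp: supp)
    then have "D y = (\<lambda>_. 0)" using d has_derivative_unique by blast
    then show ?thesis by simp
  qed
  have [measurable]: "?G \<in> borel_measurable borel" by (rule borel_measurable_continuous_onI[OF c])
  have Fc: "continuous_on UNIV F" by (rule has_derivative_continuous_on[OF has_derivative_at_withinI[OF d]])
  note [measurable] = borel_measurable_continuous_onI[OF Fc]
  obtain K where K: "0 \<le> K" "\<And>y. \<bar>?G y\<bar> \<le> K"
  proof -
    have "compact (?G ` cball 0 R)"
      by (intro compact_continuous_image continuous_on_subset[OF c]) auto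
    then obtain K where "\<forall>z\<in>?G ` cball 0 R. norm z \<le> K"
      using compact_imp_bounded bounded_iff by metis
    then have Kb: "\<And>y. y \<in> cball 0 R \<Longrightarrow> \<bar>?G y\<bar> \<le> K" by auto
    have "\<bar>?G y\<bar> \<le> max K 0" for y
      using Kb[of y] Dz[of y] by (cases "y \<in> cball 0 R") auto
    then show ?thesis by (intro that[of "max K 0"]) auto
  qed
  have int: "integrable lborel ?G"
  proof -
    have "integrable lborel (\<lambda>y. indicator (cball 0 R) y *\<^sub>R ?G y)"
      by (rule borel_integrable_compact) (auto intro: continuous_on_subset[OF c])
    moreover have "(\<lambda>y. indicator (cball 0 R) y *\<^sub>R ?G y) = ?G" using Dz by (auto simp: indicator_def fun_eq_iff not_le)
    ultimately show ?thesis by simp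
  qed
  have Fint: "integrable lborel F"
  proof -
    have "integrable lborel (\<lambda>y. indicator (cball 0 R) y *\<^sub>R F y)"
      by (rule borel_integrable_compact) (auto intro: continuous_on_subset[OF Fc])
    moreover have "(\<lambda>y. indicator (cball 0 R) y *\<^sub>R F y) = F" using supp by (auto simp: indicator_def fun_eq_iff not_le)
    ultimately show ?thesis by simp
  qed
  define H where "H = (\<lambda>(y, t). indicator {0..1::real} t * ?G (t *\<^sub>R b + y))"
  have [measurable]: "H \<in> borel_measurable (lborel \<Otimes>\<^sub>M lborel)" unfolding H_def by measurable
  define U where "U y = K * indicator (cball (0::'a) (R + norm b)) y" for y :: 'a
  have Uint: "integrable lborel U"
    unfolding U_def using emeasure_lborel_cball_finite[of 0 "R + norm b"]
    by (intro integrable_mult_right integrable_real_indicator) (auto simp: less_top)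
  have U0: "0 \<le> U y" for y using K by (simp add: U_def)
  have HU: "norm (H (y, t)) \<le> indicator {0..1} t * U y" for y t
  proof (cases "t \<in> {0..1}")
    case True
    then have tb: "norm (t *\<^sub>R b) \<le> norm b" by (simp add: mult_left_le_one_le)
    show ?thesis
    proof (cases "y \<in> cball 0 (R + norm b)")
      case False
      have "norm y \<le> norm (t *\<^sub>R b + y) + norm (t *\<^sub>R b)"
        using norm_triangle_ineq4[of "t *\<^sub>R b + y" "t *\<^sub>R b"] by simp
      with False tb have "R < norm (t *\<^sub>R b + y)" by auto
      then show ?thesis using Dz U0 by (simp add: H_def indicator_def)
    qed (use K in \<open>auto simp: H_def U_def indicator_def\<close>)
  qed (simp add: H_def)
  have Hint: "integrable (lborel \<Otimes>\<^sub>M lborel) H"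
  proof (rule lborel_pair.Fubini_integrable)
    have *: "integrable lborel (\<lambda>t. H (y, t))" for y
    proof (rule Bochner_Integration.integrable_bound)
      show "integrable lborel (\<lambda>t::real. indicator {0..1} t * U y)" by simp
      show "AE t in lborel. norm (H (y, t)) \<le> norm (indicator {0..1} t * U y)"
        using HU[of y] by (intro AE_I2) (metis abs_ge_self order_trans real_norm_def)
    qed (simp add: H_def)
    then show "AE y in lborel. integrable lborel (\<lambda>t. H (y, t))" by simp
    show "integrable lborel (\<lambda>y. LINT t|lborel. norm (H (y, t)))"
    proof (rule Bochner_Integration.integrable_bound[OF Uint])
      show "(\<lambda>y. LINT t|lborel. norm (H (y, t))) \<in> borel_measurable lborel" by measurable
      show "AE y in lborel. norm (LINT t|lborel. norm (H (y, t))) \<le> norm (U y)"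
      proof (rule AE_I2)
        fix y
        have "(LINT t|lborel. norm (H (y, t))) \<le> (LINT t|lborel. indicator {0..1::real} t * U y)"
          using * HU by (intro integral_mono) auto
        then show "norm (LINT t|lborel. norm (H (y, t))) \<le> norm (U y)" by simp
      qed
    qed
  qed measurable
  have shift: "(LINT y|lborel. f (v + y)) = (LINT y|lborel. f y)" if [measurable]: "f \<in> borel_measurable borel" for f :: "'a \<Rightarrow> real" and v
    using integral_distr[of "(+) v" lborel borel f] by (simp add: lborel_distr_plus)
  have FTC: "(LINT t|lborel. H (y, t)) = F (b + y) - F y" for y
  proof -
    have "((\<lambda>t. F (t *\<^sub>R b + y)) has_real_derivative ?G (t *\<^sub>R b + y)) (at t within {0..1})" for t :: real
    proof -
      have "((\<lambda>t. t *\<^sub>R b + y) has_derivative (\<lambda>h. h *\<^sub>R b)) (at t within {0..1})"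
        by (auto intro!: derivative_eq_intros)
      then have "((\<lambda>t. F (t *\<^sub>R b + y)) has_derivative (\<lambda>h. D (t *\<^sub>R b + y) (h *\<^sub>R b))) (at t within {0..1})"
        using has_derivative_compose[OF _ d] by blast
      moreover have "D z (h *\<^sub>R b) = h * D z b" for z h
        using linear_cmul[OF has_derivative_linear[OF d[of z]], of h b] by simp
      ultimately show ?thesis by (simp add: has_field_derivative_def mult.commute[of _ "?G (t *\<^sub>R b + y)"])
    qed
    then have "(LBINT t. indicator {0..1} t *\<^sub>R ?G (t *\<^sub>R b + y)) = F (1 *\<^sub>R b + y) - F (0 *\<^sub>R b + y)"
      by (intro integral_FTC_Icc[of 0 1 "\<lambda>t. F (t *\<^sub>R b + y)"])
         (auto simp: has_real_derivative_iff_has_vector_derivative intro!: continuous_intros continuous_on_compose2[OF c])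
    then show ?thesis by (simp add: H_def)
  qed
  have Fbint: "integrable lborel (\<lambda>y. F (b + y))"
    using integrable_distr_eq[of "(+) b" lborel borel F] Fint by (simp add: lborel_distr_plus)
  have shiftG: "(LINT y|lborel. ?G (t *\<^sub>R b + y)) = (LINT y|lborel. ?G y)" for t
    by (rule shift) measurable
  have "0 = (LINT y|lborel. F (b + y)) - (LINT y|lborel. F y)"
    by (subst shift) simp_all
  also have "\<dots> = (LINT y|lborel. (LINT t|lborel. H (y, t)))"
    unfolding FTC by (rule Bochner_Integration.integral_diff[symmetric, OF Fbint Fint])
  also have "\<dots> = (LINT t|lborel. (LINT y|lborel. H (y, t)))"
    using lborel_pair.Fubini_integral[of "\<lambda>y t. H (y, t)"] Hint by simp
  also have "\<dots> = (LINT t|lborel. indicator {0..1::real} t * (LINT y|lborel. ?G y))"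
    by (simp add: H_def shiftG)
  also have "\<dots> = (LINT y|lborel. ?G y)" by simp
  finally show ?thesis by simp
qed

text \<open>The derivative of the product of \<eta> and a test function integrates to 0. This serves
  for constants, whose gradient is 0, and for the cutoffs behind the measure density.\<close>

lemma weak_grad_eq_C1:
  fixes \<eta> :: "'a::euclidean_space \<Rightarrow> real" and G :: "'a \<Rightarrow> 'a"
  assumes \<eta>: "\<And>y. (\<eta> has_derivative (\<lambda>h. G y \<bullet> h)) (at y)" and G: "continuous_on UNIV G"
  shows "weak_grad_eq \<Omega> (\<lambda>y. indicator \<Omega> y * \<eta> y) (\<lambda>y. indicator \<Omega> y *\<^sub>R G y)"
  unfolding weak_grad_eq_def
proof (intro allI impI ballI)
  fix \<phi> :: "'a \<Rightarrow> real" and b :: 'a assume \<phi>: "test_function \<Omega> \<phi>" and b: "b \<in> Basis"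
  note t = test_function_facts[OF \<phi>]
  let ?D = "\<lambda>y. frechet_derivative \<phi> (at y)"
  have dphi: "(\<phi> has_derivative ?D y) (at y)" for y using t(5) frechet_derivative_works by blast
  have \<eta>c: "continuous_on UNIV \<eta>" by (rule has_derivative_continuous_on[OF has_derivative_at_withinI[OF \<eta>]])
  obtain R where R: "\<And>y. R \<le> norm y \<Longrightarrow> \<phi> y = 0"
  proof -
    have "bounded (closure {x. \<phi> x \<noteq> 0})" by (rule compact_imp_bounded[OF t(8)])
    from bounded_subset_ballD[OF this, of 0]
    obtain R where "closure {x. \<phi> x \<noteq> 0} \<subseteq> ball 0 R" by auto
    then have sub: "{x. \<phi> x \<noteq> 0} \<subseteq> ball 0 R" by (rule order_trans[OF closure_subset])
    show ?thesis
    proof (rule that[of R])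
      fix y :: 'a assume "R \<le> norm y"
      then have "y \<notin> ball 0 R" by simp
      then show "\<phi> y = 0" using sub by blast
    qed
  qed
  have "(LINT y|lborel. \<eta> y * ?D y b + (G y \<bullet> b) * \<phi> y) = 0"
  proof (rule integral_frechet_derivative_zero)
    show "((\<lambda>y. \<eta> y * \<phi> y) has_derivative (\<lambda>h. \<eta> y * ?D y h + (G y \<bullet> h) * \<phi> y)) (at y)" for y
      by (rule has_derivative_mult[OF \<eta> dphi])
    show "continuous_on UNIV (\<lambda>y. \<eta> y * ?D y b + G y \<bullet> b * \<phi> y)"
      by (intro continuous_intros \<eta>c t(3)[OF b] t(1) G)
    show "R \<le> norm y \<Longrightarrow> \<eta> y * \<phi> y = 0" for y using R by simp
  qed
  moreover have int: "integrable lborel f" if f: "continuous_on UNIV f" and z: "\<And>y. R < norm y \<Longrightarrow> f y = 0" for f :: "'a \<Rightarrow> real"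
  proof -
    have "integrable lborel (\<lambda>y. indicator (cball 0 R) y *\<^sub>R f y)"
      by (rule borel_integrable_compact) (auto intro: continuous_on_subset[OF f])
    moreover have "(\<lambda>y. indicator (cball 0 R) y *\<^sub>R f y) = f" using z by (auto simp: indicator_def fun_eq_iff not_le)
    ultimately show ?thesis by simp
  qed
  have Dz: "?D y b = 0" if "R < norm y" for y
  proof -
    have y: "y \<in> - cball 0 R" using that by simp
    have "((\<lambda>_. 0) has_derivative (\<lambda>_. 0)) (at y)" by (rule has_derivative_const)
    then have "(\<phi> has_derivative (\<lambda>_. 0)) (at y)"
      by (rule has_derivative_transform_within_open[OF _ _ y]) (auto simp: R)
    then have "?D y = (\<lambda>_. 0)" using frechet_derivative_at by metis
    then show ?thesis by simp
  qed
  have "integrable lborel (\<lambda>y. \<eta> y * ?D y b)" "integrable lborel (\<lambda>y. (G y \<bullet> b) * \<phi> y)"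
    by (intro int continuous_intros \<eta>c t(3)[OF b] t(1) G; simp add: Dz R)+
  ultimately have "(LINT y|lborel. \<eta> y * ?D y b) = - (LINT y|lborel. (G y \<bullet> b) * \<phi> y)" by simp
  moreover have "(\<lambda>y. indicator \<Omega> y * \<eta> y * ?D y b) = (\<lambda>y. \<eta> y * ?D y b)"
    "(\<lambda>y. ((indicator \<Omega> y *\<^sub>R G y) \<bullet> b) * \<phi> y) = (\<lambda>y. (G y \<bullet> b) * \<phi> y)"
    using t(6,7) by (auto simp: indicator_def fun_eq_iff)
  ultimately show "(LINT y|lborel. indicator \<Omega> y * \<eta> y * ?D y b) = - (LINT y|lborel. ((indicator \<Omega> y *\<^sub>R G y) \<bullet> b) * \<phi> y)"
    by simp
qed

text \<open>The p-th power of the norm, without the root: it adds over disjoint sets for every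
  exponent, also below 1, and it may be infinite.\<close>

definition Lpp :: "real \<Rightarrow> ('a::euclidean_space \<Rightarrow> 'b::euclidean_space) \<Rightarrow> ennreal" where
  "Lpp p f = (\<integral>\<^sup>+x. epow (ennreal (norm (f x))) p \<partial>lborel)"

lemma Lpp_real: "Lpp p u = (\<integral>\<^sup>+x. epow (ennreal \<bar>u x\<bar>) p \<partial>lborel)"
  by (simp only: Lpp_def real_norm_def)

lemma sob_Lpp:
  assumes "sob \<Omega> p u g" shows "Lpp p u < top" "Lpp p g < top"
  using sobD(5,6)[OF assms] by (simp_all only: Lpp_def real_norm_def)

lemma test_function_derivative_bounded:
  assumes \<phi>: "test_function \<Omega> (\<phi> :: 'a::euclidean_space \<Rightarrow> real)" and b: "b \<in> Basis"
  obtains K R where "\<And>y. \<bar>frechet_derivative \<phi> (at y) b\<bar> \<le> K" "\<And>y. y \<notin> cball 0 R \<Longrightarrow> frechet_derivative \<phi> (at y) b = 0"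
proof -
  note t = test_function_facts[OF \<phi>]
  let ?S = "closure {x. \<phi> x \<noteq> 0}"
  have z: "frechet_derivative \<phi> (at y) b = 0" if "y \<notin> ?S" for y
  proof -
    \<comment> \<open>With the point y removed from the space, \<phi> is still a test function, so
      its derivative vanishes at y as at any point outside the domain.\<close>
    have "test_function (- {y}) \<phi>" using \<phi> that by (auto simp: test_function_def)
    from test_function_facts(7)[OF this, of y b] show ?thesis by simp
  qed
  from bounded_subset_ballD[OF compact_imp_bounded[OF t(8)], of 0]
  obtain R where R: "?S \<subseteq> ball 0 R" by auto
  have "compact ((\<lambda>y. frechet_derivative \<phi> (at y) b) ` ?S)"
    by (intro compact_continuous_image continuous_on_subset[OF t(3)[OF b]] t(8)) auto
  then obtain K where "\<forall>z\<in>(\<lambda>y. frechet_derivative \<phi> (at y) b) ` ?S. norm z \<le> K"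
    using compact_imp_bounded bounded_iff by metis
  then have K: "\<And>y. y \<in> ?S \<Longrightarrow> \<bar>frechet_derivative \<phi> (at y) b\<bar> \<le> K" by auto
  show ?thesis
  proof (rule that[of "max K 0" R])
    fix y
    show "\<bar>frechet_derivative \<phi> (at y) b\<bar> \<le> max K 0" using K[of y] z[of y] by (cases "y \<in> ?S") auto
    assume "y \<notin> cball 0 R"
    then have "y \<notin> ?S" using R ball_subset_cball by blast
    then show "frechet_derivative \<phi> (at y) b = 0" by (rule z)
  qed
qed

text \<open>Constants on \<Omega> have weak gradient 0, the case \<eta> = 1 of
  \<open>weak_grad_eq_C1\<close>.\<close>

lemma weak_grad_eq_diff_const:
  fixes u :: "'a::euclidean_space \<Rightarrow> real"
  assumes u: "loc_int u" and g: "weak_grad_eq \<Omega> u g" and \<Omega>: "open \<Omega>"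
  shows "weak_grad_eq \<Omega> (\<lambda>x. u x - c * indicator \<Omega> x) g"
  unfolding weak_grad_eq_def
proof (intro allI impI ballI)
  fix \<phi> :: "'a \<Rightarrow> real" and b :: 'a assume \<phi>: "test_function \<Omega> \<phi>" and b: "b \<in> Basis"
  let ?D = "\<lambda>y. frechet_derivative \<phi> (at y) b"
  have [measurable]: "\<Omega> \<in> sets borel" using \<Omega> by simp
  obtain K R where K: "\<And>y. \<bar>?D y\<bar> \<le> K" "\<And>y. y \<notin> cball 0 R \<Longrightarrow> ?D y = 0"
    using test_function_derivative_bounded[OF \<phi> b] by blast
  have m: "?D \<in> borel_measurable borel" by (rule test_function_facts(4)[OF \<phi> b])
  have li: "loc_int (indicator \<Omega> :: 'a \<Rightarrow> real)"
    unfolding loc_int_def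
  proof (intro conjI allI)
    fix x :: 'a and r
    have "integrable lborel (\<lambda>y. indicator \<Omega> y *\<^sub>R (indicator (cball x r) y :: real))"
      using emeasure_lborel_cball_finite[of x r] by (intro integrable_mult_indicator integrable_real_indicator) auto
    then show "integrable lborel (\<lambda>y. indicator (cball x r) y *\<^sub>R (indicator \<Omega> y :: real))" by (simp add: mult.commute)
  qed simp
  have i1: "integrable lborel (\<lambda>y. u y * ?D y)" by (rule loc_int_mult[OF u m K])
  have i2: "integrable lborel (\<lambda>y. indicator \<Omega> y * ?D y)" by (rule loc_int_mult[OF li m K])
  have "weak_grad_eq \<Omega> (\<lambda>y. indicator \<Omega> y * (1::real)) (\<lambda>y. indicator \<Omega> y *\<^sub>R (0::'a))"
    by (rule weak_grad_eq_C1) auto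
  then have 0: "(LINT y|lborel. indicator \<Omega> y * ?D y) = 0" using \<phi> b by (simp add: weak_grad_eq_def)
  have "(LINT y|lborel. (u y - c * indicator \<Omega> y) * ?D y) = (LINT y|lborel. u y * ?D y - c * (indicator \<Omega> y * ?D y))"
    by (simp add: left_diff_distrib mult.assoc)
  also have "\<dots> = (LINT y|lborel. u y * ?D y) - c * (LINT y|lborel. indicator \<Omega> y * ?D y)"
    using i1 i2 by simp
  also have "\<dots> = - (LINT y|lborel. (g y \<bullet> b) * \<phi> y)" using 0 g \<phi> b by (simp add: weak_grad_eq_def)
  finally show "(LINT y|lborel. (u y - c * indicator \<Omega> y) * ?D y) = - (LINT y|lborel. (g y \<bullet> b) * \<phi> y)" .
qed

text \<open>Finite measure makes constants integrable to any power; \<open>epow_plus_le\<close>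
  stands in for the triangle inequality, so that exponents below 1 are covered.\<close>

lemma Lpp_diff_const_finite:
  fixes u :: "'a::euclidean_space \<Rightarrow> real"
  assumes [measurable]: "u \<in> borel_measurable borel" "\<Omega> \<in> sets borel" and fin: "emeasure lborel \<Omega> < top"
    and p: "0 < p" and u: "Lpp p u < top"
  shows "Lpp p (\<lambda>x. u x - c * indicator \<Omega> x) < top"
proof -
  have "Lpp p (\<lambda>x. u x - c * indicator \<Omega> x) \<le> (\<integral>\<^sup>+x. ennreal (2 powr p) * (epow (ennreal \<bar>u x\<bar>) p + epow (ennreal \<bar>c\<bar>) p * indicator \<Omega> x) \<partial>lborel)"
    unfolding Lpp_real
  proof (rule nn_integral_mono)
    fix x
    have "ennreal \<bar>u x - c * indicator \<Omega> x\<bar> \<le> ennreal \<bar>u x\<bar> + ennreal \<bar>c * indicator \<Omega> x\<bar>"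
      by (simp add: ennreal_plus[symmetric] ennreal_leI del: ennreal_plus)
    then have "epow (ennreal \<bar>u x - c * indicator \<Omega> x\<bar>) p \<le> epow (ennreal \<bar>u x\<bar> + ennreal \<bar>c * indicator \<Omega> x\<bar>) p"
      using p by (intro epow_mono) auto
    also have "\<dots> \<le> ennreal (2 powr p) * (epow (ennreal \<bar>u x\<bar>) p + epow (ennreal \<bar>c * indicator \<Omega> x\<bar>) p)"
      using p by (intro epow_plus_le) auto
    also have "epow (ennreal \<bar>c * indicator \<Omega> x\<bar>) p = epow (ennreal \<bar>c\<bar>) p * indicator \<Omega> x"
      by (auto simp: indicator_def)
    finally show "epow (ennreal \<bar>u x - c * indicator \<Omega> x\<bar>) p \<le> ennreal (2 powr p) * (epow (ennreal \<bar>u x\<bar>) p + epow (ennreal \<bar>c\<bar>) p * indicator \<Omega> x)" .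
  qed
  also have "\<dots> = ennreal (2 powr p) * (Lpp p u + epow (ennreal \<bar>c\<bar>) p * emeasure lborel \<Omega>)"
    by (simp add: nn_integral_cmult nn_integral_add Lpp_real del: epow_ennreal)
  also have "\<dots> < top" using u fin by (auto simp: ennreal_mult_eq_top_iff less_top[symmetric] simp del: epow_ennreal)
  finally show ?thesis .
qed

lemma sob_diff_const:
  fixes \<Omega> :: "'a::euclidean_space set"
  assumes s: "sob \<Omega> p u g" and \<Omega>: "open \<Omega>" and fin: "emeasure lborel \<Omega> < top" and p: "1 \<le> p"
  shows "sob \<Omega> p (\<lambda>x. u x - c * indicator \<Omega> x) g"
proof -
  have [measurable]: "\<Omega> \<in> sets borel" using \<Omega> by simp
  note [measurable] = sobD(1,2)[OF s]
  have "Lpp p (\<lambda>x. u x - c * indicator \<Omega> x) < top"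
    using p by (intro Lpp_diff_const_finite fin sob_Lpp[OF s]) auto
  then show ?thesis
    using sobD[OF s] weak_grad_eq_diff_const[OF sob_loc_int(1)[OF s p] sobD(7)[OF s] \<Omega>]
    unfolding sob_def Lpp_real by (auto simp del: epow_ennreal)
qed

section \<open>Embeddings on the whole space\<close>

lemma loc_int_set_integrable_ball:
  fixes w :: "'a::euclidean_space \<Rightarrow> real"
  assumes w: "loc_int w"
  shows "set_integrable lborel (ball 0 R) (\<lambda>z. w (x + z))"
proof -
  note [measurable] = loc_int_measurable[OF w]
  have [measurable]: "cball x R \<in> sets borel" by simp
  have "integrable (distr lborel borel ((+) x)) (\<lambda>y. indicator (cball x R) y *\<^sub>R w y)"
    using w by (simp add: lborel_distr_plus loc_int_def)
  then have "integrable lborel (\<lambda>z. indicator (cball x R) (x + z) *\<^sub>R w (x + z))"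
    by (subst (asm) integrable_distr_eq) auto
  also have "(\<lambda>z. indicator (cball x R) (x + z) *\<^sub>R w (x + z)) = (\<lambda>z. indicator (cball 0 R) z *\<^sub>R w (x + z))"
    by (auto simp: indicator_def dist_norm fun_eq_iff)
  finally have "set_integrable lborel (cball 0 R) (\<lambda>z. w (x + z))" by (simp add: set_integrable_def)
  then show ?thesis by (rule set_integrable_subset) auto
qed

text \<open>At unit radius both parts of w, its ball average and the deviation from it, are bounded
  in L^q by the full Sobolev norm.\<close>

lemma Lq_embedding_ge:
  fixes p q :: real
  assumes p: "1 \<le> p" "DIM('a::euclidean_space) \<le> p" and pq: "p \<le> q"
  shows "\<exists>C>0. \<forall>(w :: 'a \<Rightarrow> real) h. sob UNIV p w h \<longrightarrow> Lpp q w \<le> ennreal C * epow (Lpp p h + Lpp p w) (q / p)"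
proof -
  have q: "0 < q" using p pq by simp
  define V where "V = ball_volume TYPE('a) 1 powr (-1/p)"
  have V: "0 \<le> V" by (simp add: V_def)
  obtain C where C: "0 < C" "\<And>(u :: 'a \<Rightarrow> real) g R. loc_int u \<Longrightarrow> loc_int g \<Longrightarrow> weak_grad_eq UNIV u g \<Longrightarrow> 0 < R \<Longrightarrow>
    (\<integral>\<^sup>+x. epow (ennreal \<bar>u x - ball_avg u R x\<bar>) q \<partial>lborel)
      \<le> ennreal (C * R powr (q - DIM('a) * (q - p) / p)) * epow (\<integral>\<^sup>+x. epow (ennreal (norm (g x))) p \<partial>lborel) (q / p)"
    using diff_ball_avg_Lq_weak[OF p pq] by blast
  define C' where "C' = 2 powr q * (C + V powr (q - p))"
  have C': "0 < C'" unfolding C'_def using C(1) V by (intro mult_pos_pos add_pos_nonneg) auto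
  show ?thesis
  proof (intro exI[of _ C'] conjI allI impI C')
    fix w :: "'a \<Rightarrow> real" and h assume s: "sob UNIV p w h"
    note l = sob_loc_int[OF s p(1)]
    note [measurable] = sobD(1,2)[OF s]
    define S where "S = Lpp p h + Lpp p w"
    \<comment> \<open>As for the potential, q - p powers are bounded uniformly and the remaining p
      are averaged.\<close>
    have avg: "epow (ennreal \<bar>ball_avg w 1 x\<bar>) q \<le> ennreal (V powr (q - p)) * epow (Lpp p w) ((q - p)/p) * ball_mean (\<lambda>y. epow (ennreal \<bar>w y\<bar>) p) 1 x" for x
    proof -
      have si: "set_integrable lborel (ball 0 1) (\<lambda>z. w (x + z))" by (rule loc_int_set_integrable_ball[OF l(1)])
      have "epow (ennreal \<bar>ball_avg w 1 x\<bar>) q \<le> epow (ball_mean (\<lambda>y. ennreal \<bar>w y\<bar>) 1 x) q"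
        using q by (intro epow_mono ball_avg_le_ball_mean si) auto
      also have "\<dots> = epow (ball_mean (\<lambda>y. ennreal \<bar>w y\<bar>) 1 x) (q - p) * epow (ball_mean (\<lambda>y. ennreal \<bar>w y\<bar>) 1 x) p"
        by (simp add: epow_add[symmetric])
      also have "\<dots> \<le> epow (ennreal V * epow (Lpp p w) (1/p)) (q - p) * ball_mean (\<lambda>y. epow (ennreal \<bar>w y\<bar>) p) 1 x"
        using ball_mean_bound[of "\<lambda>y. ennreal \<bar>w y\<bar>" p 1 x] p pq
        by (intro mult_mono epow_mono ball_mean_Jensen) (auto simp: V_def Lpp_real simp del: epow_ennreal)
      also have "epow (ennreal V * epow (Lpp p w) (1/p)) (q - p) = ennreal (V powr (q - p)) * epow (Lpp p w) ((q - p)/p)"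
        using V by (simp add: epow_mult epow_epow)
      finally show ?thesis .
    qed
    have "Lpp q w \<le> (\<integral>\<^sup>+x. ennreal (2 powr q) * (epow (ennreal \<bar>w x - ball_avg w 1 x\<bar>) q + epow (ennreal \<bar>ball_avg w 1 x\<bar>) q) \<partial>lborel)"
      unfolding Lpp_real
    proof (rule nn_integral_mono)
      fix x
      have "ennreal \<bar>w x\<bar> \<le> ennreal \<bar>w x - ball_avg w 1 x\<bar> + ennreal \<bar>ball_avg w 1 x\<bar>"
        by (simp add: ennreal_plus[symmetric] ennreal_leI del: ennreal_plus)
      then have "epow (ennreal \<bar>w x\<bar>) q \<le> epow (ennreal \<bar>w x - ball_avg w 1 x\<bar> + ennreal \<bar>ball_avg w 1 x\<bar>) q"
        using q by (intro epow_mono) auto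
      also have "\<dots> \<le> ennreal (2 powr q) * (epow (ennreal \<bar>w x - ball_avg w 1 x\<bar>) q + epow (ennreal \<bar>ball_avg w 1 x\<bar>) q)"
        using q by (intro epow_plus_le) auto
      finally show "epow (ennreal \<bar>w x\<bar>) q \<le> ennreal (2 powr q) * (epow (ennreal \<bar>w x - ball_avg w 1 x\<bar>) q + epow (ennreal \<bar>ball_avg w 1 x\<bar>) q)" .
    qed
    also have "\<dots> = ennreal (2 powr q) * ((\<integral>\<^sup>+x. epow (ennreal \<bar>w x - ball_avg w 1 x\<bar>) q \<partial>lborel) + (\<integral>\<^sup>+x. epow (ennreal \<bar>ball_avg w 1 x\<bar>) q \<partial>lborel))"
      by (simp add: nn_integral_cmult nn_integral_add del: epow_ennreal)
    also have "(\<integral>\<^sup>+x. epow (ennreal \<bar>w x - ball_avg w 1 x\<bar>) q \<partial>lborel) \<le> ennreal C * epow S (q / p)"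
    proof -
      have "(\<integral>\<^sup>+x. epow (ennreal \<bar>w x - ball_avg w 1 x\<bar>) q \<partial>lborel) \<le> ennreal C * epow (Lpp p h) (q / p)"
        using C(2)[OF l sobD(7)[OF s], of 1] by (simp add: Lpp_def del: epow_ennreal)
      also have "\<dots> \<le> ennreal C * epow S (q / p)"
        using p pq by (intro mult_left_mono epow_mono) (auto simp: S_def)
      finally show ?thesis .
    qed
    also have "(\<integral>\<^sup>+x. epow (ennreal \<bar>ball_avg w 1 x\<bar>) q \<partial>lborel) \<le> ennreal (V powr (q - p)) * epow S (q / p)"
    proof -
      have "(\<integral>\<^sup>+x. epow (ennreal \<bar>ball_avg w 1 x\<bar>) q \<partial>lborel)
        \<le> (\<integral>\<^sup>+x. ennreal (V powr (q - p)) * epow (Lpp p w) ((q - p)/p) * ball_mean (\<lambda>y. epow (ennreal \<bar>w y\<bar>) p) 1 x \<partial>lborel)"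
        by (intro nn_integral_mono avg)
      also have "\<dots> = ennreal (V powr (q - p)) * epow (Lpp p w) ((q - p)/p) * Lpp p w"
        by (simp add: nn_integral_cmult nn_integral_ball_mean Lpp_real del: epow_ennreal)
      also have "\<dots> = ennreal (V powr (q - p)) * epow (Lpp p w) (q/p)"
        using epow_add[of "Lpp p w" "(q - p)/p" 1] p by (simp add: mult.assoc diff_divide_distrib)
      also have "\<dots> \<le> ennreal (V powr (q - p)) * epow S (q / p)"
        using p pq by (intro mult_left_mono epow_mono) (auto simp: S_def)
      finally show ?thesis .
    qed
    finally have "Lpp q w \<le> ennreal (2 powr q) * (ennreal C * epow S (q / p) + ennreal (V powr (q - p)) * epow S (q / p))"
      by (simp add: mult_left_mono add_mono)
    also have "\<dots> = ennreal C' * epow S (q / p)"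
      using C(1) by (simp add: C'_def ennreal_mult ennreal_plus distrib_right mult.assoc)
    finally show "Lpp q w \<le> ennreal C' * epow (Lpp p h + Lpp p w) (q / p)" by (simp add: S_def)
  qed
qed

lemma Linf_embedding:
  fixes p :: real
  assumes p: "1 \<le> p" "DIM('a::euclidean_space) < p"
  shows "\<exists>C>0. \<forall>(w :: 'a \<Rightarrow> real) h. sob UNIV p w h \<longrightarrow> (AE x in lborel. ennreal \<bar>w x\<bar> \<le> ennreal C * epow (Lpp p h + Lpp p w) (1 / p))"
proof -
  define V where "V = ball_volume TYPE('a) 1 powr (-1/p)"
  define c where "c = V / (1 - DIM('a) / p)"
  have V: "0 < V" using ball_volume_pos[of 1, where 'a='a] by (simp add: V_def)
  have c: "0 < c" using V p by (simp add: c_def)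
  show ?thesis
  proof (intro exI[of _ "c + V"] conjI allI impI)
    show "0 < c + V" using c V by simp
    fix w :: "'a \<Rightarrow> real" and h assume s: "sob UNIV p w h"
    note l = sob_loc_int[OF s p(1)]
    note [measurable] = sobD(1,2)[OF s]
    define S where "S = Lpp p h + Lpp p w"
    have "AE x in lborel. ennreal \<bar>w x - ball_avg w 1 x\<bar> \<le> ennreal c * epow (Lpp p h) (1/p)"
      using diff_ball_avg_sup_weak[OF l sobD(7)[OF s], of 1 p] p by (simp add: c_def V_def Lpp_def del: epow_ennreal)
    then show "AE x in lborel. ennreal \<bar>w x\<bar> \<le> ennreal (c + V) * epow (Lpp p h + Lpp p w) (1 / p)"
    proof eventually_elim
      fix x assume *: "ennreal \<bar>w x - ball_avg w 1 x\<bar> \<le> ennreal c * epow (Lpp p h) (1/p)"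
      have si: "set_integrable lborel (ball 0 1) (\<lambda>z. w (x + z))" by (rule loc_int_set_integrable_ball[OF l(1)])
      have "ennreal \<bar>w x\<bar> \<le> ennreal \<bar>w x - ball_avg w 1 x\<bar> + ennreal \<bar>ball_avg w 1 x\<bar>"
        by (simp add: ennreal_plus[symmetric] ennreal_leI del: ennreal_plus)
      also have "ennreal \<bar>ball_avg w 1 x\<bar> \<le> ball_mean (\<lambda>y. ennreal \<bar>w y\<bar>) 1 x"
        by (intro ball_avg_le_ball_mean si) auto
      also have "\<dots> \<le> ennreal V * epow (Lpp p w) (1/p)"
        using ball_mean_bound[of "\<lambda>y. ennreal \<bar>w y\<bar>" p 1 x] p by (simp add: V_def Lpp_real del: epow_ennreal)
      also have "epow (Lpp p w) (1/p) \<le> epow S (1/p)" using p by (intro epow_mono) (auto simp: S_def)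
      also have "ennreal \<bar>w x - ball_avg w 1 x\<bar> \<le> ennreal c * epow S (1/p)"
        using p by (intro order_trans[OF *] mult_left_mono epow_mono) (auto simp: S_def)
      finally have "ennreal \<bar>w x\<bar> \<le> ennreal c * epow S (1/p) + ennreal V * epow S (1/p)"
        by (simp add: mult_left_mono add_mono)
      then show "ennreal \<bar>w x\<bar> \<le> ennreal (c + V) * epow (Lpp p h + Lpp p w) (1 / p)"
        using c V by (simp add: S_def distrib_right)
    qed
  qed
qed

text \<open>The Sobolev inequality, with the p-norm of w added on the right so that both ranges of p
  give a bound of the same shape.\<close>

lemma Lq_embedding_less:
  fixes p :: real
  assumes p: "1 \<le> p" "p < DIM('a::euclidean_space)"
  defines "q \<equiv> DIM('a) * p / (DIM('a) - p)"
  shows "p < q" "\<exists>C>0. \<forall>(w :: 'a \<Rightarrow> real) h. sob UNIV p w h \<longrightarrow> Lpp q w \<le> ennreal C * epow (Lpp p h + Lpp p w) (q / p)"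
proof -
  show "p < q" using p by (simp add: q_def divide_simps)
  have q: "1 + p / (DIM('a) - p) = q / p" "p * (q / p) = q"
    using p by (simp_all add: q_def field_simps)
  obtain C where C: "0 < C" "\<And>(u :: 'a \<Rightarrow> real) g. loc_int u \<Longrightarrow> loc_int g \<Longrightarrow> weak_grad_eq UNIV u g \<Longrightarrow>
    (\<integral>\<^sup>+x. epow (ennreal \<bar>u x\<bar>) p \<partial>lborel) < top \<Longrightarrow>
    (\<integral>\<^sup>+x. epow (ennreal \<bar>u x\<bar>) q \<partial>lborel) \<le> ennreal C * epow (\<integral>\<^sup>+x. epow (ennreal (norm (g x))) p \<partial>lborel) (q / p)"
    using sobolev_weak[OF p] unfolding q by blast
  show "\<exists>C>0. \<forall>(w :: 'a \<Rightarrow> real) h. sob UNIV p w h \<longrightarrow> Lpp q w \<le> ennreal C * epow (Lpp p h + Lpp p w) (q / p)"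
  proof (intro exI[of _ C] conjI allI impI C(1))
    fix w :: "'a \<Rightarrow> real" and h assume s: "sob UNIV p w h"
    have "Lpp q w \<le> ennreal C * epow (Lpp p h) (q / p)"
      using C(2)[OF sob_loc_int[OF s p(1)] sobD(7,5)[OF s]] by (simp only: Lpp_def real_norm_def)
    also have "\<dots> \<le> ennreal C * epow (Lpp p h + Lpp p w) (q / p)"
      using p \<open>p < q\<close> by (intro mult_left_mono epow_mono) auto
    finally show "Lpp q w \<le> ennreal C * epow (Lpp p h + Lpp p w) (q / p)" .
  qed
qed

section \<open>Higher integrability and the Poincare inequality on extension domains\<close>

text \<open>Restates the extension property for Borel representatives, so that the estimates on
  \<Omega> can be carried out entirely with \<open>sob\<close> and \<open>Lpp\<close>.\<close>

locale sobolev_extension_domain =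
  fixes \<Omega> :: "'a::euclidean_space set" and p :: real
  assumes p: "1 < p" and open_dom: "open \<Omega>" and connected_dom: "connected \<Omega>" and nonempty: "\<Omega> \<noteq> {}"
    and finite_measure_dom: "emeasure lborel \<Omega> < top"
    and extension: "\<exists>C\<ge>1. \<forall>u g. sob \<Omega> p u g \<longrightarrow> (\<exists>w h. sob UNIV p w h \<and> (AE x in lborel. x \<in> \<Omega> \<longrightarrow> w x = u x) \<and>
      Lpp p h + Lpp p w \<le> ennreal C * (Lpp p g + Lpp p u))"
begin

lemma dom_borel [measurable]: "\<Omega> \<in> sets borel"
  using open_dom by simp

text \<open>Restriction to \<Omega> does not increase the L^q norm, so an embedding on the whole
  space passes through the extension.\<close>

lemma Lq_embedding_dom:
  assumes q: "p \<le> q"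
    and emb: "\<exists>C>0. \<forall>(w :: 'a \<Rightarrow> real) h. sob UNIV p w h \<longrightarrow> Lpp q w \<le> ennreal C * epow (Lpp p h + Lpp p w) (q / p)"
  shows "\<exists>C>0. \<forall>u g. sob \<Omega> p u g \<longrightarrow> Lpp q u \<le> ennreal C * epow (Lpp p g + Lpp p u) (q / p)"
proof -
  obtain C where C: "0 < C" "\<And>(w :: 'a \<Rightarrow> real) h. sob UNIV p w h \<Longrightarrow> Lpp q w \<le> ennreal C * epow (Lpp p h + Lpp p w) (q / p)"
    using emb by blast
  obtain D where D: "1 \<le> D" "\<And>u g. sob \<Omega> p u g \<Longrightarrow> (\<exists>w h. sob UNIV p w h \<and> (AE x in lborel. x \<in> \<Omega> \<longrightarrow> w x = u x) \<and>
      Lpp p h + Lpp p w \<le> ennreal D * (Lpp p g + Lpp p u))"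
    using extension by blast
  show ?thesis
  proof (intro exI[of _ "C * D powr (q / p)"] conjI allI impI)
    show "0 < C * D powr (q / p)" using C D by simp
    fix u g assume s: "sob \<Omega> p u g"
    obtain w h where w: "sob UNIV p w h" "AE x in lborel. x \<in> \<Omega> \<longrightarrow> w x = u x" "Lpp p h + Lpp p w \<le> ennreal D * (Lpp p g + Lpp p u)"
      using D(2)[OF s] by blast
    have "Lpp q u \<le> Lpp q w"
      unfolding Lpp_def
    proof (rule nn_integral_mono_AE)
      show "AE x in lborel. epow (ennreal (norm (u x))) q \<le> epow (ennreal (norm (w x))) q"
        using w(2)
      proof eventually_elim
        fix x assume "x \<in> \<Omega> \<longrightarrow> w x = u x"
        then show "epow (ennreal (norm (u x))) q \<le> epow (ennreal (norm (w x))) q"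
          using sobD(3)[OF s, of x] by (cases "x \<in> \<Omega>") auto
      qed
    qed
    also have "\<dots> \<le> ennreal C * epow (Lpp p h + Lpp p w) (q / p)" by (rule C(2)[OF w(1)])
    also have "\<dots> \<le> ennreal C * epow (ennreal D * (Lpp p g + Lpp p u)) (q / p)"
      using q p by (intro mult_left_mono epow_mono w(3)) auto
    also have "\<dots> = ennreal (C * D powr (q / p)) * epow (Lpp p g + Lpp p u) (q / p)"
      using C D by (simp add: epow_mult ennreal_mult mult.assoc)
    finally show "Lpp q u \<le> ennreal (C * D powr (q / p)) * epow (Lpp p g + Lpp p u) (q / p)" .
  qed
qed

text \<open>Any gain q > p is enough for the Poincare inequality; for p >= n the value 2 p is an
  arbitrary choice.\<close>

lemma higher_integrability:
  "\<exists>q>p. \<exists>C>0. \<forall>u g. sob \<Omega> p u g \<longrightarrow> Lpp q u \<le> ennreal C * epow (Lpp p g + Lpp p u) (q / p)"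
proof (cases "p < DIM('a)")
  case True
  define q where "q = DIM('a) * p / (DIM('a) - p)"
  have "p < q" using Lq_embedding_less(1)[where 'a='a, of p] p True by (simp add: q_def)
  moreover have "\<exists>C>0. \<forall>u g. sob \<Omega> p u g \<longrightarrow> Lpp q u \<le> ennreal C * epow (Lpp p g + Lpp p u) (q / p)"
    using \<open>p < q\<close> p True unfolding q_def by (intro Lq_embedding_dom Lq_embedding_less(2)) auto
  ultimately show ?thesis by blast
next
  case False
  have "\<exists>C>0. \<forall>u g. sob \<Omega> p u g \<longrightarrow> Lpp (2 * p) u \<le> ennreal C * epow (Lpp p g + Lpp p u) (2 * p / p)"
    using p False by (intro Lq_embedding_dom Lq_embedding_ge) auto
  then show ?thesis using p by (intro exI[of _ "2 * p"]) auto
qed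

text \<open>The constant c may depend on u and is not tied to a mean value; this freedom lets the
  property pass to overlapping unions. The gradient norm is always taken over the whole
  domain.\<close>

definition poincare_set :: "'a set \<Rightarrow> bool" where
  "poincare_set K \<longleftrightarrow> K \<in> sets borel \<and> K \<subseteq> \<Omega> \<and> (\<exists>C\<ge>0. \<forall>u g. sob \<Omega> p u g \<longrightarrow>
     (\<exists>c. (\<integral>\<^sup>+x\<in>K. epow (ennreal \<bar>u x - c\<bar>) p \<partial>lborel) \<le> ennreal C * Lpp p g))"

text \<open>Jensen replaces one variable of the double integral by the ball average. The doubled
  ball inside \<Omega> leaves a margin R for mollification.\<close>

lemma poincare_set_ball:
  assumes R: "0 < R" and sub: "cball x0 (2 * R) \<subseteq> \<Omega>"
  shows "poincare_set (ball x0 R)"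
proof -
  let ?B = "ball x0 R" and ?v = "ball_volume TYPE('a) R"
  have [measurable]: "?B \<in> sets borel" by simp
  have v: "0 < ?v" "0 < ball_volume TYPE('a) (2 * R)" using ball_volume_pos[where 'a='a] R by auto
  have sub': "cball x R \<subseteq> \<Omega>" if "x \<in> ?B" for x
  proof -
    have "cball x R \<subseteq> cball x0 (2 * R)"
    proof
      fix y assume "y \<in> cball x R"
      then show "y \<in> cball x0 (2 * R)" using dist_triangle[of x0 y x] that by auto
    qed
    then show ?thesis using sub by blast
  qed
  define C where "C = (2 * R) powr p * ball_volume TYPE('a) (2 * R)"
  have C: "0 \<le> C" using v by (simp add: C_def)
  have main: "\<exists>c. (\<integral>\<^sup>+x\<in>?B. epow (ennreal \<bar>u x - c\<bar>) p \<partial>lborel) \<le> ennreal (1 / ?v * C) * Lpp p g"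
    if s: "sob \<Omega> p u g" for u g
  proof (intro exI[of _ "ball_avg u R x0"])
    note [measurable] = sobD(1,2)[OF s]
    have l: "loc_int u" "loc_int g" using sob_loc_int[OF s] p by auto
    have bm: "ball_mean f R x0 = ennreal (1 / ?v) * (\<integral>\<^sup>+x\<in>?B. f x \<partial>lborel)" if [measurable]: "f \<in> borel_measurable borel" for f
    proof -
      have "(\<integral>\<^sup>+x\<in>?B. f x \<partial>lborel) = (\<integral>\<^sup>+z. f (x0 + z) * indicator ?B (x0 + z) \<partial>lborel)"
        by (subst nn_integral_lborel_translate[of _ x0, symmetric]) auto
      also have "(\<lambda>z. indicator ?B (x0 + z) :: ennreal) = indicator (ball 0 R)"
        by (auto simp: indicator_def dist_norm fun_eq_iff)
      then have "(\<lambda>z. f (x0 + z) * indicator ?B (x0 + z)) = (\<lambda>z. f (x0 + z) * indicator (ball 0 R) z)"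
        by metis
      finally show ?thesis by (simp add: ball_mean_def)
    qed
    have "(\<integral>\<^sup>+y\<in>?B. epow (ennreal \<bar>u y - ball_avg u R x0\<bar>) p \<partial>lborel)
      \<le> (\<integral>\<^sup>+y. ennreal (1 / ?v) * ((\<integral>\<^sup>+x\<in>?B. epow (ennreal \<bar>u x - u y\<bar>) p \<partial>lborel) * indicator ?B y) \<partial>lborel)"
    proof (rule nn_integral_mono)
      fix y
      have "ennreal \<bar>u y - ball_avg u R x0\<bar> \<le> ball_mean (\<lambda>v. ennreal \<bar>u y - u v\<bar>) R x0"
        unfolding ball_mean_def by (rule ball_avg_diff_le[OF R loc_int_set_integrable_ball[OF l(1)]])
      then have "epow (ennreal \<bar>u y - ball_avg u R x0\<bar>) p \<le> epow (ball_mean (\<lambda>v. ennreal \<bar>u y - u v\<bar>) R x0) p"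
        using p by (intro epow_mono) auto
      also have "\<dots> \<le> ball_mean (\<lambda>v. epow (ennreal \<bar>u y - u v\<bar>) p) R x0"
        using p by (intro ball_mean_Jensen R) auto
      also have "\<dots> = ennreal (1 / ?v) * (\<integral>\<^sup>+x\<in>?B. epow (ennreal \<bar>u x - u y\<bar>) p \<partial>lborel)"
        by (subst bm) (auto simp: abs_minus_commute simp del: epow_ennreal)
      finally show "epow (ennreal \<bar>u y - ball_avg u R x0\<bar>) p * indicator ?B y
        \<le> ennreal (1 / ?v) * ((\<integral>\<^sup>+x\<in>?B. epow (ennreal \<bar>u x - u y\<bar>) p \<partial>lborel) * indicator ?B y)"
        by (auto simp: indicator_def simp del: epow_ennreal)
    qed
    also have "\<dots> = ennreal (1 / ?v) * (\<integral>\<^sup>+y\<in>?B. (\<integral>\<^sup>+x\<in>?B. epow (ennreal \<bar>u x - u y\<bar>) p \<partial>lborel) \<partial>lborel)"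
      by (rule nn_integral_cmult) measurable
    also have "\<dots> \<le> ennreal (1 / ?v) * (ennreal C * Lpp p g)"
      unfolding C_def Lpp_def
      by (intro mult_left_mono poincare_ball_weak[OF l sobD(7)[OF s] R _ R sub']) (use p in auto)
    also have "\<dots> = ennreal (1 / ?v * C) * Lpp p g"
      unfolding mult.assoc[symmetric] using v C by (subst ennreal_mult) auto
    finally show "(\<integral>\<^sup>+x\<in>?B. epow (ennreal \<bar>u x - ball_avg u R x0\<bar>) p \<partial>lborel) \<le> ennreal (1 / ?v * C) * Lpp p g" .
  qed
  show ?thesis
    unfolding poincare_set_def
  proof (intro conjI exI[of _ "1 / ?v * C"])
    show "?B \<subseteq> \<Omega>" using sub R by (auto simp: subset_iff)
    show "0 \<le> 1 / ?v * C" using v C by simp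
    show "?B \<in> sets borel" by simp
    show "\<forall>u g. sob \<Omega> p u g \<longrightarrow> (\<exists>c. (\<integral>\<^sup>+x\<in>?B. epow (ennreal \<bar>u x - c\<bar>) p \<partial>lborel) \<le> ennreal (1 / ?v * C) * Lpp p g)"
      using main by blast
  qed
qed

text \<open>On the overlap both constants approximate u, so they differ by a controlled amount; the
  constant of \<open>K1\<close> can then be used on \<open>K2\<close> as well.\<close>

lemma poincare_set_Un:
  assumes K1: "poincare_set K1" and K2: "poincare_set K2" and m: "0 < emeasure lborel (K1 \<inter> K2)"
  shows "poincare_set (K1 \<union> K2)"
proof -
  have [measurable]: "K1 \<in> sets borel" "K2 \<in> sets borel" and sub: "K1 \<subseteq> \<Omega>" "K2 \<subseteq> \<Omega>"
    using K1 K2 by (auto simp: poincare_set_def)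
  obtain C1 where C1: "0 \<le> C1" "\<And>u g. sob \<Omega> p u g \<Longrightarrow> \<exists>c. (\<integral>\<^sup>+x\<in>K1. epow (ennreal \<bar>u x - c\<bar>) p \<partial>lborel) \<le> ennreal C1 * Lpp p g"
    using K1 by (auto simp: poincare_set_def)
  obtain C2 where C2: "0 \<le> C2" "\<And>u g. sob \<Omega> p u g \<Longrightarrow> \<exists>c. (\<integral>\<^sup>+x\<in>K2. epow (ennreal \<bar>u x - c\<bar>) p \<partial>lborel) \<le> ennreal C2 * Lpp p g"
    using K2 by (auto simp: poincare_set_def)
  have fin: "emeasure lborel (K1 \<inter> K2) < top" "emeasure lborel K2 < top"
    using sub by (auto intro!: le_less_trans[OF emeasure_mono finite_measure_dom])
  obtain \<mu> where \<mu>: "0 < \<mu>" "emeasure lborel (K1 \<inter> K2) = ennreal \<mu>"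
    using m fin(1) by (cases "emeasure lborel (K1 \<inter> K2)") auto
  obtain M where M: "0 \<le> M" "emeasure lborel K2 = ennreal M"
    using fin(2) by (cases "emeasure lborel K2") auto
  define T where "T = 2 powr p"
  have T: "0 < T" by (simp add: T_def)
  define C where "C = C1 + T * (C2 + M / \<mu> * (T * (C1 + C2)))"
  have C: "0 \<le> C" using C1 C2 M \<mu> T by (simp add: C_def)
  have main: "\<exists>c. (\<integral>\<^sup>+x\<in>K1 \<union> K2. epow (ennreal \<bar>u x - c\<bar>) p \<partial>lborel) \<le> ennreal C * Lpp p g" if s: "sob \<Omega> p u g" for u g
  proof -
    note [measurable] = sobD(1,2)[OF s]
    define N where "N = Lpp p g"
    obtain n where n: "0 \<le> n" "N = ennreal n" using sob_Lpp(2)[OF s] by (cases N) (auto simp: N_def)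
    obtain c1 where c1: "(\<integral>\<^sup>+x\<in>K1. epow (ennreal \<bar>u x - c1\<bar>) p \<partial>lborel) \<le> ennreal (C1 * n)"
      using C1(2)[OF s] C1(1) n by (auto simp: ennreal_mult N_def)
    obtain c2 where c2: "(\<integral>\<^sup>+x\<in>K2. epow (ennreal \<bar>u x - c2\<bar>) p \<partial>lborel) \<le> ennreal (C2 * n)"
      using C2(2)[OF s] C2(1) n by (auto simp: ennreal_mult N_def)
    define d where "d = \<bar>c1 - c2\<bar> powr p"
    have tri: "epow (ennreal \<bar>a - b\<bar>) p \<le> ennreal T * (epow (ennreal \<bar>e - a\<bar>) p + epow (ennreal \<bar>e - b\<bar>) p)" for a b e :: real
    proof -
      have "ennreal \<bar>a - b\<bar> \<le> ennreal \<bar>e - a\<bar> + ennreal \<bar>e - b\<bar>"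
        by (simp add: ennreal_plus[symmetric] ennreal_leI del: ennreal_plus)
      then have "epow (ennreal \<bar>a - b\<bar>) p \<le> epow (ennreal \<bar>e - a\<bar> + ennreal \<bar>e - b\<bar>) p"
        using p by (intro epow_mono) auto
      also have "\<dots> \<le> ennreal T * (epow (ennreal \<bar>e - a\<bar>) p + epow (ennreal \<bar>e - b\<bar>) p)"
        unfolding T_def using p by (intro epow_plus_le) auto
      finally show ?thesis .
    qed
    \<comment> \<open>The p-th power of the difference of the constants is integrated over the
      overlap; dividing by its measure later requires the overlap to be non-null.\<close>
    have "ennreal d * ennreal \<mu> = (\<integral>\<^sup>+x. epow (ennreal \<bar>c1 - c2\<bar>) p * indicator (K1 \<inter> K2) x \<partial>lborel)"
      by (simp add: nn_integral_cmult \<mu>(2) d_def)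
    also have "\<dots> \<le> (\<integral>\<^sup>+x. ennreal T * (epow (ennreal \<bar>u x - c1\<bar>) p * indicator K1 x + epow (ennreal \<bar>u x - c2\<bar>) p * indicator K2 x) \<partial>lborel)"
      using tri by (intro nn_integral_mono) (auto simp: indicator_def simp del: epow_ennreal)
    also have "\<dots> = ennreal T * ((\<integral>\<^sup>+x\<in>K1. epow (ennreal \<bar>u x - c1\<bar>) p \<partial>lborel) + (\<integral>\<^sup>+x\<in>K2. epow (ennreal \<bar>u x - c2\<bar>) p \<partial>lborel))"
      by (simp add: nn_integral_cmult nn_integral_add del: epow_ennreal)
    also have "\<dots> \<le> ennreal T * (ennreal (C1 * n) + ennreal (C2 * n))"
      by (intro mult_left_mono add_mono c1 c2) auto
    also have "\<dots> = ennreal (T * (C1 * n + C2 * n))"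
      using C1 C2 n T by (simp add: ennreal_mult ennreal_plus)
    finally have "d * \<mu> \<le> T * (C1 * n + C2 * n)"
      using C1 C2 n T \<mu> by (simp add: ennreal_mult[symmetric] d_def ennreal_le_iff)
    define d' where "d' = T * (C1 * n + C2 * n) / \<mu>"
    have d'0: "0 \<le> d'" using C1 C2 n T \<mu> by (simp add: d'_def)
    have d: "d \<le> d'" using \<open>d * \<mu> \<le> _\<close> \<mu> by (simp add: pos_le_divide_eq d'_def)
    have "(\<integral>\<^sup>+x\<in>K2. epow (ennreal \<bar>u x - c1\<bar>) p \<partial>lborel)
      \<le> (\<integral>\<^sup>+x. ennreal T * (epow (ennreal \<bar>u x - c2\<bar>) p * indicator K2 x + ennreal d * indicator K2 x) \<partial>lborel)"
    proof (rule nn_integral_mono)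
      fix x
      have "epow (ennreal \<bar>u x - c1\<bar>) p \<le> ennreal T * (epow (ennreal \<bar>u x - c2\<bar>) p + ennreal d)"
        using tri[of "u x" c1 c2] by (simp add: d_def abs_minus_commute)
      then show "epow (ennreal \<bar>u x - c1\<bar>) p * indicator K2 x \<le> ennreal T * (epow (ennreal \<bar>u x - c2\<bar>) p * indicator K2 x + ennreal d * indicator K2 x)"
        by (auto simp: indicator_def simp del: epow_ennreal)
    qed
    also have "\<dots> = ennreal T * ((\<integral>\<^sup>+x\<in>K2. epow (ennreal \<bar>u x - c2\<bar>) p \<partial>lborel) + ennreal d * ennreal M)"
      by (simp add: nn_integral_cmult nn_integral_add M(2) del: epow_ennreal)
    also have "\<dots> \<le> ennreal T * (ennreal (C2 * n) + ennreal d' * ennreal M)"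
      using d by (intro mult_left_mono add_mono mult_right_mono ennreal_leI c2) auto
    also have "\<dots> = ennreal (T * (C2 * n + d' * M))"
      using C2 n T M d'0 by (simp add: ennreal_mult ennreal_plus)
    finally have 2: "(\<integral>\<^sup>+x\<in>K2. epow (ennreal \<bar>u x - c1\<bar>) p \<partial>lborel) \<le> ennreal (T * (C2 * n + d' * M))" .
    have "(\<integral>\<^sup>+x\<in>K1 \<union> K2. epow (ennreal \<bar>u x - c1\<bar>) p \<partial>lborel)
      \<le> (\<integral>\<^sup>+x. epow (ennreal \<bar>u x - c1\<bar>) p * indicator K1 x + epow (ennreal \<bar>u x - c1\<bar>) p * indicator K2 x \<partial>lborel)"
      by (intro nn_integral_mono) (auto simp: indicator_def simp del: epow_ennreal)
    also have "\<dots> = (\<integral>\<^sup>+x\<in>K1. epow (ennreal \<bar>u x - c1\<bar>) p \<partial>lborel) + (\<integral>\<^sup>+x\<in>K2. epow (ennreal \<bar>u x - c1\<bar>) p \<partial>lborel)"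
      by (rule nn_integral_add) auto
    also have "\<dots> \<le> ennreal (C1 * n) + ennreal (T * (C2 * n + d' * M))"
      by (intro add_mono c1 2)
    also have "\<dots> = ennreal (C1 * n + T * (C2 * n + d' * M))"
      using C1 C2 n T d'0 M by (subst ennreal_plus) auto
    also have "C1 * n + T * (C2 * n + d' * M) = C * n"
      using \<mu> by (simp add: C_def d'_def field_simps)
    also have "ennreal (C * n) = ennreal C * Lpp p g" using C n by (simp add: ennreal_mult N_def)
    finally show ?thesis by blast
  qed
  show ?thesis
    unfolding poincare_set_def
  proof (intro conjI exI[of _ C])
    show "K1 \<union> K2 \<in> sets borel" by simp
    show "K1 \<union> K2 \<subseteq> \<Omega>" using sub by blast
    show "\<forall>u g. sob \<Omega> p u g \<longrightarrow> (\<exists>c. (\<integral>\<^sup>+x\<in>K1 \<union> K2. epow (ennreal \<bar>u x - c\<bar>) p \<partial>lborel) \<le> ennreal C * Lpp p g)"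
      using main by blast
  qed (rule C)
qed

lemma open_inter_emeasure_pos:
  assumes "open A" "A \<noteq> {}" shows "0 < emeasure lborel (A :: 'a set)"
proof -
  obtain x where "x \<in> A" using assms by auto
  then obtain e where e: "0 < e" "ball x e \<subseteq> A" using assms open_contains_ball by blast
  have "0 < ennreal (ball_volume TYPE('a) e)" using ball_volume_pos[OF e(1), where 'a='a] by simp
  also have "\<dots> = emeasure lborel (ball x e)" by (simp add: emeasure_ball_volume)
  also have "\<dots> \<le> emeasure lborel A" using e assms by (intro emeasure_mono) auto
  finally show ?thesis .
qed

text \<open>Connectedness lets finite chains of overlapping balls reach every point: the points
  around which some ball lies in a Poincare set containing a fixed ball form an open and relatively
  closed set. A countable subcover and continuity of the measure from above give the rest.\<close>

lemma poincare_set_exhaustion: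
  assumes \<delta>: "0 < \<delta>"
  shows "\<exists>K. poincare_set K \<and> emeasure lborel (\<Omega> - K) < ennreal \<delta>"
proof -
  obtain x0 where x0: "x0 \<in> \<Omega>" using nonempty by auto
  have ballin: "\<exists>r>0. cball x (2 * r) \<subseteq> \<Omega>" if "x \<in> \<Omega>" for x
  proof -
    from open_contains_cball[THEN iffD1, OF open_dom] that
    obtain e where "0 < e" "cball x e \<subseteq> \<Omega>" by auto
    then show ?thesis by (intro exI[of _ "e/2"]) auto
  qed
  obtain r0 where r0: "0 < r0" "cball x0 (2 * r0) \<subseteq> \<Omega>" using ballin[OF x0] by blast
  let ?B0 = "ball x0 r0"
  have B0: "poincare_set ?B0" by (rule poincare_set_ball[OF r0])
  \<comment> \<open>Retaining the ball about \<open>x0\<close> in every set guarantees that any two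
    of them overlap, so finite unions stay admissible.\<close>
  define P where "P K \<longleftrightarrow> poincare_set K \<and> ?B0 \<subseteq> K" for K
  define S where "S = \<Union>{ball x e | x e. 0 < e \<and> (\<exists>K. P K \<and> ball x e \<subseteq> K)}"
  have PK: "K \<in> sets borel" "K \<subseteq> \<Omega>" if "P K" for K using that by (auto simp: P_def poincare_set_def)
  have Ssub: "S \<subseteq> \<Omega>" using PK by (auto simp: S_def)
  have "open S" unfolding S_def by (intro open_Union) auto
  have "S = \<Omega>"
  proof (rule ccontr)
    assume "S \<noteq> \<Omega>"
    \<comment> \<open>A ball with its double in \<Omega> that meets \<open>S\<close> meets some
      admissible set in positive measure. It can be adjoined to that set, so its centre lies in
      \<open>S\<close>.\<close>
    have "open (\<Omega> - S)"
    proof (subst open_subopen, intro ballI)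
      fix x assume x: "x \<in> \<Omega> - S"
      obtain r where r: "0 < r" "cball x (2 * r) \<subseteq> \<Omega>" using ballin x by blast
      have Bx: "poincare_set (ball x r)" by (rule poincare_set_ball[OF r])
      have "ball x r \<inter> S = {}"
      proof (rule ccontr)
        assume "ball x r \<inter> S \<noteq> {}"
        then obtain y z e K where y: "y \<in> ball x r" "y \<in> ball z e" "P K" "ball z e \<subseteq> K" by (auto simp: S_def)
        have "0 < emeasure lborel (ball x r \<inter> ball z e)"
          using y(1,2) by (intro open_inter_emeasure_pos) auto
        also have "\<dots> \<le> emeasure lborel (K \<inter> ball x r)"
          using y(4) PK(1)[OF y(3)] by (intro emeasure_mono) auto
        finally have "poincare_set (K \<union> ball x r)"
          using y(3) Bx by (intro poincare_set_Un) (auto simp: P_def)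
        then have "P (K \<union> ball x r)" using y(3) by (auto simp: P_def)
        moreover have "ball x r \<subseteq> K \<union> ball x r" by simp
        ultimately have "ball x r \<in> {ball x e | x e. 0 < e \<and> (\<exists>K. P K \<and> ball x e \<subseteq> K)}" using r(1) by blast
        then have "x \<in> S" unfolding S_def by (rule UnionI) (use r(1) in simp)
        with x show False by simp
      qed
      moreover have "ball x r \<subseteq> \<Omega>" using r by (auto simp: subset_iff)
      ultimately show "\<exists>T. open T \<and> x \<in> T \<and> T \<subseteq> \<Omega> - S" using r(1) by (intro exI[of _ "ball x r"]) auto
    qed
    moreover have "x0 \<in> S"
    proof -
      have "P ?B0" using B0 by (simp add: P_def)
      then have "?B0 \<in> {ball x e | x e. 0 < e \<and> (\<exists>K. P K \<and> ball x e \<subseteq> K)}" using r0(1) by blast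
      then show ?thesis unfolding S_def by (rule UnionI) (use r0(1) in simp)
    qed
    moreover from \<open>open (\<Omega> - S)\<close> have "S \<inter> \<Omega> = {} \<or> (\<Omega> - S) \<inter> \<Omega> = {}"
      by (intro connectedD[OF connected_dom \<open>open S\<close>]) auto
    ultimately show False using Ssub \<open>S \<noteq> \<Omega>\<close> by blast
  qed
  define \<B> where "\<B> = {ball x e | x e. 0 < e \<and> (\<exists>K. P K \<and> ball x e \<subseteq> K)}"
  have opB: "open B" if "B \<in> \<B>" for B using that by (auto simp: \<B>_def)
  obtain \<C> where \<C>': "\<C> \<subseteq> \<B>" "countable \<C>" "\<Union>\<C> = \<Union>\<B>"
    by (rule Lindelof[OF opB])
  have \<C>: "\<C> \<subseteq> {ball x e | x e. 0 < e \<and> (\<exists>K. P K \<and> ball x e \<subseteq> K)}" "countable \<C>" "\<Union>\<C> = \<Omega>"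
    using \<C>' \<open>S = \<Omega>\<close> by (simp_all only: \<B>_def S_def)
  have "\<C> \<noteq> {}" using \<C>(3) nonempty by auto
  define A where "A = from_nat_into \<C>"
  have rA: "range A = \<C>" unfolding A_def by (rule range_from_nat_into[OF \<open>\<C> \<noteq> {}\<close> \<C>(2)])
  have "\<forall>k. \<exists>K. P K \<and> A k \<subseteq> K"
  proof
    fix k
    have "A k \<in> \<C>" using rA by auto
    then show "\<exists>K. P K \<and> A k \<subseteq> K" using \<C>(1) by blast
  qed
  then obtain K where K: "\<And>k. P (K k)" "\<And>k. A k \<subseteq> K k" by metis
  define U where "U n = (\<Union>k\<le>n. K k)" for n :: nat
  have PU: "P (U n)" for n
  proof (induction n)
    case 0
    then show ?case using K(1)[of 0] by (simp add: U_def)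
  next
    case (Suc n)
    have eq: "U (Suc n) = U n \<union> K (Suc n)" by (auto simp: U_def atMost_Suc)
    have "0 < emeasure lborel ?B0" using r0 by (intro open_inter_emeasure_pos) auto
    also have "\<dots> \<le> emeasure lborel (U n \<inter> K (Suc n))"
      using Suc K(1)[of "Suc n"] PK(1)[OF Suc] PK(1)[OF K(1)[of "Suc n"]] by (intro emeasure_mono) (auto simp: P_def)
    finally have "poincare_set (U n \<union> K (Suc n))" using Suc K(1)[of "Suc n"] by (intro poincare_set_Un) (auto simp: P_def)
    then show ?case unfolding eq using Suc by (auto simp: P_def)
  qed
  have [measurable]: "U n \<in> sets borel" for n by (rule PK(1)[OF PU])
  have "(\<lambda>n. emeasure lborel (\<Omega> - U n)) \<longlonglongrightarrow> emeasure lborel (\<Inter>n. \<Omega> - U n)"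
  proof (rule Lim_emeasure_decseq)
    show "decseq (\<lambda>n. \<Omega> - U n)" by (auto simp: decseq_def U_def)
    show "emeasure lborel (\<Omega> - U i) \<noteq> \<infinity>" for i
      using le_less_trans[OF emeasure_mono[of "\<Omega> - U i" \<Omega> lborel] finite_measure_dom] by auto
  qed auto
  moreover have "(\<Inter>n. \<Omega> - U n) = {}"
  proof -
    have "x \<in> (\<Union>n. U n)" if x: "x \<in> \<Omega>" for x
    proof -
      obtain k where "x \<in> A k" using x rA \<C>(3) by blast
      then have "x \<in> U k" using K(2)[of k] by (auto simp: U_def)
      then show ?thesis by blast
    qed
    then show ?thesis by blast
  qed
  ultimately have "(\<lambda>n. emeasure lborel (\<Omega> - U n)) \<longlonglongrightarrow> 0" by (simp only: emeasure_empty)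
  then have "\<forall>\<^sub>F n in sequentially. emeasure lborel (\<Omega> - U n) < ennreal \<delta>"
    using \<delta> by (intro order_tendstoD(2)) auto
  then obtain n where "emeasure lborel (\<Omega> - U n) < ennreal \<delta>" by (auto simp: eventually_sequentially)
  then show ?thesis using PU[of n] by (auto simp: P_def)
qed

text \<open>On the small set \<open>\<Omega> - K\<close> the higher integrability absorbs the \<open>L\<^sup>p\<close> norm, so no compact
  embedding is needed.\<close>

lemma poincare_const:
  "\<exists>C>0. \<forall>u g. sob \<Omega> p u g \<longrightarrow> (\<exists>c. Lpp p (\<lambda>x. u x - c * indicator \<Omega> x) \<le> ennreal C * Lpp p g)"
proof -
  obtain q C1 where q: "p < q" and C1: "0 < C1" "\<And>u g. sob \<Omega> p u g \<Longrightarrow> Lpp q u \<le> ennreal C1 * epow (Lpp p g + Lpp p u) (q / p)"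
    using higher_integrability by blast
  \<comment> \<open>\<open>L\<close> and \<delta> are tuned so that the large values and the small
    set each contribute at most a quarter of n + P below.\<close>
  define L where "L = (4 * C1) powr (1 / (q - p))"
  have L: "0 < L" using C1 by (simp add: L_def)
  have LC: "L powr (p - q) * C1 = 1/4"
  proof -
    have "(1 / (q - p)) * (p - q) = -1" using q by (simp add: divide_simps)
    then have "L powr (p - q) = (4 * C1) powr (-1)" by (simp only: L_def powr_powr)
    then have "L powr (p - q) = inverse (4 * C1)" using C1 by (simp add: powr_minus)
    then show ?thesis using C1 by (simp add: field_simps)
  qed
  define \<delta> where "\<delta> = 1 / (4 * L powr p)"
  have \<delta>: "0 < \<delta>" using L by (simp add: \<delta>_def)
  obtain K where K: "poincare_set K" "emeasure lborel (\<Omega> - K) < ennreal \<delta>"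
    using poincare_set_exhaustion[OF \<delta>] by blast
  have [measurable]: "K \<in> sets borel" and KO: "K \<subseteq> \<Omega>" using K(1) by (auto simp: poincare_set_def)
  obtain CK where CK: "0 \<le> CK" "\<And>u g. sob \<Omega> p u g \<Longrightarrow> \<exists>c. (\<integral>\<^sup>+x\<in>K. epow (ennreal \<bar>u x - c\<bar>) p \<partial>lborel) \<le> ennreal CK * Lpp p g"
    using K(1) unfolding poincare_set_def by blast
  show ?thesis
  proof (rule exI[of _ "2 * CK + 1"], intro conjI allI impI)
    show "0 < 2 * CK + 1" using CK by simp
    fix u g assume s: "sob \<Omega> p u g"
    obtain c where c: "(\<integral>\<^sup>+x\<in>K. epow (ennreal \<bar>u x - c\<bar>) p \<partial>lborel) \<le> ennreal CK * Lpp p g"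
      using CK(2)[OF s] by blast
    define v where "v = (\<lambda>x. u x - c * indicator \<Omega> x)"
    have sv: "sob \<Omega> p v g" unfolding v_def using p by (intro sob_diff_const s open_dom finite_measure_dom) auto
    note [measurable] = sobD(1,2)[OF sv]
    obtain n where n: "0 \<le> n" "Lpp p g = ennreal n" using sob_Lpp(2)[OF sv] by (cases "Lpp p g") auto
    obtain P where P: "0 \<le> P" "Lpp p v = ennreal P" using sob_Lpp(1)[OF sv] by (cases "Lpp p v") auto
    have "P \<le> (2 * CK + 1) * n"
    proof (cases "n + P = 0")
      case True
      then have "n = 0" "P = 0" using n P by linarith+
      then show ?thesis by simp
    next
      case False
      then have T: "0 < n + P" using n P by simp
      \<comment> \<open>The threshold scales like the full Sobolev norm, which makes both error
        terms linear in n + P.\<close>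
      define M where "M = L * (n + P) powr (1/p)"
      have M: "0 < M" using L T by (simp add: M_def)
      have Mp: "M powr p = L powr p * (n + P)" using L T p by (simp add: M_def powr_mult powr_powr)
      have Mpq: "M powr (p - q) * (n + P) powr (q / p) = L powr (p - q) * (n + P)"
      proof -
        have "M powr (p - q) = L powr (p - q) * (n + P) powr ((p - q) / p)"
          using L T by (simp add: M_def powr_mult powr_powr)
        moreover have "(n + P) powr ((p - q) / p) * (n + P) powr (q / p) = n + P"
          using p T by (simp add: powr_add[symmetric] diff_divide_distrib)
        ultimately show ?thesis by (simp add: mult.assoc)
      qed
      \<comment> \<open>Three contributions: the set \<open>K\<close>, the values up to M on the
        small set, and the values above M, where the q-th power dominates because q > p.\<close>
      have pw: "epow (ennreal \<bar>v x\<bar>) p \<le> epow (ennreal \<bar>u x - c\<bar>) p * indicator K x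
          + (ennreal (M powr p) * indicator (\<Omega> - K) x + ennreal (M powr (p - q)) * epow (ennreal \<bar>v x\<bar>) q)" for x
      proof (cases "x \<in> K")
        case True
        then have "v x = u x - c" using KO by (auto simp: v_def)
        then show ?thesis using True by (simp del: epow_ennreal)
      next
        case out: False
        show ?thesis
        proof (cases "x \<in> \<Omega>")
          case True
          have "\<bar>v x\<bar> powr p \<le> M powr p + M powr (p - q) * \<bar>v x\<bar> powr q"
          proof (cases "\<bar>v x\<bar> \<le> M")
            case True
            then show ?thesis using p by (intro add_increasing2 powr_mono2) auto
          next
            case False
            have "\<bar>v x\<bar> powr p = \<bar>v x\<bar> powr (p - q) * \<bar>v x\<bar> powr q" using False M by (simp add: powr_add[symmetric])
            also have "\<dots> \<le> M powr (p - q) * \<bar>v x\<bar> powr q"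
              using False M q by (intro mult_right_mono powr_mono2') auto
            finally show ?thesis by (simp add: add_increasing)
          qed
          then show ?thesis using True out by (simp add: ennreal_mult[symmetric] ennreal_plus[symmetric] ennreal_leI del: ennreal_plus)
        next
          case False
          then show ?thesis using sobD(3)[OF sv, of x] by simp
        qed
      qed
      have "Lpp p v \<le> (\<integral>\<^sup>+x. epow (ennreal \<bar>u x - c\<bar>) p * indicator K x
          + (ennreal (M powr p) * indicator (\<Omega> - K) x + ennreal (M powr (p - q)) * epow (ennreal \<bar>v x\<bar>) q) \<partial>lborel)"
        unfolding Lpp_real by (intro nn_integral_mono pw)
      also have "\<dots> = (\<integral>\<^sup>+x\<in>K. epow (ennreal \<bar>u x - c\<bar>) p \<partial>lborel)
          + (ennreal (M powr p) * emeasure lborel (\<Omega> - K) + ennreal (M powr (p - q)) * Lpp q v)"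
        using sobD(1)[OF s] by (simp add: nn_integral_add nn_integral_cmult Lpp_real del: epow_ennreal)
      also have "\<dots> \<le> ennreal CK * ennreal n + (ennreal (M powr p) * ennreal \<delta> + ennreal (M powr (p - q)) * (ennreal C1 * epow (ennreal n + ennreal P) (q / p)))"
        using c K(2) C1(2)[OF sv] by (intro add_mono mult_left_mono) (auto simp: n P)
      also have "\<dots> = ennreal (CK * n + (M powr p * \<delta> + M powr (p - q) * (C1 * (n + P) powr (q / p))))"
        using n P CK C1 \<delta> by (simp add: ennreal_mult ennreal_plus[symmetric] del: ennreal_plus) (simp add: ennreal_plus ennreal_mult)
      finally have "ennreal P \<le> ennreal (CK * n + (M powr p * \<delta> + M powr (p - q) * (C1 * (n + P) powr (q / p))))"
        unfolding P(2) .
      then have "P \<le> CK * n + (M powr p * \<delta> + M powr (p - q) * (C1 * (n + P) powr (q / p)))"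
        by (subst (asm) ennreal_le_iff) (use n P CK C1 \<delta> in auto)
      also have "M powr p * \<delta> = (n + P) / 4" using L by (simp add: Mp \<delta>_def)
      also have "M powr (p - q) * (C1 * (n + P) powr (q / p)) = (n + P) / 4"
      proof -
        have "M powr (p - q) * (C1 * (n + P) powr (q / p)) = C1 * (M powr (p - q) * (n + P) powr (q / p))" by (simp only: mult_ac)
        also have "\<dots> = (L powr (p - q) * C1) * (n + P)" unfolding Mpq by (simp only: mult_ac)
        finally show ?thesis by (simp add: LC)
      qed
      finally have *: "P \<le> CK * n + ((n + P) / 4 + (n + P) / 4)" .
      \<comment> \<open>Half of P is absorbed on the left.\<close>
      have "P \<le> 2 * X + n" if "P \<le> X + ((n + P) / 4 + (n + P) / 4)" for X
        using that by (simp add: field_simps)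
      from this[OF *] have "P \<le> 2 * (CK * n) + n" .
      then show ?thesis by (simp add: distrib_right mult.assoc)
    qed
    then have "Lpp p v \<le> ennreal (2 * CK + 1) * Lpp p g"
      using n CK unfolding P(2) n(2) by (simp add: ennreal_mult[symmetric] ennreal_leI del: ennreal_plus)
    then show "\<exists>c. Lpp p (\<lambda>x. u x - c * indicator \<Omega> x) \<le> ennreal (2 * CK + 1) * Lpp p g"
      unfolding v_def by blast
  qed
qed

section \<open>Centring by the mean value\<close>

definition \<mu> :: real where "\<mu> = measure lborel \<Omega>"

lemma \<mu>: "0 < \<mu>" "emeasure lborel \<Omega> = ennreal \<mu>"
proof -
  show *: "emeasure lborel \<Omega> = ennreal \<mu>"
    using finite_measure_dom by (simp add: \<mu>_def emeasure_eq_ennreal_measure)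
  have "0 < emeasure lborel \<Omega>" by (rule open_inter_emeasure_pos[OF open_dom nonempty])
  then show "0 < \<mu>" unfolding * by simp
qed

definition mean :: "('a \<Rightarrow> real) \<Rightarrow> real" where
  "mean u = (LINT x|lborel. u x) / \<mu>"

abbreviation centered :: "('a \<Rightarrow> real) \<Rightarrow> 'a \<Rightarrow> real" where
  "centered u \<equiv> (\<lambda>x. u x - mean u * indicator \<Omega> x)"

lemma sob_integrable:
  assumes s: "sob \<Omega> p u g" shows "integrable lborel u"
  unfolding integrable_iff_bounded
proof
  note [measurable] = sobD(1,2)[OF s]
  show "u \<in> borel_measurable lborel" by simp
  have "(\<integral>\<^sup>+x. ennreal (norm (u x)) \<partial>lborel) \<le> (\<integral>\<^sup>+x. indicator \<Omega> x + epow (ennreal \<bar>u x\<bar>) p \<partial>lborel)"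
  proof (rule nn_integral_mono)
    fix x
    show "ennreal (norm (u x)) \<le> indicator \<Omega> x + epow (ennreal \<bar>u x\<bar>) p"
    proof (cases "x \<in> \<Omega>")
      case True
      have "\<bar>u x\<bar> \<le> 1 + \<bar>u x\<bar> powr p"
      proof (cases "\<bar>u x\<bar> \<le> 1")
        case False
        then have "\<bar>u x\<bar> powr 1 \<le> \<bar>u x\<bar> powr p" using p by (intro powr_mono) auto
        with False show ?thesis by simp
      qed (simp add: add_increasing2)
      then have "ennreal \<bar>u x\<bar> \<le> 1 + ennreal (\<bar>u x\<bar> powr p)"
        by (simp add: ennreal_1[symmetric] ennreal_plus[symmetric] ennreal_leI del: ennreal_1 ennreal_plus)
      then show ?thesis using True by simp
    qed (use sobD(3)[OF s] in auto)
  qed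
  also have "\<dots> = emeasure lborel \<Omega> + Lpp p u" by (simp add: nn_integral_add Lpp_real del: epow_ennreal)
  also have "\<dots> < \<infinity>" using finite_measure_dom sob_Lpp(1)[OF s] by simp
  finally show "(\<integral>\<^sup>+x. ennreal (norm (u x)) \<partial>lborel) < \<infinity>" .
qed

text \<open>By Jensen the mean differs from any constant c by at most the normalised L^p distance of
  u from c; hence it may replace the constant of \<open>poincare_const\<close>.\<close>

lemma poincare_mean:
  "\<exists>C>0. \<forall>u g. sob \<Omega> p u g \<longrightarrow> Lpp p (centered u) \<le> ennreal C * Lpp p g"
proof -
  obtain C where C: "0 < C" "\<And>u g. sob \<Omega> p u g \<Longrightarrow> \<exists>c. Lpp p (\<lambda>x. u x - c * indicator \<Omega> x) \<le> ennreal C * Lpp p g"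
    using poincare_const by blast
  show ?thesis
  proof (intro exI[of _ "2 powr p * 2 * C"] conjI allI impI)
    show "0 < 2 powr p * 2 * C" using C by simp
    fix u g assume s: "sob \<Omega> p u g"
    obtain c where c: "Lpp p (\<lambda>x. u x - c * indicator \<Omega> x) \<le> ennreal C * Lpp p g" using C(2)[OF s] by blast
    define v where "v = (\<lambda>x. u x - c * indicator \<Omega> x)"
    have sv: "sob \<Omega> p v g" unfolding v_def using p by (intro sob_diff_const s open_dom finite_measure_dom) auto
    note [measurable] = sobD(1,2)[OF s] sobD(1)[OF sv]
    define m where "m = mean u - c"
    have "(LINT x|lborel. v x) = (LINT x|lborel. u x) - c * \<mu>"
      using sob_integrable[OF s] \<mu>(2) unfolding v_def by (simp add: \<mu>_def)
    then have m: "m = (LINT x|lborel. v x) / \<mu>" using \<mu>(1) by (simp add: m_def mean_def field_simps)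
    have "epow (ennreal \<bar>m\<bar>) p * ennreal \<mu> \<le> Lpp p v"
    proof -
      have "ennreal \<bar>m\<bar> = ennreal (1 / \<mu>) * ennreal (norm (LINT x|lborel. v x))"
        using \<mu>(1) by (simp add: m abs_mult ennreal_mult[symmetric])
      also have "\<dots> \<le> ennreal (1 / \<mu>) * (\<integral>\<^sup>+x. ennreal (norm (v x)) \<partial>lborel)"
        by (intro mult_left_mono integral_norm_bound_ennreal sob_integrable[OF sv]) auto
      also have "(\<integral>\<^sup>+x. ennreal (norm (v x)) \<partial>lborel) = (\<integral>\<^sup>+x. ennreal \<bar>v x\<bar> * indicator \<Omega> x \<partial>lborel)"
        using sobD(3)[OF sv] by (intro nn_integral_cong) (auto simp: indicator_def)
      finally have "epow (ennreal \<bar>m\<bar>) p \<le> epow (ennreal (1 / \<mu>) * (\<integral>\<^sup>+x. ennreal \<bar>v x\<bar> * indicator \<Omega> x \<partial>lborel)) p"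
        using p by (intro epow_mono) auto
      also have "\<dots> = epow (ennreal (1 / \<mu>)) p * epow (\<integral>\<^sup>+x. ennreal \<bar>v x\<bar> * indicator \<Omega> x \<partial>lborel) p"
        by (rule epow_mult)
      also have "epow (\<integral>\<^sup>+x. ennreal \<bar>v x\<bar> * indicator \<Omega> x \<partial>lborel) p
          \<le> epow (\<integral>\<^sup>+x. indicator \<Omega> x \<partial>lborel) (p - 1) * (\<integral>\<^sup>+x. epow (ennreal \<bar>v x\<bar>) p * indicator \<Omega> x \<partial>lborel)"
        by (rule nn_integral_Jensen_powr) (use p finite_measure_dom in auto)
      also have "(\<integral>\<^sup>+x. epow (ennreal \<bar>v x\<bar>) p * indicator \<Omega> x \<partial>lborel) \<le> Lpp p v"
        unfolding Lpp_real by (intro nn_integral_mono) (auto simp: indicator_def)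
      also have "epow (\<integral>\<^sup>+x. indicator \<Omega> x \<partial>lborel) (p - 1) = ennreal (\<mu> powr (p - 1))"
        using \<mu> by simp
      finally have "epow (ennreal \<bar>m\<bar>) p \<le> epow (ennreal (1 / \<mu>)) p * (ennreal (\<mu> powr (p - 1)) * Lpp p v)"
        by (simp add: mult_left_mono)
      then have "epow (ennreal \<bar>m\<bar>) p * ennreal \<mu> \<le> epow (ennreal (1 / \<mu>)) p * (ennreal (\<mu> powr (p - 1)) * Lpp p v) * ennreal \<mu>"
        by (rule mult_right_mono) simp
      also have "\<dots> = (ennreal ((1 / \<mu>) powr p) * ennreal (\<mu> powr (p - 1)) * ennreal \<mu>) * Lpp p v"
        using \<mu>(1) by (simp add: mult_ac)
      also have "ennreal ((1 / \<mu>) powr p) * ennreal (\<mu> powr (p - 1)) * ennreal \<mu> = 1"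
        using \<mu>(1) by (simp add: ennreal_mult[symmetric] powr_divide powr_diff)
      finally show ?thesis by simp
    qed
    have "Lpp p (centered u) \<le> (\<integral>\<^sup>+x. ennreal (2 powr p) * (epow (ennreal \<bar>v x\<bar>) p + epow (ennreal \<bar>m\<bar>) p * indicator \<Omega> x) \<partial>lborel)"
      unfolding Lpp_real
    proof (rule nn_integral_mono)
      fix x
      have eq: "centered u x = v x - m * indicator \<Omega> x" by (simp add: v_def m_def algebra_simps)
      have "ennreal \<bar>centered u x\<bar> \<le> ennreal \<bar>v x\<bar> + ennreal \<bar>m * indicator \<Omega> x\<bar>"
        unfolding eq by (simp add: ennreal_plus[symmetric] ennreal_leI del: ennreal_plus)
      then have "epow (ennreal \<bar>centered u x\<bar>) p \<le> epow (ennreal \<bar>v x\<bar> + ennreal \<bar>m * indicator \<Omega> x\<bar>) p"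
        using p by (intro epow_mono) auto
      also have "\<dots> \<le> ennreal (2 powr p) * (epow (ennreal \<bar>v x\<bar>) p + epow (ennreal \<bar>m * indicator \<Omega> x\<bar>) p)"
        using p by (intro epow_plus_le) auto
      also have "epow (ennreal \<bar>m * indicator \<Omega> x\<bar>) p = epow (ennreal \<bar>m\<bar>) p * indicator \<Omega> x"
        by (auto simp: indicator_def)
      finally show "epow (ennreal \<bar>centered u x\<bar>) p \<le> ennreal (2 powr p) * (epow (ennreal \<bar>v x\<bar>) p + epow (ennreal \<bar>m\<bar>) p * indicator \<Omega> x)" .
    qed
    also have "\<dots> = ennreal (2 powr p) * (Lpp p v + epow (ennreal \<bar>m\<bar>) p * ennreal \<mu>)"
      by (simp add: nn_integral_cmult nn_integral_add Lpp_real \<mu> del: epow_ennreal)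
    also have "\<dots> \<le> ennreal (2 powr p) * (Lpp p v + Lpp p v)"
      using \<open>epow (ennreal \<bar>m\<bar>) p * ennreal \<mu> \<le> Lpp p v\<close> by (intro mult_left_mono add_mono) auto
    also have "\<dots> = ennreal (2 powr p * 2) * Lpp p v"
      by (simp add: ennreal_mult mult_2[symmetric] mult.assoc)
    also have "\<dots> \<le> ennreal (2 powr p * 2) * (ennreal C * Lpp p g)"
      using c unfolding v_def by (intro mult_left_mono) auto
    also have "\<dots> = ennreal (2 powr p * 2 * C) * Lpp p g"
      unfolding mult.assoc[symmetric] using C by (subst ennreal_mult[symmetric]) auto
    finally show "Lpp p (centered u) \<le> ennreal (2 powr p * 2 * C) * Lpp p g" .
  qed
qed

text \<open>Centring comes before extending: the extension bound contains the norm of the function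
  itself, which the gradient controls only after the mean is removed.\<close>

lemma extension_centered:
  "\<exists>C>0. \<forall>u g. sob \<Omega> p u g \<longrightarrow> sob \<Omega> p (centered u) g \<and> Lpp p g + Lpp p (centered u) \<le> ennreal C * Lpp p g \<and>
    (\<exists>w h. sob UNIV p w h \<and> (AE x in lborel. x \<in> \<Omega> \<longrightarrow> w x = centered u x) \<and> Lpp p h + Lpp p w \<le> ennreal C * Lpp p g)"
proof -
  obtain C where C: "0 < C" "\<And>u g. sob \<Omega> p u g \<Longrightarrow> Lpp p (centered u) \<le> ennreal C * Lpp p g"
    using poincare_mean by blast
  obtain D where D: "1 \<le> D" "\<And>u g. sob \<Omega> p u g \<Longrightarrow> (\<exists>w h. sob UNIV p w h \<and> (AE x in lborel. x \<in> \<Omega> \<longrightarrow> w x = u x) \<and>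
      Lpp p h + Lpp p w \<le> ennreal D * (Lpp p g + Lpp p u))"
    using extension by blast
  show ?thesis
  proof (intro exI[of _ "D * (1 + C)"] allI impI conjI)
    show "0 < D * (1 + C)" using C D by simp
    fix u g assume s: "sob \<Omega> p u g"
    show sv: "sob \<Omega> p (centered u) g" using p by (intro sob_diff_const s open_dom finite_measure_dom) auto
    have "Lpp p g + Lpp p (centered u) \<le> Lpp p g + ennreal C * Lpp p g"
      using C(2)[OF s] by (intro add_mono) auto
    also have "\<dots> = ennreal (1 + C) * Lpp p g" using C(1) by (simp add: distrib_right)
    finally have 1: "Lpp p g + Lpp p (centered u) \<le> ennreal (1 + C) * Lpp p g" .
    have DC: "ennreal D * (ennreal (1 + C) * Lpp p g) = ennreal (D * (1 + C)) * Lpp p g"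
      unfolding mult.assoc[symmetric] using D(1) C(1) by (subst ennreal_mult[symmetric]) auto
    have "1 + C \<le> D * (1 + C)" using D(1) C(1) by simp
    then show "Lpp p g + Lpp p (centered u) \<le> ennreal (D * (1 + C)) * Lpp p g"
      by (intro order_trans[OF 1] mult_right_mono ennreal_leI) auto
    obtain w h where w: "sob UNIV p w h" "AE x in lborel. x \<in> \<Omega> \<longrightarrow> w x = centered u x"
      "Lpp p h + Lpp p w \<le> ennreal D * (Lpp p g + Lpp p (centered u))"
      using D(2)[OF sv] by blast
    have "Lpp p h + Lpp p w \<le> ennreal D * (ennreal (1 + C) * Lpp p g)"
      by (intro order_trans[OF w(3)] mult_left_mono 1) auto
    then have "Lpp p h + Lpp p w \<le> ennreal (D * (1 + C)) * Lpp p g" by (simp only: DC)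
    with w(1,2) show "\<exists>w h. sob UNIV p w h \<and> (AE x in lborel. x \<in> \<Omega> \<longrightarrow> w x = centered u x) \<and> Lpp p h + Lpp p w \<le> ennreal (D * (1 + C)) * Lpp p g"
      by blast
  qed
qed

end

section \<open>Measure density\<close>

text \<open>A piecewise quadratic transition from 0 to 1 on the unit interval whose derivative is a
  tent of height 2; it is only C^1, the regularity that \<open>weak_grad_eq_C1\<close> asks
  for.\<close>

definition smooth_step :: "real \<Rightarrow> real" where
  "smooth_step t = 2 * (max 0 t)\<^sup>2 - 4 * (max 0 (t - 1/2))\<^sup>2 + 2 * (max 0 (t - 1))\<^sup>2"

definition smooth_step' :: "real \<Rightarrow> real" where
  "smooth_step' t = 4 * max 0 t - 8 * max 0 (t - 1/2) + 4 * max 0 (t - 1)"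

lemma max_0_power2_has_derivative: "((\<lambda>t::real. (max 0 (t - c))\<^sup>2) has_real_derivative 2 * max 0 (t - c)) (at t)"
proof -
  consider "t < c" | "t = c" | "c < t" by linarith
  then show ?thesis
  proof cases
    case 1
    have "((\<lambda>_. 0) has_real_derivative 2 * max 0 (t - c)) (at t)" using 1 by auto
    then show ?thesis
      by (rule has_field_derivative_transform_within_open[of _ _ _ "{..<c}"]) (use 1 in auto)
  next
    case 2
    have "((\<lambda>h::real. max 0 h) \<longlongrightarrow> max 0 0) (at 0)" by (intro tendsto_intros)
    moreover have "(\<lambda>h. ((max 0 (c + h - c))\<^sup>2 - (max 0 (c - c))\<^sup>2) / h) = (\<lambda>h::real. max 0 h)"
      by (rule ext) (auto simp: max_def power2_eq_square)
    ultimately have "((\<lambda>t::real. (max 0 (t - c))\<^sup>2) has_real_derivative max 0 0) (at c)"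
      unfolding DERIV_def by (simp only:)
    then show ?thesis using 2 by simp
  next
    case 3
    have "((\<lambda>t. (t - c)\<^sup>2) has_real_derivative 2 * max 0 (t - c)) (at t)" using 3 by (auto intro!: derivative_eq_intros)
    then show ?thesis
      by (rule has_field_derivative_transform_within_open[of _ _ _ "{c<..}"]) (use 3 in auto)
  qed
qed

lemma smooth_step_has_derivative: "(smooth_step has_real_derivative smooth_step' t) (at t)"
proof -
  have "((\<lambda>t. 2 * (max 0 (t - 0))\<^sup>2 - 4 * (max 0 (t - 1/2))\<^sup>2 + 2 * (max 0 (t - 1))\<^sup>2) has_real_derivative
      2 * (2 * max 0 (t - 0)) - 4 * (2 * max 0 (t - 1/2)) + 2 * (2 * max 0 (t - 1))) (at t)"
    by (intro DERIV_add DERIV_diff DERIV_cmult max_0_power2_has_derivative)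
  then show ?thesis by (simp add: smooth_step_def[abs_def] smooth_step'_def)
qed

lemma smooth_step_values:
  "t \<le> 0 \<Longrightarrow> smooth_step t = 0" "1 \<le> t \<Longrightarrow> smooth_step t = 1" "\<bar>smooth_step t\<bar> \<le> 1"
  "t \<le> 0 \<Longrightarrow> smooth_step' t = 0" "\<bar>smooth_step' t\<bar> \<le> 2"
proof -
  show "t \<le> 0 \<Longrightarrow> smooth_step t = 0" by (simp add: smooth_step_def)
  show *: "1 \<le> t \<Longrightarrow> smooth_step t = 1" by (simp add: smooth_step_def power2_eq_square algebra_simps)
  show "t \<le> 0 \<Longrightarrow> smooth_step' t = 0" by (simp add: smooth_step'_def)
  show "\<bar>smooth_step' t\<bar> \<le> 2" by (auto simp: smooth_step'_def max_def)
  consider "t \<le> 0" | "0 < t" "t \<le> 1/2" | "1/2 < t" "t < 1" | "1 \<le> t" by linarith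
  then show "\<bar>smooth_step t\<bar> \<le> 1"
  proof cases
    case 2
    then have "t\<^sup>2 \<le> (1/2)\<^sup>2" by (intro power_mono) auto
    then show ?thesis using 2 by (simp add: smooth_step_def power2_eq_square)
  next
    case 3
    then have "smooth_step t = 1 - 2 * (1 - t)\<^sup>2" by (simp add: smooth_step_def power2_eq_square algebra_simps)
    moreover have "(1 - t)\<^sup>2 \<le> (1/2)\<^sup>2" using 3 by (intro power_mono) auto
    moreover have "0 \<le> (1 - t)\<^sup>2" by simp
    ultimately show ?thesis by (simp add: power2_eq_square)
  next
    case 4
    then show ?thesis by (simp add: *)
  qed (simp add: smooth_step_def)
qed

text \<open>Composing with the squared distance avoids the singularity of the norm at the
  centre.\<close>

lemma radial_cutoff:
  fixes x :: "'a::euclidean_space"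
  assumes ab: "0 < a" "a < b"
  obtains \<eta> :: "'a \<Rightarrow> real" and G :: "'a \<Rightarrow> 'a"
  where "\<And>y. (\<eta> has_derivative (\<lambda>h. G y \<bullet> h)) (at y)" "continuous_on UNIV G" "\<And>y. \<bar>\<eta> y\<bar> \<le> 1"
    "\<And>y. y \<in> ball x a \<Longrightarrow> \<eta> y = 1" "\<And>y. y \<notin> ball x b \<Longrightarrow> \<eta> y = 0" "\<And>y. y \<notin> ball x b \<Longrightarrow> G y = 0"
    "\<And>y. norm (G y) \<le> 4 / (b - a)"
proof -
  define d where "d = b\<^sup>2 - a\<^sup>2"
  have deq: "d = (b - a) * (b + a)" by (simp add: d_def power2_eq_square algebra_simps)
  have d: "0 < d" using ab by (simp add: deq)
  define T where "T y = (b\<^sup>2 - (y - x) \<bullet> (y - x)) / d" for y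
  define G where "G y = (smooth_step' (T y) * (- 2 / d)) *\<^sub>R (y - x)" for y
  have sq: "(y - x) \<bullet> (y - x) = (dist x y)\<^sup>2" for y by (simp add: dist_norm norm_minus_commute dot_square_norm)
  have far: "T y \<le> 0" if "y \<notin> ball x b" for y
  proof -
    have "b\<^sup>2 \<le> (dist x y)\<^sup>2" using that ab by (intro power_mono) auto
    then show ?thesis using d by (simp add: T_def sq divide_le_0_iff)
  qed
  have near: "1 \<le> T y" if "y \<in> ball x a" for y
  proof -
    have "(dist x y)\<^sup>2 \<le> a\<^sup>2" using that ab by (intro power_mono) auto
    then show ?thesis using d by (simp add: T_def sq pos_le_divide_eq d_def)
  qed
  show ?thesis
  proof (rule that[of "\<lambda>y. smooth_step (T y)" G])
    fix y
    have "(T has_derivative (\<lambda>h. (- (2 * ((y - x) \<bullet> h))) / d)) (at y)"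
      unfolding T_def[abs_def] using d by (auto intro!: derivative_eq_intros simp: inner_commute)
    from DERIV_compose_FDERIV[OF smooth_step_has_derivative this]
    show "((\<lambda>y. smooth_step (T y)) has_derivative (\<lambda>h. G y \<bullet> h)) (at y)"
      by (simp add: G_def algebra_simps diff_divide_distrib)
    show "\<bar>smooth_step (T y)\<bar> \<le> 1" by (rule smooth_step_values)
    show "y \<in> ball x a \<Longrightarrow> smooth_step (T y) = 1" using near smooth_step_values by blast
    show "y \<notin> ball x b \<Longrightarrow> smooth_step (T y) = 0" using far smooth_step_values by blast
    show G0: "y \<notin> ball x b \<Longrightarrow> G y = 0" using far smooth_step_values(4) by (simp add: G_def)
    show "norm (G y) \<le> 4 / (b - a)"
    proof (cases "y \<in> ball x b")
      case True
      \<comment> \<open>The generous bound b + a cancels against a factor of b^2 - a^2, leaving 4 /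
        (b - a).\<close>
      then have "norm (y - x) \<le> b + a" using ab by (simp add: dist_norm norm_minus_commute)
      then have "\<bar>smooth_step' (T y)\<bar> * (2 / d) * norm (y - x) \<le> 2 * (2 / d) * (b + a)"
        using smooth_step_values(5)[of "T y"] d ab by (intro mult_mono) auto
      also have "\<dots> = 4 / (b - a)"
      proof -
        have "k * (2 / (c * e)) * e = 2 * k / c" if "e \<noteq> 0" for k c e :: real using that by simp
        from this[of "b + a" 2 "b - a"] show ?thesis using ab by (simp add: deq)
      qed
      finally show ?thesis using d by (simp add: G_def abs_mult)
    qed (use G0 ab in auto)
  next
    have "continuous_on UNIV T" unfolding T_def[abs_def] using d by (intro continuous_intros) auto
    then show "continuous_on UNIV G"
      unfolding G_def[abs_def] smooth_step'_def by (intro continuous_intros)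
  qed
qed

section \<open>Positive density from the extension property\<close>

context sobolev_extension_domain
begin

definition dens :: "'a \<Rightarrow> real \<Rightarrow> real" where
  "dens x r = measure lborel (\<Omega> \<inter> ball x r)"

lemma emeasure_dens: "emeasure lborel (\<Omega> \<inter> ball x r) = ennreal (dens x r)"
proof -
  have "emeasure lborel (\<Omega> \<inter> ball x r) \<le> emeasure lborel \<Omega>" by (intro emeasure_mono) auto
  also have "\<dots> < top" by (rule finite_measure_dom)
  finally show ?thesis by (simp add: dens_def emeasure_eq_ennreal_measure)
qed

lemma dens_nonneg: "0 \<le> dens x r"
  by (simp add: dens_def)

lemma dens_mono: "r \<le> r' \<Longrightarrow> dens x r \<le> dens x r'"
proof -
  assume "r \<le> r'"
  then have "emeasure lborel (\<Omega> \<inter> ball x r) \<le> emeasure lborel (\<Omega> \<inter> ball x r')" by (intro emeasure_mono) auto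
  then show ?thesis by (simp add: emeasure_dens dens_nonneg)
qed

lemma dens_pos: "x \<in> \<Omega> \<Longrightarrow> 0 < r \<Longrightarrow> 0 < dens x r"
proof -
  assume "x \<in> \<Omega>" "0 < r"
  then have "0 < emeasure lborel (\<Omega> \<inter> ball x r)"
    using open_dom by (intro open_inter_emeasure_pos) auto
  then show ?thesis by (simp add: emeasure_dens)
qed

text \<open>A function that is 1 on one set and 0 on the other cannot stay within 1/3 of its ball
  averages on both sets, unless these averages themselves vary.\<close>

lemma separated_sets:
  assumes np: "DIM('a) \<le> p"
  shows "\<exists>C>0. \<forall>x R a b F. 0 < a \<longrightarrow> a < b \<longrightarrow> b \<le> R \<longrightarrow> R \<le> 1 \<longrightarrow> F \<in> sets borel \<longrightarrow>
    F \<subseteq> (\<Omega> \<inter> ball x (6 * R)) - ball x b \<longrightarrow>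
    min (dens x a) (measure lborel F) \<le> C * R powr (2 * p - DIM('a)) * (dens x b / (b - a) powr p)\<^sup>2"
proof -
  obtain D where D: "1 \<le> D" "\<And>u g. sob \<Omega> p u g \<Longrightarrow> (\<exists>w h. sob UNIV p w h \<and> (AE x in lborel. x \<in> \<Omega> \<longrightarrow> w x = u x) \<and>
      Lpp p h + Lpp p w \<le> ennreal D * (Lpp p g + Lpp p u))"
    using extension by blast
  have p1: "1 \<le> p" "p \<le> 2 * p" using p by auto
  \<comment> \<open>With q = 2 p the energy enters squared, which gives the quadratic recursion of
    the later iteration.\<close>
  from diff_ball_avg_Lq_weak[OF p1(1) np p1(2)]
  obtain C1 where C1: "0 < C1" "\<And>(u :: 'a \<Rightarrow> real) g R. loc_int u \<Longrightarrow> loc_int g \<Longrightarrow> weak_grad_eq UNIV u g \<Longrightarrow> 0 < R \<Longrightarrow>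
    (\<integral>\<^sup>+x. epow (ennreal \<bar>u x - ball_avg u R x\<bar>) (2 * p) \<partial>lborel)
      \<le> ennreal (C1 * R powr (2 * p - DIM('a) * (2 * p - p) / p)) * epow (\<integral>\<^sup>+x. epow (ennreal (norm (g x))) p \<partial>lborel) (2 * p / p)"
    by blast
  define V1 where "V1 = ball_volume TYPE('a) 1"
  have V1: "0 < V1" unfolding V1_def by (rule ball_volume_pos) simp
  define V where "V = V1 powr (-1/p)"
  have V: "0 < V" using V1 by (simp add: V_def)
  define C2 where "C2 = 3 powr (2 * p) * C1 + V1 * (36 * V) powr (2 * p)"
  have C2: "0 < C2" unfolding C2_def using C1 V1 by (intro add_pos_nonneg) auto
  define D' where "D' = D * (4 powr p + 1)"
  have D': "0 < D'" using D by (simp add: D'_def add_pos_pos)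
  have main: "min (dens x a) (measure lborel F) \<le> (C2 * D'\<^sup>2) * R powr (2 * p - DIM('a)) * (dens x b / (b - a) powr p)\<^sup>2"
    if ab: "0 < a" "a < b" "b \<le> R" "R \<le> 1" and [measurable]: "F \<in> sets borel" and F: "F \<subseteq> (\<Omega> \<inter> ball x (6 * R)) - ball x b"
    for x R a b F
  proof -
    have R: "0 < R" using ab by simp
    have [measurable]: "ball x b \<in> sets borel" "ball x a \<in> sets borel" by simp_all
    obtain \<eta> :: "'a \<Rightarrow> real" and G where \<eta>: "\<And>y. (\<eta> has_derivative (\<lambda>h. G y \<bullet> h)) (at y)" "continuous_on UNIV G" "\<And>y. \<bar>\<eta> y\<bar> \<le> 1"
      "\<And>y. y \<in> ball x a \<Longrightarrow> \<eta> y = 1" "\<And>y. y \<notin> ball x b \<Longrightarrow> \<eta> y = 0" "\<And>y. y \<notin> ball x b \<Longrightarrow> G y = 0"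
      "\<And>y. norm (G y) \<le> 4 / (b - a)"
      by (rule radial_cutoff[OF ab(1,2), of x]) blast
    have \<eta>c: "continuous_on UNIV \<eta>" by (rule has_derivative_continuous_on[OF has_derivative_at_withinI[OF \<eta>(1)]])
    note [measurable] = borel_measurable_continuous_onI[OF \<eta>c] borel_measurable_continuous_onI[OF \<eta>(2)]
    define u where "u = (\<lambda>y. indicator \<Omega> y * \<eta> y)"
    define g where "g = (\<lambda>y. indicator \<Omega> y *\<^sub>R G y)"
    have [measurable]: "u \<in> borel_measurable borel" "g \<in> borel_measurable borel" unfolding u_def g_def by measurable
    define m where "m = dens x b"
    have m: "0 \<le> m" by (simp add: m_def dens_nonneg)
    have ind: "(\<integral>\<^sup>+y. indicator (\<Omega> \<inter> ball x b) y \<partial>lborel) = ennreal m"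
      by (simp add: emeasure_dens m_def)
    have Lu: "Lpp p u \<le> ennreal m"
      unfolding ind[symmetric] Lpp_real
    proof (rule nn_integral_mono)
      fix y
      have "\<bar>\<eta> y\<bar> powr p \<le> 1 powr p" using \<eta>(3)[of y] p by (intro powr_mono2) auto
      then show "epow (ennreal \<bar>u y\<bar>) p \<le> indicator (\<Omega> \<inter> ball x b) y"
        using \<eta>(5)[of y] by (cases "y \<in> ball x b") (auto simp: u_def indicator_def ennreal_1[symmetric] simp del: ennreal_1 intro!: ennreal_leI)
    qed
    define B where "B = (4 / (b - a)) powr p"
    have B: "0 \<le> B" by (simp add: B_def)
    have "Lpp p g \<le> (\<integral>\<^sup>+y. ennreal B * indicator (\<Omega> \<inter> ball x b) y \<partial>lborel)"
      unfolding Lpp_def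
    proof (rule nn_integral_mono)
      fix y
      have "norm (G y) powr p \<le> B" unfolding B_def using \<eta>(7)[of y] p by (intro powr_mono2) auto
      then show "epow (ennreal (norm (g y))) p \<le> ennreal B * indicator (\<Omega> \<inter> ball x b) y"
        using \<eta>(6)[of y] by (cases "y \<in> ball x b") (auto simp: g_def indicator_def intro!: ennreal_leI)
    qed
    also have "\<dots> = ennreal B * (\<integral>\<^sup>+y. indicator (\<Omega> \<inter> ball x b) y \<partial>lborel)" by (rule nn_integral_cmult) measurable
    also have "\<dots> = ennreal (B * m)" unfolding ind using B m by (simp add: ennreal_mult)
    finally have Lg: "Lpp p g \<le> ennreal (B * m)" .
    have s: "sob \<Omega> p u g"
      unfolding sob_def
    proof (intro conjI)
      show "weak_grad_eq \<Omega> u g" unfolding u_def g_def by (rule weak_grad_eq_C1[OF \<eta>(1,2)])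
      show "(\<integral>\<^sup>+x. epow (ennreal \<bar>u x\<bar>) p \<partial>lborel) < top" using Lu unfolding Lpp_real by (rule le_less_trans) simp
      show "(\<integral>\<^sup>+x. epow (ennreal (norm (g x))) p \<partial>lborel) < top" using Lg unfolding Lpp_def by (rule le_less_trans) simp
    qed (auto simp: u_def g_def)
    obtain w h where w: "sob UNIV p w h" "AE x in lborel. x \<in> \<Omega> \<longrightarrow> w x = u x" "Lpp p h + Lpp p w \<le> ennreal D * (Lpp p g + Lpp p u)"
      using D(2)[OF s] by blast
    note l = sob_loc_int[OF w(1) p1(1)]
    note [measurable] = sobD(1,2)[OF w(1)]
    \<comment> \<open>An upper bound for the energy of the extended cutoff; since b - a <= 1, the
      gradient term dominates.\<close>
    define N where "N = D' * (m / (b - a) powr p)"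
    have N: "0 \<le> N" using D' m by (simp add: N_def)
    have LN: "Lpp p h \<le> ennreal N"
    proof -
      have "Lpp p h \<le> Lpp p h + Lpp p w" by simp
      also have "\<dots> \<le> ennreal D * (ennreal (B * m) + ennreal m)"
        by (intro order_trans[OF w(3)] mult_left_mono add_mono Lg Lu) auto
      also have "\<dots> = ennreal (D * (B * m + m))" using D B m by (simp add: ennreal_mult ennreal_plus)
      also have "\<dots> \<le> ennreal N"
      proof (rule ennreal_leI)
        have "(b - a) powr p \<le> 1 powr p" using ab p by (intro powr_mono2) auto
        then have b1: "1 \<le> 1 / (b - a) powr p" using ab by simp
        have "B * m + m = (4 powr p * (1 / (b - a) powr p) + 1) * m"
          using ab by (simp add: B_def powr_divide algebra_simps)
        also have "\<dots> \<le> (4 powr p * (1 / (b - a) powr p) + 1 / (b - a) powr p) * m"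
          using b1 m by (intro mult_right_mono add_left_mono) auto
        also have "\<dots> = (4 powr p + 1) * (m / (b - a) powr p)" by (simp add: add_divide_distrib distrib_right)
        finally have "D * (B * m + m) \<le> D * ((4 powr p + 1) * (m / (b - a) powr p))" using D by (intro mult_left_mono) auto
        then show "D * (B * m + m) \<le> N" by (simp add: N_def D'_def mult.assoc)
      qed
      finally show ?thesis .
    qed
    define H where "H y = \<bar>w y - ball_avg w R y\<bar>" for y
    have [measurable]: "H \<in> borel_measurable borel" unfolding H_def by measurable
    define J where "J = C1 * R powr (2 * p - DIM('a)) * N\<^sup>2"
    have J: "0 \<le> J" using C1 by (simp add: J_def)
    have HJ: "(\<integral>\<^sup>+y. epow (ennreal (H y)) (2 * p) \<partial>lborel) \<le> ennreal J"
    proof -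
      have "(\<integral>\<^sup>+y. epow (ennreal (H y)) (2 * p) \<partial>lborel) \<le> ennreal (C1 * R powr (2 * p - DIM('a))) * epow (Lpp p h) 2"
        using C1(2)[OF l sobD(7)[OF w(1)] R] p by (simp add: H_def Lpp_def del: epow_ennreal)
      also have "\<dots> \<le> ennreal (C1 * R powr (2 * p - DIM('a))) * epow (ennreal N) 2"
        by (intro mult_left_mono epow_mono LN) auto
      also have "\<dots> = ennreal J" using N C1 by (simp add: J_def ennreal_mult powr_numeral)
      finally show ?thesis .
    qed
    \<comment> \<open>Bounds the oscillation of the averages over \<open>ball x (6 * R)\<close>,
      whose points are at most 12 R apart.\<close>
    define \<tau> where "\<tau> = 12 * R * (V * R powr (- DIM('a) / p)) * N powr (1/p)"
    have tau: "\<bar>ball_avg w R y - ball_avg w R z\<bar> \<le> \<tau>" if y: "y \<in> ball x (6 * R)" and z: "z \<in> ball x (6 * R)" for y z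
    proof -
      have yz: "norm (y - z) \<le> 12 * R"
        using dist_triangle[of y z x] y z by (simp add: dist_norm norm_minus_commute)
      have "ennreal \<bar>ball_avg w R y - ball_avg w R z\<bar> \<le> ennreal (norm (y - z) * (V * R powr (- DIM('a) / p))) * epow (Lpp p h) (1/p)"
        using ball_avg_diff_weak[OF l sobD(7)[OF w(1)] R p1(1), of y z] by (simp only: Lpp_def V_def V1_def)
      also have "\<dots> \<le> ennreal (12 * R * (V * R powr (- DIM('a) / p))) * epow (ennreal N) (1/p)"
        using yz V p by (intro mult_mono ennreal_leI mult_right_mono epow_mono LN) auto
      also have "\<dots> = ennreal \<tau>" using N R V by (simp add: \<tau>_def ennreal_mult)
      finally show ?thesis using N R V by (simp add: \<tau>_def ennreal_le_iff)
    qed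
    have A6: "\<Omega> \<inter> ball x a \<subseteq> ball x (6 * R)" using ab R by auto
    \<comment> \<open>Writes the power of R in the form in which \<tau> contains it, for the second
      case below.\<close>
    have RR: "R powr (2 * p - DIM('a)) = R powr DIM('a) * (R * R powr (- DIM('a) / p)) powr (2 * p)"
    proof -
      have "R * R powr (- DIM('a) / p) = R powr (1 - DIM('a) / p)" using R by (simp add: powr_mult_base)
      then have "(R * R powr (- DIM('a) / p)) powr (2 * p) = R powr ((1 - DIM('a) / p) * (2 * p))" by (simp add: powr_powr)
      also have "(1 - DIM('a) / p) * (2 * p) = 2 * p - 2 * DIM('a)" using p by (simp add: field_simps)
      finally show ?thesis by (simp add: powr_add[symmetric])
    qed
    have "min (dens x a) (measure lborel F) \<le> C2 * R powr (2 * p - DIM('a)) * N\<^sup>2"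
    \<comment> \<open>If the averages may oscillate by 1/3 or more, the energy is already so large
      that the volume of a ball of radius R suffices as a bound.\<close>
    proof (cases "\<tau> < 1/3")
      case True
      define Q where "Q y \<longleftrightarrow> (y \<in> \<Omega> \<longrightarrow> w y = u y)" for y
      have Q: "AE y in lborel. Q y" using w(2) by (simp add: Q_def)
      have HA: "ennreal (measure lborel A) \<le> ennreal (3 powr (2 * p) * J)"
        if [measurable]: "A \<in> sets borel" and sub: "A \<subseteq> \<Omega>" and ae: "AE y in lborel. y \<in> A \<longrightarrow> 1/3 \<le> H y" for A
      proof -
        have "emeasure lborel A < top" using sub by (auto intro!: le_less_trans[OF emeasure_mono finite_measure_dom])
        then have "ennreal (measure lborel A) = (\<integral>\<^sup>+y. indicator A y \<partial>lborel)" by (simp add: emeasure_eq_ennreal_measure)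
        also have "\<dots> \<le> (\<integral>\<^sup>+y. ennreal (3 powr (2 * p)) * epow (ennreal (H y)) (2 * p) \<partial>lborel)"
        proof (rule nn_integral_mono_AE)
          show "AE y in lborel. indicator A y \<le> ennreal (3 powr (2 * p)) * epow (ennreal (H y)) (2 * p)"
            using ae
          proof eventually_elim
            fix y assume *: "y \<in> A \<longrightarrow> 1/3 \<le> H y"
            show "indicator A y \<le> ennreal (3 powr (2 * p)) * epow (ennreal (H y)) (2 * p)"
            proof (cases "y \<in> A")
              case True
              have "1 powr (2 * p) \<le> (3 * H y) powr (2 * p)" using * True p by (intro powr_mono2) auto
              then have "1 \<le> 3 powr (2 * p) * H y powr (2 * p)" by (simp add: powr_mult H_def)
              then have "ennreal 1 \<le> ennreal (3 powr (2 * p) * H y powr (2 * p))" by (rule ennreal_leI)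
              then show ?thesis using True by (simp add: ennreal_mult H_def)
            qed simp
          qed
        qed
        also have "\<dots> = ennreal (3 powr (2 * p)) * (\<integral>\<^sup>+y. epow (ennreal (H y)) (2 * p) \<partial>lborel)"
          by (rule nn_integral_cmult) measurable
        also have "\<dots> \<le> ennreal (3 powr (2 * p)) * ennreal J" by (intro mult_left_mono HJ) auto
        also have "\<dots> = ennreal (3 powr (2 * p) * J)" using J by (simp add: ennreal_mult)
        finally show ?thesis .
      qed
      \<comment> \<open>A point of each set with deviation below 1/3 would give 1 = w y - w z < 1.
        Hence the deviation is at least 1/3 almost everywhere on one of the two sets.\<close>
      have "(AE y in lborel. y \<in> \<Omega> \<inter> ball x a \<longrightarrow> 1/3 \<le> H y) \<or> (AE z in lborel. z \<in> F \<longrightarrow> 1/3 \<le> H z)"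
      proof (rule ccontr)
        assume "\<not> ?thesis"
        then have n1: "\<not> (AE y in lborel. y \<in> \<Omega> \<inter> ball x a \<longrightarrow> 1/3 \<le> H y)" and n2: "\<not> (AE z in lborel. z \<in> F \<longrightarrow> 1/3 \<le> H z)" by auto
        have "\<exists>y. Q y \<and> \<not> (y \<in> \<Omega> \<inter> ball x a \<longrightarrow> 1/3 \<le> H y)"
          using n1 eventually_mono[OF Q, of "\<lambda>y. y \<in> \<Omega> \<inter> ball x a \<longrightarrow> 1/3 \<le> H y"] by blast
        then obtain y where y: "Q y" "y \<in> \<Omega>" "y \<in> ball x a" "H y < 1/3" by (auto simp: not_le)
        have "\<exists>z. Q z \<and> \<not> (z \<in> F \<longrightarrow> 1/3 \<le> H z)"
          using n2 eventually_mono[OF Q, of "\<lambda>z. z \<in> F \<longrightarrow> 1/3 \<le> H z"] by blast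
        then obtain z where z: "Q z" "z \<in> F" "H z < 1/3" by (auto simp: not_le)
        have "w y = 1" using y \<eta>(4) by (simp add: Q_def u_def)
        moreover have "z \<in> \<Omega>" "z \<notin> ball x b" "z \<in> ball x (6 * R)" using z F by auto
        moreover from this have "w z = 0" using z(1) \<eta>(5) by (simp add: Q_def u_def)
        moreover have "y \<in> ball x (6 * R)" using y(2,3) A6 by blast
        ultimately have "1 \<le> H y + \<bar>ball_avg w R y - ball_avg w R z\<bar> + H z" and "\<bar>ball_avg w R y - ball_avg w R z\<bar> \<le> \<tau>"
          using tau[of y z] by (auto simp: H_def)
        with y z True show False by linarith
      qed
      then have "dens x a \<le> 3 powr (2 * p) * J \<or> measure lborel F \<le> 3 powr (2 * p) * J"
      proof
        assume "AE y in lborel. y \<in> \<Omega> \<inter> ball x a \<longrightarrow> 1/3 \<le> H y"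
        then have "ennreal (measure lborel (\<Omega> \<inter> ball x a)) \<le> ennreal (3 powr (2 * p) * J)" by (intro HA) auto
        then show ?thesis using J by (simp add: ennreal_le_iff dens_def)
      next
        assume "AE z in lborel. z \<in> F \<longrightarrow> 1/3 \<le> H z"
        then have "ennreal (measure lborel F) \<le> ennreal (3 powr (2 * p) * J)" using F by (intro HA) auto
        then show ?thesis using J by (simp add: ennreal_le_iff)
      qed
      then have "min (dens x a) (measure lborel F) \<le> 3 powr (2 * p) * J" by auto
      also have "\<dots> = 3 powr (2 * p) * C1 * (R powr (2 * p - DIM('a)) * N\<^sup>2)" by (simp add: J_def mult_ac)
      also have "\<dots> \<le> C2 * (R powr (2 * p - DIM('a)) * N\<^sup>2)"
        unfolding C2_def using V1 by (intro mult_right_mono) auto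
      finally show ?thesis by (simp add: mult.assoc)
    next
      case False
      then have t1: "1 \<le> 3 * \<tau>" by simp
      have "1 powr (2 * p) \<le> (3 * \<tau>) powr (2 * p)" using t1 p by (intro powr_mono2) auto
      also have "3 * \<tau> = (36 * V) * (R * R powr (- DIM('a) / p)) * N powr (1/p)" by (simp add: \<tau>_def mult_ac)
      also have "\<dots> powr (2 * p) = (36 * V) powr (2 * p) * (R * R powr (- DIM('a) / p)) powr (2 * p) * N\<^sup>2"
        using V R N p by (simp add: powr_mult powr_powr powr_numeral)
      finally have 1: "1 \<le> (36 * V) powr (2 * p) * (R * R powr (- DIM('a) / p)) powr (2 * p) * N\<^sup>2" by simp
      have "ennreal (dens x a) \<le> emeasure lborel (ball x R)"
        unfolding emeasure_dens[symmetric] using ab by (intro emeasure_mono) auto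
      also have "\<dots> = ennreal (V1 * R powr DIM('a))"
        using ball_volume_powr[OF R, where 'a='a] by (simp add: emeasure_ball_volume V1_def mult.commute)
      finally have "dens x a \<le> V1 * R powr DIM('a)" using V1 by (simp add: ennreal_le_iff)
      then have "min (dens x a) (measure lborel F) \<le> V1 * R powr DIM('a) * 1" by simp
      also have "\<dots> \<le> V1 * R powr DIM('a) * ((36 * V) powr (2 * p) * (R * R powr (- DIM('a) / p)) powr (2 * p) * N\<^sup>2)"
        using V1 1 by (intro mult_left_mono) auto
      also have "\<dots> = V1 * (36 * V) powr (2 * p) * (R powr (2 * p - DIM('a)) * N\<^sup>2)"
        unfolding RR by (simp only: mult_ac)
      also have "\<dots> \<le> C2 * (R powr (2 * p - DIM('a)) * N\<^sup>2)"
        unfolding C2_def using C1 by (intro mult_right_mono) auto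
      finally show ?thesis by (simp add: mult.assoc)
    qed
    then show ?thesis by (simp add: N_def m_def power_mult_distrib power2_eq_square mult_ac)
  qed
  show ?thesis
  proof (intro exI[of _ "C2 * D'\<^sup>2"] conjI)
    show "0 < C2 * D'\<^sup>2" using C2 D' by simp
  qed (use main in blast)
qed

text \<open>De Giorgi's iteration over shrinking radii: a small density forces the measure to vanish
  on a half ball unless the reference set \<open>F\<close> is smaller still.\<close>

lemma quadratic_recursion_decay:
  fixes t :: "nat \<Rightarrow> real"
  assumes A: "0 < A" and B: "1 < B" and t: "\<And>j. 0 \<le> t j" and rec: "\<And>j. t (Suc j) \<le> A * B ^ j * (t j)\<^sup>2"
    and t0: "t 0 * (A * B) \<le> 1"
  shows "t j \<le> t 0 * (1 / B) ^ j"
proof (induction j)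
  case (Suc j)
  have "t (Suc j) \<le> A * B ^ j * (t j)\<^sup>2" by (rule rec)
  also have "\<dots> \<le> A * B ^ j * (t 0 * (1 / B) ^ j)\<^sup>2"
    using A B t[of j] Suc by (intro mult_left_mono power_mono) auto
  \<comment> \<open>The square supplies a second factor t 0 B^(-j): it cancels the growth B^j, and A
    times t 0 is at most 1/B.\<close>
  also have "\<dots> = (A * t 0) * (t 0 * (1 / B) ^ j)"
    using B by (simp add: power2_eq_square power_one_over field_simps)
  also have "\<dots> \<le> (1 / B) * (t 0 * (1 / B) ^ j)"
    using t0 B t[of 0] by (intro mult_right_mono) (auto simp: pos_le_divide_eq mult_ac)
  finally show ?case by simp
qed simp

text \<open>The reference sets come from connectedness: for small \<rho> and x in \<Omega> some y in
  \<Omega> lies at distance exactly 3 \<rho>, and \<open>ball y \<rho>\<close> is disjoint from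
  \<open>ball x \<rho>\<close>. Of the two measures the smaller is iterated against the larger. Were
  it below c \<rho>^n, it would vanish on a half ball, although the centre of that ball lies in the
  open set \<Omega>.\<close>

lemma measure_density:
  assumes np: "DIM('a) \<le> p"
  shows "\<exists>c>0. \<exists>\<rho>0>0. \<rho>0 \<le> 1 \<and> (\<forall>x\<in>\<Omega>. \<forall>\<rho>. 0 < \<rho> \<longrightarrow> \<rho> \<le> \<rho>0 \<longrightarrow> c * \<rho> powr DIM('a) \<le> dens x \<rho>)"
proof -
  obtain C where C: "0 < C" "\<And>x R a b F. 0 < a \<Longrightarrow> a < b \<Longrightarrow> b \<le> R \<Longrightarrow> R \<le> 1 \<Longrightarrow> F \<in> sets borel \<Longrightarrow>
    F \<subseteq> (\<Omega> \<inter> ball x (6 * R)) - ball x b \<Longrightarrow>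
    min (dens x a) (measure lborel F) \<le> C * R powr (2 * p - DIM('a)) * (dens x b / (b - a) powr p)\<^sup>2"
    using separated_sets[OF np] by metis
  \<comment> \<open>Shells of width \<rho> 2^(-(j + 2)) enter with the power -2 p, which gives the
    factor 16^p 4^(p j) at step j.\<close>
  define A where "A = C * 16 powr p"
  define B where "B = 4 powr p"
  have A: "0 < A" using C by (simp add: A_def)
  have B: "1 < B" unfolding B_def using p by (intro gr_one_powr) auto
  \<comment> \<open>The smallness threshold of \<open>quadratic_recursion_decay\<close>.\<close>
  define c where "c = 1 / (A * B)"
  have c: "0 < c" using A B by (simp add: c_def)
  have one: "c * \<rho> powr DIM('a) \<le> dens x \<rho>"
    if x: "x \<in> \<Omega>" and xy: "dist x y = 3 * \<rho>" and \<rho>: "0 < \<rho>" "\<rho> \<le> 1" and le: "dens x \<rho> \<le> dens y \<rho>" for x y \<rho>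
  proof (rule ccontr)
    assume "\<not> ?thesis"
    then have small: "dens x \<rho> < c * \<rho> powr DIM('a)" by simp
    define F where "F = \<Omega> \<inter> ball y \<rho>"
    define r where "r j = \<rho> / 2 * (1 + (1/2) ^ j)" for j :: nat
    have r: "\<rho> / 2 < r j" "r j \<le> \<rho>" "r (Suc j) < r j" for j
      using \<rho> by (auto simp: r_def power_le_one)
    have rd: "r j - r (Suc j) = \<rho> * (1/2) ^ (j + 2)" for j by (simp add: r_def algebra_simps)
    define t where "t j = dens x (r j) / \<rho> powr DIM('a)" for j
    have rec: "t (Suc j) \<le> A * B ^ j * (t j)\<^sup>2" for j
    proof -
      have Fs: "F \<subseteq> (\<Omega> \<inter> ball x (6 * \<rho>)) - ball x (r j)"
      proof
        fix z assume z: "z \<in> F"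
        then have "dist x z < 6 * \<rho>" using dist_triangle[of x z y] xy \<rho> by (auto simp: F_def)
        moreover have "2 * \<rho> < dist x z" using dist_triangle[of x y z] xy z by (auto simp: F_def dist_commute)
        ultimately show "z \<in> (\<Omega> \<inter> ball x (6 * \<rho>)) - ball x (r j)" using z r(2)[of j] \<rho> by (auto simp: F_def)
      qed
      have Fm: "F \<in> sets borel" unfolding F_def by (intro sets.Int dom_borel) simp
      have "min (dens x (r (Suc j))) (measure lborel F) \<le> C * \<rho> powr (2 * p - DIM('a)) * (dens x (r j) / (r j - r (Suc j)) powr p)\<^sup>2"
        using r[of j] r[of "Suc j"] \<rho> by (intro C(2) Fm Fs) auto
      \<comment> \<open>That x has the smaller density removes the minimum from the
        estimate.\<close>
      moreover have "dens x (r (Suc j)) \<le> measure lborel F"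
        using dens_mono[OF r(2)[of "Suc j"], of x] le by (simp add: F_def dens_def)
      ultimately have "dens x (r (Suc j)) \<le> C * \<rho> powr (2 * p - DIM('a)) * (dens x (r j) / (r j - r (Suc j)) powr p)\<^sup>2" by simp
      also have "(r j - r (Suc j)) powr p = \<rho> powr p * (1/2) powr (p * (j + 2))"
      proof -
        have 1: "(1/2::real) ^ (j + 2) = (1/2) powr real (j + 2)" by (rule powr_realpow[symmetric]) simp
        have 2: "(\<rho> * (1/2) powr k) powr p = \<rho> powr p * (1/2) powr (p * k)" for k
          using \<rho> by (simp add: powr_mult powr_powr mult.commute)
        show ?thesis unfolding rd 1 2 ..
      qed
      also have "C * \<rho> powr (2 * p - DIM('a)) * (dens x (r j) / (\<rho> powr p * (1/2) powr (p * (j + 2))))\<^sup>2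
         = (C * 16 powr p) * 4 powr (p * j) * (dens x (r j))\<^sup>2 * \<rho> powr (- DIM('a))"
      proof -
        have "((1/2) powr (p * (j + 2)))\<^sup>2 = 1 / (16 powr p * 4 powr (p * j))"
        proof -
          have "((1/2::real) powr (p * (j + 2)))\<^sup>2 = (1/2) powr (p * (j + 2) * 2)" by (simp add: powr_powr[symmetric] powr_numeral)
          also have "p * (j + 2) * 2 = 4 * p + 2 * (p * j)" by (simp add: algebra_simps)
          also have "(1/2::real) powr (4 * p + 2 * (p * j)) = ((1/2) powr 4) powr p * ((1/2) powr 2) powr (p * j)"
            by (simp only: powr_powr powr_add)
          also have "(1/2::real) powr 4 = 1/16" by (simp add: powr_numeral power_divide)
          also have "(1/2::real) powr 2 = 1/4" by (simp add: powr_numeral power_divide)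
          finally show ?thesis by (simp add: powr_divide)
        qed
        moreover have "(\<rho> powr p)\<^sup>2 = \<rho> powr (2 * p)" by (simp add: powr_powr[symmetric] powr_numeral mult.commute[of 2])
        moreover have "\<rho> powr (2 * p - DIM('a)) = \<rho> powr (2 * p) * \<rho> powr (- DIM('a))" by (simp add: powr_add[symmetric])
        ultimately show ?thesis using \<rho> by (simp add: power_divide power_mult_distrib field_simps)
      qed
      finally have "dens x (r (Suc j)) \<le> A * 4 powr (p * j) * (dens x (r j))\<^sup>2 * \<rho> powr (- DIM('a))" by (simp add: A_def)
      then have "t (Suc j) \<le> A * 4 powr (p * j) * (dens x (r j))\<^sup>2 * \<rho> powr (- DIM('a)) / \<rho> powr DIM('a)"
        unfolding t_def by (intro divide_right_mono) auto
      also have "\<dots> = A * 4 powr (p * j) * (t j)\<^sup>2" by (simp add: t_def powr_minus power2_eq_square divide_simps)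
      also have "4 powr (p * j) = B ^ j" by (simp add: B_def powr_powr[symmetric] powr_realpow)
      finally show ?thesis .
    qed
    have t0: "t 0 * (A * B) \<le> 1"
      using small \<rho> A B by (simp add: t_def r_def c_def divide_simps mult_ac)
    have tn: "0 \<le> t j" for j by (simp add: t_def dens_nonneg)
    have dec: "t j \<le> t 0 * (1 / B) ^ j" for j by (rule quadratic_recursion_decay[OF A B tn rec t0])
    have "(\<lambda>j. t 0 * (1 / B) ^ j) \<longlonglongrightarrow> t 0 * 0" using B by (intro tendsto_mult tendsto_const LIMSEQ_power_zero) auto
    moreover have "dens x (\<rho> / 2) / \<rho> powr DIM('a) \<le> t 0 * (1 / B) ^ j" for j
    proof -
      have "dens x (\<rho> / 2) / \<rho> powr DIM('a) \<le> t j"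
        unfolding t_def using r(1)[of j] by (intro divide_right_mono dens_mono) auto
      then show ?thesis using dec[of j] by simp
    qed
    ultimately have "dens x (\<rho> / 2) / \<rho> powr DIM('a) \<le> 0" by (intro LIMSEQ_le_const[of _ "0::real"]) auto
    moreover have "0 < dens x (\<rho> / 2)" using x \<rho> by (intro dens_pos) auto
    ultimately show False using \<rho> by (simp add: divide_le_0_iff)
  qed
  obtain a b where ab: "a \<in> \<Omega>" "b \<in> \<Omega>" "a \<noteq> b"
  proof -
    obtain a where a: "a \<in> \<Omega>" using nonempty by auto
    then obtain e where e: "0 < e" "ball a e \<subseteq> \<Omega>" using open_contains_ball[THEN iffD1, OF open_dom] by auto
    have i: "(SOME i. i \<in> Basis) \<in> (Basis :: 'a set)" by (rule SOME_Basis)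
    define i :: 'a where "i = (SOME i. i \<in> Basis)"
    note i = i[folded i_def]
    have "a + (e / 2) *\<^sub>R i \<in> ball a e" using e i by (simp add: dist_norm)
    then have "a + (e / 2) *\<^sub>R i \<in> \<Omega>" using e by blast
    moreover have "a \<noteq> a + (e / 2) *\<^sub>R i" using e nonzero_Basis[OF i] by simp
    ultimately show ?thesis using that a by blast
  qed
  \<comment> \<open>With 6 \<rho> <= dist a b, at least one of a and b is at distance 3 \<rho> or
    more from any given point.\<close>
  define \<rho>0 where "\<rho>0 = min 1 (dist a b / 6)"
  have \<rho>0: "0 < \<rho>0" "\<rho>0 \<le> 1" "6 * \<rho>0 \<le> dist a b" using ab by (auto simp: \<rho>0_def)
  have "c * \<rho> powr DIM('a) \<le> dens x \<rho>" if x: "x \<in> \<Omega>" and \<rho>: "0 < \<rho>" "\<rho> \<le> \<rho>0" for x \<rho>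
  proof -
    obtain z where z: "z \<in> \<Omega>" "3 * \<rho> \<le> dist x z"
    proof (cases "3 * \<rho> \<le> dist x a")
      case False
      then have "3 * \<rho> \<le> dist x b" using dist_triangle2[of a b x] \<rho>0(3) \<rho> by (simp add: dist_commute)
      then show ?thesis using that ab(2) by blast
    qed (use that ab(1) in blast)
    have "connected (dist x ` \<Omega>)" by (intro connected_continuous_image connected_dom continuous_intros)
    moreover have "dist x x \<in> dist x ` \<Omega>" "dist x z \<in> dist x ` \<Omega>" using x z by auto
    ultimately have "3 * \<rho> \<in> dist x ` \<Omega>"
      using connected_contains_Icc[of "dist x ` \<Omega>" "dist x x" "dist x z"] z \<rho> by (auto simp: subset_iff)
    then obtain y where y: "y \<in> \<Omega>" "dist x y = 3 * \<rho>" by auto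
    show ?thesis
    proof (cases "dens x \<rho> \<le> dens y \<rho>")
      case True
      then show ?thesis using one[OF x y(2)] \<rho> \<rho>0 by simp
    next
      case False
      then show ?thesis using one[OF y(1), of x \<rho>] y(2) \<rho> \<rho>0 by (simp add: dist_commute)
    qed
  qed
  with c \<rho>0 show ?thesis by blast
qed

end

section \<open>Gagliardo-Nirenberg interpolation\<close>

text \<open>The two terms govern the values below and above \<open>M\<close>; above it, a may be
  replaced by a majorant f. The level \<open>M\<close> stays free until the norms to be balanced are
  known.\<close>

lemma powr_interp:
  fixes a f M s r q :: real
  assumes "0 \<le> a" "0 < M" "s \<le> r" "r \<le> q" "0 \<le> q" "M < a \<Longrightarrow> a \<le> f"
  shows "a powr r \<le> M powr (r - s) * a powr s + M powr (r - q) * f powr q"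
proof (cases "a \<le> M")
  case True
  have "a powr r = a powr (r - s) * a powr s" by (simp add: powr_add[symmetric])
  also have "\<dots> \<le> M powr (r - s) * a powr s" using assms True by (intro mult_right_mono powr_mono2) auto
  finally show ?thesis by (simp add: add_increasing2)
next
  case False
  have "a powr r = a powr (r - q) * a powr q" by (simp add: powr_add[symmetric])
  also have "\<dots> \<le> M powr (r - q) * f powr q"
    using assms False by (intro mult_mono powr_mono2 powr_mono2') auto
  finally show ?thesis by (simp add: add_increasing)
qed

lemma Lpp_interp:
  fixes v f :: "'a::euclidean_space \<Rightarrow> real"
  assumes [measurable]: "v \<in> borel_measurable borel" "f \<in> borel_measurable borel"
    and M: "0 < M" and srq: "s \<le> r" "r \<le> q" "0 \<le> q" and f: "AE x in lborel. M < \<bar>v x\<bar> \<longrightarrow> \<bar>v x\<bar> \<le> \<bar>f x\<bar>"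
  shows "Lpp r v \<le> ennreal (M powr (r - s)) * Lpp s v + ennreal (M powr (r - q)) * Lpp q f"
proof -
  have "Lpp r v \<le> (\<integral>\<^sup>+x. ennreal (M powr (r - s)) * epow (ennreal \<bar>v x\<bar>) s + ennreal (M powr (r - q)) * epow (ennreal \<bar>f x\<bar>) q \<partial>lborel)"
    unfolding Lpp_real
  proof (rule nn_integral_mono_AE, use f in eventually_elim)
    case (elim x)
    have "\<bar>v x\<bar> powr r \<le> M powr (r - s) * \<bar>v x\<bar> powr s + M powr (r - q) * \<bar>f x\<bar> powr q"
      using elim by (intro powr_interp M srq) auto
    then show ?case by (simp add: ennreal_mult[symmetric] ennreal_plus[symmetric] ennreal_leI del: ennreal_plus)
  qed
  also have "\<dots> = ennreal (M powr (r - s)) * Lpp s v + ennreal (M powr (r - q)) * Lpp q f"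
    by (simp add: nn_integral_add nn_integral_cmult Lpp_real del: epow_ennreal)
  finally show ?thesis .
qed

lemma Lpp_eq_0_iff:
  fixes v :: "'a::euclidean_space \<Rightarrow> real"
  assumes [measurable]: "v \<in> borel_measurable borel"
  shows "Lpp p v = 0 \<longleftrightarrow> (AE x in lborel. v x = 0)"
  unfolding Lpp_real by (subst nn_integral_0_iff_AE) (auto simp del: epow_ennreal)

lemma Lpp_scale:
  fixes v :: "'a::euclidean_space \<Rightarrow> real"
  assumes [measurable]: "v \<in> borel_measurable borel" and "0 \<le> c"
  shows "Lpp q (\<lambda>x. c * v x) = ennreal (c powr q) * Lpp q v"
proof -
  have "epow (ennreal \<bar>c * v x\<bar>) q = ennreal (c powr q) * epow (ennreal \<bar>v x\<bar>) q" for x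
    using assms(2) by (simp add: abs_mult ennreal_mult epow_mult)
  then show ?thesis by (simp add: Lpp_real nn_integral_cmult del: epow_ennreal)
qed

section \<open>Reduction to positive norms\<close>

context sobolev_extension_domain
begin

lemma centered_measurable:
  assumes "sob \<Omega> p u g" shows "centered u \<in> borel_measurable borel"
  using sobD(1)[OF assms] by measurable

text \<open>If the gradient vanishes, so does the centred function, by the Poincare inequality.
  Outside a trivial case one may therefore divide by \<open>D\<close> and \<open>S\<close>.\<close>

lemma zero_or_positive:
  assumes su: "sob \<Omega> p u g" and fin: "Lpp s (centered u) < top" and s: "0 < s"
  obtains "AE x in lborel. centered u x = 0"
    | D S where "0 < D" "0 < S" "Lpp p g = ennreal (D powr p)" "Lpp s (centered u) = ennreal (S powr s)"
proof (cases "Lpp p g = 0 \<or> Lpp s (centered u) = 0")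
  case True
  obtain C where "Lpp p g + Lpp p (centered u) \<le> ennreal C * Lpp p g"
    using extension_centered su by blast
  with True have "Lpp p (centered u) = 0 \<or> Lpp s (centered u) = 0" by auto
  then show ?thesis
    using that(1) by (simp add: Lpp_eq_0_iff[OF centered_measurable[OF su]])
next
  case False
  obtain d where d: "0 \<le> d" "Lpp p g = ennreal d" using sob_Lpp(2)[OF su] by (cases "Lpp p g") auto
  obtain e where e: "0 \<le> e" "Lpp s (centered u) = ennreal e" using fin by (cases "Lpp s (centered u)") auto
  have "0 < d" "0 < e" using False d e by (auto simp: less_le)
  then show ?thesis
    using that(2)[of "d powr (1/p)" "e powr (1/s)"] d e s p by (simp add: powr_powr)
qed

text \<open>For positive \<open>D\<close> and \<open>S\<close>, \<open>rpow\<close> agrees with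
  \<open>powr\<close>; in the degenerate case the left side is 0 and the right side is
  nonnegative.\<close>

lemma gagliardo_nirenberg_of_positive:
  assumes \<theta>: "0 \<le> \<theta>" "\<theta> \<le> 1" and s: "0 < s" and r: "0 < r" and C: "0 < C"
    and pos: "\<And>u g D S. sob \<Omega> p u g \<Longrightarrow> 0 < D \<Longrightarrow> 0 < S \<Longrightarrow> Lpp p g = ennreal (D powr p) \<Longrightarrow>
      Lpp s (centered u) = ennreal (S powr s) \<Longrightarrow> Lpp r (centered u) \<le> ennreal (C * (D powr \<theta> * S powr (1 - \<theta>)) powr r)"
    and su: "sob \<Omega> p u g" and fin: "Lpp s (centered u) < top"
  shows "Lpp r (centered u) < top" "enn2real (Lpp r (centered u)) powr (1/r) \<le> C powr (1/r) *
    rpow (enn2real (Lpp p g) powr (1/p)) \<theta> * rpow (enn2real (Lpp s (centered u)) powr (1/s)) (1 - \<theta>)"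
proof -
  have "Lpp r (centered u) < top \<and> enn2real (Lpp r (centered u)) powr (1/r) \<le> C powr (1/r) *
    rpow (enn2real (Lpp p g) powr (1/p)) \<theta> * rpow (enn2real (Lpp s (centered u)) powr (1/s)) (1 - \<theta>)"
  proof (rule zero_or_positive[OF su fin s])
    assume "AE x in lborel. centered u x = 0"
    then have "Lpp r (centered u) = 0" using Lpp_eq_0_iff[OF centered_measurable[OF su]] by blast
    then show ?thesis by (simp add: rpow_def)
  next
    fix D S :: real assume D: "0 < D" and S: "0 < S" and eq: "Lpp p g = ennreal (D powr p)" "Lpp s (centered u) = ennreal (S powr s)"
    have le: "Lpp r (centered u) \<le> ennreal (C * (D powr \<theta> * S powr (1 - \<theta>)) powr r)" by (rule pos[OF su D S eq])
    then have "enn2real (Lpp r (centered u)) \<le> C * (D powr \<theta> * S powr (1 - \<theta>)) powr r"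
      using C by (intro enn2real_leI) auto
    then have "enn2real (Lpp r (centered u)) powr (1/r) \<le> (C * (D powr \<theta> * S powr (1 - \<theta>)) powr r) powr (1/r)"
      using r by (intro powr_mono2) auto
    also have "\<dots> = C powr (1/r) * (D powr \<theta> * S powr (1 - \<theta>))"
      using r C D S by (simp add: powr_mult powr_powr)
    also have "D powr \<theta> = rpow (enn2real (Lpp p g) powr (1/p)) \<theta>"
      using D p by (simp add: eq powr_powr rpow_def)
    also have "S powr (1 - \<theta>) = rpow (enn2real (Lpp s (centered u)) powr (1/s)) (1 - \<theta>)"
      using S s by (simp add: eq powr_powr rpow_def)
    finally show ?thesis using le by (auto simp: mult.assoc intro: le_less_trans)
  qed
  then show "Lpp r (centered u) < top" "enn2real (Lpp r (centered u)) powr (1/r) \<le> C powr (1/r) *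
    rpow (enn2real (Lpp p g) powr (1/p)) \<theta> * rpow (enn2real (Lpp s (centered u)) powr (1/s)) (1 - \<theta>)" by auto
qed

lemma gagliardo_nirenberg_of_positive_sup:
  assumes s: "0 < s"
    and pos: "\<And>u g D S. sob \<Omega> p u g \<Longrightarrow> 0 < D \<Longrightarrow> 0 < S \<Longrightarrow> Lpp p g = ennreal (D powr p) \<Longrightarrow>
      Lpp s (centered u) = ennreal (S powr s) \<Longrightarrow> AE x in lborel. \<bar>centered u x\<bar> \<le> C * (D powr \<theta> * S powr (1 - \<theta>))"
    and C: "0 < C" and su: "sob \<Omega> p u g" and fin: "Lpp s (centered u) < top"
  shows "AE x in lborel. \<bar>centered u x\<bar> \<le> C *
    rpow (enn2real (Lpp p g) powr (1/p)) \<theta> * rpow (enn2real (Lpp s (centered u)) powr (1/s)) (1 - \<theta>)"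
proof (rule zero_or_positive[OF su fin s])
  assume "AE x in lborel. centered u x = 0"
  then show ?thesis
  proof eventually_elim
    case (elim x)
    have "0 \<le> C * rpow (enn2real (Lpp p g) powr (1/p)) \<theta> * rpow (enn2real (Lpp s (centered u)) powr (1/s)) (1 - \<theta>)"
      using C by (simp add: rpow_def)
    then show ?case unfolding elim by simp
  qed
next
  fix D S :: real assume D: "0 < D" and S: "0 < S" and eq: "Lpp p g = ennreal (D powr p)" "Lpp s (centered u) = ennreal (S powr s)"
  have "AE x in lborel. \<bar>centered u x\<bar> \<le> C * (D powr \<theta> * S powr (1 - \<theta>))" by (rule pos[OF su D S eq])
  also have "D powr \<theta> = rpow (enn2real (Lpp p g) powr (1/p)) \<theta>"
    using D p by (simp add: eq powr_powr rpow_def)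
  also have "S powr (1 - \<theta>) = rpow (enn2real (Lpp s (centered u)) powr (1/s)) (1 - \<theta>)"
    using S s by (simp add: eq powr_powr rpow_def)
  finally show ?thesis by (simp only: mult.assoc)
qed

lemma embedding_centered:
  assumes pq: "p \<le> q"
    and emb: "\<exists>C>0. \<forall>(w :: 'a \<Rightarrow> real) h. sob UNIV p w h \<longrightarrow> Lpp q w \<le> ennreal C * epow (Lpp p h + Lpp p w) (q / p)"
  shows "\<exists>C>0. \<forall>u g D. sob \<Omega> p u g \<longrightarrow> 0 < D \<longrightarrow> Lpp p g = ennreal (D powr p) \<longrightarrow> Lpp q (centered u) \<le> ennreal (C * D powr q)"
proof -
  obtain A where A: "0 < A" "\<And>u g. sob \<Omega> p u g \<Longrightarrow> Lpp q u \<le> ennreal A * epow (Lpp p g + Lpp p u) (q / p)"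
    using Lq_embedding_dom[OF pq emb] by blast
  obtain B where B: "0 < B" "\<And>u g. sob \<Omega> p u g \<Longrightarrow> sob \<Omega> p (centered u) g \<and> Lpp p g + Lpp p (centered u) \<le> ennreal B * Lpp p g"
    using extension_centered by blast
  show ?thesis
  proof (intro exI[of _ "A * B powr (q / p)"] conjI allI impI)
    show "0 < A * B powr (q / p)" using A B by simp
    fix u g D assume su: "sob \<Omega> p u g" and D: "0 < D" "Lpp p g = ennreal (D powr p)"
    have "Lpp q (centered u) \<le> ennreal A * epow (Lpp p g + Lpp p (centered u)) (q / p)"
      using A(2) B(2)[OF su] by blast
    also have "\<dots> \<le> ennreal A * epow (ennreal B * Lpp p g) (q / p)"
      using B(2)[OF su] p pq by (intro mult_left_mono epow_mono) auto
    also have "\<dots> = ennreal (A * B powr (q / p) * D powr q)"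
      using A B p by (simp add: D ennreal_mult[symmetric] powr_mult powr_powr mult.assoc)
    finally show "Lpp q (centered u) \<le> ennreal (A * B powr (q / p) * D powr q)" .
  qed
qed

section \<open>Exponents p below the dimension\<close>

lemma gagliardo_nirenberg_less_dim:
  assumes pn: "p < DIM('a)" and q_def: "q = DIM('a) * p / (DIM('a) - p)" and s: "0 < s" "s \<le> r" "r \<le> q"
    and \<theta>: "0 \<le> \<theta>" "\<theta> \<le> 1" and eq: "\<theta> * (1 / p - 1 / DIM('a)) + (1 - \<theta>) * (1 / s) = 1 / r"
  shows "\<exists>C>0. \<forall>u g D S. sob \<Omega> p u g \<longrightarrow> 0 < D \<longrightarrow> 0 < S \<longrightarrow> Lpp p g = ennreal (D powr p) \<longrightarrow>
      Lpp s (centered u) = ennreal (S powr s) \<longrightarrow> Lpp r (centered u) \<le> ennreal (C * (D powr \<theta> * S powr (1 - \<theta>)) powr r)"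
proof -
  have p1: "1 \<le> p" using p by simp
  have pq: "p < q" unfolding q_def by (rule Lq_embedding_less(1)[OF p1 pn])
  have q0: "0 < q" using p pq by simp
  have r0: "0 < r" using s by simp
  obtain A where A: "0 < A" "\<And>u g D. sob \<Omega> p u g \<Longrightarrow> 0 < D \<Longrightarrow> Lpp p g = ennreal (D powr p) \<Longrightarrow> Lpp q (centered u) \<le> ennreal (A * D powr q)"
    using embedding_centered[OF less_imp_le[OF pq] Lq_embedding_less(2)[OF p1 pn, folded q_def]] by blast
  have qi: "1 / p - 1 / DIM('a) = 1 / q" using p pn by (simp add: q_def field_simps)
  have \<theta>r: "\<theta> * r * (q - s) = q * (r - s)"
  proof -
    have "\<theta> * (1 / q) + (1 - \<theta>) * (1 / s) = 1 / r" using eq unfolding qi .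
    moreover have "\<theta> * (1 / q) + (1 - \<theta>) * (1 / s) = (\<theta> * s + (1 - \<theta>) * q) / (q * s)"
      using q0 s by (simp add: field_simps)
    ultimately have "(\<theta> * s + (1 - \<theta>) * q) * r = q * s"
      using q0 r0 s by (simp add: frac_eq_eq)
    then show ?thesis by (simp add: algebra_simps)
  qed
  show ?thesis
  proof (cases "s < q")
    case True
    \<comment> \<open>Exponents of the threshold M = D^a S^b, the solution of M^(q - s) = D^q
      S^(-s), at which S^s and D^q enter the interpolation with equal size.\<close>
    define a where "a = q / (q - s)"
    define b where "b = - s / (q - s)"
    have \<theta>a: "a * (r - s) = \<theta> * r" "b * (r - s) + s = (1 - \<theta>) * r"
    proof -
      show *: "a * (r - s) = \<theta> * r" using \<theta>r True by (simp add: a_def divide_simps)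
      have b: "b = 1 - a" using True by (simp add: a_def b_def divide_simps)
      have "b * (r - s) + s = r - a * (r - s)" unfolding b by (simp add: algebra_simps)
      then show "b * (r - s) + s = (1 - \<theta>) * r" unfolding * by (simp add: algebra_simps)
    qed
    have \<theta>b: "a * (r - q) + q = \<theta> * r" "b * (r - q) = (1 - \<theta>) * r"
    proof -
      have "a * (q - s) = q" "b * (q - s) = - s" using True by (simp_all add: a_def b_def)
      then show "a * (r - q) + q = \<theta> * r" "b * (r - q) = (1 - \<theta>) * r" using \<theta>a by (simp_all add: algebra_simps)
    qed
    show ?thesis
    proof (intro exI[of _ "1 + A"] conjI allI impI)
      show "0 < 1 + A" using A by simp
      fix u g D S assume su: "sob \<Omega> p u g" and D: "0 < D" "Lpp p g = ennreal (D powr p)" and S: "0 < S" "Lpp s (centered u) = ennreal (S powr s)"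
      define M where "M = D powr a * S powr b"
      define X where "X = (D powr \<theta> * S powr (1 - \<theta>)) powr r"
      have X: "X = D powr (\<theta> * r) * S powr ((1 - \<theta>) * r)" using D S by (simp add: X_def powr_mult powr_powr)
      have M: "0 < M" using D S by (simp add: M_def)
      have "M powr (r - s) = D powr (a * (r - s)) * S powr (b * (r - s))"
        using D S by (simp add: M_def powr_mult powr_powr)
      then have "M powr (r - s) * S powr s = D powr (a * (r - s)) * S powr (b * (r - s) + s)"
        by (simp add: powr_add)
      then have 1: "M powr (r - s) * S powr s = X" unfolding X \<theta>a .
      have "M powr (r - q) = D powr (a * (r - q)) * S powr (b * (r - q))"
        using D S by (simp add: M_def powr_mult powr_powr)
      then have "M powr (r - q) * D powr q = D powr (a * (r - q) + q) * S powr (b * (r - q))"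
        by (simp add: powr_add)
      then have 2: "M powr (r - q) * D powr q = X" unfolding X \<theta>b .
      have "Lpp r (centered u) \<le> ennreal (M powr (r - s)) * Lpp s (centered u) + ennreal (M powr (r - q)) * Lpp q (centered u)"
        using s q0 by (intro Lpp_interp centered_measurable[OF su] M) auto
      also have "\<dots> \<le> ennreal (M powr (r - s)) * ennreal (S powr s) + ennreal (M powr (r - q)) * ennreal (A * D powr q)"
        using A(2)[OF su D] S by (intro add_mono mult_left_mono) auto
      also have "\<dots> = ennreal (M powr (r - s) * S powr s + A * (M powr (r - q) * D powr q))"
        using A by (simp add: ennreal_mult[symmetric] ennreal_plus[symmetric] mult_ac del: ennreal_plus)
      also have "M powr (r - s) * S powr s + A * (M powr (r - q) * D powr q) = (1 + A) * X"
        unfolding 1 2 by (simp add: algebra_simps)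
      finally show "Lpp r (centered u) \<le> ennreal ((1 + A) * (D powr \<theta> * S powr (1 - \<theta>)) powr r)" unfolding X_def .
    qed
  next
    \<comment> \<open>Here s = r = q and every \<theta> satisfies the exponent relation. The
      embedding bounds \<open>S\<close> by a multiple of \<open>D\<close>, and the \<theta>-th power
      of that bound is used.\<close>
    case False
    then have sq: "s = q" "r = q" using s by auto
    show ?thesis
    proof (intro exI[of _ "A powr \<theta>"] conjI allI impI)
      show "0 < A powr \<theta>" using A by simp
      fix u g D S assume su: "sob \<Omega> p u g" and D: "0 < D" "Lpp p g = ennreal (D powr p)" and S: "0 < S" "Lpp s (centered u) = ennreal (S powr s)"
      have "S powr q \<le> A * D powr q" using A(2)[OF su D] A(1) S by (simp add: sq)
      then have "(S powr q) powr \<theta> * (S powr q) powr (1 - \<theta>) \<le> (A * D powr q) powr \<theta> * (S powr q) powr (1 - \<theta>)"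
        using \<theta> by (intro mult_right_mono powr_mono2) auto
      moreover have "(S powr q) powr \<theta> * (S powr q) powr (1 - \<theta>) = S powr q"
        using S by (simp add: powr_add[symmetric])
      moreover have "(A * D powr q) powr \<theta> * (S powr q) powr (1 - \<theta>) = A powr \<theta> * (D powr \<theta> * S powr (1 - \<theta>)) powr r"
        using A D S by (simp add: sq powr_mult powr_powr mult_ac)
      ultimately show "Lpp r (centered u) \<le> ennreal (A powr \<theta> * (D powr \<theta> * S powr (1 - \<theta>)) powr r)"
        using S by (simp add: sq ennreal_leI)
    qed
  qed
qed

section \<open>Exponents p at least the dimension\<close>

lemma centered_extension:
  "\<exists>E>0. \<forall>u g D. sob \<Omega> p u g \<longrightarrow> 0 < D \<longrightarrow> Lpp p g = ennreal (D powr p) \<longrightarrow>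
    (\<exists>w h. sob UNIV p w h \<and> (AE x in lborel. x \<in> \<Omega> \<longrightarrow> w x = centered u x) \<and>
      Lpp p h \<le> ennreal (E * D powr p) \<and> Lpp p h + Lpp p w \<le> ennreal (E * D powr p))"
proof -
  obtain E where E: "0 < E" "\<And>u g. sob \<Omega> p u g \<Longrightarrow> (\<exists>w h. sob UNIV p w h \<and> (AE x in lborel. x \<in> \<Omega> \<longrightarrow> w x = centered u x) \<and> Lpp p h + Lpp p w \<le> ennreal E * Lpp p g)"
    using extension_centered by blast
  show ?thesis
  proof (intro exI[of _ E] conjI allI impI E(1))
    fix u g D assume su: "sob \<Omega> p u g" and D: "0 < D" "Lpp p g = ennreal (D powr p)"
    from E(2)[OF su] obtain w h where w: "sob UNIV p w h" "AE x in lborel. x \<in> \<Omega> \<longrightarrow> w x = centered u x" "Lpp p h + Lpp p w \<le> ennreal E * Lpp p g"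
      by blast
    have le: "Lpp p h + Lpp p w \<le> ennreal (E * D powr p)" using w(3) E(1) by (simp add: D ennreal_mult)
    moreover have "Lpp p h \<le> Lpp p h + Lpp p w" by simp
    ultimately have "Lpp p h \<le> ennreal (E * D powr p)" by (rule order_trans[rotated])
    with le show "\<exists>w h. sob UNIV p w h \<and> (AE x in lborel. x \<in> \<Omega> \<longrightarrow> w x = centered u x) \<and>
      Lpp p h \<le> ennreal (E * D powr p) \<and> Lpp p h + Lpp p w \<le> ennreal (E * D powr p)"
      using w(1,2) by blast
  qed
qed

text \<open>Chebyshev and the measure density of \<open>\<Omega>\<close> give a point \<open>y \<in> \<Omega>\<close> near \<open>x\<close> at which both
  \<open>\<bar>v y\<bar>\<close> and the distance from \<open>v y\<close> to the local average are controlled.\<close>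

lemma local_average_bound:
  assumes np: "DIM('a) \<le> p" and s: "0 < s" and E: "0 < E"
  defines "\<alpha> \<equiv> 1 - DIM('a) / p"
  shows "\<exists>L>0. \<exists>\<rho>0>0. \<forall>v w h D S \<rho> x. v \<in> borel_measurable borel \<longrightarrow> sob UNIV p w h \<longrightarrow> (AE y in lborel. y \<in> \<Omega> \<longrightarrow> w y = v y) \<longrightarrow>
    0 < D \<longrightarrow> 0 < S \<longrightarrow> Lpp p h \<le> ennreal (E * D powr p) \<longrightarrow> Lpp s v = ennreal (S powr s) \<longrightarrow> 0 < \<rho> \<longrightarrow> \<rho> \<le> \<rho>0 \<longrightarrow> x \<in> \<Omega> \<longrightarrow>
    \<bar>ball_avg w \<rho> x\<bar> \<le> L * (\<rho> powr \<alpha> * D + \<rho> powr (- DIM('a) / s) * S)"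
proof -
  have p1: "1 \<le> p" using p by simp
  obtain c \<rho>0 where c: "0 < c" "0 < \<rho>0" "\<And>x \<rho>. x \<in> \<Omega> \<Longrightarrow> 0 < \<rho> \<Longrightarrow> \<rho> \<le> \<rho>0 \<Longrightarrow> c * \<rho> powr DIM('a) \<le> dens x \<rho>"
    using measure_density[OF np] by blast
  obtain B where B: "0 < B" "\<And>(u :: 'a \<Rightarrow> real) g R. loc_int u \<Longrightarrow> loc_int g \<Longrightarrow> weak_grad_eq UNIV u g \<Longrightarrow> 0 < R \<Longrightarrow>
    (\<integral>\<^sup>+x. epow (ennreal \<bar>u x - ball_avg u R x\<bar>) p \<partial>lborel)
      \<le> ennreal (B * R powr (p - DIM('a) * (p - p) / p)) * epow (\<integral>\<^sup>+x. epow (ennreal (norm (g x))) p \<partial>lborel) (p / p)"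
    using diff_ball_avg_Lq_weak[OF p1 np order_refl] by blast
  define V where "V = ball_volume TYPE('a) 1 powr (-1/p)"
  have V: "0 \<le> V" by (simp add: V_def)
  \<comment> \<open>The factors 3 make each exceptional set occupy at most a third of the guaranteed
    measure c \<rho>^n.\<close>
  define a where "a = (3 * (B * E) / c) powr (1 / p)"
  define b where "b = (3 / c) powr (1 / s)"
  have ab: "0 < a" "0 < b" using B E c by (simp_all add: a_def b_def)
  define L where "L = V * E powr (1/p) + a + b"
  have L: "0 < L" using V ab by (simp add: L_def add_nonneg_pos)
  show ?thesis
  proof (rule exI[of _ L], intro conjI L, rule exI[of _ \<rho>0], intro conjI c(2) allI impI)
    fix v w h D S \<rho> x
    assume [measurable]: "v \<in> borel_measurable borel" and w: "sob UNIV p w h" and wv: "AE y in lborel. y \<in> \<Omega> \<longrightarrow> w y = v y"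
      and D: "0 < D" and S: "0 < S" and h: "Lpp p h \<le> ennreal (E * D powr p)" and Sv: "Lpp s v = ennreal (S powr s)"
      and \<rho>: "0 < \<rho>" "\<rho> \<le> \<rho>0" and x: "x \<in> \<Omega>"
    note [measurable] = sobD(1)[OF w]
    have wl: "loc_int w" "loc_int h" "weak_grad_eq UNIV w h" using sob_loc_int[OF w p1] sobD(7)[OF w] by auto
    define e where "e y = w y - ball_avg w \<rho> y" for y
    have [measurable]: "e \<in> borel_measurable borel" unfolding e_def[abs_def] by measurable
    have e: "Lpp p e \<le> ennreal (B * E * (\<rho> * D) powr p)"
    proof -
      have "Lpp p e \<le> ennreal (B * \<rho> powr p) * Lpp p h"
        using B(2)[OF wl \<rho>(1)] p by (simp add: Lpp_real e_def Lpp_def[of p h] del: epow_ennreal)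
      also have "\<dots> \<le> ennreal (B * \<rho> powr p) * ennreal (E * D powr p)" by (intro mult_left_mono h) auto
      also have "\<dots> = ennreal (B * E * (\<rho> * D) powr p)" using B E \<rho> D by (simp add: ennreal_mult[symmetric] powr_mult mult_ac)
      finally show ?thesis .
    qed
    define N where "N = \<rho> powr DIM('a)"
    have N: "0 < N" using \<rho> by (simp add: N_def)
    define t1 where "t1 = a * (\<rho> powr \<alpha> * D)"
    define t2 where "t2 = b * (\<rho> powr (- DIM('a) / s) * S)"
    have t: "0 < t1" "0 < t2" using ab \<rho> D S by (simp_all add: t1_def t2_def)
    have t1: "t1 powr p = 3 * (B * E) / c * ((\<rho> * D) powr p / N)"
    proof -
      have "\<alpha> * p = p - DIM('a)" using p by (simp add: \<alpha>_def field_simps)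
      then have "(\<rho> powr \<alpha>) powr p = \<rho> powr p / N" by (simp add: powr_powr N_def powr_diff)
      moreover have "a powr p = 3 * (B * E) / c" using B E c p by (simp add: a_def powr_powr)
      ultimately show ?thesis using ab \<rho> D by (simp add: t1_def powr_mult)
    qed
    have t2: "t2 powr s = 3 / c * (S powr s / N)"
    proof -
      have "(\<rho> powr (- DIM('a) / s)) powr s = 1 / N"
        unfolding powr_powr using s by (simp add: N_def powr_minus_divide)
      moreover have "b powr s = 3 / c" using c s by (simp add: b_def powr_powr)
      ultimately show ?thesis using ab \<rho> S by (simp add: t2_def powr_mult)
    qed
    \<comment> \<open>The sets where e or v is large fill at most two thirds of c \<rho>^n, so the
      good points are not negligible, and one of them can be taken where w = v.\<close>
    have "\<not> (AE y in lborel. y \<in> \<Omega> \<inter> ball x \<rho> \<longrightarrow> t1 < \<bar>e y\<bar> \<or> t2 < \<bar>v y\<bar>)"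
    proof
      assume bad: "AE y in lborel. y \<in> \<Omega> \<inter> ball x \<rho> \<longrightarrow> t1 < \<bar>e y\<bar> \<or> t2 < \<bar>v y\<bar>"
      have "ennreal (dens x \<rho>) = (\<integral>\<^sup>+y. indicator (\<Omega> \<inter> ball x \<rho>) y \<partial>lborel)"
        by (simp add: emeasure_dens)
      also have "\<dots> \<le> (\<integral>\<^sup>+y. ennreal (1 / t1 powr p) * epow (ennreal \<bar>e y\<bar>) p + ennreal (1 / t2 powr s) * epow (ennreal \<bar>v y\<bar>) s \<partial>lborel)"
      proof (rule nn_integral_mono_AE, use bad in eventually_elim)
        case (elim y)
        show ?case
        proof (cases "y \<in> \<Omega> \<inter> ball x \<rho>")
          case True
          have "1 \<le> 1 / t1 powr p * \<bar>e y\<bar> powr p + 1 / t2 powr s * \<bar>v y\<bar> powr s"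
          proof (cases "t1 < \<bar>e y\<bar>")
            case True
            then have "t1 powr p \<le> \<bar>e y\<bar> powr p" using t p by (intro powr_mono2) auto
            then show ?thesis using t by (intro add_increasing2) (auto simp: pos_le_divide_eq)
          next
            case False
            then have "t2 powr s \<le> \<bar>v y\<bar> powr s" using elim True t s by (intro powr_mono2) auto
            then show ?thesis using t by (intro add_increasing) (auto simp: pos_le_divide_eq)
          qed
          then show ?thesis using True t
            by (simp add: ennreal_mult[symmetric] ennreal_plus[symmetric] ennreal_1[symmetric] ennreal_leI del: ennreal_plus ennreal_1)
        qed simp
      qed
      also have "\<dots> = ennreal (1 / t1 powr p) * Lpp p e + ennreal (1 / t2 powr s) * Lpp s v"
        by (simp add: nn_integral_add nn_integral_cmult Lpp_real del: epow_ennreal)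
      also have "\<dots> \<le> ennreal (1 / t1 powr p) * ennreal (B * E * (\<rho> * D) powr p) + ennreal (1 / t2 powr s) * ennreal (S powr s)"
        using Sv by (intro add_mono mult_left_mono e) auto
      also have "\<dots> = ennreal (1 / t1 powr p * (B * E * (\<rho> * D) powr p) + 1 / t2 powr s * S powr s)"
        using B E by (simp add: ennreal_mult[symmetric] ennreal_plus[symmetric] del: ennreal_plus)
      also have "1 / t1 powr p * (B * E * (\<rho> * D) powr p) + 1 / t2 powr s * S powr s = 2 / 3 * (c * N)"
        unfolding t1 t2 using B E c N \<rho> D S by simp
      finally have "dens x \<rho> \<le> 2 / 3 * (c * N)" using c N by (simp add: ennreal_le_iff)
      moreover have "c * N \<le> dens x \<rho>" unfolding N_def by (rule c(3)[OF x \<rho>])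
      ultimately show False using mult_pos_pos[OF c(1) N] by linarith
    qed
    then obtain y where y: "y \<in> \<Omega> \<inter> ball x \<rho>" "\<bar>e y\<bar> \<le> t1" "\<bar>v y\<bar> \<le> t2" "w y = v y"
    proof (rule contrapos_np)
      assume "\<not> thesis"
      then have no: "\<not> (y \<in> \<Omega> \<inter> ball x \<rho> \<and> \<bar>e y\<bar> \<le> t1 \<and> \<bar>v y\<bar> \<le> t2 \<and> w y = v y)" for y
        using that by blast
      from wv show "AE y in lborel. y \<in> \<Omega> \<inter> ball x \<rho> \<longrightarrow> t1 < \<bar>e y\<bar> \<or> t2 < \<bar>v y\<bar>"
        by eventually_elim (use no in \<open>auto simp: not_le\<close>)
    qed
    \<comment> \<open>From the good point: the average at x is close to the one at y, that one is
      close to w y, and w y = v y is small.\<close>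
    have "ennreal \<bar>ball_avg w \<rho> x - ball_avg w \<rho> y\<bar> \<le> ennreal (norm (x - y) * (V * \<rho> powr (- DIM('a) / p))) * epow (Lpp p h) (1/p)"
      using ball_avg_diff_weak[OF wl \<rho>(1) p1, of x y] by (simp add: V_def Lpp_def del: epow_ennreal)
    also have "\<dots> \<le> ennreal (\<rho> * (V * \<rho> powr (- DIM('a) / p))) * epow (ennreal (E * D powr p)) (1/p)"
      using y(1) V p \<rho> h by (intro mult_mono epow_mono ennreal_leI mult_right_mono) (auto simp: dist_norm)
    also have "\<dots> = ennreal (V * E powr (1/p) * (\<rho> powr \<alpha> * D))"
    proof -
      have "\<rho> * \<rho> powr (- DIM('a) / p) = \<rho> powr \<alpha>" using \<rho> by (simp add: \<alpha>_def powr_diff powr_minus_divide)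
      moreover have "(E * D powr p) powr (1/p) = E powr (1/p) * D" using E D p by (simp add: powr_mult powr_powr)
      moreover have "\<rho> * (V * \<rho> powr (- DIM('a) / p)) * (E * D powr p) powr (1/p) = V * (\<rho> * \<rho> powr (- DIM('a) / p)) * (E * D powr p) powr (1/p)"
        by simp
      ultimately have *: "\<rho> * (V * \<rho> powr (- DIM('a) / p)) * (E * D powr p) powr (1/p) = V * E powr (1/p) * (\<rho> powr \<alpha> * D)"
        by simp
      have "ennreal k * epow (ennreal l) (1/p) = ennreal (k * l powr (1/p))" if "0 \<le> k" "0 \<le> l" for k l
        using that by (simp add: ennreal_mult)
      from this[of "\<rho> * (V * \<rho> powr (- DIM('a) / p))" "E * D powr p"] show ?thesis
        unfolding * using V \<rho> E by simp
    qed
    finally have "\<bar>ball_avg w \<rho> x - ball_avg w \<rho> y\<bar> \<le> V * E powr (1/p) * (\<rho> powr \<alpha> * D)"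
      using V D by (simp add: ennreal_le_iff)
    moreover have "\<bar>w y - ball_avg w \<rho> y\<bar> \<le> t1" using y(2) by (simp add: e_def)
    moreover have "\<bar>w y\<bar> \<le> t2" using y(3,4) by simp
    ultimately have "\<bar>ball_avg w \<rho> x\<bar> \<le> V * E powr (1/p) * (\<rho> powr \<alpha> * D) + t1 + t2" by linarith
    also have "\<dots> \<le> L * (\<rho> powr \<alpha> * D + \<rho> powr (- DIM('a) / s) * S)"
    proof -
      have "P * A + a * A + b * B \<le> (P + a + b) * (A + B)" if "0 \<le> P" "0 \<le> A" "0 \<le> B" for P A B :: real
        using that ab by (simp add: algebra_simps)
      then show ?thesis unfolding L_def t1_def t2_def using V D S by simp
    qed
    finally show "\<bar>ball_avg w \<rho> x\<bar> \<le> L * (\<rho> powr \<alpha> * D + \<rho> powr (- DIM('a) / s) * S)" .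
  qed
qed

text \<open>The scale \<rho> eliminates S: the quantities to be compared become products of powers
  of D and \<rho>, and it remains to compare exponents.\<close>

lemma scale_relations:
  fixes D S \<alpha> \<beta> n s :: real
  assumes D: "0 < D" and S: "0 < S" and \<beta>: "0 < \<beta>" and \<beta>_def: "\<beta> = \<alpha> + n / s" and s: "0 < s"
  defines "\<rho> \<equiv> (S / D) powr (1 / \<beta>)"
  shows "0 < \<rho>" "D powr \<theta> * S powr (1 - \<theta>) = D * \<rho> powr ((1 - \<theta>) * \<beta>)"
    "\<rho> powr (- (n / s)) * S = \<rho> powr \<alpha> * D" "S powr s = (\<rho> powr \<alpha> * D) powr s * \<rho> powr n"
proof -
  show \<rho>: "0 < \<rho>" using D S by (simp add: \<rho>_def)
  have "\<rho> powr \<beta> = S / D" using D S \<beta> by (simp add: \<rho>_def powr_powr)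
  then have Seq: "S = \<rho> powr \<beta> * D" using D by simp
  have "D powr \<theta> * S powr (1 - \<theta>) = (D powr \<theta> * D powr (1 - \<theta>)) * \<rho> powr ((1 - \<theta>) * \<beta>)"
    unfolding Seq using D \<rho> by (simp add: powr_mult powr_powr mult_ac)
  then show "D powr \<theta> * S powr (1 - \<theta>) = D * \<rho> powr ((1 - \<theta>) * \<beta>)"
    using D by (simp add: powr_add[symmetric])
  have "\<rho> powr (- (n / s)) * S = (\<rho> powr (- (n / s)) * \<rho> powr \<beta>) * D" unfolding Seq by simp
  then show lam: "\<rho> powr (- (n / s)) * S = \<rho> powr \<alpha> * D" by (simp only: powr_add[symmetric] \<beta>_def) simp
  have "(\<rho> powr (- (n / s)) * S) powr s * \<rho> powr n = S powr s * (\<rho> powr (- (n / s) * s) * \<rho> powr n)"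
    using \<rho> S by (simp add: powr_mult powr_powr mult_ac)
  also have "- (n / s) * s = - n" using s by simp
  finally show "S powr s = (\<rho> powr \<alpha> * D) powr s * \<rho> powr n"
    using \<rho> by (simp add: lam powr_add[symmetric])
qed

lemma gagliardo_nirenberg_ge_dim:
  assumes np: "DIM('a) \<le> p" and s: "0 < s" "s \<le> r" and \<theta>: "0 \<le> \<theta>" "\<theta> \<le> 1"
    and eq: "\<theta> * (1 / p - 1 / DIM('a)) + (1 - \<theta>) * (1 / s) = 1 / r"
  shows "\<exists>C>0. \<forall>u g D S. sob \<Omega> p u g \<longrightarrow> 0 < D \<longrightarrow> 0 < S \<longrightarrow> Lpp p g = ennreal (D powr p) \<longrightarrow>
      Lpp s (centered u) = ennreal (S powr s) \<longrightarrow> Lpp r (centered u) \<le> ennreal (C * (D powr \<theta> * S powr (1 - \<theta>)) powr r)"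
proof -
  define n where "n = real DIM('a)"
  define \<alpha> where "\<alpha> = 1 - n / p"
  define \<beta> where "\<beta> = \<alpha> + n / s"
  \<comment> \<open>The deviation from the averages is estimated in an exponent that is at least p,
    and the interpolation asks for one that is at least r.\<close>
  define q where "q = max r p"
  have n: "0 < n" "n \<le> p" using np by (simp_all add: n_def)
  have p1: "1 \<le> p" using p by simp
  have q: "p \<le> q" "r \<le> q" "0 \<le> q" using p by (auto simp: q_def)
  have r: "0 < r" using s by simp
  have \<alpha>: "0 \<le> \<alpha>" using n p by (simp add: \<alpha>_def)
  have \<beta>: "0 < \<beta>" using \<alpha> n s by (simp add: \<beta>_def add_nonneg_pos)
  \<comment> \<open>The exponent relation multiplied by n r. It says that the target X is l^r
    \<rho>^n, where l is the common value of both terms at scale \<rho>.\<close>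
  have \<theta>\<beta>: "(1 - \<theta>) * \<beta> * r = \<alpha> * r + n"
  proof -
    have "n * (\<theta> * (1 / p - 1 / n) + (1 - \<theta>) * (1 / s)) = n * (1 / r)" using eq unfolding n_def by simp
    moreover have "n * (\<theta> * (1 / p - 1 / n) + (1 - \<theta>) * (1 / s)) = (1 - \<theta>) * \<beta> - \<alpha>"
      using n by (simp add: \<alpha>_def \<beta>_def algebra_simps diff_divide_distrib)
    moreover have "n * (1 / r) = n / r" by simp
    ultimately have "(1 - \<theta>) * \<beta> = \<alpha> + n / r" by linarith
    then show ?thesis using r by (simp add: distrib_right)
  qed
  obtain E where E: "0 < E" "\<And>u g D. sob \<Omega> p u g \<Longrightarrow> 0 < D \<Longrightarrow> Lpp p g = ennreal (D powr p) \<Longrightarrow>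
    \<exists>w h. sob UNIV p w h \<and> (AE x in lborel. x \<in> \<Omega> \<longrightarrow> w x = centered u x) \<and> Lpp p h \<le> ennreal (E * D powr p)"
    using centered_extension by blast
  obtain L \<rho>0 where L: "0 < L" "0 < \<rho>0" "\<And>v w h D S \<rho> x. v \<in> borel_measurable borel \<Longrightarrow> sob UNIV p w h \<Longrightarrow>
    (AE y in lborel. y \<in> \<Omega> \<longrightarrow> w y = v y) \<Longrightarrow> 0 < D \<Longrightarrow> 0 < S \<Longrightarrow> Lpp p h \<le> ennreal (E * D powr p) \<Longrightarrow>
    Lpp s v = ennreal (S powr s) \<Longrightarrow> 0 < \<rho> \<Longrightarrow> \<rho> \<le> \<rho>0 \<Longrightarrow> x \<in> \<Omega> \<Longrightarrow>
    \<bar>ball_avg w \<rho> x\<bar> \<le> L * (\<rho> powr \<alpha> * D + \<rho> powr (- (n / s)) * S)"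
    using local_average_bound[OF np s(1) E(1)] unfolding \<alpha>_def n_def by auto
  obtain B where B: "0 < B" "\<And>(u :: 'a \<Rightarrow> real) g R. loc_int u \<Longrightarrow> loc_int g \<Longrightarrow> weak_grad_eq UNIV u g \<Longrightarrow> 0 < R \<Longrightarrow>
    (\<integral>\<^sup>+x. epow (ennreal \<bar>u x - ball_avg u R x\<bar>) q \<partial>lborel)
      \<le> ennreal (B * R powr (q - n * (q - p) / p)) * epow (\<integral>\<^sup>+x. epow (ennreal (norm (g x))) p \<partial>lborel) (q / p)"
    using diff_ball_avg_Lq_weak[OF p1 np q(1)] unfolding n_def by blast
  obtain A where A: "0 < A" "\<And>u g D. sob \<Omega> p u g \<Longrightarrow> 0 < D \<Longrightarrow> Lpp p g = ennreal (D powr p) \<Longrightarrow> Lpp q (centered u) \<le> ennreal (A * D powr q)"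
    using embedding_centered[OF q(1) Lq_embedding_ge[OF p1 np q(1)]] by blast
  define k where "k = (1 - \<theta>) * \<beta> * r"
  have k: "0 \<le> k" using \<theta> \<beta> r by (simp add: k_def)
  define C1 where "C1 = (4 * L) powr (r - s) + (4 * L) powr (r - q) * (2 powr q * (B * E powr (q / p)))"
  define C2 where "C2 = (\<mu> + A) * \<rho>0 powr (- k)"
  have C: "0 < C1" "0 < C2" using L B E A \<mu>(1) by (auto simp: C1_def C2_def intro!: add_pos_pos mult_pos_pos)
  show ?thesis
  proof (rule exI[of _ "C1 + C2"], intro conjI allI impI)
    show "0 < C1 + C2" using C by simp
    fix u g D S assume su: "sob \<Omega> p u g" and D: "0 < D" and S: "0 < S"
      and Dg: "Lpp p g = ennreal (D powr p)" and Sv: "Lpp s (centered u) = ennreal (S powr s)"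
    define v where "v = centered u"
    have vm [measurable]: "v \<in> borel_measurable borel" unfolding v_def by (rule centered_measurable[OF su])
    have v0: "v x = 0" if "x \<notin> \<Omega>" for x using that sobD(3)[OF su] by (simp add: v_def)
    define \<rho> where "\<rho> = (S / D) powr (1 / \<beta>)"
    note sc = scale_relations[OF D S \<beta> \<beta>_def s(1), folded \<rho>_def]
    define X where "X = (D powr \<theta> * S powr (1 - \<theta>)) powr r"
    have X: "X = D powr r * \<rho> powr k"
      unfolding X_def sc(2) using D by (simp add: powr_mult powr_powr k_def)
    have X0: "0 < X" unfolding X using D sc(1) by simp
    have "Lpp r v \<le> ennreal ((C1 + C2) * X)"
    proof (cases "\<rho> \<le> \<rho>0")
      case True
      define l where "l = \<rho> powr \<alpha> * D"
      have l: "0 < l" using sc(1) D by (simp add: l_def)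
      have lX: "l powr r * \<rho> powr n = X"
        unfolding X k_def \<theta>\<beta> using D sc(1) by (simp add: l_def powr_mult powr_powr powr_add)
      obtain w h where w: "sob UNIV p w h" "AE x in lborel. x \<in> \<Omega> \<longrightarrow> w x = v x" "Lpp p h \<le> ennreal (E * D powr p)"
        using E(2)[OF su D Dg] unfolding v_def by blast
      note [measurable] = sobD(1)[OF w(1)]
      have wl: "loc_int w" "loc_int h" "weak_grad_eq UNIV w h" using sob_loc_int[OF w(1) p1] sobD(7)[OF w(1)] by auto
      define e where "e y = w y - ball_avg w \<rho> y" for y
      have [measurable]: "e \<in> borel_measurable borel" unfolding e_def[abs_def] by measurable
      have avg: "\<bar>ball_avg w \<rho> x\<bar> \<le> 2 * L * l" if "x \<in> \<Omega>" for x
        using L(3)[OF vm w(1,2) D S w(3) Sv[folded v_def] sc(1) True that] unfolding sc(3) by (simp add: l_def mult_ac)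
      have eq: "Lpp q e \<le> ennreal (B * E powr (q / p) * (l powr q * \<rho> powr n))"
      proof -
        have "Lpp q e \<le> ennreal (B * \<rho> powr (q - n * (q - p) / p)) * epow (Lpp p h) (q / p)"
          using B(2)[OF wl sc(1)] by (simp add: Lpp_real e_def Lpp_def[of p h] del: epow_ennreal)
        also have "\<dots> \<le> ennreal (B * \<rho> powr (q - n * (q - p) / p)) * epow (ennreal (E * D powr p)) (q / p)"
          using q p by (intro mult_left_mono epow_mono w(3)) auto
        also have "\<dots> = ennreal (B * \<rho> powr (q - n * (q - p) / p) * (E powr (q / p) * D powr q))"
          using B E D p by (simp add: ennreal_mult[symmetric] powr_mult powr_powr)
        also have "q - n * (q - p) / p = \<alpha> * q + n" using p by (simp add: \<alpha>_def field_simps)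
        also have "B * \<rho> powr (\<alpha> * q + n) * (E powr (q / p) * D powr q) = B * E powr (q / p) * (l powr q * \<rho> powr n)"
          using D sc(1) by (simp add: l_def powr_mult powr_powr powr_add)
        finally show ?thesis .
      qed
      \<comment> \<open>Averages are at most M / 2, so where |v| exceeds M at least half of it is
        deviation from the average.\<close>
      define M where "M = 4 * L * l"
      have M: "0 < M" using L l by (simp add: M_def)
      have pw: "AE x in lborel. M < \<bar>v x\<bar> \<longrightarrow> \<bar>v x\<bar> \<le> \<bar>2 * e x\<bar>"
        using w(2)
      proof eventually_elim
        case (elim x)
        show ?case
        proof (cases "x \<in> \<Omega>")
          case True
          then show ?thesis using elim avg[OF True] by (auto simp: e_def M_def)
        qed (use v0 M in auto)
      qed
      have "Lpp r v \<le> ennreal (M powr (r - s)) * Lpp s v + ennreal (M powr (r - q)) * Lpp q (\<lambda>x. 2 * e x)"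
        using s q by (intro Lpp_interp M pw) auto
      also have "\<dots> \<le> ennreal (M powr (r - s)) * ennreal (S powr s)
          + ennreal (M powr (r - q)) * (ennreal (2 powr q) * ennreal (B * E powr (q / p) * (l powr q * \<rho> powr n)))"
        using Sv eq by (intro add_mono mult_left_mono) (auto simp: Lpp_scale v_def intro!: mult_left_mono)
      also have "\<dots> = ennreal (M powr (r - s) * S powr s + M powr (r - q) * (2 powr q * (B * E powr (q / p) * (l powr q * \<rho> powr n))))"
        using B E by (simp add: ennreal_mult[symmetric] ennreal_plus[symmetric] del: ennreal_plus)
      also have "M powr (r - s) * S powr s = (4 * L) powr (r - s) * ((l powr (r - s) * l powr s) * \<rho> powr n)"
        unfolding sc(4) l_def[symmetric] M_def using L l by (simp add: powr_mult mult_ac)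
      also have "l powr (r - s) * l powr s = l powr r" by (simp add: powr_add[symmetric])
      also have "M powr (r - q) * (2 powr q * (B * E powr (q / p) * (l powr q * \<rho> powr n)))
          = (4 * L) powr (r - q) * (2 powr q * (B * E powr (q / p))) * ((l powr (r - q) * l powr q) * \<rho> powr n)"
        unfolding M_def using L l by (simp add: powr_mult mult_ac)
      also have "l powr (r - q) * l powr q = l powr r" by (simp add: powr_add[symmetric])
      also have "(4 * L) powr (r - s) * (l powr r * \<rho> powr n) + (4 * L) powr (r - q) * (2 powr q * (B * E powr (q / p))) * (l powr r * \<rho> powr n) = C1 * X"
        unfolding lX C1_def by (simp only: distrib_right)
      finally show ?thesis by (rule order_trans) (use C X0 in \<open>auto intro!: ennreal_leI\<close>)
    next
      case False
      \<comment> \<open>Interpolation starts here from exponent 0: since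
        \<open>epow 0 0 = 0\<close>, \<open>Lpp 0 v\<close> is the measure of the set where v is
        nonzero, at most that of \<Omega>.\<close>
      have "Lpp 0 v \<le> (\<integral>\<^sup>+x. indicator \<Omega> x \<partial>lborel)"
        unfolding Lpp_real by (intro nn_integral_mono) (auto simp: v0 indicator_def)
      then have L0: "Lpp 0 v \<le> ennreal \<mu>" by (simp add: \<mu>(2))
      have "Lpp r v \<le> ennreal (D powr (r - 0)) * Lpp 0 v + ennreal (D powr (r - q)) * Lpp q v"
        using r q D by (intro Lpp_interp) auto
      also have "\<dots> \<le> ennreal (D powr (r - 0)) * ennreal \<mu> + ennreal (D powr (r - q)) * ennreal (A * D powr q)"
        using A(2)[OF su D Dg] by (intro add_mono mult_left_mono L0) (auto simp: v_def)
      also have "\<dots> = ennreal (D powr r * \<mu> + A * (D powr (r - q) * D powr q))"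
        using A \<mu>(1) by (simp add: ennreal_mult[symmetric] ennreal_plus[symmetric] mult_ac del: ennreal_plus)
      also have "D powr (r - q) * D powr q = D powr r" by (simp add: powr_add[symmetric])
      also have "D powr r * \<mu> + A * D powr r = (\<mu> + A) * D powr r" by (simp add: algebra_simps)
      also have "ennreal ((\<mu> + A) * D powr r) \<le> ennreal ((C1 + C2) * X)"
      proof (rule ennreal_leI)
        \<comment> \<open>As \<rho> exceeds \<rho>0 and k >= 0, the power D^r is at most
          \<rho>0^(-k) X.\<close>
        have "\<rho>0 powr k \<le> \<rho> powr k" using False L k by (intro powr_mono2) auto
        then have "1 \<le> \<rho>0 powr (- k) * \<rho> powr k" using L by (simp add: powr_minus field_simps)
        then have "(\<mu> + A) * D powr r * 1 \<le> (\<mu> + A) * D powr r * (\<rho>0 powr (- k) * \<rho> powr k)"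
          using \<mu>(1) A by (intro mult_left_mono) auto
        also have "\<dots> = C2 * X" by (simp add: C2_def X mult_ac)
        also have "\<dots> \<le> (C1 + C2) * X" using C X0 by simp
        finally show "(\<mu> + A) * D powr r \<le> (C1 + C2) * X" by simp
      qed
      finally show ?thesis .
    qed
    then show "Lpp r (centered u) \<le> ennreal ((C1 + C2) * (D powr \<theta> * S powr (1 - \<theta>)) powr r)"
      unfolding v_def X_def .
  qed
qed

text \<open>For infinite r the exponent relation becomes (1 - \<theta>) \<beta> = \<alpha>, so the
  target is exactly \<rho>^\<alpha> D, the common value at scale \<rho>. Morrey's estimate takes the
  place of the L^q bound and of the interpolation.\<close>

lemma gagliardo_nirenberg_sup:
  assumes np: "DIM('a) < p" and s: "0 < s" and \<theta>: "0 \<le> \<theta>" "\<theta> \<le> 1"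
    and eq: "\<theta> * (1 / p - 1 / DIM('a)) + (1 - \<theta>) * (1 / s) = 0"
  shows "\<exists>C>0. \<forall>u g D S. sob \<Omega> p u g \<longrightarrow> 0 < D \<longrightarrow> 0 < S \<longrightarrow> Lpp p g = ennreal (D powr p) \<longrightarrow>
      Lpp s (centered u) = ennreal (S powr s) \<longrightarrow> (AE x in lborel. \<bar>centered u x\<bar> \<le> C * (D powr \<theta> * S powr (1 - \<theta>)))"
proof -
  define n where "n = real DIM('a)"
  define \<alpha> where "\<alpha> = 1 - n / p"
  define \<beta> where "\<beta> = \<alpha> + n / s"
  have n: "0 < n" "n < p" using np by (simp_all add: n_def)
  have p1: "1 \<le> p" using p by simp
  have \<alpha>: "0 < \<alpha>" using n p by (simp add: \<alpha>_def)
  have \<beta>: "0 < \<beta>" using \<alpha> n s by (simp add: \<beta>_def add_nonneg_pos)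
  have \<theta>\<beta>: "(1 - \<theta>) * \<beta> = \<alpha>"
  proof -
    have "n * (\<theta> * (1 / p - 1 / n) + (1 - \<theta>) * (1 / s)) = 0" using eq unfolding n_def by simp
    moreover have "n * (\<theta> * (1 / p - 1 / n) + (1 - \<theta>) * (1 / s)) = (1 - \<theta>) * \<beta> - \<alpha>"
      using n by (simp add: \<alpha>_def \<beta>_def algebra_simps diff_divide_distrib)
    ultimately show ?thesis by linarith
  qed
  obtain E where E: "0 < E" "\<And>u g D. sob \<Omega> p u g \<Longrightarrow> 0 < D \<Longrightarrow> Lpp p g = ennreal (D powr p) \<Longrightarrow>
    \<exists>w h. sob UNIV p w h \<and> (AE x in lborel. x \<in> \<Omega> \<longrightarrow> w x = centered u x) \<and> Lpp p h \<le> ennreal (E * D powr p) \<and>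
      Lpp p h + Lpp p w \<le> ennreal (E * D powr p)"
    using centered_extension by blast
  obtain L \<rho>0 where L: "0 < L" "0 < \<rho>0" "\<And>v w h D S \<rho> x. v \<in> borel_measurable borel \<Longrightarrow> sob UNIV p w h \<Longrightarrow>
    (AE y in lborel. y \<in> \<Omega> \<longrightarrow> w y = v y) \<Longrightarrow> 0 < D \<Longrightarrow> 0 < S \<Longrightarrow> Lpp p h \<le> ennreal (E * D powr p) \<Longrightarrow>
    Lpp s v = ennreal (S powr s) \<Longrightarrow> 0 < \<rho> \<Longrightarrow> \<rho> \<le> \<rho>0 \<Longrightarrow> x \<in> \<Omega> \<Longrightarrow>
    \<bar>ball_avg w \<rho> x\<bar> \<le> L * (\<rho> powr \<alpha> * D + \<rho> powr (- (n / s)) * S)"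
    using local_average_bound[OF less_imp_le[OF np] s E(1)] unfolding \<alpha>_def n_def by auto
  define b where "b = ball_volume TYPE('a) 1 powr (-1/p) / (1 - DIM('a) / p)"
  have b: "0 < b" using ball_volume_pos[of 1, where 'a='a] np p by (simp add: b_def)
  obtain A where A: "0 < A" "\<And>(w :: 'a \<Rightarrow> real) h. sob UNIV p w h \<Longrightarrow> AE x in lborel. ennreal \<bar>w x\<bar> \<le> ennreal A * epow (Lpp p h + Lpp p w) (1 / p)"
    using Linf_embedding[OF p1 np] by blast
  have root: "epow (ennreal (E * D powr p)) (1 / p) = ennreal (E powr (1/p) * D)" if "0 < D" for D
    using that E p by (simp add: powr_mult powr_powr)
  define C1 where "C1 = b * E powr (1/p) + 2 * L"
  define C2 where "C2 = A * E powr (1/p) * \<rho>0 powr (- \<alpha>)"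
  have C: "0 < C1" "0 < C2" using b L E A by (auto simp: C1_def C2_def intro!: add_pos_pos)
  show ?thesis
  proof (rule exI[of _ "C1 + C2"], intro conjI allI impI)
    show "0 < C1 + C2" using C by simp
    fix u g D S assume su: "sob \<Omega> p u g" and D: "0 < D" and S: "0 < S"
      and Dg: "Lpp p g = ennreal (D powr p)" and Sv: "Lpp s (centered u) = ennreal (S powr s)"
    define v where "v = centered u"
    have vm [measurable]: "v \<in> borel_measurable borel" unfolding v_def by (rule centered_measurable[OF su])
    have v0: "v x = 0" if "x \<notin> \<Omega>" for x using that sobD(3)[OF su] by (simp add: v_def)
    define \<rho> where "\<rho> = (S / D) powr (1 / \<beta>)"
    note sc = scale_relations[OF D S \<beta> \<beta>_def s, folded \<rho>_def]
    have X: "D powr \<theta> * S powr (1 - \<theta>) = D * \<rho> powr \<alpha>" unfolding sc(2) \<theta>\<beta> ..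
    obtain w h where w: "sob UNIV p w h" "AE x in lborel. x \<in> \<Omega> \<longrightarrow> w x = v x" "Lpp p h \<le> ennreal (E * D powr p)"
      "Lpp p h + Lpp p w \<le> ennreal (E * D powr p)"
      using E(2)[OF su D Dg] unfolding v_def by blast
    have wl: "loc_int w" "loc_int h" "weak_grad_eq UNIV w h" using sob_loc_int[OF w(1) p1] sobD(7)[OF w(1)] by auto
    have "AE x in lborel. \<bar>v x\<bar> \<le> (C1 + C2) * (D * \<rho> powr \<alpha>)"
    proof (cases "\<rho> \<le> \<rho>0")
      case True
      have avg: "\<bar>ball_avg w \<rho> x\<bar> \<le> 2 * L * (\<rho> powr \<alpha> * D)" if "x \<in> \<Omega>" for x
        using L(3)[OF vm w(1,2) D S w(3) Sv[folded v_def] sc(1) True that] unfolding sc(3) by (simp add: mult_ac)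
      have "ennreal (b * \<rho> powr \<alpha>) * epow (Lpp p h) (1/p) \<le> ennreal (b * \<rho> powr \<alpha>) * ennreal (E powr (1/p) * D)"
        unfolding root[OF D, symmetric] using p by (intro mult_left_mono epow_mono w(3)) auto
      also have "\<dots> = ennreal (b * E powr (1/p) * (\<rho> powr \<alpha> * D))"
        using b E D by (simp add: ennreal_mult[symmetric] mult_ac)
      finally have h: "ennreal (b * \<rho> powr \<alpha>) * epow (Lpp p h) (1/p) \<le> ennreal (b * E powr (1/p) * (\<rho> powr \<alpha> * D))" .
      have "AE x in lborel. ennreal \<bar>w x - ball_avg w \<rho> x\<bar> \<le> ennreal (b * \<rho> powr \<alpha>) * epow (Lpp p h) (1/p)"
        using diff_ball_avg_sup_weak[OF wl sc(1) p1 np] by (simp add: b_def \<alpha>_def n_def Lpp_def del: epow_ennreal)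
      then show ?thesis using w(2)
      proof eventually_elim
        case (elim x)
        show ?case
        proof (cases "x \<in> \<Omega>")
          case True
          from elim(1) h have "ennreal \<bar>w x - ball_avg w \<rho> x\<bar> \<le> ennreal (b * E powr (1/p) * (\<rho> powr \<alpha> * D))"
            by (rule order_trans)
          then have "\<bar>w x - ball_avg w \<rho> x\<bar> \<le> b * E powr (1/p) * (\<rho> powr \<alpha> * D)" using b D by (simp add: ennreal_le_iff)
          then have "\<bar>v x\<bar> \<le> b * E powr (1/p) * (\<rho> powr \<alpha> * D) + 2 * L * (\<rho> powr \<alpha> * D)"
            using avg[OF True] elim(2) True by auto
          also have "\<dots> = C1 * (D * \<rho> powr \<alpha>)" by (simp add: C1_def algebra_simps)
          also have "\<dots> \<le> (C1 + C2) * (D * \<rho> powr \<alpha>)" using C D by (intro mult_right_mono) auto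
          finally show ?thesis .
        qed (use v0 C D in auto)
      qed
    next
      case False
      \<comment> \<open>Above \<rho>0 the sup bound at unit radius suffices, since D is at most
        \<rho>0^(-\<alpha>) times the target.\<close>
      have "ennreal A * epow (Lpp p h + Lpp p w) (1/p) \<le> ennreal A * ennreal (E powr (1/p) * D)"
        unfolding root[OF D, symmetric] using p by (intro mult_left_mono epow_mono w(4)) auto
      also have "\<dots> = ennreal (A * E powr (1/p) * D)"
        using A E D by (simp add: ennreal_mult[symmetric] mult_ac)
      finally have h: "ennreal A * epow (Lpp p h + Lpp p w) (1/p) \<le> ennreal (A * E powr (1/p) * D)" .
      from A(2)[OF w(1)] w(2) show ?thesis
      proof eventually_elim
        case (elim x)
        show ?case
        proof (cases "x \<in> \<Omega>")
          case True
          from elim(1) h have "ennreal \<bar>w x\<bar> \<le> ennreal (A * E powr (1/p) * D)" by (rule order_trans)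
          then have vx: "\<bar>v x\<bar> \<le> A * E powr (1/p) * D * 1" using elim(2) True A D by (simp add: ennreal_le_iff)
          have "\<rho>0 powr \<alpha> \<le> \<rho> powr \<alpha>" using False L \<alpha> by (intro powr_mono2) auto
          then have "1 \<le> \<rho>0 powr (- \<alpha>) * \<rho> powr \<alpha>" using L by (simp add: powr_minus field_simps)
          note vx
          also have "A * E powr (1/p) * D * 1 \<le> A * E powr (1/p) * D * (\<rho>0 powr (- \<alpha>) * \<rho> powr \<alpha>)"
            using A D \<open>1 \<le> \<rho>0 powr (- \<alpha>) * \<rho> powr \<alpha>\<close> by (intro mult_left_mono) auto
          also have "\<dots> = C2 * (D * \<rho> powr \<alpha>)" by (simp add: C2_def mult_ac)
          also have "\<dots> \<le> (C1 + C2) * (D * \<rho> powr \<alpha>)" using C D by (intro mult_right_mono) auto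
          finally show ?thesis .
        qed (use v0 C D in auto)
      qed
    qed
    then show "AE x in lborel. \<bar>centered u x\<bar> \<le> (C1 + C2) * (D powr \<theta> * S powr (1 - \<theta>))"
      unfolding X v_def .
  qed
qed

end

section \<open>Return to the original function spaces\<close>

lemma borel_rep_Linf:
  fixes f :: "'a::euclidean_space \<Rightarrow> 'b::euclidean_space"
  assumes \<Omega>: "\<Omega> \<in> sets borel" and rep: "borel_rep \<Omega> f f'" and B: "0 \<le> B" "AE x in lborel. norm (f' x) \<le> B"
  shows "f \<in> Lp_space \<Omega> \<infinity>" "Lp_norm \<Omega> \<infinity> f \<le> B"
proof -
  note [measurable] = borel_rep_measurable[OF \<Omega> rep]
  have "AE x in lborel. x \<in> \<Omega> \<longrightarrow> f x = f' x" using rep by (simp add: borel_rep_def)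
  with B(2) have "AE x in lborel. x \<in> \<Omega> \<longrightarrow> ereal (norm (f x)) \<le> ereal B"
    by eventually_elim auto
  then have "AE x in lebesgue. x \<in> \<Omega> \<longrightarrow> ereal (norm (f x)) \<le> ereal B" by (rule AE_completion)
  then have "AE x in lebesgue_on \<Omega>. ereal (norm (f x)) \<le> ereal B"
    using \<Omega> by (subst AE_restrict_space_iff) auto
  then have le: "esssup (lebesgue_on \<Omega>) (\<lambda>x. ereal (norm (f x))) \<le> ereal B"
    by (intro esssup_I) auto
  then show "f \<in> Lp_space \<Omega> \<infinity>" by (auto simp: Lp_space_def)
  show "Lp_norm \<Omega> \<infinity> f \<le> B"
    using le B(1) by (cases "esssup (lebesgue_on \<Omega>) (\<lambda>x. ereal (norm (f x)))") (auto simp: Lp_norm_def)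
qed

context sobolev_extension_domain
begin

lemma W1p_centered:
  assumes u: "u \<in> W1p \<Omega> p"
  obtains u' g' where "sob \<Omega> p u' g'" "borel_rep \<Omega> u u'" "borel_rep \<Omega> (weak_gradient \<Omega> u) g'"
    "borel_rep \<Omega> (\<lambda>x. u x - mean_value \<Omega> u) (centered u')"
proof -
  obtain u' g' where rep: "borel_rep \<Omega> u u'" "borel_rep \<Omega> (weak_gradient \<Omega> u) g'" and su: "sob \<Omega> p u' g'"
    using W1p_sob[OF open_dom _ u] p by auto
  have u0: "indicator \<Omega> x *\<^sub>R u' x = u' x" for x by (cases "x \<in> \<Omega>") (use sobD(3)[OF su, of x] in auto)
  have "(LINT x|lebesgue_on \<Omega>. u x) = (LINT x|lborel. indicator \<Omega> x *\<^sub>R u' x)"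
    using sobD(1)[OF su] by (intro borel_rep_integral(1)[OF dom_borel rep(1), of "\<lambda>y x. y"]) (simp only: u0)
  moreover have "measure lebesgue \<Omega> = \<mu>" by (simp add: \<mu>_def measure_completion)
  ultimately have "mean_value \<Omega> u = mean u'" by (simp only: mean_value_def mean_def u0) simp
  moreover have "borel_rep \<Omega> (\<lambda>x. u x - mean u') (centered u')"
    using rep(1) centered_measurable[OF su] by (auto simp: borel_rep_def elim!: eventually_mono)
  ultimately show ?thesis using that[OF su rep] by simp
qed

lemma centered_Ls_finite:
  assumes su: "sob \<Omega> p u' g'" and rep: "borel_rep \<Omega> u u'" and u: "u \<in> Lp_space \<Omega> (ereal s)" and s: "0 < s"
  shows "Lpp s (centered u') < top"
proof -
  have "Lpp s u' < top" using u borel_rep_Lp(1)[OF dom_borel rep s] by (simp add: Lpp_def)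
  then show ?thesis using sobD(1)[OF su] finite_measure_dom s by (intro Lpp_diff_const_finite) auto
qed

end

theorem corollary3:
  fixes \<Omega> :: "'a::euclidean_space set" and p s \<theta> :: real and r :: ereal
  assumes "1 < p"
    and "W1p_extension_domain \<Omega> p"
    and "\<Omega> \<in> lmeasurable"
    and "0 < s"
    and "(p < real DIM('a) \<and> ereal s \<le> r \<and>
            r \<le> ereal (real DIM('a) * p / (real DIM('a) - p))) \<or>
         (p = real DIM('a) \<and> real DIM('a) > 1 \<and> ereal s \<le> r \<and> r < \<infinity>) \<or>
         ((p > real DIM('a) \<or> (p = real DIM('a) \<and> real DIM('a) = 1)) \<and> ereal s \<le> r \<and> r \<le> \<infinity>)"
    and "0 \<le> \<theta>" and "\<theta> \<le> 1"
    and "\<theta> * (1 / p - 1 / real DIM('a)) + (1 - \<theta>) * (1 / s) = real_of_ereal (1 / r)"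
  shows "\<exists>C::real. \<forall>u \<in> W1p \<Omega> p \<inter> Lp_space \<Omega> (ereal s).
           (\<lambda>x. u x - mean_value \<Omega> u) \<in> Lp_space \<Omega> r \<and>
           Lp_norm \<Omega> r (\<lambda>x. u x - mean_value \<Omega> u)
             \<le> C * rpow (Lp_norm \<Omega> (ereal p) (weak_gradient \<Omega> u)) \<theta>
                 * rpow (Lp_norm \<Omega> (ereal s) (\<lambda>x. u x - mean_value \<Omega> u)) (1 - \<theta>)"
proof -
  have p1: "1 \<le> p" using assms(1) by simp
  have dom: "open \<Omega>" "connected \<Omega>" "\<Omega> \<noteq> {}"
    using assms(2) by (auto simp: W1p_extension_domain_def is_domain_def)
  have "\<Omega> \<in> sets lborel" using dom(1) by simp
  then have fin: "emeasure lborel \<Omega> < top"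
    using fmeasurableD2[OF assms(3)] by (simp add: emeasure_completion sets_completionI_sets less_top[symmetric])
  interpret sobolev_extension_domain \<Omega> p
    by standard (use assms(1) dom fin W1p_extension_sob[OF p1 assms(2)] in \<open>simp_all only: Lpp_def real_norm_def simp_thms\<close>)
  have norms: "Lp_norm \<Omega> (ereal p) (weak_gradient \<Omega> u) = enn2real (Lpp p g') powr (1 / p)"
    "Lp_norm \<Omega> (ereal s) (\<lambda>x. u x - mean_value \<Omega> u) = enn2real (Lpp s (centered u')) powr (1 / s)"
    if "borel_rep \<Omega> (weak_gradient \<Omega> u) g'" "borel_rep \<Omega> (\<lambda>x. u x - mean_value \<Omega> u) (centered u')" for u u' g'
    using that borel_rep_Lp(2)[OF dom_borel that(1), of p] borel_rep_Lp(2)[OF dom_borel that(2) assms(4)] assms(1)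
    by (simp_all add: Lpp_def)
  show ?thesis
  proof (cases r)
    case (real r')
    have sr: "s \<le> r'" using assms(5) by (auto simp: real)
    have r: "0 < r'" using sr assms(4) by simp
    have eq: "\<theta> * (1 / p - 1 / real DIM('a)) + (1 - \<theta>) * (1 / s) = 1 / r'"
      using assms(8) r by (simp add: real one_ereal_def)
    have "\<exists>C>0. \<forall>u g D S. sob \<Omega> p u g \<longrightarrow> 0 < D \<longrightarrow> 0 < S \<longrightarrow> Lpp p g = ennreal (D powr p) \<longrightarrow>
      Lpp s (centered u) = ennreal (S powr s) \<longrightarrow> Lpp r' (centered u) \<le> ennreal (C * (D powr \<theta> * S powr (1 - \<theta>)) powr r')"
    proof (cases "p < DIM('a)")
      case True
      then have "r' \<le> DIM('a) * p / (DIM('a) - p)" using assms(5) by (auto simp: real)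
      then show ?thesis using assms sr True eq by (intro gagliardo_nirenberg_less_dim) auto
    next
      case False
      then show ?thesis using assms sr eq by (intro gagliardo_nirenberg_ge_dim) auto
    qed
    then obtain C where C: "0 < C" "\<And>u g D S. sob \<Omega> p u g \<Longrightarrow> 0 < D \<Longrightarrow> 0 < S \<Longrightarrow> Lpp p g = ennreal (D powr p) \<Longrightarrow>
      Lpp s (centered u) = ennreal (S powr s) \<Longrightarrow> Lpp r' (centered u) \<le> ennreal (C * (D powr \<theta> * S powr (1 - \<theta>)) powr r')"
      by blast
    show ?thesis
    proof (rule exI[of _ "C powr (1 / r')"], intro ballI)
      fix u assume u: "u \<in> W1p \<Omega> p \<inter> Lp_space \<Omega> (ereal s)"
      obtain u' g' where su: "sob \<Omega> p u' g'" and rep: "borel_rep \<Omega> u u'" "borel_rep \<Omega> (weak_gradient \<Omega> u) g'"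
        "borel_rep \<Omega> (\<lambda>x. u x - mean_value \<Omega> u) (centered u')"
        using u W1p_centered by blast
      have "Lpp s (centered u') < top" using u assms(4) by (intro centered_Ls_finite[OF su rep(1)]) auto
      note gn = gagliardo_nirenberg_of_positive[OF assms(6,7,4) r C su this]
      show "(\<lambda>x. u x - mean_value \<Omega> u) \<in> Lp_space \<Omega> r \<and> Lp_norm \<Omega> r (\<lambda>x. u x - mean_value \<Omega> u)
        \<le> C powr (1 / r') * rpow (Lp_norm \<Omega> (ereal p) (weak_gradient \<Omega> u)) \<theta>
          * rpow (Lp_norm \<Omega> (ereal s) (\<lambda>x. u x - mean_value \<Omega> u)) (1 - \<theta>)"
        unfolding norms[OF rep(2,3)] unfolding real
        using gn borel_rep_Lp[OF dom_borel rep(3) r] by (simp add: Lpp_def del: epow_ennreal)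
    qed
  next
    case PInf
    \<comment> \<open>Since 1 < p excludes p = n = 1, an infinite exponent forces p > n.\<close>
    have np: "DIM('a) < p" using assms(1,5) by (auto simp: PInf)
    have eq: "\<theta> * (1 / p - 1 / real DIM('a)) + (1 - \<theta>) * (1 / s) = 0"
      using assms(8) by (simp add: PInf)
    obtain C where C: "0 < C" "\<And>u g D S. sob \<Omega> p u g \<Longrightarrow> 0 < D \<Longrightarrow> 0 < S \<Longrightarrow> Lpp p g = ennreal (D powr p) \<Longrightarrow>
      Lpp s (centered u) = ennreal (S powr s) \<Longrightarrow> AE x in lborel. \<bar>centered u x\<bar> \<le> C * (D powr \<theta> * S powr (1 - \<theta>))"
      using gagliardo_nirenberg_sup[OF np assms(4,6,7) eq] by blast
    show ?thesis
    proof (rule exI[of _ C], intro ballI)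
      fix u assume u: "u \<in> W1p \<Omega> p \<inter> Lp_space \<Omega> (ereal s)"
      obtain u' g' where su: "sob \<Omega> p u' g'" and rep: "borel_rep \<Omega> u u'" "borel_rep \<Omega> (weak_gradient \<Omega> u) g'"
        "borel_rep \<Omega> (\<lambda>x. u x - mean_value \<Omega> u) (centered u')"
        using u W1p_centered by blast
      have "Lpp s (centered u') < top" using u assms(4) by (intro centered_Ls_finite[OF su rep(1)]) auto
      note gn = gagliardo_nirenberg_of_positive_sup[OF assms(4) C(2,1) su this]
      have "0 \<le> C * rpow (enn2real (Lpp p g') powr (1/p)) \<theta> * rpow (enn2real (Lpp s (centered u')) powr (1/s)) (1 - \<theta>)"
        using C by (simp add: rpow_def)
      note sup = borel_rep_Linf[OF dom_borel rep(3) this, unfolded real_norm_def, OF gn]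
      show "(\<lambda>x. u x - mean_value \<Omega> u) \<in> Lp_space \<Omega> r \<and> Lp_norm \<Omega> r (\<lambda>x. u x - mean_value \<Omega> u)
        \<le> C * rpow (Lp_norm \<Omega> (ereal p) (weak_gradient \<Omega> u)) \<theta>
          * rpow (Lp_norm \<Omega> (ereal s) (\<lambda>x. u x - mean_value \<Omega> u)) (1 - \<theta>)"
        unfolding norms[OF rep(2,3)] PInf by (rule conjI[OF sup])
    qed
  next
    case MInf
    then show ?thesis using assms(4,5) by auto
  qed
qed

end
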